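(* Let $q$ be a prime, $D\ge1$, $S\in\mathrm{Sym}_D$, $N=\dim\ker(S)$ and let $\epsilon\in\{-1,0,1\}$ be the type of $S$. Let $A$ and $A^*$ be the adjacency and dual adjacency matrices of the symplectic dual polar graph. Then $W(S)$ is invariant under $A$ and $A^*$, and $$A|_{W(S)}=\epsilon q^{D/2}\mathcal{K}-1+q^{D/2}\mathcal{K}^{1/2}\big(q^{-1/4}\hat{\mathcal{L}}+q^{1/4}\hat{\mathcal{R}}\big),$$ $$A^*|_{W(S)}=-\frac{q(q^{D-1}+1)}{q-1}+\frac{q(q^{D-1}+1)(q^D+1)}{2(q-1)}\,q^{-D+N/2}\,\mathcal{K}^{-1},$$ where $\mathcal{K}=\phi^{-1}\circ K\circ\phi$, $\hat{\mathcal{L}}=\phi^{-1}\circ\hat L\circ\phi$, $\hat{\mathcal{R}}=\phi^{-1}\circ\hat R\circ\phi$, and $\mathcal{K}^{1/2}$ is the diagonal operator with the positive square roots of the eigenvalues of $\mathcal{K}$ on the same eigenvectors.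
   Context: Equip $\mathbb{F}_q^{2D}$ with the non-degenerate symplectic form $\mathfrak{B}$ for which $e_1,\dots,e_D,f_1,\dots,f_D$ is a symplectic basis: $\mathfrak{B}(e_i,e_j)=\mathfrak{B}(f_i,f_j)=0$, $\mathfrak{B}(e_i,f_j)=-\mathfrak{B}(f_j,e_i)=\delta_{ij}$. $X$ is the set of maximal isotropic subspaces (all of dimension $D$); the symplectic dual polar graph has vertex set $X$, $x\sim y$ iff $\dim(x\cap y)=D-1$, distance $\mathrm{dist}(x,y)=D-\dim(x\cap y)$. $V=\mathrm{span}_{\mathbb{C}}\{|x\rangle:x\in X\}$ with $\{|x\rangle\}$ orthonormal; $A$ is the adjacency matrix. The eigenvalues of $A$ are $\theta_j=\frac{1-q+q^{D+1-j}-q^j}{q-1}$, $0\le j\le D$; $E_j$ is the orthogonal projector onto the $\theta_j$-eigenspace. Put $x_0=\mathrm{span}\{e_1,\dots,e_D\}$; $A^*$ is the diagonal matrix with $(A^* )_{xx}=|X|(E_1)_{x_0x}$. Put $x_i=\mathrm{span}\{e_1,\dots,e_{D-i}\}\oplus\mathrm{span}\{f_{D-i+1},\dots,f_D\}$. $\mathrm{Sym}_D$: symmetric $D\times D$ matrices over $\mathbb{F}_q$; $\mathrm{Sym}_{D,i}$: those $\mathcal{F}$ with $\mathcal{F}_{mn}=0$ whenever $m\le D-i$ or $n\le D-i$. For $\mathcal{C}\in GL(D,q)$, $\mathcal{F}\in\mathrm{Sym}_D$, $(\mathcal{C},\mathcal{F})\in Sp(2D,q)$ has matrix $\begin{pmatrix}\mathcal{C}&0\\0&(\mathcal{C}^t)^{-1}\end{pmatrix}\begin{pmatrix}I&\mathcal{F}\\0&I\end{pmatrix}$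 in the basis $(e_1,\dots,e_D,f_1,\dots,f_D)$; $g$ acts on subspaces by $gx=\{gv:v\in x\}$, $\rho(g)|x\rangle=|gx\rangle$. For $S'\in\mathrm{Sym}_{D,i}$, $|[I],S'\rangle_i=q^{-i(i+1)/4}\sum_{\mathcal{F}\in\mathrm{Sym}_{D,i}}e^{2\pi\sqrt{-1}\,\mathrm{tr}(S'\mathcal{F})/q}|(I,\mathcal{F})x_i\rangle$ (elements of $\mathbb{F}_q$ in exponents identified with integers in $\{0,\dots,q-1\}$); for $\mathcal{C}\in GL(D,q)$ with $\mathcal{C}^tS\mathcal{C}\in\mathrm{Sym}_{D,i}$, $|[\mathcal{C}],S\rangle_i=\rho((\mathcal{C},0))|[I],\mathcal{C}^tS\mathcal{C}\rangle_i$; $W(S)=\bigoplus_{i=0}^D\mathrm{span}_{\mathbb{C}}\{|[\mathcal{C}],S\rangle_i:\mathcal{C}^tS\mathcal{C}\in\mathrm{Sym}_{D,i}\}$. The linear map $\phi(|[\mathcal{C}],S\rangle_i)=|(\mathcal{C},0)x_i\cap x_0\rangle$ is a linear isomorphism from $W(S)$ onto $V_{L_N(q)}=\mathrm{span}_{\mathbb{C}}\{|U\rangle:U\subseteq\mathbb{V}_0\}$ for an $N$-dimensional subspace $\mathbb{V}_0\subseteq x_0$ (formal orthonormal basis $|U\rangle$ indexed by subspaces). On $V_{L_N(q)}$: $L|U'\rangle=\sum_{U\subset U',\dim U=\dim U'-1}|U\rangle$, $R|U'\rangle=\sum_{U\supset U',\dim U=\dim U'+1}|U\rangle$, $K|U\rangle=q^{N/2-\dim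 U}|U\rangle$, $\hat L=q^{(1-N)/4}L$, $\hat R=q^{(1-N)/4}R$. Type of $S$: if $S=0$, $\epsilon=1$; otherwise let $r=\mathrm{rank}(S)$ and choose $\Upsilon\in GL(D,q)$ with $\Upsilon^tS\Upsilon=\begin{pmatrix}0&0\\0&Q\end{pmatrix}$, $Q$ a non-singular $r\times r$ matrix; $\epsilon=1$ if $r$ is even and $(-1)^{r/2}\det Q$ is a square in $\mathbb{F}_q$, $\epsilon=-1$ if $r$ is even and it is a non-square, $\epsilon=0$ if $r$ is odd.
   Formalization: For q = 2 the formal statement assumes rank(S) ≤ 1; the claim fails for q = 2 and every S of rank ≥ 2, e.g. D = 2, S = [[0,1],[1,0]], where W(S) is one-dimensional and not invariant under A. All odd primes are covered. *)

theory Defs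
  imports
    "Berlekamp_Zassenhaus.Finite_Field"
    "Jordan_Normal_Form.Matrix_Kernel"
    "Jordan_Normal_Form.DL_Rank"
    "Jordan_Normal_Form.Gauss_Jordan_Elimination"
    "HOL-Library.Function_Algebras"
    "HOL-Library.FuncSet"
begin

text \<open>
  The prime field with \<open>q\<close> elements is \<^typ>\<open>'p mod_ring\<close> with \<open>q = CARD('p)\<close> prime.
  Subspaces of \<open>F_q^(2 D)\<close> are sets of vectors.  Formal complex combinations of subspaces are
  complex-valued functions on sets of vectors, \<open>ket x\<close> being the indicator function of \<open>x\<close>.
\<close>

type_synonym 'p fvec = "'p mod_ring vec"
type_synonym 'p fmat = "'p mod_ring mat"
type_synonym 'p state = "'p mod_ring vec set \<Rightarrow> complex"


subsection \<open>Formal complex combinations\<close>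

definition cscale :: "complex \<Rightarrow> ('b \<Rightarrow> complex) \<Rightarrow> 'b \<Rightarrow> complex" where
  "cscale c v = (\<lambda>x. c * v x)"

interpretation cfun: vector_space cscale
  by unfold_locales (auto simp: cscale_def fun_eq_iff algebra_simps)

definition ket :: "'b \<Rightarrow> 'b \<Rightarrow> complex" where
  "ket x = (\<lambda>y. if y = x then 1 else 0)"

text \<open>Linear operator on the span of \<open>ket ` B\<close>, given by the images of the basis vectors.\<close>

definition lin_ext :: "'b set \<Rightarrow> ('b \<Rightarrow> 'c \<Rightarrow> complex) \<Rightarrow> ('b \<Rightarrow> complex) \<Rightarrow> 'c \<Rightarrow> complex" where
  "lin_ext B f v = (\<Sum>b\<in>B. cscale (v b) (f b))"

text \<open>Linear operator on the span of \<open>ket ` B\<close>, given by its matrix with respect to \<open>ket ` B\<close>.\<close>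

definition mat_op :: "'b set \<Rightarrow> ('b \<Rightarrow> 'b \<Rightarrow> complex) \<Rightarrow> ('b \<Rightarrow> complex) \<Rightarrow> 'b \<Rightarrow> complex" where
  "mat_op B M v = (\<lambda>x. if x \<in> B then \<Sum>y\<in>B. M x y * v y else 0)"

definition cinner :: "'b set \<Rightarrow> ('b \<Rightarrow> complex) \<Rightarrow> ('b \<Rightarrow> complex) \<Rightarrow> complex" where
  "cinner B u v = (\<Sum>x\<in>B. cnj (u x) * v x)"

definition orth_proj :: "'b set \<Rightarrow> ('b \<Rightarrow> complex) set \<Rightarrow> ('b \<Rightarrow> complex) \<Rightarrow> 'b \<Rightarrow> complex" where
  "orth_proj B W v = (THE w. w \<in> W \<and> (\<forall>u\<in>W. cinner B u (v - w) = 0))"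


subsection \<open>Subspaces and the symplectic form\<close>

abbreviation fspan :: "nat \<Rightarrow> 'p::prime_card fvec set \<Rightarrow> 'p fvec set" where
  "fspan n \<equiv> LinearCombinations.module.span class_ring (module_vec TYPE('p mod_ring) n)"

abbreviation fsubspace :: "nat \<Rightarrow> 'p::prime_card fvec set \<Rightarrow> bool" where
  "fsubspace n W \<equiv> VectorSpace.subspace class_ring W (module_vec TYPE('p mod_ring) n)"

abbreviation fdim :: "nat \<Rightarrow> 'p::prime_card fvec set \<Rightarrow> nat" where
  "fdim n W \<equiv> vectorspace.dim class_ring ((module_vec TYPE('p mod_ring) n)\<lparr>carrier := W\<rparr>)"

definition e_vec :: "nat \<Rightarrow> nat \<Rightarrow> 'p::prime_card fvec" where
  "e_vec D m = unit_vec (2 * D) (m - 1)"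

definition f_vec :: "nat \<Rightarrow> nat \<Rightarrow> 'p::prime_card fvec" where
  "f_vec D m = unit_vec (2 * D) (D + m - 1)"

definition symp_form :: "nat \<Rightarrow> 'p::prime_card fvec \<Rightarrow> 'p fvec \<Rightarrow> 'p mod_ring" where
  "symp_form D u v = (\<Sum>k<D. u $ k * v $ (D + k) - u $ (D + k) * v $ k)"

definition isotropic :: "nat \<Rightarrow> 'p::prime_card fvec set \<Rightarrow> bool" where
  "isotropic D W \<longleftrightarrow> fsubspace (2 * D) W \<and> (\<forall>u\<in>W. \<forall>v\<in>W. symp_form D u v = 0)"

definition max_isotropic :: "nat \<Rightarrow> 'p::prime_card fvec set set" where
  "max_isotropic D = {W. isotropic D W \<and> (\<forall>W'. isotropic D W' \<and> W \<subseteq> W' \<longrightarrow> W' = W)}"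

definition x_sub :: "nat \<Rightarrow> nat \<Rightarrow> 'p::prime_card fvec set" where
  "x_sub D i = LinearCombinations.module.submodule_sum (module_vec TYPE('p mod_ring) (2 * D))
     (fspan (2 * D) (e_vec D ` {1..D - i})) (fspan (2 * D) (f_vec D ` {D - i + 1..D}))"


subsection \<open>Adjacency and dual adjacency matrices of the dual polar graph\<close>

definition V_space :: "nat \<Rightarrow> 'p::prime_card state set" where
  "V_space D = cfun.span (ket ` max_isotropic D)"

definition dpg_adj :: "nat \<Rightarrow> 'p::prime_card fvec set \<Rightarrow> 'p fvec set \<Rightarrow> complex" where
  "dpg_adj D x y = (if fdim (2 * D) (x \<inter> y) = D - 1 then 1 else 0)"

definition dpg_A :: "nat \<Rightarrow> 'p::prime_card state \<Rightarrow> 'p state" where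
  "dpg_A D = mat_op (max_isotropic D) (dpg_adj D)"

definition dpg_theta :: "real \<Rightarrow> nat \<Rightarrow> nat \<Rightarrow> real" where
  "dpg_theta q D j = (1 - q + q ^ (D + 1 - j) - q ^ j) / (q - 1)"

definition dpg_E :: "nat \<Rightarrow> nat \<Rightarrow> 'p::prime_card state \<Rightarrow> 'p state" where
  "dpg_E D j = orth_proj (max_isotropic D)
     {v \<in> V_space D. dpg_A D v = cscale (complex_of_real (dpg_theta (real CARD('p)) D j)) v}"

text \<open>The entry of \<open>E_1\<close> in row \<open>x_0\<close> and column \<open>x\<close> is the \<open>x_0\<close>-coordinate of \<open>E_1 (ket x)\<close>.\<close>

definition dpg_dual_adj :: "nat \<Rightarrow> 'p::prime_card fvec set \<Rightarrow> 'p fvec set \<Rightarrow> complex" where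
  "dpg_dual_adj D x y =
     (if x = y then of_nat (card (max_isotropic D :: 'p fvec set set)) * dpg_E D 1 (ket x) (x_sub D 0)
      else 0)"

definition dpg_Astar :: "nat \<Rightarrow> 'p::prime_card state \<Rightarrow> 'p state" where
  "dpg_Astar D = mat_op (max_isotropic D) (dpg_dual_adj D)"


subsection \<open>The Siegel parabolic subgroup and the spaces \<open>W(S)\<close>\<close>

definition Sym :: "nat \<Rightarrow> 'p::prime_card fmat set" where
  "Sym D = {F \<in> carrier_mat D D. transpose_mat F = F}"

text \<open>Rows and columns are numbered from 0, so \<open>m \<le> D - i\<close> reads \<open>m < D - i\<close>.\<close>

definition Sym_sub :: "nat \<Rightarrow> nat \<Rightarrow> 'p::prime_card fmat set" where
  "Sym_sub D i = {F \<in> Sym D. \<forall>m<D. \<forall>n<D. m < D - i \<or> n < D - i \<longrightarrow> F $$ (m, n) = 0}"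

definition GL :: "nat \<Rightarrow> 'p::prime_card fmat set" where
  "GL D = {C \<in> carrier_mat D D. invertible_mat C}"

definition siegel :: "nat \<Rightarrow> 'p::prime_card fmat \<Rightarrow> 'p fmat \<Rightarrow> 'p fmat" where
  "siegel D C F =
     four_block_mat C (0\<^sub>m D D) (0\<^sub>m D D) (the (mat_inverse (transpose_mat C))) *
     four_block_mat (1\<^sub>m D) F (0\<^sub>m D D) (1\<^sub>m D)"

definition act :: "'p::prime_card fmat \<Rightarrow> 'p fvec set \<Rightarrow> 'p fvec set" where
  "act g x = (\<lambda>v. g *\<^sub>v v) ` x"

definition rho :: "nat \<Rightarrow> 'p::prime_card fmat \<Rightarrow> 'p state \<Rightarrow> 'p state" where
  "rho D g = lin_ext (max_isotropic D) (\<lambda>x. ket (act g x))"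

definition mtrace :: "'p::prime_card fmat \<Rightarrow> 'p mod_ring" where
  "mtrace M = (\<Sum>k<dim_row M. M $$ (k, k))"

text \<open>
  The vector \<open>|[I],S'>_i\<close>.  For \<open>q = 2\<close> the off-diagonal entries of \<open>S'\<close> contribute twice to
  \<open>tr (S' F)\<close>, so that this vector only depends on the diagonal of \<open>S'\<close>.
\<close>

definition psi_id :: "nat \<Rightarrow> nat \<Rightarrow> 'p::prime_card fmat \<Rightarrow> 'p state" where
  "psi_id D i S' =
     cscale (complex_of_real (real CARD('p) powr (- (real i * (real i + 1) / 4))))
       (\<Sum>F\<in>Sym_sub D i.
          cscale (exp (2 * complex_of_real pi * \<i> * of_int (to_int_mod_ring (mtrace (S' * F)))
                    / of_nat CARD('p)))
            (ket (act (siegel D (1\<^sub>m D) F) (x_sub D i))))"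

text \<open>The vector \<open>|[C],S>_i\<close>.\<close>

definition psi :: "nat \<Rightarrow> nat \<Rightarrow> 'p::prime_card fmat \<Rightarrow> 'p fmat \<Rightarrow> 'p state" where
  "psi D i C S = rho D (siegel D C (0\<^sub>m D D)) (psi_id D i (transpose_mat C * S * C))"

definition W_layer :: "nat \<Rightarrow> 'p::prime_card fmat \<Rightarrow> nat \<Rightarrow> 'p state set" where
  "W_layer D S i =
     cfun.span {psi D i C S | C. C \<in> GL D \<and> transpose_mat C * S * C \<in> Sym_sub D i}"

text \<open>
  The sum of the layers is automatically direct: layer \<open>i\<close> is supported on the \<open>x\<close> with
  \<open>dim (x \<inter> x_0) = D - i\<close>.
\<close>

definition W_space :: "nat \<Rightarrow> 'p::prime_card fmat \<Rightarrow> 'p state set" where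
  "W_space D S = {\<Sum>i\<le>D. w i | w. \<forall>i\<le>D. w i \<in> W_layer D S i}"


subsection \<open>The subspace lattice of the kernel\<close>

text \<open>
  The subspaces \<open>(C,0) x_i \<inter> x_0\<close> with \<open>C^t S C\<close> in \<open>Sym_sub D i\<close> are exactly the subspaces of the
  kernel of \<open>S\<close>, placed in \<open>x_0\<close>; hence this is the only possible \<open>V_0\<close>.
\<close>

definition V0 :: "nat \<Rightarrow> 'p::prime_card fmat \<Rightarrow> 'p fvec set" where
  "V0 D S = {v @\<^sub>v 0\<^sub>v D | v. v \<in> mat_kernel S}"

definition subs_V0 :: "nat \<Rightarrow> 'p::prime_card fmat \<Rightarrow> 'p fvec set set" where
  "subs_V0 D S = {U. fsubspace (2 * D) U \<and> U \<subseteq> V0 D S}"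

definition VL_space :: "nat \<Rightarrow> 'p::prime_card fmat \<Rightarrow> 'p state set" where
  "VL_space D S = cfun.span (ket ` subs_V0 D S)"

definition opL :: "nat \<Rightarrow> 'p::prime_card fmat \<Rightarrow> 'p state \<Rightarrow> 'p state" where
  "opL D S = lin_ext (subs_V0 D S) (\<lambda>U'.
     \<Sum>U\<in>{U \<in> subs_V0 D S. U \<subset> U' \<and> fdim (2 * D) U + 1 = fdim (2 * D) U'}. ket U)"

definition opR :: "nat \<Rightarrow> 'p::prime_card fmat \<Rightarrow> 'p state \<Rightarrow> 'p state" where
  "opR D S = lin_ext (subs_V0 D S) (\<lambda>U'.
     \<Sum>U\<in>{U \<in> subs_V0 D S. U' \<subset> U \<and> fdim (2 * D) U = fdim (2 * D) U' + 1}. ket U)"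

definition kappa :: "nat \<Rightarrow> 'p::prime_card fmat \<Rightarrow> 'p fvec set \<Rightarrow> real" where
  "kappa D S U = real CARD('p) powr (real (kernel_dim S) / 2 - real (fdim (2 * D) U))"

definition opK :: "nat \<Rightarrow> 'p::prime_card fmat \<Rightarrow> 'p state \<Rightarrow> 'p state" where
  "opK D S = lin_ext (subs_V0 D S) (\<lambda>U. cscale (complex_of_real (kappa D S U)) (ket U))"

definition opK_half :: "nat \<Rightarrow> 'p::prime_card fmat \<Rightarrow> 'p state \<Rightarrow> 'p state" where
  "opK_half D S = lin_ext (subs_V0 D S) (\<lambda>U. cscale (complex_of_real (sqrt (kappa D S U))) (ket U))"

definition opLhat :: "nat \<Rightarrow> 'p::prime_card fmat \<Rightarrow> 'p state \<Rightarrow> 'p state" where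
  "opLhat D S v =
     cscale (complex_of_real (real CARD('p) powr ((1 - real (kernel_dim S)) / 4))) (opL D S v)"

definition opRhat :: "nat \<Rightarrow> 'p::prime_card fmat \<Rightarrow> 'p state \<Rightarrow> 'p state" where
  "opRhat D S v =
     cscale (complex_of_real (real CARD('p) powr ((1 - real (kernel_dim S)) / 4))) (opR D S v)"


subsection \<open>The isomorphism \<open>\<phi>\<close> and transported operators\<close>

text \<open>
  The clause \<open>extensional\<close> only fixes the values outside \<open>W(S)\<close>, so that the map is unique.
\<close>

definition is_phi :: "nat \<Rightarrow> 'p::prime_card fmat \<Rightarrow> ('p state \<Rightarrow> 'p state) \<Rightarrow> bool" where
  "is_phi D S \<phi> \<longleftrightarrow>
     \<phi> \<in> extensional (W_space D S) \<and>
     (\<forall>u\<in>W_space D S. \<forall>v\<in>W_space D S. \<phi> (u + v) = \<phi> u + \<phi> v) \<and>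
     (\<forall>c. \<forall>v\<in>W_space D S. \<phi> (cscale c v) = cscale c (\<phi> v)) \<and>
     (\<forall>i\<le>D. \<forall>C\<in>GL D. transpose_mat C * S * C \<in> Sym_sub D i \<longrightarrow>
        \<phi> (psi D i C S) = ket (act (siegel D C (0\<^sub>m D D)) (x_sub D i) \<inter> x_sub D 0)) \<and>
     bij_betw \<phi> (W_space D S) (VL_space D S)"

definition phi :: "nat \<Rightarrow> 'p::prime_card fmat \<Rightarrow> 'p state \<Rightarrow> 'p state" where
  "phi D S = (THE \<phi>. is_phi D S \<phi>)"

definition transport :: "nat \<Rightarrow> 'p::prime_card fmat \<Rightarrow> ('p state \<Rightarrow> 'p state) \<Rightarrow> 'p state \<Rightarrow> 'p state" where
  "transport D S T = inv_into (W_space D S) (phi D S) \<circ> T \<circ> phi D S"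

definition calK :: "nat \<Rightarrow> 'p::prime_card fmat \<Rightarrow> 'p state \<Rightarrow> 'p state" where
  "calK D S = transport D S (opK D S)"

definition calK_half :: "nat \<Rightarrow> 'p::prime_card fmat \<Rightarrow> 'p state \<Rightarrow> 'p state" where
  "calK_half D S = transport D S (opK_half D S)"

definition calK_inv :: "nat \<Rightarrow> 'p::prime_card fmat \<Rightarrow> 'p state \<Rightarrow> 'p state" where
  "calK_inv D S = inv_into (W_space D S) (calK D S)"

definition calL :: "nat \<Rightarrow> 'p::prime_card fmat \<Rightarrow> 'p state \<Rightarrow> 'p state" where
  "calL D S = transport D S (opLhat D S)"

definition calR :: "nat \<Rightarrow> 'p::prime_card fmat \<Rightarrow> 'p state \<Rightarrow> 'p state" where
  "calR D S = transport D S (opRhat D S)"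


subsection \<open>The type of a symmetric matrix\<close>

text \<open>
  The block \<open>Q\<close> is unique up to congruence, so the square class of its determinant does not depend
  on the choice.
\<close>

definition nonsing_block :: "nat \<Rightarrow> 'p::prime_card fmat \<Rightarrow> 'p fmat" where
  "nonsing_block D S = (let r = vec_space.rank D S in
     SOME Q. Q \<in> carrier_mat r r \<and> invertible_mat Q \<and>
       (\<exists>Y\<in>GL D. transpose_mat Y * S * Y =
          four_block_mat (0\<^sub>m (D - r) (D - r)) (0\<^sub>m (D - r) r) (0\<^sub>m r (D - r)) Q))"

definition form_type :: "nat \<Rightarrow> 'p::prime_card fmat \<Rightarrow> int" where
  "form_type D S = (let r = vec_space.rank D S in
     if S = 0\<^sub>m D D then 1
     else if odd r then 0
     else if \<exists>z. (- 1) ^ (r div 2) * det (nonsing_block D S) = z\<^sup>2 then 1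
     else - 1)"

end

theory Submission
  imports Defs
begin

text \<open>
  Write a maximal isotropic subspace as the graph of a symmetric map over \<open>U = x \<inter> x_0\<close>, determined on the
  annihilator of \<open>U\<close>.  The vectors \<open>|[C],S>_i\<close> become plane waves \<open>M \<mapsto> chi (tr (S M))\<close> on the fibre over a
  subspace \<open>U\<close> of the kernel of \<open>S\<close>.  The neighbours of a vertex over \<open>U\<close> lie over \<open>U\<close> itself, over the
  covers of \<open>U\<close>, or over the subspaces covered by \<open>U\<close>.  Over a cover there is a single neighbour.  Over a
  covered subspace the neighbours form a family indexed by vectors, and the wave sum vanishes unless \<open>U\<close> lies in
  the kernel of \<open>S\<close>.  Over \<open>U\<close> they are the rank one perturbations \<open>M + c l l^t\<close>, and the wave sum
  is the sum over \<open>c\<close> of the quadratic Gauss sums of \<open>c S\<close>, which gives the type of \<open>S\<close>.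

  For the dual adjacency matrix, an affine function of \<open>q^(dim (x \<inter> x_0))\<close> is a \<open>\<theta>_1\<close>-eigenvector.  Any
  \<open>\<theta>_1\<close>-eigenvector vanishing at \<open>x_0\<close> has zero sum over each sphere around \<open>x_0\<close>, so this radial
  eigenvector is, up to a scalar, the projection of \<open>x_0\<close>.
\<close>

subsection \<open>The additive character and subspaces\<close>

text \<open>Over the field with two elements \<open>tr (S M)\<close> sees only the diagonal of
  \<open>S\<close>, so a wave can be constant where the neighbour sums ought to cancel. What the
  argument needs is that \<open>u \<bullet> (S *\<^sub>v u) = 0\<close> forces
  \<open>S *\<^sub>v u = 0\<^sub>v D\<close>; for \<open>q = 2\<close> the rank bound supplies this,
  for odd \<open>q\<close> division by 2 takes its place. Subspaces are measured by cardinality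
  instead of dimension, which turns duality and index computations into character sums and divisions
  of natural numbers. The data that describe a neighbour are redundant, so sums over neighbours are
  taken over all parameters and divided by the constant fibre size; the numbers of neighbours are
  the case \<open>S = 0\<close> of the same sums. The scalar in the dual matrix is fixed by the
  idempotence of the projector: the row \<open>t\<close> of \<open>|X| E_1\<close> at
  \<open>x_0\<close> has \<open>\<Sum> t(x)^2 = |X| t(x_0)\<close>. The first two moments of
  \<open>q^(dim (x \<inter> x_0))\<close> that this requires come from summing the adjacency
  relations for this function and its square over all vertices.\<close>

definition chi :: "'p::prime_card mod_ring \<Rightarrow> complex" where
  "chi z = exp (2 * complex_of_real pi * \<i> * of_int (to_int_mod_ring z) / of_nat CARD('p))"

lemma chi_cis: "chi (z :: 'p::prime_card mod_ring) =
    cis (2 * pi * of_int (to_int_mod_ring z) / of_nat CARD('p))"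
  unfolding chi_def cis_conv_exp by (simp add: field_simps)

lemma chi_0 [simp]: "chi 0 = 1"
  by (simp add: chi_def)

lemma cis_mod_nat:
  assumes "q > 0"
  shows "cis (2 * pi * of_int (k mod int q) / of_nat q) = cis (2 * pi * of_int k / of_nat q)"
proof -
  have "of_int k = (of_int (k mod int q) + of_nat q * of_int (k div int q) :: real)"
    by (metis mod_mult_div_eq of_int_add of_int_mult of_int_of_nat_eq)
  then have "2 * pi * of_int k / of_nat q
      = 2 * pi * of_int (k mod int q) / of_nat q + 2 * pi * of_int (k div int q)"
    using assms by (simp add: field_simps)
  then show ?thesis
    by (metis cis_mult cis_multiple_2pi Ints_of_int mult.right_neutral)
qed

text \<open>The representative of a sum is the sum of the representatives reduced modulo
  \<open>q\<close>, and the reduction is invisible because \<open>cis\<close> has period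
  \<open>2 * pi\<close>.\<close>

lemma chi_add: "chi (a + b) = chi a * chi (b :: 'p::prime_card mod_ring)"
proof -
  have "to_int_mod_ring (a + b) = (to_int_mod_ring a + to_int_mod_ring b) mod int CARD('p)"
    by (transfer) simp
  then show ?thesis
    unfolding chi_cis by (simp add: cis_mod_nat cis_mult ring_distribs add_divide_distrib)
qed

lemma chi_eq_1_iff: "chi z = 1 \<longleftrightarrow> z = (0 :: 'p::prime_card mod_ring)"
proof
  assume 1: "chi z = 1"
  define k where "k = to_int_mod_ring z"
  have k: "0 \<le> k" "k < int CARD('p)" unfolding k_def by (transfer, simp)+
  have "cos (2 * pi * of_int k / of_nat CARD('p)) = 1"
    using 1 unfolding chi_cis k_def by (metis cis.simps(1) one_complex.simps(1))
  then obtain n :: int where "2 * pi * of_int k / of_nat CARD('p) = of_int n * 2 * pi"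
    by (auto simp: cos_one_2pi_int)
  then have "(of_int k :: real) = of_int n * of_nat CARD('p)"
    by (simp add: field_simps)
  then have "k = n * int CARD('p)"
    by (metis of_int_eq_iff of_int_mult of_int_of_nat_eq)
  with k have "k = 0"
    by (metis mod_mult_self2_is_0 mod_pos_pos_trivial)
  then show "z = 0" unfolding k_def by simp
qed simp

lemma card_vec [simp]: "card (carrier_vec n :: 'p::prime_card mod_ring vec set) = CARD('p) ^ n"
proof -
  have eq: "carrier_vec n = vec_of_list ` {xs :: 'p mod_ring list. set xs \<subseteq> UNIV \<and> length xs = n}"
  proof (intro equalityI subsetI)
    fix v :: "'p mod_ring vec" assume "v \<in> carrier_vec n"
    then show "v \<in> vec_of_list ` {xs. set xs \<subseteq> UNIV \<and> length xs = n}"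
      by (intro image_eqI[of _ _ "list_of_vec v"]) (auto simp: vec_list)
  qed (auto intro: carrier_vecI)
  have "inj (vec_of_list :: 'p mod_ring list \<Rightarrow> _)"
    by (metis injI list_vec)
  then show ?thesis
    unfolding eq using card_lists_length_eq[of "UNIV :: 'p mod_ring set" n]
    by (subst card_image) (auto intro: inj_on_subset)
qed

lemma finite_vec [simp]: "finite (carrier_vec n :: 'p::prime_card mod_ring vec set)"
  by (rule card_ge_0_finite) simp

text \<open>The closure conditions of a subspace in plain vector arithmetic, so that set-level
  arguments stay outside the vector space locale; \<open>fsubspace_iff\<close> is the bridge to the
  notion used in the definitions.\<close>

definition sub :: "nat \<Rightarrow> 'p::prime_card mod_ring vec set \<Rightarrow> bool" where
  "sub n W \<longleftrightarrow> W \<subseteq> carrier_vec n \<and> 0\<^sub>v n \<in> W \<and> (\<forall>u\<in>W. \<forall>v\<in>W. u + v \<in> W) \<and>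
     (\<forall>c. \<forall>v\<in>W. c \<cdot>\<^sub>v v \<in> W)"

lemma fsubspace_iff: "fsubspace n W \<longleftrightarrow> sub n W"
proof -
  interpret vec_space "TYPE('a mod_ring)" n .
  show ?thesis
    unfolding VectorSpace.subspace_def sub_def submodule_def
    using vec_vs vec_module by (auto simp: module_vec_simps class_ring_simps)
qed

lemma subD:
  assumes "sub n W"
  shows "W \<subseteq> carrier_vec n" "0\<^sub>v n \<in> W" "u \<in> W \<Longrightarrow> v \<in> W \<Longrightarrow> u + v \<in> W"
    "u \<in> W \<Longrightarrow> c \<cdot>\<^sub>v u \<in> W" "finite W" "card W > 0"
proof -
  show f: "finite W" using assms finite_subset[OF _ finite_vec] by (auto simp: sub_def)
  show "card W > 0" using assms f by (auto simp: sub_def card_gt_0_iff)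
qed (use assms in \<open>auto simp: sub_def\<close>)

lemma sub_minus:
  assumes "sub n W" "u \<in> W" "v \<in> W" shows "u - v \<in> W"
proof -
  have "u - v = u + (- 1) \<cdot>\<^sub>v v"
    using subD(1)[OF assms(1)] assms(2,3) by (intro eq_vecI) auto
  then show ?thesis using subD[OF assms(1)] assms(2,3) by simp
qed

lemma sub_carrier [simp]: "sub n (carrier_vec n)"
  by (auto simp: sub_def)

lemma sub_Int: "sub n A \<Longrightarrow> sub n B \<Longrightarrow> sub n (A \<inter> B)"
  by (auto simp: sub_def)

text \<open>Coordinates with respect to a finite basis identify \<open>W\<close> with the functions
  from the basis to the field. This translates the dimensions in the definitions into the
  cardinalities in which all counting is done.\<close>

lemma card_sub:
  assumes "sub n (W :: 'p::prime_card mod_ring vec set)"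
  shows "card W = CARD('p) ^ fdim n W"
proof -
  interpret vec_space "TYPE('p mod_ring)" n .
  have fs: "fsubspace n W" using assms by (simp add: fsubspace_iff)
  interpret W: vectorspace class_ring "vs W"
    using fs subspace_is_vs by blast
  have finW: "finite W" using subD(5)[OF assms] .
  have "W.fin_dim"
    unfolding W.fin_dim_def
    using finW W.span_is_subset2[of W] W.in_own_span[of W] by (intro exI[of _ W]) auto
  then obtain B where B: "finite B" "W.basis B"
    using W.finite_basis_exists by blast
  then have Bc: "B \<subseteq> W" by (auto simp: W.basis_def)
  have dim: "W.dim = card B" using W.dim_basis[OF B] .
  have crit: "\<forall>v. v \<in> W \<longrightarrow> (\<exists>!a. a \<in> B \<rightarrow>\<^sub>E UNIV \<and> W.lincomb a B = v)"
    using W.basis_criterion[OF B(1)] B(2) Bc by (simp add: class_ring_simps)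
  have "bij_betw (\<lambda>a. W.lincomb a B) (B \<rightarrow>\<^sub>E UNIV) W"
    unfolding bij_betw_def
  proof
    have lc: "W.lincomb a B \<in> W" if "a \<in> B \<rightarrow>\<^sub>E UNIV" for a
      using W.lincomb_closed[of B a] Bc by (simp add: class_ring_simps)
    show "inj_on (\<lambda>a. W.lincomb a B) (B \<rightarrow>\<^sub>E UNIV)"
      using crit lc by (intro inj_onI) metis
    show "(\<lambda>a. W.lincomb a B) ` (B \<rightarrow>\<^sub>E UNIV) = W"
      using crit lc by (auto simp: image_iff)
  qed
  from bij_betw_same_card[OF this] have "card W = card (B \<rightarrow>\<^sub>E (UNIV :: 'p mod_ring set))"
    by simp
  also have "\<dots> = CARD('p) ^ card B" using B(1) by (simp add: card_PiE)
  finally show ?thesis using dim by simp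
qed

lemma bij_betw_translate:
  assumes "sub n W" "v \<in> W" shows "bij_betw (\<lambda>u. u + v) W W"
proof -
  have inj: "inj_on (\<lambda>u. u + v) W"
  proof (rule inj_onI, rule eq_vecI)
    fix a b i assume ab: "a \<in> W" "b \<in> W" "a + v = b + v" and i: "i < dim_vec b"
    have d: "dim_vec a = n" "dim_vec b = n" "dim_vec v = n"
      using subD(1)[OF assms(1)] assms(2) ab by auto
    have "(a + v) $ i = (b + v) $ i" using ab(3) by simp
    then show "a $ i = b $ i" using i d by simp
  next
    fix a b assume "a \<in> W" "b \<in> W"
    then have "a \<in> carrier_vec n" "b \<in> carrier_vec n" using subD(1)[OF assms(1)] by auto
    then show "dim_vec a = dim_vec b" by simp
  qed
  have "(\<lambda>u. u + v) ` W \<subseteq> W" using subD(3)[OF assms(1)] assms(2) by auto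
  then show ?thesis
    unfolding bij_betw_def using inj endo_inj_surj[OF subD(5)[OF assms(1)]] by blast
qed

text \<open>Translation by a \<open>v\<close> with \<open>f v \<noteq> 0\<close> permutes
  \<open>W\<close> and multiplies the sum by \<open>chi (f v) \<noteq> 1\<close>. Asking only for
  additivity of \<open>f\<close> admits scalar products and, in characteristic 2, also quadratic
  forms.\<close>

lemma sum_chi_additive:
  assumes W: "sub n W" and add: "\<And>u v. u \<in> W \<Longrightarrow> v \<in> W \<Longrightarrow> f (u + v) = f u + f v"
  shows "(\<Sum>v\<in>W. chi (f v)) = (if \<forall>v\<in>W. f v = 0 then of_nat (card W) else 0)"
proof (cases "\<forall>v\<in>W. f v = 0")
  case False
  then obtain v where v: "v \<in> W" "f v \<noteq> 0" by auto
  have "(\<Sum>u\<in>W. chi (f u)) = (\<Sum>u\<in>W. chi (f (u + v)))"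
    using sum.reindex_bij_betw[OF bij_betw_translate[OF W v(1)], of "\<lambda>u. chi (f u)"] by simp
  also have "\<dots> = (\<Sum>u\<in>W. chi (f u)) * chi (f v)"
    using v(1) by (simp add: add chi_add sum_distrib_right)
  finally have "(\<Sum>u\<in>W. chi (f u)) * (1 - chi (f v)) = 0" by (simp add: algebra_simps)
  then show ?thesis using v(2) False by (subst if_not_P) (auto simp: chi_eq_1_iff)
qed simp

lemma sum_chi_mult:
  "(\<Sum>c\<in>UNIV. chi (c * a)) = (if a = 0 then of_nat CARD('p) else (0::complex))"
  for a :: "'p::prime_card mod_ring"
proof (cases "a = 0")
  case False
  have "bij_betw (\<lambda>c. c + 1) (UNIV :: 'p mod_ring set) UNIV"
    by (rule bij_betw_byWitness[of _ "\<lambda>c. c - 1"]) auto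
  from sum.reindex_bij_betw[OF this, of "\<lambda>c. chi (c * a)"]
  have "(\<Sum>c\<in>UNIV. chi (c * a)) = (\<Sum>c\<in>UNIV. chi (c * a)) * chi a"
    by (simp add: ring_distribs chi_add sum_distrib_right)
  then have "(\<Sum>c\<in>UNIV. chi (c * a)) * (1 - chi a) = 0" by (simp add: algebra_simps)
  then show ?thesis using False by (simp add: chi_eq_1_iff)
qed simp

subsection \<open>Annihilators and flags\<close>

lemma card_field_gt_1: "1 < CARD('p::prime_card)"
  by (rule prime_gt_1_nat[OF prime_card])

lemma mult_mat_zero_vec: "C \<in> carrier_mat m n \<Longrightarrow> C *\<^sub>v 0\<^sub>v n = 0\<^sub>v m"
  by (intro eq_vecI) (auto simp: scalar_prod_def)

definition perp :: "nat \<Rightarrow> 'p::prime_card mod_ring vec set \<Rightarrow> 'p mod_ring vec set" where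
  "perp n U = {b \<in> carrier_vec n. \<forall>a\<in>U. a \<bullet> b = 0}"

definition ext :: "'p::prime_card mod_ring vec set \<Rightarrow> 'p mod_ring vec \<Rightarrow> 'p mod_ring vec set" where
  "ext A v = (\<lambda>(a, c). a + c \<cdot>\<^sub>v v) ` (A \<times> UNIV)"

lemma extI: "a \<in> A \<Longrightarrow> a + c \<cdot>\<^sub>v v \<in> ext A v"
  by (force simp: ext_def)

lemma ext_subset:
  assumes "sub n B" "A \<subseteq> B" "v \<in> B" shows "ext A v \<subseteq> B"
  using subD[OF assms(1)] assms(2,3) by (auto simp: ext_def)

lemma sub_ext:
  assumes A: "sub n A" and v: "v \<in> carrier_vec n"
  shows "sub n (ext A v)" "A \<subseteq> ext A v" "v \<in> ext A v"
proof -
  have Ac: "a \<in> carrier_vec n" if "a \<in> A" for a using subD(1)[OF A] that by auto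
  show sA: "A \<subseteq> ext A v"
  proof
    fix a assume a: "a \<in> A"
    have "a = a + 0 \<cdot>\<^sub>v v" using Ac[OF a] v by auto
    then show "a \<in> ext A v" using extI[OF a, of 0 v] by simp
  qed
  have "v = 0\<^sub>v n + 1 \<cdot>\<^sub>v v" using v by auto
  then show "v \<in> ext A v" using extI[OF subD(2)[OF A], of 1 v] by simp
  show "sub n (ext A v)"
    unfolding sub_def
  proof (intro conjI ballI allI)
    show "ext A v \<subseteq> carrier_vec n" using Ac v by (auto simp: ext_def)
    show "0\<^sub>v n \<in> ext A v" using sA subD(2)[OF A] by auto
  next
    fix x y assume "x \<in> ext A v" "y \<in> ext A v"
    then obtain a b c d where xy: "x = a + c \<cdot>\<^sub>v v" "y = b + d \<cdot>\<^sub>v v" "a \<in> A" "b \<in> A"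
      by (auto simp: ext_def)
    then have "x + y = (a + b) + (c + d) \<cdot>\<^sub>v v"
      using Ac[of a] Ac[of b] v by (intro eq_vecI) (auto simp: algebra_simps)
    then show "x + y \<in> ext A v" using extI[OF subD(3)[OF A xy(3,4)]] by simp
  next
    fix e x assume "x \<in> ext A v"
    then obtain a c where x: "x = a + c \<cdot>\<^sub>v v" "a \<in> A" by (auto simp: ext_def)
    then have "e \<cdot>\<^sub>v x = (e \<cdot>\<^sub>v a) + (e * c) \<cdot>\<^sub>v v"
      using Ac[of a] v by (intro eq_vecI) (auto simp: algebra_simps)
    then show "e \<cdot>\<^sub>v x \<in> ext A v" using extI[OF subD(4)[OF A x(2)]] by simp
  qed
qed

text \<open>Two representations with different coefficients of \<open>v\<close> could be solved for
  \<open>v\<close>, which would put it into \<open>A\<close>.\<close>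

lemma ext_inj:
  assumes A: "sub n A" and v: "v \<in> carrier_vec n" "v \<notin> A"
  shows "inj_on (\<lambda>(a, c). a + c \<cdot>\<^sub>v v) (A \<times> UNIV)"
proof (rule inj_onI, clarsimp)
  fix a c b d
  assume ab: "a \<in> A" "b \<in> A" and eq: "a + c \<cdot>\<^sub>v v = b + d \<cdot>\<^sub>v v"
  have car: "a \<in> carrier_vec n" "b \<in> carrier_vec n" using subD(1)[OF A] ab by auto
  have ix: "a $ i + c * v $ i = b $ i + d * v $ i" if "i < n" for i
    using arg_cong[OF eq, of "\<lambda>x. x $ i"] car v that by simp
  have "c = d"
  proof (rule ccontr)
    assume cd: "c \<noteq> d"
    have "v = (1 / (c - d)) \<cdot>\<^sub>v (b - a)"
    proof (rule eq_vecI)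
      fix i assume "i < dim_vec ((1 / (c - d)) \<cdot>\<^sub>v (b - a))"
      then have i: "i < n" using car by simp
      have "v $ i * (c - d) = b $ i - a $ i" using ix[OF i] by (simp add: algebra_simps)
      then show "v $ i = ((1 / (c - d)) \<cdot>\<^sub>v (b - a)) $ i"
        using i car cd by (simp add: field_simps)
    qed (use v car in auto)
    then show False using v(2) subD(4)[OF A sub_minus[OF A ab(2,1)]] by metis
  qed
  moreover have "a = b" using ix car \<open>c = d\<close> by (intro eq_vecI) auto
  ultimately show "a = b \<and> c = d" by simp
qed

lemma card_ext:
  fixes A :: "'p::prime_card mod_ring vec set"
  assumes "sub n A" "v \<in> carrier_vec n" "v \<notin> A"
  shows "card (ext A v) = CARD('p) * card A"
  unfolding ext_def by (subst card_image[OF ext_inj[OF assms]]) (simp add: card_cartesian_product)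

text \<open>Index \<open>q\<close> leaves no room for an intermediate subspace: adjoining any new
  vector already multiplies the size of \<open>A\<close> by \<open>q\<close>.\<close>

lemma ext_eq:
  fixes A :: "'p::prime_card mod_ring vec set"
  assumes "sub n A" "sub n B" "A \<subseteq> B" "card B = CARD('p) * card A" "v \<in> B" "v \<notin> A"
  shows "ext A v = B"
proof (rule card_subset_eq)
  show "finite B" using subD(5)[OF assms(2)] .
  show "ext A v \<subseteq> B" using ext_subset assms by blast
  have "v \<in> carrier_vec n" using subD(1)[OF assms(2)] assms(5) by auto
  then show "card (ext A v) = card B" using card_ext assms by metis
qed

lemma sub_perp: "U \<subseteq> carrier_vec n \<Longrightarrow> sub n (perp n U)"
  unfolding sub_def perp_def
  by (auto simp: scalar_prod_add_distrib[where n = n] subset_iff)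

lemma perp_carrier: "perp n U \<subseteq> carrier_vec n"
  by (auto simp: perp_def)

lemma perpD: "b \<in> perp n U \<Longrightarrow> a \<in> U \<Longrightarrow> a \<bullet> b = 0"
  by (auto simp: perp_def)

lemma perpD': "b \<in> perp n U \<Longrightarrow> a \<in> U \<Longrightarrow> U \<subseteq> carrier_vec n \<Longrightarrow> b \<bullet> a = 0"
  by (subst comm_scalar_prod[where n = n]) (auto simp: perp_def)

lemma perp_mono: "U \<subseteq> U' \<Longrightarrow> perp n U' \<subseteq> perp n U"
  by (auto simp: perp_def)

lemma scalar_zero_iff:
  assumes "(a :: 'a :: comm_ring_1 vec) \<in> carrier_vec n" "\<forall>b\<in>carrier_vec n. a \<bullet> b = 0"
  shows "a = 0\<^sub>v n"
proof (rule eq_vecI)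
  fix i assume "i < dim_vec (0\<^sub>v n)"
  then show "a $ i = 0\<^sub>v n $ i"
    using assms(2)[rule_format, of "unit_vec n i"] scalar_prod_right_unit[of i n a] by simp
qed (use assms in auto)

text \<open>Double counting of \<open>chi (u \<bullet> b)\<close> over all \<open>u\<close> in
  \<open>U\<close> and all \<open>b\<close>. Summing over \<open>b\<close> leaves only
  \<open>u = 0\<close>, with value \<open>q^n\<close>; summing over \<open>u\<close> leaves only the
  \<open>b\<close> in the annihilator, each with value \<open>card U\<close>.\<close>

lemma card_perp:
  fixes U :: "'p::prime_card mod_ring vec set"
  assumes U: "sub n U"
  shows "card U * card (perp n U) = CARD('p) ^ n"
proof -
  let ?V = "carrier_vec n :: 'p mod_ring vec set"
  have Uc: "u \<in> carrier_vec n" if "u \<in> U" for u using subD(1)[OF U] that by auto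
  have "(\<Sum>u\<in>U. \<Sum>b\<in>?V. chi (u \<bullet> b)) = (\<Sum>u\<in>U. if u = 0\<^sub>v n then of_nat (card ?V) else 0)"
  proof (rule sum.cong[OF refl])
    fix u assume u: "u \<in> U"
    have "(\<Sum>b\<in>?V. chi (u \<bullet> b)) = (if \<forall>b\<in>?V. u \<bullet> b = 0 then of_nat (card ?V) else 0)"
      by (rule sum_chi_additive[where n = n]) (use Uc[OF u] in \<open>auto simp: scalar_prod_add_distrib[where n = n]\<close>)
    also have "(\<forall>b\<in>?V. u \<bullet> b = 0) \<longleftrightarrow> u = 0\<^sub>v n"
      using scalar_zero_iff Uc[OF u] by auto
    finally show "(\<Sum>b\<in>?V. chi (u \<bullet> b)) = (if u = 0\<^sub>v n then of_nat (card ?V) else 0)" .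
  qed
  also have "\<dots> = of_nat (CARD('p) ^ n)"
    using subD(2,5)[OF U] by (simp add: sum.delta)
  finally have 1: "(\<Sum>u\<in>U. \<Sum>b\<in>?V. chi (u \<bullet> b)) = of_nat (CARD('p) ^ n)" .
  have "(\<Sum>u\<in>U. \<Sum>b\<in>?V. chi (u \<bullet> b)) = (\<Sum>b\<in>?V. \<Sum>u\<in>U. chi (u \<bullet> b))"
    by (rule sum.swap)
  also have "\<dots> = (\<Sum>b\<in>?V. if b \<in> perp n U then of_nat (card U) else 0)"
  proof (rule sum.cong[OF refl])
    fix b assume b: "b \<in> ?V"
    have "(\<Sum>u\<in>U. chi (u \<bullet> b)) = (if \<forall>u\<in>U. u \<bullet> b = 0 then of_nat (card U) else 0)"
      by (rule sum_chi_additive[OF U]) (use Uc b in \<open>auto simp: add_scalar_prod_distrib[where n = n]\<close>)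
    then show "(\<Sum>u\<in>U. chi (u \<bullet> b)) = (if b \<in> perp n U then of_nat (card U) else 0)"
      using b by (simp add: perp_def)
  qed
  also have "\<dots> = of_nat (card U * card (perp n U))"
    using perp_carrier[of n U] by (simp add: sum.If_cases Int_absorb1)
  finally have "of_nat (card U * card (perp n U)) = (of_nat (CARD('p) ^ n) :: complex)"
    using 1 by simp
  then show ?thesis by (simp only: of_nat_eq_iff)
qed

text \<open>\<open>U\<close> lies in its double annihilator, and applying the product formula twice
  shows that both have the same size.\<close>

lemma perp_perp:
  fixes U :: "'p::prime_card mod_ring vec set"
  assumes U: "sub n U"
  shows "perp n (perp n U) = U"
proof -
  have sP: "sub n (perp n U)" using sub_perp subD(1)[OF U] by blast
  have "card (perp n U) * card (perp n (perp n U)) = card U * card (perp n U)"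
    using card_perp[OF U] card_perp[OF sP] by simp
  then have "card U = card (perp n (perp n U))"
    using subD(6)[OF sP] by simp
  moreover have "U \<subseteq> perp n (perp n U)"
    using subD(1)[OF U] perpD'[OF _ _ subD(1)[OF U]] by (auto simp: perp_def[of n "perp n U"])
  ultimately show ?thesis
    using card_subset_eq[of "perp n (perp n U)" U] subD(5)[OF sub_perp[OF perp_carrier]] by metis
qed

text \<open>A \<open>v\<close> orthogonal to the whole annihilator would lie in \<open>U\<close> by
  biduality; scaling makes the pairing 1. The resulting \<open>b\<close> serves below as the
  functional or dual vector that reads off a coefficient.\<close>

lemma perp_separate:
  assumes U: "sub n U" and v: "v \<in> carrier_vec n" "v \<notin> U"
  obtains b where "b \<in> perp n U" "v \<bullet> b = 1" "b \<bullet> v = 1" "b \<in> carrier_vec n"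
proof -
  have "v \<notin> perp n (perp n U)" using perp_perp[OF U] v by simp
  then obtain b where b: "b \<in> perp n U" "b \<bullet> v \<noteq> 0" using v by (auto simp: perp_def[of n "perp n U"])
  have bc: "b \<in> carrier_vec n" using b perp_carrier by blast
  let ?b = "(1 / (b \<bullet> v)) \<cdot>\<^sub>v b"
  have "?b \<in> perp n U" using subD(4)[OF sub_perp[OF subD(1)[OF U]]] b by blast
  moreover have "?b \<bullet> v = 1" using bc v b(2) by simp
  moreover have "v \<bullet> ?b = 1" using comm_scalar_prod[of v n ?b] bc v \<open>?b \<bullet> v = 1\<close> by simp
  ultimately show ?thesis using that bc by auto
qed

section \<open>Coordinate flags and their images under invertible matrices\<close>

definition std :: "nat \<Rightarrow> nat \<Rightarrow> 'p::prime_card mod_ring vec set" where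
  "std n k = {v \<in> carrier_vec n. \<forall>j. k \<le> j \<longrightarrow> j < n \<longrightarrow> v $ j = 0}"

lemma sub_std: "sub n (std n k)"
  by (auto simp: sub_def std_def)

lemma std_n [simp]: "std n n = carrier_vec n"
  by (auto simp: std_def)

lemma std_0: "std n 0 = {0\<^sub>v n}"
  by (auto simp: std_def)

lemma std_Suc:
  assumes "k < n"
  shows "std n (Suc k) = ext (std n k) (unit_vec n k)"
proof (rule antisym)
  show "std n (Suc k) \<subseteq> ext (std n k) (unit_vec n k :: 'a mod_ring vec)"
  proof
    fix v :: "'a mod_ring vec" assume v: "v \<in> std n (Suc k)"
    let ?a = "vec n (\<lambda>j. if j = k then 0 else v $ j)"
    have "v = ?a + (v $ k) \<cdot>\<^sub>v unit_vec n k"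
      using v assms by (intro eq_vecI) (auto simp: std_def)
    moreover have "?a \<in> std n k" using v by (auto simp: std_def)
    ultimately show "v \<in> ext (std n k) (unit_vec n k)" using extI by metis
  qed
  show "ext (std n k) (unit_vec n k) \<subseteq> (std n (Suc k) :: 'a mod_ring vec set)"
    by (rule ext_subset[OF sub_std]) (auto simp: std_def)
qed

lemma card_std: "k \<le> n \<Longrightarrow> card (std n k :: 'p::prime_card mod_ring vec set) = CARD('p) ^ k"
proof (induction k)
  case (Suc k)
  have "unit_vec n k \<notin> (std n k :: 'p mod_ring vec set)"
    using Suc.prems by (auto simp: std_def intro!: exI[of _ k])
  then show ?case using Suc by (simp add: std_Suc card_ext[OF sub_std])
qed (simp add: std_0)

lemma mult_mat_vec_inj:
  assumes C: "C \<in> carrier_mat m n" and W: "sub n W"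
    and ker: "\<And>v. v \<in> W \<Longrightarrow> C *\<^sub>v v = 0\<^sub>v m \<Longrightarrow> v = 0\<^sub>v n"
  shows "inj_on ((*\<^sub>v) C) W"
proof (rule inj_onI)
  fix u v assume uv: "u \<in> W" "v \<in> W" "C *\<^sub>v u = C *\<^sub>v v"
  have car: "u \<in> carrier_vec n" "v \<in> carrier_vec n" using uv subD(1)[OF W] by auto
  have "C *\<^sub>v (u - v) = 0\<^sub>v m"
    using mult_minus_distrib_mat_vec[OF C car] uv(3) C by (auto intro!: eq_vecI)
  then have z: "u - v = 0\<^sub>v n" using ker sub_minus[OF W uv(1,2)] by blast
  show "u = v"
  proof (rule eq_vecI)
    fix i assume "i < dim_vec v"
    then show "u $ i = v $ i" using car arg_cong[OF z, of "\<lambda>x. x $ i"] by auto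
  qed (use car in auto)
qed

lemma sub_image:
  assumes C: "C \<in> carrier_mat m n" and W: "sub n W"
  shows "sub m ((*\<^sub>v) C ` W)"
proof -
  have Wc: "v \<in> carrier_vec n" if "v \<in> W" for v using subD(1)[OF W] that by auto
  show ?thesis unfolding sub_def
  proof (intro conjI ballI allI)
    show "(*\<^sub>v) C ` W \<subseteq> carrier_vec m" using C Wc by (auto intro: mult_mat_vec_carrier)
    have "C *\<^sub>v 0\<^sub>v n = 0\<^sub>v m" using C by auto
    then show "0\<^sub>v m \<in> (*\<^sub>v) C ` W" using subD(2)[OF W] by (metis imageI)
  next
    fix x y assume "x \<in> (*\<^sub>v) C ` W" "y \<in> (*\<^sub>v) C ` W"
    then obtain a b where "x = C *\<^sub>v a" "y = C *\<^sub>v b" "a \<in> W" "b \<in> W" by auto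
    then have "x + y = C *\<^sub>v (a + b)" "a + b \<in> W"
      using mult_add_distrib_mat_vec[OF C] Wc subD(3)[OF W] by auto
    then show "x + y \<in> (*\<^sub>v) C ` W" by auto
  next
    fix c x assume "x \<in> (*\<^sub>v) C ` W"
    then obtain a where "x = C *\<^sub>v a" "a \<in> W" by auto
    then have "c \<cdot>\<^sub>v x = C *\<^sub>v (c \<cdot>\<^sub>v a)" "c \<cdot>\<^sub>v a \<in> W"
      using mult_mat_vec[OF C Wc] subD(4)[OF W] by auto
    then show "c \<cdot>\<^sub>v x \<in> (*\<^sub>v) C ` W" by auto
  qed
qed

lemma replace_column_mult:
  assumes C: "C \<in> carrier_mat n n" and u: "u \<in> carrier_vec n" and v: "v \<in> carrier_vec n" and k: "k < n"
  shows "mat n n (\<lambda>(i, j). if j = k then u $ i else C $$ (i, j)) *\<^sub>v v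
    = C *\<^sub>v vec n (\<lambda>j. if j = k then 0 else v $ j) + (v $ k) \<cdot>\<^sub>v (u :: 'a :: comm_ring_1 vec)"
  (is "?C *\<^sub>v v = C *\<^sub>v ?v + _")
proof (rule eq_vecI)
  fix i assume "i < dim_vec (C *\<^sub>v ?v + (v $ k) \<cdot>\<^sub>v u)"
  then have i: "i < n" using u by simp
  have "(?C *\<^sub>v v) $ i = (\<Sum>j\<in>{0..<n}. (if j = k then u $ i else C $$ (i, j)) * v $ j)"
    using i v by (auto simp: scalar_prod_def intro!: sum.cong)
  also have "\<dots> = u $ i * v $ k + (\<Sum>j\<in>{0..<n} - {k}. (if j = k then u $ i else C $$ (i, j)) * v $ j)"
    using k by (subst sum.remove[of _ k]) auto
  also have "(\<Sum>j\<in>{0..<n} - {k}. (if j = k then u $ i else C $$ (i, j)) * v $ j)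
      = (\<Sum>j\<in>{0..<n} - {k}. C $$ (i, j) * (if j = k then 0 else v $ j))"
    by (rule sum.cong) auto
  also have "\<dots> = (\<Sum>j\<in>{0..<n}. C $$ (i, j) * (if j = k then 0 else v $ j))"
    using k by (subst (2) sum.remove[of _ k]) auto
  also have "\<dots> = (C *\<^sub>v ?v) $ i"
    using i C by (auto simp: scalar_prod_def intro!: sum.cong)
  finally show "(?C *\<^sub>v v) $ i = (C *\<^sub>v ?v + (v $ k) \<cdot>\<^sub>v u) $ i"
    using i u C by (simp add: mult.commute add.commute)
qed (use u C in auto)

text \<open>Column \<open>k\<close> of \<open>C\<close> is replaced by \<open>u\<close>, which does
  not affect vectors without a \<open>k\<close>-th coordinate. Injectivity survives because a kernel
  vector with non-zero \<open>k\<close>-th coordinate would express \<open>u\<close> through the old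
  image.\<close>

lemma flag_step:
  fixes C :: "'p::prime_card mod_ring mat"
  assumes kn: "k < n" and C: "C \<in> carrier_mat n n" "inj_on ((*\<^sub>v) C) (std n k)"
    and uc: "u \<in> carrier_vec n" and u: "u \<notin> (*\<^sub>v) C ` std n k"
  obtains C' where "C' \<in> carrier_mat n n" "inj_on ((*\<^sub>v) C') (std n (Suc k))"
    "\<And>v. v \<in> std n (Suc k) \<Longrightarrow> \<exists>w\<in>std n k. C' *\<^sub>v v = C *\<^sub>v w + (v $ k) \<cdot>\<^sub>v u"
    "\<And>v. v \<in> std n k \<Longrightarrow> C' *\<^sub>v v = C *\<^sub>v v" "C' *\<^sub>v unit_vec n k = u"
proof -
  let ?I = "(*\<^sub>v) C ` std n k"
  have sI: "sub n ?I" using sub_image[OF C(1) sub_std] .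
  define C' where "C' = mat n n (\<lambda>(i, j). if j = k then u $ i else C $$ (i, j))"
  define cut where "cut v = vec n (\<lambda>j. if j = k then 0 else v $ j)" for v :: "'p mod_ring vec"
  have C'v: "C' *\<^sub>v v = C *\<^sub>v cut v + (v $ k) \<cdot>\<^sub>v u" if "v \<in> carrier_vec n" for v
    unfolding C'_def cut_def using replace_column_mult[OF C(1) uc that kn] .
  have cut: "cut v \<in> std n k" if "v \<in> std n (Suc k)" for v
    using that by (auto simp: std_def cut_def)
  have mem: "v \<in> carrier_vec n" if "v \<in> std n j" for v :: "'p mod_ring vec" and j
    using that by (auto simp: std_def)
  have C'c: "C' \<in> carrier_mat n n" by (simp add: C'_def)
  have inj: "inj_on ((*\<^sub>v) C') (std n (Suc k))"
  proof (rule mult_mat_vec_inj[OF C'c sub_std])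
    fix v assume v: "v \<in> std n (Suc k)" and 0: "C' *\<^sub>v v = 0\<^sub>v n"
    have e: "C *\<^sub>v cut v + (v $ k) \<cdot>\<^sub>v u = 0\<^sub>v n" using C'v[OF mem[OF v]] 0 by simp
    have "v $ k = 0"
    proof (rule ccontr)
      assume nz: "v $ k \<noteq> 0"
      have "u = (- 1 / v $ k) \<cdot>\<^sub>v (C *\<^sub>v cut v)"
      proof (rule eq_vecI)
        fix i assume "i < dim_vec ((- 1 / v $ k) \<cdot>\<^sub>v (C *\<^sub>v cut v))"
        then have i: "i < n" using C(1) by simp
        have "(C *\<^sub>v cut v) $ i + v $ k * u $ i = 0"
          using arg_cong[OF e, of "\<lambda>x. x $ i"] i uc C(1) by simp
        then show "u $ i = ((- 1 / v $ k) \<cdot>\<^sub>v (C *\<^sub>v cut v)) $ i"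
          using i C(1) nz by (simp add: field_simps add_eq_0_iff)
      qed (use uc C(1) in auto)
      then show False using u subD(4)[OF sI imageI[OF cut[OF v]]] by metis
    qed
    then have "cut v = v" using mem[OF v] by (auto simp: cut_def)
    moreover have "C *\<^sub>v v + 0 \<cdot>\<^sub>v u = C *\<^sub>v v" using uc C(1) by auto
    ultimately have "C *\<^sub>v v = C *\<^sub>v 0\<^sub>v n" "v \<in> std n k"
      using e \<open>v $ k = 0\<close> cut[OF v] mult_mat_zero_vec[OF C(1)] by auto
    then show "v = 0\<^sub>v n" using inj_onD[OF C(2)] subD(2)[OF sub_std] by blast
  qed
  have agree: "C' *\<^sub>v v = C *\<^sub>v v" if v: "v \<in> std n k" for v
  proof -
    have vk: "v $ k = 0" using v kn by (auto simp: std_def)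
    have "cut v = v" using mem[OF v] vk by (auto simp: cut_def)
    then show ?thesis using C'v[OF mem[OF v]] vk uc C(1) mem[OF v] by auto
  qed
  have "C' *\<^sub>v unit_vec n k = u"
  proof -
    have "cut (unit_vec n k) = 0\<^sub>v n" using kn by (auto simp: cut_def)
    then show ?thesis using C'v[of "unit_vec n k"] mult_mat_zero_vec[OF C(1)] uc kn by auto
  qed
  then show ?thesis using that[OF C'c inj _ agree] C'v[OF mem] cut by blast
qed

text \<open>\<open>C\<close> only has to be injective on \<open>std n k\<close>: its columns from
  \<open>k\<close> on are overwritten one at a time by vectors of \<open>V\<close> outside the
  current image, and such vectors exist because that image has fewer than \<open>q^m\<close>
  elements.\<close>

lemma flag_extend:
  fixes V :: "'p::prime_card mod_ring vec set"
  assumes "k \<le> m" "m \<le> n" and V: "sub n V" "card V = CARD('p) ^ m"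
    and C: "C \<in> carrier_mat n n" "inj_on ((*\<^sub>v) C) (std n k)" "(*\<^sub>v) C ` std n k \<subseteq> V"
  shows "\<exists>C'\<in>carrier_mat n n. inj_on ((*\<^sub>v) C') (std n m) \<and> (*\<^sub>v) C' ` std n m = V \<and>
    (\<forall>v\<in>std n k. C' *\<^sub>v v = C *\<^sub>v v)"
  using assms(1) C
proof (induction k arbitrary: C rule: inc_induct)
  case base
  have "card ((*\<^sub>v) C ` std n m) = card V"
    using V(2) card_image[OF base(2)] card_std[OF assms(2)] by simp
  then have "(*\<^sub>v) C ` std n m = V"
    using base(3) subD(5)[OF V(1)] by (metis card_subset_eq)
  then show ?case using base by auto
next
  case (step k)
  have kn: "k < n" using step assms by simp
  let ?I = "(*\<^sub>v) C ` std n k"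
  have "card ?I = CARD('p) ^ k" using card_image[OF step.prems(2)] card_std[of k n] kn by simp
  also have "\<dots> < CARD('p) ^ m" using step.hyps card_field_gt_1[where 'p = 'p] by simp
  finally have "?I \<noteq> V" using V(2) by auto
  then obtain u where u: "u \<in> V" "u \<notin> ?I" using step.prems(3) by auto
  have uc: "u \<in> carrier_vec n" using u subD(1)[OF V(1)] by auto
  obtain C' where C': "C' \<in> carrier_mat n n" "inj_on ((*\<^sub>v) C') (std n (Suc k))"
    "\<And>v. v \<in> std n (Suc k) \<Longrightarrow> \<exists>w\<in>std n k. C' *\<^sub>v v = C *\<^sub>v w + (v $ k) \<cdot>\<^sub>v u"
    "\<And>v. v \<in> std n k \<Longrightarrow> C' *\<^sub>v v = C *\<^sub>v v"
    using flag_step[OF kn step.prems(1,2) uc u(2)] by metis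
  have "(*\<^sub>v) C' ` std n (Suc k) \<subseteq> V"
  proof
    fix x assume "x \<in> (*\<^sub>v) C' ` std n (Suc k)"
    then obtain v where v: "v \<in> std n (Suc k)" "x = C' *\<^sub>v v" by auto
    obtain w where w: "w \<in> std n k" "C' *\<^sub>v v = C *\<^sub>v w + (v $ k) \<cdot>\<^sub>v u" using C'(3)[OF v(1)] by blast
    have "C *\<^sub>v w \<in> V" using step.prems(3) w(1) by auto
    then show "x \<in> V" using v w subD(3,4)[OF V(1)] u(1) by simp
  qed
  then obtain C'' where C'': "C'' \<in> carrier_mat n n" "inj_on ((*\<^sub>v) C'') (std n m)"
    "(*\<^sub>v) C'' ` std n m = V" "\<forall>v\<in>std n (Suc k). C'' *\<^sub>v v = C' *\<^sub>v v"
    using step.IH[OF C'(1,2)] by auto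
  have "std n k \<subseteq> std n (Suc k)" by (auto simp: std_def)
  then have "C'' *\<^sub>v v = C *\<^sub>v v" if v: "v \<in> std n k" for v
    using C''(4) C'(4)[OF v] v by auto
  then show ?case using C'' by blast
qed

lemma GL_iff:
  "C \<in> GL n \<longleftrightarrow> C \<in> carrier_mat n n \<and> (\<exists>B\<in>carrier_mat n n. C * B = 1\<^sub>m n \<and> B * C = 1\<^sub>m n)"
proof safe
  assume C: "C \<in> GL n"
  then show cC: "C \<in> carrier_mat n n" by (simp add: GL_def)
  obtain B where B: "inverts_mat C B" "inverts_mat B C" using C by (auto simp: GL_def invertible_mat_def)
  have "B \<in> carrier_mat n n"
    using B cC unfolding inverts_mat_def
    by (metis carrier_matD carrier_matI index_mult_mat(2,3) index_one_mat(2,3))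
  then show "\<exists>B\<in>carrier_mat n n. C * B = 1\<^sub>m n \<and> B * C = 1\<^sub>m n"
    using B cC unfolding inverts_mat_def by auto
next
  fix B assume "C \<in> carrier_mat n n" "B \<in> carrier_mat n n" "C * B = 1\<^sub>m n" "B * C = 1\<^sub>m n"
  then show "C \<in> GL n" by (auto simp: GL_def invertible_mat_def inverts_mat_def)
qed

lemma GL_iff_det: "C \<in> GL n \<longleftrightarrow> C \<in> carrier_mat n n \<and> det C \<noteq> 0"
proof safe
  assume "C \<in> GL n" "det C = 0"
  then obtain B where "C \<in> carrier_mat n n" "B \<in> carrier_mat n n" "C * B = 1\<^sub>m n" by (auto simp: GL_iff)
  then have "det C * det B = 1" by (metis det_mult det_one)
  then show False using \<open>det C = 0\<close> by simp
next
  assume C: "C \<in> carrier_mat n n" "det C \<noteq> 0"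
  then have "C \<in> Units (ring_mat TYPE('a mod_ring) n ())"
    by (rule det_non_zero_imp_unit)
  then show "C \<in> GL n" using C by (auto simp: GL_iff Units_def ring_mat_simps)
qed (simp add: GL_def)

lemma GL_iff_inj:
  "C \<in> GL n \<longleftrightarrow> C \<in> carrier_mat n n \<and> inj_on ((*\<^sub>v) C) (carrier_vec n)"
proof safe
  assume C: "C \<in> GL n"
  then show cC: "C \<in> carrier_mat n n" by (simp add: GL_def)
  show "inj_on ((*\<^sub>v) C) (carrier_vec n)"
    using C det_0_iff_vec_prod_zero_field[OF cC]
    by (intro mult_mat_vec_inj[OF cC]) (auto simp: GL_iff_det)
next
  assume C: "C \<in> carrier_mat n n" "inj_on ((*\<^sub>v) C) (carrier_vec n)"
  have "v = 0\<^sub>v n" if "v \<in> carrier_vec n" "C *\<^sub>v v = 0\<^sub>v n" for v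
    using inj_onD[OF C(2), of v "0\<^sub>v n"] that mult_mat_zero_vec[OF C(1)] by auto
  then show "C \<in> GL n"
    using C det_0_iff_vec_prod_zero_field[OF C(1)] by (auto simp: GL_iff_det)
qed

lemma sub_card_obtain:
  fixes U :: "'p::prime_card mod_ring vec set"
  assumes "sub n U"
  obtains k where "k \<le> n" "card U = CARD('p) ^ k"
proof -
  have "card U \<le> CARD('p) ^ n"
    using card_mono[OF finite_vec subD(1)[OF assms]] by simp
  then have "fdim n U \<le> n"
    using card_sub[OF assms] card_field_gt_1[where 'p = 'p] by simp
  then show ?thesis using that card_sub[OF assms] by blast
qed

text \<open>Two extensions: from the trivial subspace to \<open>U\<close>, with the zero matrix as a
  harmless start, and from \<open>U\<close> to the whole space without changing the columns that
  span \<open>U\<close>.\<close>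

lemma GL_flag:
  fixes U :: "'p::prime_card mod_ring vec set"
  assumes U: "sub n U" "card U = CARD('p) ^ k" "k \<le> n"
  obtains C where "C \<in> GL n" "(*\<^sub>v) C ` std n k = U"
proof -
  have "\<exists>C'\<in>carrier_mat n n. inj_on ((*\<^sub>v) C') (std n k) \<and> (*\<^sub>v) C' ` std n k = U \<and>
    (\<forall>v\<in>std n 0. C' *\<^sub>v v = 0\<^sub>m n n *\<^sub>v v)"
    using U subD(2)[OF U(1)] mult_mat_zero_vec[of "0\<^sub>m n n :: 'p mod_ring mat" n n]
    by (intro flag_extend) (auto simp: std_0)
  then obtain C1 where C1: "C1 \<in> carrier_mat n n" "inj_on ((*\<^sub>v) C1) (std n k)" "(*\<^sub>v) C1 ` std n k = U"
    by auto
  have "\<exists>C'\<in>carrier_mat n n. inj_on ((*\<^sub>v) C') (std n n) \<and> (*\<^sub>v) C' ` std n n = carrier_vec n \<and>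
    (\<forall>v\<in>std n k. C' *\<^sub>v v = C1 *\<^sub>v v)"
    using U C1 subD(1)[OF U(1)] by (intro flag_extend) auto
  then obtain C where C: "C \<in> carrier_mat n n" "inj_on ((*\<^sub>v) C) (carrier_vec n)"
    "\<forall>v\<in>std n k. C *\<^sub>v v = C1 *\<^sub>v v" by auto
  have "(*\<^sub>v) C ` std n k = U" using C(3) C1(3) by (metis (no_types, lifting) image_cong)
  then show ?thesis using that C GL_iff_inj by blast
qed

subsection \<open>Maximal isotropic subspaces as graphs of symmetric maps\<close>

lemma symp_form_append:
  assumes "a \<in> carrier_vec D" "b \<in> carrier_vec D" "a' \<in> carrier_vec D" "b' \<in> carrier_vec D"
  shows "symp_form D (a @\<^sub>v b) (a' @\<^sub>v b') = a \<bullet> b' - b \<bullet> a'"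
  using assms unfolding symp_form_def scalar_prod_def sum_subtractf
  by (intro arg_cong2[of _ _ _ _ "(-)"] sum.cong) auto

lemma append_carrier2 [simp]:
  "a \<in> carrier_vec D \<Longrightarrow> b \<in> carrier_vec D \<Longrightarrow> a @\<^sub>v b \<in> carrier_vec (2 * D)"
  by (simp add: mult_2)

lemma carrier_vec_split:
  assumes "v \<in> carrier_vec (2 * D)"
  obtains a b where "a \<in> carrier_vec D" "b \<in> carrier_vec D" "v = a @\<^sub>v b"
  using assms vec_first_last_append[of v D D] that[of "vec_first v D" "vec_last v D"]
  by (simp add: mult_2)

lemma smult_append: "c \<cdot>\<^sub>v (a @\<^sub>v b) = (c \<cdot>\<^sub>v a) @\<^sub>v (c \<cdot>\<^sub>v b)"
  by (intro eq_vecI) auto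

lemma zero_append: "0\<^sub>v (2 * D) = 0\<^sub>v D @\<^sub>v 0\<^sub>v D"
  by (intro eq_vecI) auto

lemma append_eq:
  "a \<in> carrier_vec D \<Longrightarrow> c \<in> carrier_vec D \<Longrightarrow> a @\<^sub>v b = c @\<^sub>v d \<longleftrightarrow> a = c \<and> b = d"
  by (rule append_vec_eq)

lemma symp_swap:
  assumes "u \<in> carrier_vec (2 * D)" "v \<in> carrier_vec (2 * D)"
  shows "symp_form D v u = - symp_form D u v"
proof -
  have "symp_form D v u = (\<Sum>k<D. - (u $ k * v $ (D + k) - u $ (D + k) * v $ k))"
    unfolding symp_form_def by (rule sum.cong) (auto simp: algebra_simps)
  then show ?thesis unfolding symp_form_def by (simp only: sum_negf)
qed

lemma symp_self [simp]: "symp_form D u u = 0"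
  by (simp add: symp_form_def)

lemma symp_add_right:
  assumes "u \<in> carrier_vec (2 * D)" "v \<in> carrier_vec (2 * D)" "w \<in> carrier_vec (2 * D)"
  shows "symp_form D u (v + w) = symp_form D u v + symp_form D u w"
  using assms unfolding symp_form_def
  by (auto simp: sum.distrib[symmetric] algebra_simps intro!: sum.cong)

lemma symp_smult_right:
  assumes "v \<in> carrier_vec (2 * D)"
  shows "symp_form D u (c \<cdot>\<^sub>v v) = c * symp_form D u v"
  using assms unfolding symp_form_def
  by (auto simp: sum_distrib_left algebra_simps intro!: sum.cong)

lemma isotropic_iff:
  "isotropic D W \<longleftrightarrow> sub (2 * D) W \<and> (\<forall>u\<in>W. \<forall>v\<in>W. symp_form D u v = 0)"
  by (simp add: isotropic_def fsubspace_iff)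

lemma isotropic_ext:
  assumes W: "isotropic D W" and v: "v \<in> carrier_vec (2 * D)" "\<And>w. w \<in> W \<Longrightarrow> symp_form D v w = 0"
  shows "isotropic D (ext W v)"
proof -
  have sW: "sub (2 * D) W" and iW: "\<And>u w. u \<in> W \<Longrightarrow> w \<in> W \<Longrightarrow> symp_form D u w = 0"
    using W by (auto simp: isotropic_iff)
  have car: "w \<in> carrier_vec (2 * D)" if "w \<in> W" for w using subD(1)[OF sW] that by auto
  have "symp_form D x y = 0" if xy: "x \<in> ext W v" "y \<in> ext W v" for x y
  proof -
    obtain a c b d where x: "x = a + c \<cdot>\<^sub>v v" "a \<in> W" and y: "y = b + d \<cdot>\<^sub>v v" "b \<in> W"
      using xy by (auto simp: ext_def)
    have vx: "symp_form D v x = 0"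
      using x v car[OF x(2)] by (simp add: symp_add_right symp_smult_right)
    have bx: "symp_form D b x = 0"
      using x y v car[OF x(2)] car[OF y(2)] iW symp_swap[of v D b]
      by (simp add: symp_add_right symp_smult_right)
    have xc: "x \<in> carrier_vec (2 * D)" using x v car by auto
    show ?thesis
      using y v car[OF y(2)] xc vx bx symp_swap[of v D x] symp_swap[of b D x]
      by (simp add: symp_add_right symp_smult_right)
  qed
  then show ?thesis using sub_ext(1)[OF sW v(1)] by (auto simp: isotropic_iff)
qed

lemma Sym_carrier: "M \<in> Sym D \<Longrightarrow> M \<in> carrier_mat D D"
  by (simp add: Sym_def)

lemma Sym_scalar:
  assumes "M \<in> Sym D" "x \<in> carrier_vec D" "y \<in> carrier_vec D"
  shows "(M *\<^sub>v x) \<bullet> y = x \<bullet> (M *\<^sub>v y)"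
  using assms transpose_vec_mult_scalar[of M D D y x] by (simp add: Sym_def)

lemma Sym_mult_carrier [simp]: "M \<in> Sym D \<Longrightarrow> x \<in> carrier_vec D \<Longrightarrow> M *\<^sub>v x \<in> carrier_vec D"
  by (auto simp: Sym_def)

text \<open>
  Every maximal isotropic subspace meeting \<open>x_0\<close> in \<open>U\<close> has this form.  The matrix \<open>M\<close> only matters as a
  symmetric form on the annihilator of \<open>U\<close>.
\<close>

definition lag :: "nat \<Rightarrow> 'p::prime_card mod_ring vec set \<Rightarrow> 'p mod_ring mat \<Rightarrow> 'p mod_ring vec set" where
  "lag D U M = {a @\<^sub>v b | a b. a \<in> carrier_vec D \<and> b \<in> perp D U \<and> a - M *\<^sub>v b \<in> U}"

text \<open>The intersection with \<open>x_0\<close>, with the zero second half of its vectors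
  dropped, so that it becomes a subspace of \<open>F_q^D\<close>.\<close>

definition upart :: "nat \<Rightarrow> 'p::prime_card mod_ring vec set \<Rightarrow> 'p mod_ring vec set" where
  "upart D x = {a \<in> carrier_vec D. a @\<^sub>v 0\<^sub>v D \<in> x}"

lemma lag_iff:
  assumes "a \<in> carrier_vec D"
  shows "a @\<^sub>v b \<in> lag D U M \<longleftrightarrow> b \<in> perp D U \<and> a - M *\<^sub>v b \<in> U"
proof
  assume "a @\<^sub>v b \<in> lag D U M"
  then obtain a' b' where "a @\<^sub>v b = a' @\<^sub>v b'" "a' \<in> carrier_vec D" "b' \<in> perp D U" "a' - M *\<^sub>v b' \<in> U"
    by (auto simp: lag_def)
  then show "b \<in> perp D U \<and> a - M *\<^sub>v b \<in> U" using append_eq[OF assms] by metis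
qed (use assms in \<open>auto simp: lag_def\<close>)

lemma diff_add_vec:
  assumes "a \<in> carrier_vec n" "b \<in> carrier_vec n" shows "(a - b) + b = (a :: 'a :: comm_ring_1 vec)"
  using assms by (intro eq_vecI) auto

lemma sub_lag:
  assumes U: "sub D U" and M: "M \<in> Sym D"
  shows "sub (2 * D) (lag D U M)"
  unfolding sub_def
proof (intro conjI ballI allI)
  have pc: "b \<in> carrier_vec D" if "b \<in> perp D U" for b using that perp_carrier by blast
  have sP: "sub D (perp D U)" using sub_perp[OF subD(1)[OF U]] .
  show "lag D U M \<subseteq> carrier_vec (2 * D)" using pc by (auto simp: lag_def)
  have "0\<^sub>v D - M *\<^sub>v 0\<^sub>v D = 0\<^sub>v D" using mult_mat_zero_vec[OF Sym_carrier[OF M]] by auto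
  then show "0\<^sub>v (2 * D) \<in> lag D U M"
    using subD(2)[OF U] subD(2)[OF sP] by (simp add: zero_append lag_iff)
  {
    fix x y assume "x \<in> lag D U M" "y \<in> lag D U M"
    then obtain a b c d where x: "x = a @\<^sub>v b" "a \<in> carrier_vec D" "b \<in> perp D U" "a - M *\<^sub>v b \<in> U"
      and y: "y = c @\<^sub>v d" "c \<in> carrier_vec D" "d \<in> perp D U" "c - M *\<^sub>v d \<in> U" by (auto simp: lag_def)
    have "(a + c) - M *\<^sub>v (b + d) = (a - M *\<^sub>v b) + (c - M *\<^sub>v d)"
      unfolding mult_add_distrib_mat_vec[OF Sym_carrier[OF M] pc[OF x(3)] pc[OF y(3)]]
      using x(2) y(2) carrier_vecD[OF pc[OF x(3)]] carrier_vecD[OF pc[OF y(3)]] carrier_matD[OF Sym_carrier[OF M]]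
      by (intro eq_vecI) simp_all
    then have "(a + c) @\<^sub>v (b + d) \<in> lag D U M"
      using x y subD(3)[OF U] subD(3)[OF sP] by (simp add: lag_iff)
    then show "x + y \<in> lag D U M"
      using append_vec_add[OF x(2) y(2) pc[OF x(3)] pc[OF y(3)]] x(1) y(1) by simp
  }
  {
    fix e x assume "x \<in> lag D U M"
    then obtain a b where x: "x = a @\<^sub>v b" "a \<in> carrier_vec D" "b \<in> perp D U" "a - M *\<^sub>v b \<in> U"
      by (auto simp: lag_def)
    have "(e \<cdot>\<^sub>v a) - M *\<^sub>v (e \<cdot>\<^sub>v b) = e \<cdot>\<^sub>v (a - M *\<^sub>v b)"
      unfolding mult_mat_vec[OF Sym_carrier[OF M] pc[OF x(3)], of e]
      using x(2) carrier_vecD[OF pc[OF x(3)]] carrier_matD[OF Sym_carrier[OF M]]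
      by (intro eq_vecI) (simp_all add: right_diff_distrib)
    then have "(e \<cdot>\<^sub>v a) @\<^sub>v (e \<cdot>\<^sub>v b) \<in> lag D U M"
      using x subD(4)[OF U] subD(4)[OF sP] by (simp add: lag_iff)
    then show "e \<cdot>\<^sub>v x \<in> lag D U M" using x by (simp add: smult_append)
  }
qed

text \<open>Modulo \<open>U\<close>, which the annihilator does not see, the first halves are
  \<open>M b\<close> and \<open>M d\<close>; the form becomes
  \<open>(M b) \<bullet> d - b \<bullet> (M d)\<close>, which is zero by symmetry of
  \<open>M\<close>.\<close>

lemma isotropic_lag:
  assumes U: "sub D U" and M: "M \<in> Sym D"
  shows "isotropic D (lag D U M)"
proof -
  have pc: "b \<in> carrier_vec D" if "b \<in> perp D U" for b using that perp_carrier by blast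
  have "symp_form D x y = 0" if xy: "x \<in> lag D U M" "y \<in> lag D U M" for x y
  proof -
    obtain a b c d where x: "x = a @\<^sub>v b" "a \<in> carrier_vec D" "b \<in> perp D U" "a - M *\<^sub>v b \<in> U"
      and y: "y = c @\<^sub>v d" "c \<in> carrier_vec D" "d \<in> perp D U" "c - M *\<^sub>v d \<in> U"
      using xy by (auto simp: lag_def)
    have car: "b \<in> carrier_vec D" "d \<in> carrier_vec D" using x y pc by auto
    have "(a - M *\<^sub>v b) \<bullet> d = 0" "b \<bullet> (c - M *\<^sub>v d) = 0"
      using perpD[OF y(3) x(4)] perpD'[OF x(3) y(4) subD(1)[OF U]] by auto
    then have "a \<bullet> d = (M *\<^sub>v b) \<bullet> d" "b \<bullet> c = b \<bullet> (M *\<^sub>v d)"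
      using x y car M by (auto simp: minus_scalar_prod_distrib[where n = D] scalar_prod_minus_distrib[where n = D])
    then show ?thesis
      using x y car Sym_scalar[OF M, of b d] by (simp add: symp_form_append)
  qed
  then show ?thesis using sub_lag[OF U M] by (auto simp: isotropic_iff)
qed

text \<open>Self-orthogonality, hence maximality. Testing against
  \<open>u @\<^sub>v 0\<^sub>v D\<close> with \<open>u\<close> in \<open>U\<close> forces
  \<open>b\<close> into the annihilator; testing against
  \<open>(M *\<^sub>v b') @\<^sub>v b'\<close> forces \<open>a - M *\<^sub>v b\<close> into the
  double annihilator, which is \<open>U\<close>.\<close>

lemma lag_perp:
  assumes U: "sub D U" and M: "M \<in> Sym D" and v: "v \<in> carrier_vec (2 * D)"
    and perp: "\<And>w. w \<in> lag D U M \<Longrightarrow> symp_form D v w = 0"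
  shows "v \<in> lag D U M"
proof -
  have pc: "b \<in> carrier_vec D" if "b \<in> perp D U" for b using that perp_carrier by blast
  have Uc: "u \<in> carrier_vec D" if "u \<in> U" for u using that subD(1)[OF U] by blast
  have sP: "sub D (perp D U)" using sub_perp[OF subD(1)[OF U]] .
  obtain a b where ab: "a \<in> carrier_vec D" "b \<in> carrier_vec D" "v = a @\<^sub>v b"
    using carrier_vec_split[OF v] .
  have "u @\<^sub>v 0\<^sub>v D \<in> lag D U M" if "u \<in> U" for u
  proof -
    have "u - M *\<^sub>v 0\<^sub>v D = u" using mult_mat_zero_vec[OF Sym_carrier[OF M]] Uc[OF that] by auto
    then show ?thesis using that Uc[OF that] subD(2)[OF sP] by (simp add: lag_iff)
  qed
  then have "b \<bullet> u = 0" if "u \<in> U" for u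
    using perp[of "u @\<^sub>v 0\<^sub>v D"] that Uc[OF that] ab by (simp add: symp_form_append)
  then have b: "b \<in> perp D U"
    using ab comm_scalar_prod[OF ab(2) Uc] by (auto simp: perp_def)
  have "b' \<bullet> (a - M *\<^sub>v b) = 0" if b': "b' \<in> perp D U" for b'
  proof -
    have "(M *\<^sub>v b') @\<^sub>v b' \<in> lag D U M"
    proof -
      have "M *\<^sub>v b' - M *\<^sub>v b' = 0\<^sub>v D" using Sym_mult_carrier[OF M pc[OF b']] by simp
      then have "M *\<^sub>v b' - M *\<^sub>v b' \<in> U" using subD(2)[OF U] by metis
      then show ?thesis using M pc[OF b'] b' by (simp add: lag_iff)
    qed
    from perp[OF this] have "a \<bullet> b' = b \<bullet> (M *\<^sub>v b')"
      using ab pc[OF b'] M by (simp add: symp_form_append)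
    then show ?thesis
      using ab pc[OF b'] M Sym_scalar[OF M, of b' b] comm_scalar_prod[of a D b'] comm_scalar_prod[of b D "M *\<^sub>v b'"]
      by (simp add: scalar_prod_minus_distrib[where n = D])
  qed
  then have "a - M *\<^sub>v b \<in> perp D (perp D U)" using ab M by (auto simp: perp_def[of D "perp D U"])
  then show ?thesis using ab b by (simp add: lag_iff perp_perp[OF U])
qed

lemma lag_max_isotropic:
  assumes U: "sub D U" and M: "M \<in> Sym D"
  shows "lag D U M \<in> max_isotropic D"
  unfolding max_isotropic_def
proof (intro CollectI conjI allI impI isotropic_lag[OF U M])
  fix W assume W: "isotropic D W \<and> lag D U M \<subseteq> W"
  then have "v \<in> lag D U M" if "v \<in> W" for v
    using that subD(1)[of "2 * D" W] by (intro lag_perp[OF U M]) (auto simp: isotropic_iff)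
  then show "W = lag D U M" using W by auto
qed

lemma upart_lag:
  assumes U: "sub D U" and M: "M \<in> Sym D"
  shows "upart D (lag D U M) = U"
proof -
  have "a - M *\<^sub>v 0\<^sub>v D = a" if "a \<in> carrier_vec D" for a
    using mult_mat_zero_vec[OF Sym_carrier[OF M]] that by auto
  moreover have "0\<^sub>v D \<in> perp D U" using subD(2)[OF sub_perp[OF subD(1)[OF U]]] .
  ultimately show ?thesis using subD(1)[OF U] by (auto simp: upart_def lag_iff)
qed

lemma lag_eq_iff:
  assumes U: "sub D U" and M: "M \<in> Sym D" and M': "M' \<in> Sym D"
  shows "lag D U M = lag D U M' \<longleftrightarrow> (\<forall>b\<in>perp D U. M *\<^sub>v b - M' *\<^sub>v b \<in> U)"
proof
  have pc: "b \<in> carrier_vec D" if "b \<in> perp D U" for b using that perp_carrier by blast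
  {
    assume eq: "lag D U M = lag D U M'"
    show "\<forall>b\<in>perp D U. M *\<^sub>v b - M' *\<^sub>v b \<in> U"
    proof
      fix b assume b: "b \<in> perp D U"
      have "M *\<^sub>v b - M *\<^sub>v b = 0\<^sub>v D" using Sym_mult_carrier[OF M pc[OF b]] by simp
      then have "M *\<^sub>v b - M *\<^sub>v b \<in> U" using subD(2)[OF U] by metis
      then have "(M *\<^sub>v b) @\<^sub>v b \<in> lag D U M" using b M pc[OF b] by (simp add: lag_iff)
      then show "M *\<^sub>v b - M' *\<^sub>v b \<in> U" using eq M pc[OF b] by (simp add: lag_iff)
    qed
  next
    assume d: "\<forall>b\<in>perp D U. M *\<^sub>v b - M' *\<^sub>v b \<in> U"
    have "a - M *\<^sub>v b \<in> U \<longleftrightarrow> a - M' *\<^sub>v b \<in> U" if a: "a \<in> carrier_vec D" and b: "b \<in> perp D U" for a b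
    proof -
      have "a - M' *\<^sub>v b = (a - M *\<^sub>v b) + (M *\<^sub>v b - M' *\<^sub>v b)"
        "a - M *\<^sub>v b = (a - M' *\<^sub>v b) - (M *\<^sub>v b - M' *\<^sub>v b)"
        using a pc[OF b] M M' by (auto intro!: eq_vecI simp: Sym_def)
      then show ?thesis using d b subD(3)[OF U, of "a - M *\<^sub>v b"] sub_minus[OF U, of "a - M' *\<^sub>v b"]
        by (metis (no_types))
    qed
    then show "lag D U M = lag D U M'" unfolding lag_def by blast
  }
qed

text \<open>Over each \<open>b\<close> the admissible first halves form the coset
  \<open>f b + U\<close>.\<close>

lemma card_fibered:
  fixes U :: "'p::prime_card mod_ring vec set"
  assumes U: "sub D U" and T: "T \<subseteq> carrier_vec D" and f: "\<And>b. b \<in> T \<Longrightarrow> f b \<in> carrier_vec D"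
  shows "card {a @\<^sub>v b | a b. a \<in> carrier_vec D \<and> b \<in> T \<and> a - f b \<in> U} = card U * card T"
proof -
  have Uc: "u \<in> carrier_vec D" if "u \<in> U" for u using that subD(1)[OF U] by blast
  have 1: "(u + f b) - f b = u" if "u \<in> U" "b \<in> T" for u b
    using Uc[OF that(1)] f[OF that(2)] by (intro eq_vecI) auto
  have "bij_betw (\<lambda>(u, b). (u + f b) @\<^sub>v b) (U \<times> T)
      {a @\<^sub>v b | a b. a \<in> carrier_vec D \<and> b \<in> T \<and> a - f b \<in> U}"
    unfolding bij_betw_def
  proof
    show "inj_on (\<lambda>(u, b). (u + f b) @\<^sub>v b) (U \<times> T)"
    proof (rule inj_onI, clarsimp)
      fix u b u' b' assume *: "u \<in> U" "b \<in> T" "u' \<in> U" "b' \<in> T" "(u + f b) @\<^sub>v b = (u' + f b') @\<^sub>v b'"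
      then have "u + f b = u' + f b' \<and> b = b'"
        using append_eq[OF add_carrier_vec[OF Uc[OF *(1)] f[OF *(2)]] add_carrier_vec[OF Uc[OF *(3)] f[OF *(4)]]]
        by blast
      then show "u = u' \<and> b = b'" using 1 * by metis
    qed
    show "(\<lambda>(u, b). (u + f b) @\<^sub>v b) ` (U \<times> T)
      = {a @\<^sub>v b | a b. a \<in> carrier_vec D \<and> b \<in> T \<and> a - f b \<in> U}"
    proof (intro equalityI subsetI)
      fix x assume "x \<in> (\<lambda>(u, b). (u + f b) @\<^sub>v b) ` (U \<times> T)"
      then obtain u b where ub: "u \<in> U" "b \<in> T" "x = (u + f b) @\<^sub>v b" by auto
      then show "x \<in> {a @\<^sub>v b | a b. a \<in> carrier_vec D \<and> b \<in> T \<and> a - f b \<in> U}"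
        using 1[OF ub(1,2)] add_carrier_vec[OF Uc[OF ub(1)] f[OF ub(2)]]
        by (intro CollectI exI[of _ "u + f b"] exI[of _ b]) simp
    next
      fix x assume "x \<in> {a @\<^sub>v b | a b. a \<in> carrier_vec D \<and> b \<in> T \<and> a - f b \<in> U}"
      then obtain a b where ab: "x = a @\<^sub>v b" "a \<in> carrier_vec D" "b \<in> T" "a - f b \<in> U" by auto
      have "(a - f b) + f b = a" by (rule diff_add_vec[OF ab(2) f[OF ab(3)]])
      then show "x \<in> (\<lambda>(u, b). (u + f b) @\<^sub>v b) ` (U \<times> T)"
        using ab by (intro image_eqI[of _ _ "(a - f b, b)"]) (simp_all only: prod.case mem_Times_iff fst_conv snd_conv)
    qed
  qed
  from bij_betw_same_card[OF this] show ?thesis unfolding card_cartesian_product by (rule sym)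
qed

lemma card_lag:
  fixes U :: "'p::prime_card mod_ring vec set"
  assumes U: "sub D U" and M: "M \<in> Sym D"
  shows "card (lag D U M) = CARD('p) ^ D"
proof -
  have "card (lag D U M) = card U * card (perp D U)"
    unfolding lag_def using perp_carrier[of D U] M by (intro card_fibered[OF U]) auto
  then show ?thesis using card_perp[OF U] by simp
qed

text \<open>The second half of a common vector lies in the smaller annihilator, that of
  \<open>U'\<close>. Since \<open>U \<subseteq> U'\<close>, the two conditions on \<open>a\<close>
  amount to one condition on \<open>b\<close> alone and membership in a coset of
  \<open>U\<close>.\<close>

lemma card_lag_Int:
  fixes U :: "'p::prime_card mod_ring vec set"
  assumes U: "sub D U" and U': "sub D U'" and le: "U \<subseteq> U'" and M: "M \<in> Sym D" and M0: "M0 \<in> Sym D"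
  shows "card (lag D U M \<inter> lag D U' M0)
    = card U * card {b \<in> perp D U'. M *\<^sub>v b - M0 *\<^sub>v b \<in> U'}" (is "_ = _ * card ?T")
proof -
  have pc: "b \<in> carrier_vec D" if "b \<in> perp D U'" for b using that perp_carrier by blast
  have key: "a - M *\<^sub>v b \<in> U \<and> a - M0 *\<^sub>v b \<in> U' \<longleftrightarrow> M *\<^sub>v b - M0 *\<^sub>v b \<in> U' \<and> a - M *\<^sub>v b \<in> U"
    if a: "a \<in> carrier_vec D" and b: "b \<in> perp D U'" for a b
  proof -
    have e: "M *\<^sub>v b - M0 *\<^sub>v b = (a - M0 *\<^sub>v b) - (a - M *\<^sub>v b)"
      "a - M0 *\<^sub>v b = (a - M *\<^sub>v b) + (M *\<^sub>v b - M0 *\<^sub>v b)"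
      using a pc[OF b] M M0 by (auto intro!: eq_vecI simp: Sym_def)
    show ?thesis
    proof
      assume "a - M *\<^sub>v b \<in> U \<and> a - M0 *\<^sub>v b \<in> U'"
      then show "M *\<^sub>v b - M0 *\<^sub>v b \<in> U' \<and> a - M *\<^sub>v b \<in> U"
        unfolding e(1) using le sub_minus[OF U'] by blast
    next
      assume "M *\<^sub>v b - M0 *\<^sub>v b \<in> U' \<and> a - M *\<^sub>v b \<in> U"
      then have "(a - M *\<^sub>v b) + (M *\<^sub>v b - M0 *\<^sub>v b) \<in> U'" "a - M *\<^sub>v b \<in> U"
        using le subD(3)[OF U'] by blast+
      then show "a - M *\<^sub>v b \<in> U \<and> a - M0 *\<^sub>v b \<in> U'" using e(2) by metis
    qed
  qed
  have "lag D U M \<inter> lag D U' M0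
      = {a @\<^sub>v b | a b. a \<in> carrier_vec D \<and> b \<in> ?T \<and> a - M *\<^sub>v b \<in> U}"
  proof (intro equalityI subsetI)
    fix x assume x: "x \<in> lag D U M \<inter> lag D U' M0"
    then obtain a b where ab: "x = a @\<^sub>v b" "a \<in> carrier_vec D" by (auto simp: lag_def)
    then have "b \<in> perp D U'" "a - M *\<^sub>v b \<in> U" "a - M0 *\<^sub>v b \<in> U'"
      using x by (auto simp: lag_iff)
    then show "x \<in> {a @\<^sub>v b | a b. a \<in> carrier_vec D \<and> b \<in> ?T \<and> a - M *\<^sub>v b \<in> U}"
      using key ab by blast
  next
    fix x assume "x \<in> {a @\<^sub>v b | a b. a \<in> carrier_vec D \<and> b \<in> ?T \<and> a - M *\<^sub>v b \<in> U}"
    then obtain a b where "x = a @\<^sub>v b" "a \<in> carrier_vec D" "b \<in> ?T" "a - M *\<^sub>v b \<in> U" by auto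
    then show "x \<in> lag D U M \<inter> lag D U' M0"
      using key[of a b] perp_mono[OF le] by (auto simp: lag_iff)
  qed
  moreover have "card {a @\<^sub>v b | a b. a \<in> carrier_vec D \<and> b \<in> ?T \<and> a - M *\<^sub>v b \<in> U} = card U * card ?T"
    using pc M by (intro card_fibered[OF U]) auto
  ultimately show ?thesis by (simp only:)
qed

text \<open>The symmetric matrix \<open>u w^t + w u^t - c u u^t\<close>. If
  \<open>u \<bullet> b0 = 1\<close> and \<open>c = w \<bullet> b0\<close>, it sends
  \<open>b0\<close> to \<open>w\<close>; for \<open>w = u\<close> it is
  \<open>(2 - c) u u^t\<close>. The first shape moves along a covered subspace, the second gives
  rank one perturbations.\<close>

definition upd :: "nat \<Rightarrow> 'p::prime_card mod_ring vec \<Rightarrow> 'p mod_ring vec \<Rightarrow> 'p mod_ring \<Rightarrow> 'p mod_ring mat" where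
  "upd D u w c = mat D D (\<lambda>(i, j). u $ i * w $ j + w $ i * u $ j - c * (u $ i * u $ j))"

lemma upd_Sym: "upd D u w c \<in> Sym D"
  by (auto simp: upd_def Sym_def intro!: eq_matI)

lemma upd_mult:
  assumes "u \<in> carrier_vec D" "w \<in> carrier_vec D" "b \<in> carrier_vec D"
  shows "upd D u w c *\<^sub>v b = (w \<bullet> b - c * (u \<bullet> b)) \<cdot>\<^sub>v u + (u \<bullet> b) \<cdot>\<^sub>v w"
proof (rule eq_vecI)
  fix i assume "i < dim_vec ((w \<bullet> b - c * (u \<bullet> b)) \<cdot>\<^sub>v u + (u \<bullet> b) \<cdot>\<^sub>v w)"
  then have i: "i < D" using assms by simp
  have "(upd D u w c *\<^sub>v b) $ i
      = (\<Sum>j\<in>{0..<D}. (u $ i * w $ j + w $ i * u $ j - c * (u $ i * u $ j)) * b $ j)"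
    using i assms by (auto simp: upd_def scalar_prod_def intro!: sum.cong)
  also have "\<dots> = u $ i * (w \<bullet> b) + w $ i * (u \<bullet> b) - c * u $ i * (u \<bullet> b)"
  proof -
    have "(u $ i * w $ j + w $ i * u $ j - c * (u $ i * u $ j)) * b $ j
      = u $ i * (w $ j * b $ j) + w $ i * (u $ j * b $ j) - c * u $ i * (u $ j * b $ j)" for j
      by (simp add: ring_distribs mult_ac)
    then show ?thesis
      using assms(3) by (simp only: sum.distrib sum_subtractf sum_distrib_left[symmetric] scalar_prod_def carrier_vecD)
  qed
  finally show "(upd D u w c *\<^sub>v b) $ i = ((w \<bullet> b - c * (u \<bullet> b)) \<cdot>\<^sub>v u + (u \<bullet> b) \<cdot>\<^sub>v w) $ i"
    using i assms by (simp add: algebra_simps)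
qed (use assms in \<open>auto simp: upd_def\<close>)

lemma upd_scalar:
  assumes "u \<in> carrier_vec D" "w \<in> carrier_vec D" "b \<in> carrier_vec D" "b' \<in> carrier_vec D"
  shows "(upd D u w c *\<^sub>v b) \<bullet> b'
    = (w \<bullet> b) * (u \<bullet> b') + (u \<bullet> b) * (w \<bullet> b') - c * (u \<bullet> b) * (u \<bullet> b')"
  using assms by (simp add: upd_mult add_scalar_prod_distrib[where n = D] algebra_simps)

lemma Sym_add:
  assumes M: "M \<in> Sym D" and M': "M' \<in> Sym D" shows "M + M' \<in> Sym D"
proof -
  have "transpose_mat (M + M') = transpose_mat M + transpose_mat M'"
    using transpose_add[OF Sym_carrier[OF M] Sym_carrier[OF M']] .
  then show ?thesis using M M' by (simp add: Sym_def)
qed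

lemma Sym_zero: "0\<^sub>m D D \<in> Sym D"
  by (simp add: Sym_def)

lemma Sym_add_mult:
  assumes "M \<in> Sym D" "M' \<in> Sym D" "b \<in> carrier_vec D"
  shows "(M + M') *\<^sub>v b = M *\<^sub>v b + M' *\<^sub>v b"
  using add_mult_distrib_mat_vec[OF Sym_carrier[OF assms(1)] Sym_carrier[OF assms(2)] assms(3)] .

text \<open>The last rule is self-orthogonality: adjoining a vector orthogonal to \<open>x\<close>
  keeps the subspace isotropic, so maximality absorbs the vector.\<close>

lemma max_isotropicD:
  assumes "x \<in> max_isotropic D"
  shows "sub (2 * D) x" "\<And>u v. u \<in> x \<Longrightarrow> v \<in> x \<Longrightarrow> symp_form D u v = 0"
    "\<And>v. v \<in> carrier_vec (2 * D) \<Longrightarrow> (\<And>w. w \<in> x \<Longrightarrow> symp_form D v w = 0) \<Longrightarrow> v \<in> x"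
proof -
  have i: "isotropic D x" using assms by (simp add: max_isotropic_def)
  then show s: "sub (2 * D) x" and "\<And>u v. u \<in> x \<Longrightarrow> v \<in> x \<Longrightarrow> symp_form D u v = 0"
    by (auto simp: isotropic_iff)
  fix v assume v: "v \<in> carrier_vec (2 * D)" "\<And>w. w \<in> x \<Longrightarrow> symp_form D v w = 0"
  have "isotropic D (ext x v)" using isotropic_ext[OF i v] .
  then have "ext x v = x" using assms sub_ext(2)[OF s v(1)] by (simp add: max_isotropic_def)
  then show "v \<in> x" using sub_ext(3)[OF s v(1)] by simp
qed

lemma sub_upart:
  assumes "sub (2 * D) x"
  shows "sub D (upart D x)"
  unfolding sub_def
proof (intro conjI ballI allI)
  show "upart D x \<subseteq> carrier_vec D" by (auto simp: upart_def)
  show "0\<^sub>v D \<in> upart D x" using subD(2)[OF assms] by (simp add: upart_def zero_append)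
  fix a b assume "a \<in> upart D x" "b \<in> upart D x"
  then have ab: "a \<in> carrier_vec D" "b \<in> carrier_vec D" "a @\<^sub>v 0\<^sub>v D \<in> x" "b @\<^sub>v 0\<^sub>v D \<in> x"
    by (auto simp: upart_def)
  have "(a + b) @\<^sub>v (0\<^sub>v D + 0\<^sub>v D) \<in> x"
    using subD(3)[OF assms ab(3,4)] append_vec_add[OF ab(1,2) zero_carrier_vec[of D] zero_carrier_vec[of D]] by simp
  then show "a + b \<in> upart D x" using ab by (simp add: upart_def)
next
  fix c a assume "a \<in> upart D x"
  then have ab: "a \<in> carrier_vec D" "a @\<^sub>v 0\<^sub>v D \<in> x" by (auto simp: upart_def)
  have "(c \<cdot>\<^sub>v a) @\<^sub>v (c \<cdot>\<^sub>v 0\<^sub>v D) \<in> x" using subD(4)[OF assms ab(2), of c] by (simp add: smult_append)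
  moreover have "c \<cdot>\<^sub>v 0\<^sub>v D = 0\<^sub>v D" by auto
  ultimately show "c \<cdot>\<^sub>v a \<in> upart D x" using ab by (simp add: upart_def)
qed

text \<open>Let \<open>T\<close> be the set of second halves. Isotropy gives one inclusion. A
  \<open>u\<close> orthogonal to \<open>T\<close> has \<open>u @\<^sub>v 0\<^sub>v D\<close>
  orthogonal to all of \<open>x\<close>, hence in \<open>x\<close>; so the annihilator of
  \<open>T\<close> lies in \<open>upart D x\<close>, and biduality reverses this into the other
  inclusion.\<close>

lemma max_isotropic_proj:
  assumes x: "x \<in> max_isotropic D"
  shows "{b \<in> carrier_vec D. \<exists>a\<in>carrier_vec D. a @\<^sub>v b \<in> x} = perp D (upart D x)" (is "?T = _")
proof -
  note x' = max_isotropicD[OF x]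
  have sT: "sub D ?T"
    unfolding sub_def
  proof (intro conjI ballI allI)
    show "?T \<subseteq> carrier_vec D" by auto
    show "0\<^sub>v D \<in> ?T" using subD(2)[OF x'(1)] by (auto simp: zero_append)
  next
    fix b b' assume "b \<in> ?T" "b' \<in> ?T"
    then obtain a a' where ab: "a \<in> carrier_vec D" "b \<in> carrier_vec D" "a @\<^sub>v b \<in> x"
      "a' \<in> carrier_vec D" "b' \<in> carrier_vec D" "a' @\<^sub>v b' \<in> x" by auto
    have "(a + a') @\<^sub>v (b + b') \<in> x"
      using subD(3)[OF x'(1) ab(3,6)] append_vec_add[OF ab(1,4,2,5)] by simp
    then show "b + b' \<in> ?T" using ab by (intro CollectI conjI bexI[of _ "a + a'"]) simp_all
  next
    fix c b assume "b \<in> ?T"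
    then obtain a where ab: "a \<in> carrier_vec D" "b \<in> carrier_vec D" "a @\<^sub>v b \<in> x" by auto
    have "(c \<cdot>\<^sub>v a) @\<^sub>v (c \<cdot>\<^sub>v b) \<in> x" using subD(4)[OF x'(1) ab(3), of c] by (simp add: smult_append)
    then show "c \<cdot>\<^sub>v b \<in> ?T" using ab by (intro CollectI conjI bexI[of _ "c \<cdot>\<^sub>v a"]) simp_all
  qed
  have Uc: "u \<in> carrier_vec D" if "u \<in> upart D x" for u using that by (simp add: upart_def)
  have "?T \<subseteq> perp D (upart D x)"
  proof
    fix b assume "b \<in> ?T"
    then obtain a where ab: "a \<in> carrier_vec D" "b \<in> carrier_vec D" "a @\<^sub>v b \<in> x" by auto
    have "u \<bullet> b = 0" if "u \<in> upart D x" for u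
      using x'(2)[of "u @\<^sub>v 0\<^sub>v D" "a @\<^sub>v b"] that ab by (simp add: upart_def symp_form_append)
    then show "b \<in> perp D (upart D x)" using ab by (simp add: perp_def)
  qed
  moreover have "perp D ?T \<subseteq> upart D x"
  proof
    fix u assume u: "u \<in> perp D ?T"
    then have uc: "u \<in> carrier_vec D" using perp_carrier by blast
    have "u @\<^sub>v 0\<^sub>v D \<in> x"
    proof (rule x'(3))
      fix w assume w: "w \<in> x"
      then have "w \<in> carrier_vec (2 * D)" using subD(1)[OF x'(1)] by blast
      then obtain a b where ab: "a \<in> carrier_vec D" "b \<in> carrier_vec D" "w = a @\<^sub>v b"
        by (rule carrier_vec_split)
      have "b \<in> ?T" using ab w by auto
      then have "u \<bullet> b = 0" using perpD'[OF u _ subD(1)[OF sT]] by blast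
      then show "symp_form D (u @\<^sub>v 0\<^sub>v D) w = 0" using ab uc by (simp add: symp_form_append)
    qed (use uc in simp)
    then show "u \<in> upart D x" using uc by (simp add: upart_def)
  qed
  then have "perp D (upart D x) \<subseteq> perp D (perp D ?T)" by (rule perp_mono)
  then have "perp D (upart D x) \<subseteq> ?T" using perp_perp[OF sT] by simp
  ultimately show ?thesis by auto
qed

text \<open>
  The symmetric form carried by a Lagrangian is extended to the whole space one dimension at a time;
  \<open>upd\<close> corrects the pairing with the new basis vector without disturbing the part already treated.
\<close>

lemma max_isotropic_sym_step:
  assumes x: "x \<in> max_isotropic D" and T0: "sub D T0" and M: "M \<in> Sym D"
    and good: "\<And>a b b'. a \<in> carrier_vec D \<Longrightarrow> a @\<^sub>v b \<in> x \<Longrightarrow> b \<in> T0 \<Longrightarrow> b' \<in> T0 \<Longrightarrow> (a - M *\<^sub>v b) \<bullet> b' = 0"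
    and b1: "b1 \<in> carrier_vec D" "b1 \<notin> T0" and a1: "a1 \<in> carrier_vec D" "a1 @\<^sub>v b1 \<in> x"
  shows "\<exists>M'\<in>Sym D. \<forall>a b b'. a \<in> carrier_vec D \<longrightarrow> a @\<^sub>v b \<in> x \<longrightarrow> b \<in> ext T0 b1 \<longrightarrow>
    b' \<in> ext T0 b1 \<longrightarrow> (a - M' *\<^sub>v b) \<bullet> b' = 0"
proof -
  note x' = max_isotropicD[OF x]
  have T0c: "t \<in> carrier_vec D" if "t \<in> T0" for t using that subD(1)[OF T0] by blast
  obtain u where u: "u \<in> perp D T0" "b1 \<bullet> u = 1" "u \<bullet> b1 = 1" "u \<in> carrier_vec D"
    using perp_separate[OF T0 b1] .
  \<comment> \<open>The difference between the value \<open>a1\<close> prescribed by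
    \<open>x\<close> at \<open>b1\<close> and the value of \<open>M\<close> there. With the constant
    \<open>w \<bullet> b1\<close> the update sends \<open>b1\<close> to exactly \<open>w\<close>,
    and it vanishes on pairs from \<open>T0\<close> because \<open>u\<close> annihilates
    \<open>T0\<close>.\<close>
  define w where "w = a1 - M *\<^sub>v b1"
  have wc: "w \<in> carrier_vec D" using a1 b1 M by (simp add: w_def)
  define M' where "M' = M + upd D u w (w \<bullet> b1)"
  have M': "M' \<in> Sym D" unfolding M'_def by (rule Sym_add[OF M upd_Sym])
  have "(a - M' *\<^sub>v b) \<bullet> b' = 0"
    if a: "a \<in> carrier_vec D" "a @\<^sub>v b \<in> x" and b: "b \<in> ext T0 b1" and b': "b' \<in> ext T0 b1" for a b b'
  proof -
    obtain t \<beta> where t: "t \<in> T0" "b = t + \<beta> \<cdot>\<^sub>v b1" using b by (auto simp: ext_def)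
    obtain t' \<beta>' where t': "t' \<in> T0" "b' = t' + \<beta>' \<cdot>\<^sub>v b1" using b' by (auto simp: ext_def)
    note tc = T0c[OF t(1)] T0c[OF t'(1)]
    have bc: "b \<in> carrier_vec D" "b' \<in> carrier_vec D" using t t' tc b1 by auto
    \<comment> \<open>Subtracting a multiple of the chosen vector over \<open>b1\<close> leads back
      to a vector of \<open>x\<close> over \<open>T0\<close>.\<close>
    define a0 where "a0 = a + (- \<beta>) \<cdot>\<^sub>v a1"
    have a0c: "a0 \<in> carrier_vec D" using a a1 by (simp add: a0_def)
    have "a0 @\<^sub>v t \<in> x"
    proof -
      have "(a @\<^sub>v b) + (- \<beta>) \<cdot>\<^sub>v (a1 @\<^sub>v b1) \<in> x" using subD(3,4)[OF x'(1)] a(2) a1(2) by blast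
      moreover have "b + (- \<beta>) \<cdot>\<^sub>v b1 = t" using t(2) tc b1(1) by (intro eq_vecI) auto
      moreover have "(a @\<^sub>v b) + (- \<beta>) \<cdot>\<^sub>v (a1 @\<^sub>v b1) = (a + (- \<beta>) \<cdot>\<^sub>v a1) @\<^sub>v (b + (- \<beta>) \<cdot>\<^sub>v b1)"
        unfolding smult_append using a a1 bc b1 by (intro append_vec_add) auto
      ultimately show ?thesis by (simp add: a0_def)
    qed
    have z1: "(a0 - M *\<^sub>v t) \<bullet> t' = 0" using good[OF a0c \<open>a0 @\<^sub>v t \<in> x\<close> t(1) t'(1)] .
    \<comment> \<open>Isotropy of \<open>x\<close> ties the value of the new functional on
      \<open>T0\<close> to the row at \<open>b1\<close>, so that one symmetric correction serves
      both orders of the pair.\<close>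
    have "a0 \<bullet> b1 = t \<bullet> a1"
      using x'(2)[OF \<open>a0 @\<^sub>v t \<in> x\<close> a1(2)] a0c tc b1 a1 by (simp add: symp_form_append)
    then have z2: "a0 \<bullet> b1 - (M *\<^sub>v t) \<bullet> b1 = w \<bullet> t"
      using Sym_scalar[OF M tc(1) b1(1)] tc b1 a1 M
        comm_scalar_prod[OF wc tc(1)]
      by (simp add: w_def scalar_prod_minus_distrib[where n = D])
    have ub: "u \<bullet> b = \<beta>" "u \<bullet> b' = \<beta>'"
      using t t' tc b1 u perpD'[OF u(1) t(1) subD(1)[OF T0]] perpD'[OF u(1) t'(1) subD(1)[OF T0]]
      by (simp_all add: scalar_prod_add_distrib[where n = D])
    have wb: "w \<bullet> b = w \<bullet> t + \<beta> * (w \<bullet> b1)" "w \<bullet> b' = w \<bullet> t' + \<beta>' * (w \<bullet> b1)"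
      using t t' tc b1 wc by (simp_all add: scalar_prod_add_distrib[where n = D])
    have a_eq: "a = a0 + \<beta> \<cdot>\<^sub>v a1" unfolding a0_def using a a1 by (intro eq_vecI) auto
    have ab': "a \<bullet> b' = a0 \<bullet> t' + \<beta>' * (a0 \<bullet> b1) + \<beta> * (a1 \<bullet> b')"
      unfolding a_eq using a0c a1 t' tc b1
      by (simp add: add_scalar_prod_distrib[where n = D] scalar_prod_add_distrib[where n = D] algebra_simps)
    have Mb': "(M *\<^sub>v b) \<bullet> b' = (M *\<^sub>v t) \<bullet> t' + \<beta>' * ((M *\<^sub>v t) \<bullet> b1) + \<beta> * ((M *\<^sub>v b1) \<bullet> b')"
    proof -
      have "M *\<^sub>v b = M *\<^sub>v t + \<beta> \<cdot>\<^sub>v (M *\<^sub>v b1)"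
        unfolding t(2) using mult_add_distrib_mat_vec[OF Sym_carrier[OF M] tc(1), of "\<beta> \<cdot>\<^sub>v b1"]
          mult_mat_vec[OF Sym_carrier[OF M] b1(1), of \<beta>] b1 by simp
      moreover have "(M *\<^sub>v t) \<bullet> b' = (M *\<^sub>v t) \<bullet> t' + \<beta>' * ((M *\<^sub>v t) \<bullet> b1)"
        unfolding t'(2) using M tc b1
        by (simp add: scalar_prod_add_distrib[where n = D] scalar_prod_smult_distrib[where n = D])
      ultimately show ?thesis using M tc b1 bc
        by (simp add: add_scalar_prod_distrib[where n = D] smult_scalar_prod_distrib[where n = D])
    qed
    have wb'': "w \<bullet> b' = a1 \<bullet> b' - (M *\<^sub>v b1) \<bullet> b'"
      unfolding w_def using a1 b1 M bc by (simp add: minus_scalar_prod_distrib[where n = D])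
    have M'b: "(M' *\<^sub>v b) \<bullet> b' = (M *\<^sub>v b) \<bullet> b' + ((w \<bullet> b) * \<beta>' + \<beta> * (w \<bullet> b') - (w \<bullet> b1) * \<beta> * \<beta>')"
      unfolding M'_def Sym_add_mult[OF M upd_Sym bc(1)]
      using M bc upd_Sym[of D u w "w \<bullet> b1"] upd_scalar[OF u(4) wc bc, of "w \<bullet> b1"] ub
      by (simp add: add_scalar_prod_distrib[where n = D])
    have z1': "a0 \<bullet> t' = (M *\<^sub>v t) \<bullet> t'"
      using z1 a0c M tc by (simp add: minus_scalar_prod_distrib[where n = D])
    have "(a - M' *\<^sub>v b) \<bullet> b' = a \<bullet> b' - (M' *\<^sub>v b) \<bullet> b'"
      using a M' bc by (simp add: minus_scalar_prod_distrib[where n = D])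
    also have "\<dots> = \<beta>' * (a0 \<bullet> b1 - (M *\<^sub>v t) \<bullet> b1) + \<beta> * (w \<bullet> b')
        - ((w \<bullet> b) * \<beta>' + \<beta> * (w \<bullet> b') - (w \<bullet> b1) * \<beta> * \<beta>')"
      unfolding M'b ab' Mb' z1' wb'' by (simp add: algebra_simps)
    also have "\<dots> = 0" unfolding z2 wb(1) by (simp add: algebra_simps)
    finally show ?thesis .
  qed
  then show ?thesis using M' by blast
qed

text \<open>Take a largest subspace \<open>T0\<close> of the annihilator on which some symmetric
  matrix represents \<open>x\<close>; the extension step rules out that it is proper. The Lagrangian
  of that matrix then contains \<open>x\<close> and equals it by maximality.\<close>

lemma max_isotropic_eq_lag:
  assumes x: "x \<in> max_isotropic D"
  obtains M where "M \<in> Sym D" "x = lag D (upart D x) M"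
proof -
  note x' = max_isotropicD[OF x]
  let ?U = "upart D x" and ?T = "perp D (upart D x)"
  have U: "sub D ?U" using sub_upart[OF x'(1)] .
  have sT: "sub D ?T" using sub_perp[OF subD(1)[OF U]] .
  define P where "P T0 \<longleftrightarrow> sub D T0 \<and> T0 \<subseteq> ?T \<and> (\<exists>M\<in>Sym D. \<forall>a b b'. a \<in> carrier_vec D \<longrightarrow>
    a @\<^sub>v b \<in> x \<longrightarrow> b \<in> T0 \<longrightarrow> b' \<in> T0 \<longrightarrow> (a - M *\<^sub>v b) \<bullet> b' = 0)" for T0
  have "P {0\<^sub>v D}"
  proof -
    have "sub D {0\<^sub>v D :: 'a mod_ring vec}" using sub_std[of D 0] by (simp add: std_0)
    moreover have "(a - 0\<^sub>m D D *\<^sub>v 0\<^sub>v D) \<bullet> (0\<^sub>v D :: 'a mod_ring vec) = 0" for a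
      by (auto simp: scalar_prod_def)
    ultimately show ?thesis
      unfolding P_def using subD(2)[OF sT] Sym_zero by blast
  qed
  moreover have "\<forall>T0. P T0 \<longrightarrow> card T0 \<le> CARD('a) ^ D"
    using card_mono[OF finite_vec subD(1), of D] by (auto simp: P_def)
  ultimately obtain T0 where T0: "P T0" and max: "\<And>T1. P T1 \<Longrightarrow> card T1 \<le> card T0"
    using ex_has_greatest_nat[of P "{0\<^sub>v D}" card "Suc (CARD('a) ^ D)"] by (auto simp: less_Suc_eq_le)
  obtain M where M: "M \<in> Sym D" and good: "\<And>a b b'. a \<in> carrier_vec D \<Longrightarrow> a @\<^sub>v b \<in> x \<Longrightarrow>
     b \<in> T0 \<Longrightarrow> b' \<in> T0 \<Longrightarrow> (a - M *\<^sub>v b) \<bullet> b' = 0"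
    using T0 unfolding P_def by blast
  have sT0: "sub D T0" "T0 \<subseteq> ?T" using T0 by (auto simp: P_def)
  have "T0 = ?T"
  proof (rule ccontr)
    assume "T0 \<noteq> ?T"
    then obtain b1 where b1: "b1 \<in> ?T" "b1 \<notin> T0" using sT0 by auto
    have b1c: "b1 \<in> carrier_vec D" using b1 perp_carrier by blast
    have "b1 \<in> {b \<in> carrier_vec D. \<exists>a\<in>carrier_vec D. a @\<^sub>v b \<in> x}"
      using b1(1) max_isotropic_proj[OF x] by simp
    then obtain a1 where a1: "a1 \<in> carrier_vec D" "a1 @\<^sub>v b1 \<in> x" by auto
    have "P (ext T0 b1)"
      unfolding P_def using sub_ext(1)[OF sT0(1) b1c] ext_subset[OF sT sT0(2) b1(1)]
        max_isotropic_sym_step[OF x sT0(1) M good b1c b1(2) a1] by simp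
    from max[OF this] show False
      using card_ext[OF sT0(1) b1c b1(2)] subD(6)[OF sT0(1)] card_field_gt_1[where 'p = 'a] by simp
  qed
  have "x \<subseteq> lag D ?U M"
  proof
    fix v assume v: "v \<in> x"
    then have "v \<in> carrier_vec (2 * D)" using subD(1)[OF x'(1)] by blast
    then obtain a b where ab: "a \<in> carrier_vec D" "b \<in> carrier_vec D" "v = a @\<^sub>v b"
      by (rule carrier_vec_split)
    have b: "b \<in> ?T" using max_isotropic_proj[OF x] ab v by auto
    have d: "a - M *\<^sub>v b \<in> carrier_vec D" using ab M by simp
    have "b' \<bullet> (a - M *\<^sub>v b) = 0" if "b' \<in> ?T" for b'
    proof -
      have "(a - M *\<^sub>v b) \<bullet> b' = 0" using good ab v b that \<open>T0 = ?T\<close> by auto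
      moreover have "b' \<in> carrier_vec D" using that perp_carrier by blast
      ultimately show ?thesis using comm_scalar_prod[OF d] by simp
    qed
    then have "a - M *\<^sub>v b \<in> perp D ?T" using d by (auto simp: perp_def[of D ?T])
    then show "v \<in> lag D ?U M" using ab b by (simp add: lag_iff perp_perp[OF U])
  qed
  then have "x = lag D ?U M" using x isotropic_lag[OF U M] by (auto simp: max_isotropic_def)
  then show ?thesis using that M by blast
qed

lemma finite_max_isotropic: "finite (max_isotropic D :: 'p::prime_card mod_ring vec set set)"
proof (rule finite_subset)
  show "max_isotropic D \<subseteq> Pow (carrier_vec (2 * D) :: 'p mod_ring vec set)"
    using subD(1)[OF max_isotropicD(1)] by auto
qed simp

lemma card_max_isotropic_elem:
  assumes "x \<in> max_isotropic D"
  shows "card (x :: 'p::prime_card mod_ring vec set) = CARD('p) ^ D"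
  using max_isotropic_eq_lag[OF assms] card_lag[OF sub_upart[OF max_isotropicD(1)[OF assms]]] by metis

text \<open>Multiplying by \<open>q\<close> avoids the predecessor \<open>D - 1\<close>. The
  condition \<open>D \<ge> 1\<close> matters: for \<open>D = 0\<close> truncated subtraction would
  make the only vertex adjacent to itself.\<close>

lemma dpg_adj_iff:
  assumes "D \<ge> 1" "x \<in> max_isotropic D" "y \<in> max_isotropic D"
  shows "dpg_adj D x y = (if CARD('p) * card (x \<inter> y :: 'p::prime_card mod_ring vec set) = CARD('p) ^ D then 1 else 0)"
proof -
  have "card (x \<inter> y) = CARD('p) ^ fdim (2 * D) (x \<inter> y)"
    using card_sub[OF sub_Int] max_isotropicD(1) assms by blast
  then have "CARD('p) * card (x \<inter> y) = CARD('p) ^ Suc (fdim (2 * D) (x \<inter> y))" by simp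
  then have "CARD('p) * card (x \<inter> y) = CARD('p) ^ D \<longleftrightarrow> Suc (fdim (2 * D) (x \<inter> y)) = D"
    using card_field_gt_1[where 'p = 'p] by (simp only: power_inject_exp)
  also have "\<dots> \<longleftrightarrow> fdim (2 * D) (x \<inter> y) = D - 1" using assms(1) by auto
  finally show ?thesis by (simp add: dpg_adj_def)
qed

text \<open>\<open>x \<inter> y\<close> has index \<open>q\<close> in \<open>x\<close>, so a single
  vector of \<open>x \<inter> x_0\<close> outside \<open>y\<close> generates \<open>x\<close> over
  it; subtracting its multiples stays inside \<open>x_0\<close>, which carries the index over to the
  traces on \<open>x_0\<close>.\<close>

lemma upart_index:
  fixes x y :: "'p::prime_card mod_ring vec set"
  assumes sx: "sub (2 * D) x" and sy: "sub (2 * D) y" and c: "CARD('p) * card (x \<inter> y) = card x"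
    and u: "u \<in> upart D x" "u \<notin> upart D y"
  shows "card (upart D x) = CARD('p) * card (upart D x \<inter> upart D y)"
    and "x = ext (x \<inter> y) (u @\<^sub>v 0\<^sub>v D)"
proof -
  have sH: "sub (2 * D) (x \<inter> y)" using sub_Int[OF sx sy] .
  have uc: "u \<in> carrier_vec D" using u by (simp add: upart_def)
  have ux: "u @\<^sub>v 0\<^sub>v D \<in> x" "u @\<^sub>v 0\<^sub>v D \<notin> x \<inter> y" using u by (auto simp: upart_def)
  show xe: "x = ext (x \<inter> y) (u @\<^sub>v 0\<^sub>v D)"
    using ext_eq[OF sH sx _ _ ux] c by auto
  have sI: "sub D (upart D x \<inter> upart D y)" using sub_Int sub_upart sx sy by blast
  have "upart D x \<subseteq> ext (upart D x \<inter> upart D y) u"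
  proof
    fix v assume v: "v \<in> upart D x"
    then have vc: "v \<in> carrier_vec D" and "v @\<^sub>v 0\<^sub>v D \<in> ext (x \<inter> y) (u @\<^sub>v 0\<^sub>v D)"
      using xe by (auto simp: upart_def)
    then obtain h c where h: "h \<in> x \<inter> y" "v @\<^sub>v 0\<^sub>v D = h + c \<cdot>\<^sub>v (u @\<^sub>v 0\<^sub>v D)"
      by (auto simp: ext_def)
    have hc: "h \<in> carrier_vec (2 * D)" using h subD(1)[OF sH] by blast
    have "h = (v @\<^sub>v 0\<^sub>v D) + (- c) \<cdot>\<^sub>v (u @\<^sub>v 0\<^sub>v D)"
      unfolding h(2) using hc uc by (intro eq_vecI) auto
    also have "\<dots> = (v + (- c) \<cdot>\<^sub>v u) @\<^sub>v (0\<^sub>v D + (- c) \<cdot>\<^sub>v 0\<^sub>v D)"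
      unfolding smult_append using vc uc by (intro append_vec_add[where m = D]) auto
    also have "0\<^sub>v D + (- c) \<cdot>\<^sub>v 0\<^sub>v D = (0\<^sub>v D :: 'p mod_ring vec)" by auto
    finally have "v + (- c) \<cdot>\<^sub>v u \<in> upart D x \<inter> upart D y"
      using h(1) vc uc by (simp add: upart_def)
    moreover have "v = (v + (- c) \<cdot>\<^sub>v u) + c \<cdot>\<^sub>v u" using vc uc by (intro eq_vecI) auto
    ultimately show "v \<in> ext (upart D x \<inter> upart D y) u" using extI by metis
  qed
  then have "ext (upart D x \<inter> upart D y) u = upart D x"
    using ext_subset[OF sub_upart[OF sx], of "upart D x \<inter> upart D y" u] u by auto
  then show "card (upart D x) = CARD('p) * card (upart D x \<inter> upart D y)"
    using card_ext[OF sI uc] u by auto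
qed

text \<open>If the traces on \<open>x_0\<close> were incomparable, \<open>y\<close> would be
  generated by \<open>x \<inter> y\<close> and a vector of \<open>x_0\<close>. A vector of
  \<open>x \<inter> x_0\<close> outside \<open>y\<close> is orthogonal to both, as \<open>x\<close>
  and \<open>x_0\<close> are isotropic, so self-orthogonality would put it into
  \<open>y\<close>.\<close>

lemma adjacent_cases:
  fixes x y :: "'p::prime_card mod_ring vec set"
  assumes x: "x \<in> max_isotropic D" and y: "y \<in> max_isotropic D"
    and adj: "CARD('p) * card (x \<inter> y) = CARD('p) ^ D"
  shows "upart D x = upart D y
    \<or> upart D x \<subset> upart D y \<and> card (upart D y) = CARD('p) * card (upart D x)
    \<or> upart D y \<subset> upart D x \<and> card (upart D x) = CARD('p) * card (upart D y)"
proof -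
  note x' = max_isotropicD[OF x] and y' = max_isotropicD[OF y]
  have cx: "CARD('p) * card (x \<inter> y) = card x" and cy: "CARD('p) * card (y \<inter> x) = card y"
    using adj card_max_isotropic_elem[OF x] card_max_isotropic_elem[OF y] by (simp_all add: Int_commute)
  have "upart D x \<subseteq> upart D y \<or> upart D y \<subseteq> upart D x"
  proof (rule ccontr)
    assume "\<not> ?thesis"
    then obtain u u' where u: "u \<in> upart D x" "u \<notin> upart D y" and u': "u' \<in> upart D y" "u' \<notin> upart D x"
      by auto
    have uc: "u \<in> carrier_vec D" "u' \<in> carrier_vec D" using u u' by (auto simp: upart_def)
    have "u @\<^sub>v 0\<^sub>v D \<in> y"
    proof (rule y'(3))
      fix w assume "w \<in> y"
      then have "w \<in> ext (y \<inter> x) (u' @\<^sub>v 0\<^sub>v D)"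
        using upart_index(2)[OF y'(1) x'(1) cy u'] by blast
      then obtain h c where h: "h \<in> y \<inter> x" "w = h + c \<cdot>\<^sub>v (u' @\<^sub>v 0\<^sub>v D)"
        by (auto simp: ext_def)
      have hc: "h \<in> carrier_vec (2 * D)" using h subD(1)[OF x'(1)] by auto
      have "symp_form D (u @\<^sub>v 0\<^sub>v D) h = 0" using x'(2) u h by (auto simp: upart_def)
      moreover have "symp_form D (u @\<^sub>v 0\<^sub>v D) (u' @\<^sub>v 0\<^sub>v D) = 0"
        using uc by (simp add: symp_form_append)
      ultimately show "symp_form D (u @\<^sub>v 0\<^sub>v D) w = 0"
        unfolding h(2) using hc uc by (simp add: symp_add_right symp_smult_right)
    qed (use uc in simp)
    then show False using u uc by (simp add: upart_def)
  qed
  moreover have "card (upart D x) = CARD('p) * card (upart D y)" if s: "upart D y \<subset> upart D x"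
  proof -
    obtain u where "u \<in> upart D x" "u \<notin> upart D y" using s by blast
    moreover have "upart D x \<inter> upart D y = upart D y" using s by blast
    ultimately show ?thesis using upart_index(1)[OF x'(1) y'(1) cx] by metis
  qed
  moreover have "card (upart D y) = CARD('p) * card (upart D x)" if s: "upart D x \<subset> upart D y"
  proof -
    obtain u where "u \<in> upart D y" "u \<notin> upart D x" using s by blast
    moreover have "upart D y \<inter> upart D x = upart D x" using s by blast
    ultimately show ?thesis using upart_index(1)[OF y'(1) x'(1) cy] by metis
  qed
  ultimately show ?thesis by blast
qed

subsection \<open>Plane waves and their sums over neighbours\<close>

text \<open>Lets a sum over a redundantly parametrised set be taken over the parameters; it serves
  neighbours, covers, squares and the image of a matrix alike.\<close>

lemma sum_fibers:
  fixes h :: "'b \<Rightarrow> complex"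
  assumes "finite A" "\<And>a. a \<in> A \<Longrightarrow> card {a' \<in> A. f a' = f a} = k"
  shows "(\<Sum>a\<in>A. h (f a)) = of_nat k * (\<Sum>x\<in>f ` A. h x)"
proof -
  have "(\<Sum>a\<in>A. h (f a)) = (\<Sum>x\<in>f ` A. \<Sum>a\<in>{a \<in> A. f a = x}. h (f a))"
    by (rule sum.image_gen[OF assms(1)])
  also have "\<dots> = (\<Sum>x\<in>f ` A. of_nat k * h x)"
  proof (rule sum.cong[OF refl])
    fix x assume "x \<in> f ` A"
    then obtain a where a: "a \<in> A" "x = f a" by auto
    have "(\<Sum>a\<in>{a \<in> A. f a = x}. h (f a)) = (\<Sum>a\<in>{a \<in> A. f a = x}. h x)"
      by (rule sum.cong) auto
    then show "(\<Sum>a\<in>{a \<in> A. f a = x}. h (f a)) = of_nat k * h x"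
      using assms(2)[OF a(1)] a(2) by simp
  qed
  finally show ?thesis by (simp add: sum_distrib_left)
qed

lemma Sym_index: "M \<in> Sym D \<Longrightarrow> i < D \<Longrightarrow> j < D \<Longrightarrow> M $$ (i, j) = M $$ (j, i)"
  by (metis (mono_tags, lifting) Sym_def carrier_matD index_transpose_mat(1) mem_Collect_eq)

lemma Sym_smult: "M \<in> Sym D \<Longrightarrow> c \<cdot>\<^sub>m M \<in> Sym D"
  using Sym_index[of M D] by (auto simp: Sym_def intro!: eq_matI)

lemma mtrace_mult:
  assumes "A \<in> carrier_mat D D" "B \<in> carrier_mat D D"
  shows "mtrace (A * B) = (\<Sum>i<D. \<Sum>j<D. A $$ (i, j) * B $$ (j, i))"
  using assms unfolding mtrace_def
  by (auto simp: scalar_prod_def atLeast0LessThan intro!: sum.cong)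

lemma mtrace_comm:
  assumes "A \<in> carrier_mat D D" "B \<in> carrier_mat D D"
  shows "mtrace (A * B) = mtrace (B * A)"
proof -
  have "mtrace (A * B) = (\<Sum>j<D. \<Sum>i<D. A $$ (i, j) * B $$ (j, i))"
    unfolding mtrace_mult[OF assms] by (rule sum.swap)
  then show ?thesis unfolding mtrace_mult[OF assms(2,1)] by (simp only: mult.commute)
qed

lemma mtrace_add:
  assumes "S \<in> carrier_mat D D" "A \<in> carrier_mat D D" "B \<in> carrier_mat D D"
  shows "mtrace (S * (A + B)) = mtrace (S * A) + mtrace (S * B)"
  using assms by (simp add: mtrace_mult[of _ D] ring_distribs sum.distrib)

lemma mtrace_congruence:
  assumes "C \<in> carrier_mat D D" "S \<in> carrier_mat D D" "F \<in> carrier_mat D D"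
  shows "mtrace (transpose_mat C * S * C * F) = mtrace (S * (C * F * transpose_mat C))"
proof -
  have "transpose_mat C * S * C * F = transpose_mat C * (S * C * F)"
    using assms by (simp add: assoc_mult_mat[where ?n\<^sub>1 = D and ?n\<^sub>2 = D and ?n\<^sub>3 = D and ?n\<^sub>4 = D])
  then have "mtrace (transpose_mat C * S * C * F) = mtrace (S * C * F * transpose_mat C)"
    using assms mtrace_comm[of "transpose_mat C" D "S * C * F"] by simp
  also have "S * C * F * transpose_mat C = S * (C * F * transpose_mat C)"
    using assms by (simp add: assoc_mult_mat[where ?n\<^sub>1 = D and ?n\<^sub>2 = D and ?n\<^sub>3 = D and ?n\<^sub>4 = D])
  finally show ?thesis .
qed

text \<open>\<open>tr (S u w^t) = w \<bullet> (S u)\<close>, and symmetry of \<open>S\<close> merges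
  the two mixed terms. The resulting factor 2 is what disappears for \<open>q = 2\<close>.\<close>

lemma mtrace_upd:
  assumes S: "S \<in> Sym D" and u: "u \<in> carrier_vec D" and w: "w \<in> carrier_vec D"
  shows "mtrace (S * upd D u w c) = 2 * (w \<bullet> (S *\<^sub>v u)) - c * (u \<bullet> (S *\<^sub>v u))"
proof -
  have bil: "x \<bullet> (S *\<^sub>v y) = (\<Sum>i<D. \<Sum>j<D. S $$ (i, j) * (x $ i * y $ j))"
    if "x \<in> carrier_vec D" "y \<in> carrier_vec D" for x y
    using that Sym_carrier[OF S]
    by (auto simp: scalar_prod_def atLeast0LessThan sum_distrib_left mult_ac intro!: sum.cong)
  have "mtrace (S * upd D u w c)
    = (\<Sum>i<D. \<Sum>j<D. S $$ (i, j) * (u $ j * w $ i + w $ j * u $ i - c * (u $ j * u $ i)))"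
    unfolding mtrace_mult[OF Sym_carrier[OF S] Sym_carrier[OF upd_Sym]]
    by (intro sum.cong refl) (auto simp: upd_def)
  also have "\<dots> = (\<Sum>i<D. \<Sum>j<D. S $$ (i, j) * (w $ i * u $ j)) + (\<Sum>i<D. \<Sum>j<D. S $$ (i, j) * (u $ i * w $ j))
      - c * (\<Sum>i<D. \<Sum>j<D. S $$ (i, j) * (u $ i * u $ j))"
    by (simp add: sum.distrib sum_subtractf sum_distrib_left ring_distribs mult_ac)
  also have "\<dots> = w \<bullet> (S *\<^sub>v u) + u \<bullet> (S *\<^sub>v w) - c * (u \<bullet> (S *\<^sub>v u))"
    using u w by (simp add: bil)
  also have "u \<bullet> (S *\<^sub>v w) = w \<bullet> (S *\<^sub>v u)"
    using Sym_scalar[OF S u w] comm_scalar_prod[of w D "S *\<^sub>v u"] S u w by simp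
  finally show ?thesis by simp
qed

lemma mat_kernel_iff:
  "S \<in> carrier_mat D D \<Longrightarrow> v \<in> mat_kernel S \<longleftrightarrow> v \<in> carrier_vec D \<and> S *\<^sub>v v = 0\<^sub>v D"
  by (auto simp: mat_kernel_def)

text \<open>In a basis adapted to \<open>U\<close> the two matrices have complementary zero
  patterns. \<open>C^t S C\<close> is zero where some index is below \<open>k\<close>, because
  \<open>U\<close> lies in the kernel; the transformed \<open>M\<close> is zero where both indices
  are at least \<open>k\<close>, because it maps the annihilator into \<open>U\<close>. This makes
  the phase of a Lagrangian independent of its matrix.\<close>

lemma mtrace_vanish:
  assumes S: "S \<in> Sym D" and U: "sub D U" "U \<subseteq> mat_kernel S" and M: "M \<in> Sym D"
    and van: "\<And>b. b \<in> perp D U \<Longrightarrow> M *\<^sub>v b \<in> U"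
  shows "mtrace (S * M) = 0"
proof -
  obtain k where k: "k \<le> D" "card U = CARD('a) ^ k" using sub_card_obtain[OF U(1)] .
  obtain C where C: "C \<in> GL D" "(*\<^sub>v) C ` std D k = U" using GL_flag[OF U(1) k(2,1)] .
  obtain B where B: "C \<in> carrier_mat D D" "B \<in> carrier_mat D D" "C * B = 1\<^sub>m D" "B * C = 1\<^sub>m D"
    using C(1) by (auto simp: GL_iff)
  note Sc = Sym_carrier[OF S] and Mc = Sym_carrier[OF M]
  let ?S = "transpose_mat C * S * C" and ?M = "B * M * transpose_mat B"
  have tB: "transpose_mat B * transpose_mat C = 1\<^sub>m D"
    using transpose_mult[OF B(1,2)] B(3) by simp
  have "C * ?M * transpose_mat C = C * (B * (M * (transpose_mat B * transpose_mat C)))"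
    using B Mc by (simp add: assoc_mult_mat[where ?n\<^sub>1 = D and ?n\<^sub>2 = D and ?n\<^sub>3 = D and ?n\<^sub>4 = D])
  also have "\<dots> = (C * B) * (M * (transpose_mat B * transpose_mat C))"
    using B Mc by (intro assoc_mult_mat[symmetric, where ?n\<^sub>4 = D]) auto
  finally have "C * ?M * transpose_mat C = M" using B(3) tB Mc by simp
  then have "mtrace (S * M) = mtrace (?S * ?M)"
    using mtrace_congruence[OF B(1) Sc, of ?M] B Mc by simp
  also have "\<dots> = (\<Sum>i<D. \<Sum>j<D. ?S $$ (i, j) * ?M $$ (j, i))"
    using B Mc Sc by (intro mtrace_mult) auto
  also have "\<dots> = 0"
  proof (intro sum.neutral ballI)
    fix i j assume "i \<in> {..<D}" "j \<in> {..<D}"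
    then have ij: "i < D" "j < D" by auto
    have colC: "col C n \<in> mat_kernel S" if "n < k" for n
    proof -
      have "C *\<^sub>v unit_vec D n = col C n" using B(1) that k(1) by (intro eq_vecI) auto
      moreover have "unit_vec D n \<in> (std D k :: 'a mod_ring vec set)" using that by (auto simp: std_def)
      ultimately have "col C n \<in> U" using C(2) by (metis imageI)
      then show ?thesis using U(2) by blast
    qed
    have Sij: "?S $$ (m, n) = col C m \<bullet> (S *\<^sub>v col C n)" if "m < D" "n < D" for m n
    proof -
      have "?S = transpose_mat C * (S * C)" using B Sc by simp
      then have "?S $$ (m, n) = col C m \<bullet> col (S * C) n" using that B Sc by simp
      also have "col (S * C) n = S *\<^sub>v col C n" using that B Sc by auto
      finally show ?thesis .
    qed
    \<comment> \<open>The rows of the inverse from index \<open>k\<close> on are the coordinate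
      functionals that vanish on \<open>U\<close>.\<close>
    have perpB: "row B n \<in> perp D U" if "n < D" "k \<le> n" for n
    proof -
      have "u \<bullet> row B n = 0" if "u \<in> U" for u
      proof -
        obtain v where v: "v \<in> std D k" "u = C *\<^sub>v v" using \<open>u \<in> U\<close> C(2) by auto
        have vc: "v \<in> carrier_vec D" using v by (simp add: std_def)
        have "row B n \<bullet> u = (B *\<^sub>v u) $ n" using \<open>n < D\<close> B by simp
        also have "B *\<^sub>v u = v" using v vc B assoc_mult_mat_vec[OF B(2,1) vc] by simp
        also have "v $ n = 0" using v(1) \<open>n < D\<close> \<open>k \<le> n\<close> by (simp add: std_def)
        finally show ?thesis using comm_scalar_prod[of u D "row B n"] B v vc \<open>n < D\<close> by simp
      qed
      then show ?thesis using that B by (auto simp: perp_def)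
    qed
    show "?S $$ (i, j) * ?M $$ (j, i) = 0"
    proof (cases "i < k \<or> j < k")
      case True
      have "col C i \<bullet> (S *\<^sub>v col C j) = 0"
      proof (cases "j < k")
        case True
        then show ?thesis using colC[OF True] Sc B ij by (simp add: mat_kernel_iff[OF Sc])
      next
        case False
        then have "S *\<^sub>v col C i = 0\<^sub>v D" using colC[of i] True mat_kernel_iff[OF Sc] by blast
        then show ?thesis
          using Sym_scalar[OF S, of "col C i" "col C j"] B ij by (metis col_carrier_vec scalar_prod_left_zero)
      qed
      then show ?thesis using Sij[OF ij] by simp
    next
      case False
      then have r: "row B i \<in> perp D U" "row B j \<in> perp D U" using perpB ij by auto
      have "?M = B * (M * transpose_mat B)" using B Mc by simp
      then have "?M $$ (j, i) = row B j \<bullet> col (M * transpose_mat B) i" using B Mc ij by simp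
      also have "col (M * transpose_mat B) i = M *\<^sub>v row B i" using B Mc ij by auto
      also have "row B j \<bullet> (M *\<^sub>v row B i) = 0"
        using perpD'[OF r(2) van[OF r(1)] subD(1)[OF U(1)]] .
      finally show ?thesis by simp
    qed
  qed
  finally show ?thesis .
qed

lemma mtrace_lag_cong:
  assumes S: "S \<in> Sym D" and U: "sub D U" "U \<subseteq> mat_kernel S" and M: "M \<in> Sym D" and M': "M' \<in> Sym D"
    and eq: "lag D U M = lag D U M'"
  shows "mtrace (S * M) = mtrace (S * M')"
proof -
  note c = Sym_carrier[OF S] Sym_carrier[OF M] Sym_carrier[OF M']
  have D: "M + (- 1) \<cdot>\<^sub>m M' \<in> Sym D" using M M' by (intro Sym_add Sym_smult)
  have "mtrace (S * (M + (- 1) \<cdot>\<^sub>m M')) = 0"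
  proof (rule mtrace_vanish[OF S U D])
    fix b assume b: "b \<in> perp D U"
    then have bc: "b \<in> carrier_vec D" using perp_carrier by blast
    have "(M + (- 1) \<cdot>\<^sub>m M') *\<^sub>v b = M *\<^sub>v b - M' *\<^sub>v b"
      using c bc by (intro eq_vecI) (auto simp: scalar_prod_def sum_subtractf[symmetric] ring_distribs intro!: sum.cong)
    then show "(M + (- 1) \<cdot>\<^sub>m M') *\<^sub>v b \<in> U" using eq b lag_eq_iff[OF U(1) M M'] by simp
  qed
  moreover have "mtrace (S * (M + (- 1) \<cdot>\<^sub>m M')) = mtrace (S * M) - mtrace (S * M')"
    using c by (simp add: mtrace_mult[of _ D] ring_distribs sum_subtractf)
  ultimately show ?thesis by simp
qed

text \<open>
  The value does not depend on the chosen \<open>M\<close> when \<open>upart D x\<close> is contained in the kernel of \<open>S\<close>,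
  by \<open>mtrace_lag_cong\<close>.
\<close>

definition wave :: "nat \<Rightarrow> 'p::prime_card mod_ring mat \<Rightarrow> 'p mod_ring vec set \<Rightarrow> complex" where
  "wave D S x = chi (mtrace (S * (SOME M. M \<in> Sym D \<and> x = lag D (upart D x) M)))"

lemma wave_lag:
  assumes S: "S \<in> Sym D" and U: "sub D U" "U \<subseteq> mat_kernel S" and M: "M \<in> Sym D"
  shows "wave D S (lag D U M) = chi (mtrace (S * M))"
proof -
  let ?P = "\<lambda>M'. M' \<in> Sym D \<and> lag D U M = lag D U M'"
  have "?P (SOME M'. ?P M')" by (rule someI[of _ M]) (use M in simp)
  then have "mtrace (S * (SOME M'. ?P M')) = mtrace (S * M)"
    using mtrace_lag_cong[OF S U _ M] by metis
  then show ?thesis unfolding wave_def upart_lag[OF U(1) M] by simp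
qed

definition nbrs :: "nat \<Rightarrow> 'p::prime_card mod_ring vec set \<Rightarrow> 'p mod_ring vec set \<Rightarrow> 'p mod_ring vec set set" where
  "nbrs D U y = {x \<in> max_isotropic D. upart D x = U \<and> CARD('p) * card (x \<inter> y) = CARD('p) ^ D}"

lemma nbrs_lag:
  assumes "sub D (U :: 'p::prime_card mod_ring vec set)"
  shows "nbrs D U y = {lag D U M | M. M \<in> Sym D \<and> CARD('p) * card (lag D U M \<inter> y) = CARD('p) ^ D}"
proof (intro equalityI subsetI)
  fix x assume "x \<in> nbrs D U y"
  then have x: "x \<in> max_isotropic D" "upart D x = U" "CARD('p) * card (x \<inter> y) = CARD('p) ^ D"
    by (auto simp: nbrs_def)
  obtain M where "M \<in> Sym D" "x = lag D U M" using max_isotropic_eq_lag[OF x(1)] x(2) by metis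
  then show "x \<in> {lag D U M | M. M \<in> Sym D \<and> CARD('p) * card (lag D U M \<inter> y) = CARD('p) ^ D}"
    using x(3) by blast
next
  fix x assume "x \<in> {lag D U M | M. M \<in> Sym D \<and> CARD('p) * card (lag D U M \<inter> y) = CARD('p) ^ D}"
  then show "x \<in> nbrs D U y"
    using lag_max_isotropic[OF assms] upart_lag[OF assms] by (auto simp: nbrs_def)
qed

text \<open>Adjacency makes the set where the forms agree modulo \<open>U\<close> fill the whole
  annihilator of \<open>U\<close>, and a Lagrangian over \<open>U\<close> depends on its form only
  there.\<close>

lemma nbrs_below:
  fixes U :: "'p::prime_card mod_ring vec set"
  assumes U: "sub D U" and U': "sub D U'" and M0: "M0 \<in> Sym D"
    and le: "U' \<subset> U" "card U = CARD('p) * card U'"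
  shows "nbrs D U (lag D U' M0) = {lag D U M0}"
proof -
  have "CARD('p) * card (lag D U M \<inter> lag D U' M0) = CARD('p) ^ D \<longleftrightarrow> lag D U M = lag D U M0"
    if M: "M \<in> Sym D" for M
  proof -
    let ?Z = "{b \<in> perp D U. M0 *\<^sub>v b - M *\<^sub>v b \<in> U}"
    have "card (lag D U M \<inter> lag D U' M0) = card U' * card ?Z"
      using card_lag_Int[OF U' U _ M0 M] le by (simp add: Int_commute)
    then have "CARD('p) * card (lag D U M \<inter> lag D U' M0) = CARD('p) ^ D \<longleftrightarrow> card U * card ?Z = card U * card (perp D U)"
      using card_perp[OF U] le(2) by (simp add: mult.assoc)
    also have "\<dots> \<longleftrightarrow> card ?Z = card (perp D U)" using subD(6)[OF U] by simp
    also have "\<dots> \<longleftrightarrow> ?Z = perp D U"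
      using card_subset_eq[of "perp D U" ?Z] subD(5)[OF sub_perp[OF subD(1)[OF U]]] by auto
    also have "\<dots> \<longleftrightarrow> lag D U M0 = lag D U M" using lag_eq_iff[OF U M0 M] by auto
    finally show ?thesis by auto
  qed
  then show ?thesis unfolding nbrs_lag[OF U] using M0 by blast
qed

lemma nbrs_empty:
  fixes U :: "'p::prime_card mod_ring vec set"
  assumes U: "sub D U" and y: "y \<in> max_isotropic D" and "nbrs D U y \<noteq> {}"
  shows "U = upart D y \<or> U \<subset> upart D y \<and> card (upart D y) = CARD('p) * card U
    \<or> upart D y \<subset> U \<and> card U = CARD('p) * card (upart D y)"
proof -
  obtain x where "x \<in> max_isotropic D" "upart D x = U" "CARD('p) * card (x \<inter> y) = CARD('p) ^ D"
    using assms(3) by (auto simp: nbrs_def)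
  then show ?thesis using adjacent_cases[OF _ y, of x] by blast
qed

lemma vec_in_perp_perp:
  assumes U: "sub D U" and v: "v \<in> carrier_vec D" and z: "\<And>b. b \<in> perp D U \<Longrightarrow> v \<bullet> b = 0"
  shows "v \<in> U"
proof -
  have "b \<bullet> v = 0" if "b \<in> perp D U" for b
    using z[OF that] comm_scalar_prod[OF v] that perp_carrier[of D U] by (metis subsetD)
  then have "v \<in> perp D (perp D U)" using v by (simp add: perp_def[of D "perp D U"])
  then show ?thesis using perp_perp[OF U] by simp
qed

lemma lag_eq_iff_scalar:
  assumes U: "sub D U" and M: "M \<in> Sym D" and M': "M' \<in> Sym D"
  shows "lag D U M = lag D U M' \<longleftrightarrow> (\<forall>b\<in>perp D U. \<forall>b'\<in>perp D U. (M *\<^sub>v b) \<bullet> b' = (M' *\<^sub>v b) \<bullet> b')"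
proof -
  have pc: "b \<in> carrier_vec D" if "b \<in> perp D U" for b using that perp_carrier by blast
  have "M *\<^sub>v b - M' *\<^sub>v b \<in> U \<longleftrightarrow> (\<forall>b'\<in>perp D U. (M *\<^sub>v b) \<bullet> b' = (M' *\<^sub>v b) \<bullet> b')"
    if b: "b \<in> perp D U" for b
  proof -
    have c: "M *\<^sub>v b \<in> carrier_vec D" "M' *\<^sub>v b \<in> carrier_vec D" using M M' pc[OF b] by auto
    have e: "(M *\<^sub>v b - M' *\<^sub>v b) \<bullet> b' = (M *\<^sub>v b) \<bullet> b' - (M' *\<^sub>v b) \<bullet> b'" if "b' \<in> perp D U" for b'
      using minus_scalar_prod_distrib[OF c pc[OF that]] .
    show ?thesis
    proof
      assume d: "M *\<^sub>v b - M' *\<^sub>v b \<in> U"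
      show "\<forall>b'\<in>perp D U. (M *\<^sub>v b) \<bullet> b' = (M' *\<^sub>v b) \<bullet> b'"
        using e perpD[OF _ d] by fastforce
    next
      assume "\<forall>b'\<in>perp D U. (M *\<^sub>v b) \<bullet> b' = (M' *\<^sub>v b) \<bullet> b'"
      then show "M *\<^sub>v b - M' *\<^sub>v b \<in> U" using c e by (intro vec_in_perp_perp[OF U]) auto
    qed
  qed
  then show ?thesis using lag_eq_iff[OF U M M'] by simp
qed

lemma lag_add_upd_iff:
  assumes U: "sub D U" and M: "M \<in> Sym D" and M0: "M0 \<in> Sym D"
    and u: "u \<in> carrier_vec D" and w: "w \<in> carrier_vec D"
  shows "lag D U M = lag D U (M0 + upd D u w c) \<longleftrightarrow> (\<forall>b\<in>perp D U. \<forall>b'\<in>perp D U.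
    (M *\<^sub>v b) \<bullet> b' - (M0 *\<^sub>v b) \<bullet> b' = (w \<bullet> b) * (u \<bullet> b') + (u \<bullet> b) * (w \<bullet> b') - c * (u \<bullet> b) * (u \<bullet> b'))"
proof -
  have pc: "b \<in> carrier_vec D" if "b \<in> perp D U" for b using that perp_carrier by blast
  have "((M0 + upd D u w c) *\<^sub>v b) \<bullet> b' = (M0 *\<^sub>v b) \<bullet> b' +
      ((w \<bullet> b) * (u \<bullet> b') + (u \<bullet> b) * (w \<bullet> b') - c * (u \<bullet> b) * (u \<bullet> b'))"
    if "b \<in> perp D U" "b' \<in> perp D U" for b b'
  proof -
    note bc = pc[OF that(1)] pc[OF that(2)]
    show ?thesis
      unfolding Sym_add_mult[OF M0 upd_Sym bc(1)] upd_scalar[OF u w bc, symmetric]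
      by (rule add_scalar_prod_distrib[OF Sym_mult_carrier[OF M0 bc(1)] Sym_mult_carrier[OF upd_Sym bc(1)] bc(2)])
  qed
  then show ?thesis
    unfolding lag_eq_iff_scalar[OF U M Sym_add[OF M0 upd_Sym]] by (auto simp: diff_eq_eq add.commute)
qed

text \<open>Adjacency means that the difference \<open>G\<close> of the two forms vanishes on the
  annihilator of \<open>U'\<close>, which is the hyperplane \<open>u = 0\<close> in the annihilator
  of \<open>U\<close> and is complemented by \<open>b0\<close>. Such a symmetric form is determined
  by its row at \<open>b0\<close>, and \<open>upd\<close> is the matrix with a prescribed
  row.\<close>

lemma nbrs_above:
  fixes U :: "'p::prime_card mod_ring vec set"
  assumes U: "sub D U" and U': "sub D U'" and M0: "M0 \<in> Sym D"
    and le: "U \<subset> U'" "card U' = CARD('p) * card U"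
    and u: "u \<in> U'" and b0: "b0 \<in> perp D U" "u \<bullet> b0 = 1"
  shows "nbrs D U (lag D U' M0) = (\<lambda>w. lag D U (M0 + upd D u w (w \<bullet> b0))) ` carrier_vec D"
proof -
  let ?T = "perp D U" and ?T' = "perp D U'"
  have pc: "b \<in> carrier_vec D" if "b \<in> ?T" for b using that perp_carrier by blast
  have sT: "sub D ?T" "sub D ?T'" using sub_perp subD(1) U U' by blast+
  have TT: "?T' \<subseteq> ?T" using perp_mono le by blast
  have uc: "u \<in> carrier_vec D" using u subD(1)[OF U'] by blast
  have unU: "u \<notin> U" using perpD[OF b0(1)] b0(2) by fastforce
  have U'e: "ext U u = U'" using ext_eq[OF U U' _ le(2) u unU] le by blast
  have T'I: "b \<in> ?T'" if b: "b \<in> ?T" "u \<bullet> b = 0" for b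
  proof -
    have "(a + c \<cdot>\<^sub>v u) \<bullet> b = 0" if "a \<in> U" for a c
      using that subD(1)[OF U] uc pc[OF b(1)] perpD[OF b(1) that] b(2)
      by (subst add_scalar_prod_distrib[where n = D]) auto
    then show ?thesis unfolding U'e[symmetric] using pc[OF b(1)] by (auto simp: perp_def ext_def)
  qed
  have adj: "CARD('p) * card (lag D U M \<inter> lag D U' M0) = CARD('p) ^ D
      \<longleftrightarrow> (\<forall>b\<in>?T'. M *\<^sub>v b - M0 *\<^sub>v b \<in> U')" if M: "M \<in> Sym D" for M
  proof -
    let ?Z = "{b \<in> ?T'. M *\<^sub>v b - M0 *\<^sub>v b \<in> U'}"
    have "card (lag D U M \<inter> lag D U' M0) = card U * card ?Z"
      using card_lag_Int[OF U U' _ M M0] le by simp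
    then have "CARD('p) * card (lag D U M \<inter> lag D U' M0) = CARD('p) ^ D \<longleftrightarrow> card U' * card ?Z = card U' * card ?T'"
      using card_perp[OF U'] le(2) by (simp add: mult.assoc)
    also have "\<dots> \<longleftrightarrow> card ?Z = card ?T'" using subD(6)[OF U'] by simp
    also have "\<dots> \<longleftrightarrow> ?Z = ?T'"
      using card_subset_eq[of ?T' ?Z] subD(5)[OF sT(2)] by auto
    finally show ?thesis by auto
  qed
  have van: "(\<forall>b\<in>?T'. M *\<^sub>v b - M0 *\<^sub>v b \<in> U') \<longleftrightarrow> (\<exists>w\<in>carrier_vec D. lag D U M = lag D U (M0 + upd D u w (w \<bullet> b0)))"
    if M: "M \<in> Sym D" for M
  proof
    define G where "G b b' = (M *\<^sub>v b) \<bullet> b' - (M0 *\<^sub>v b) \<bullet> b'" for b b'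
    have Gs: "G b b' = (M *\<^sub>v b - M0 *\<^sub>v b) \<bullet> b'" if "b \<in> carrier_vec D" "b' \<in> carrier_vec D" for b b'
      unfolding G_def using that M M0 by (simp add: minus_scalar_prod_distrib[where n = D])
    have Gsym: "G b b' = G b' b" if "b \<in> carrier_vec D" "b' \<in> carrier_vec D" for b b'
      unfolding G_def using that M M0 Sym_scalar[OF M that] Sym_scalar[OF M0 that]
        comm_scalar_prod[OF that(1) Sym_mult_carrier[OF M that(2)]]
        comm_scalar_prod[OF that(1) Sym_mult_carrier[OF M0 that(2)]] by simp
    have Gadd: "G b (x + c \<cdot>\<^sub>v y) = G b x + c * G b y"
      if "b \<in> carrier_vec D" "x \<in> carrier_vec D" "y \<in> carrier_vec D" for b c x y
      unfolding G_def using that M M0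
      by (simp add: scalar_prod_add_distrib[where n = D] scalar_prod_smult_distrib[where n = D] algebra_simps)
    {
      assume v: "\<forall>b\<in>?T'. M *\<^sub>v b - M0 *\<^sub>v b \<in> U'"
      \<comment> \<open>The row of \<open>G\<close> at \<open>b0\<close>. Decomposing both arguments
        along \<open>b0\<close> expresses every value of \<open>G\<close> by it.\<close>
      define w where "w = M *\<^sub>v b0 - M0 *\<^sub>v b0"
      have b0c: "b0 \<in> carrier_vec D" using pc b0 by blast
      have wc: "w \<in> carrier_vec D" unfolding w_def using M M0 b0c by simp
      have wG: "w \<bullet> b = G b0 b" if "b \<in> carrier_vec D" for b using Gs[OF b0c that] by (simp add: w_def)
      have split: "\<exists>t\<in>?T'. b = t + (u \<bullet> b) \<cdot>\<^sub>v b0" if b: "b \<in> ?T" for b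
      proof -
        let ?t = "b + (- (u \<bullet> b)) \<cdot>\<^sub>v b0"
        have "?t \<in> ?T" using subD(3,4)[OF sT(1)] b b0 by blast
        moreover have "u \<bullet> ?t = 0" using uc pc[OF b] b0c b0(2)
          by (simp add: scalar_prod_add_distrib[where n = D])
        moreover have "b = ?t + (u \<bullet> b) \<cdot>\<^sub>v b0" using pc[OF b] b0c by (intro eq_vecI) auto
        ultimately show ?thesis using T'I by blast
      qed
      have "G b b' = (w \<bullet> b) * (u \<bullet> b') + (u \<bullet> b) * (w \<bullet> b') - (w \<bullet> b0) * (u \<bullet> b) * (u \<bullet> b')"
        if b: "b \<in> ?T" "b' \<in> ?T" for b b'
      proof -
        obtain t where t: "t \<in> ?T'" "b = t + (u \<bullet> b) \<cdot>\<^sub>v b0" using split[OF b(1)] by blast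
        obtain t' where t': "t' \<in> ?T'" "b' = t' + (u \<bullet> b') \<cdot>\<^sub>v b0" using split[OF b(2)] by blast
        have tc: "t \<in> carrier_vec D" "t' \<in> carrier_vec D" using t t' perp_carrier by blast+
        have z: "G t t' = 0" using Gs[OF tc] v t(1) perpD[OF t'(1)] by simp
        have "G b b' = G b t' + (u \<bullet> b') * G b b0" using Gadd[OF pc[OF b(1)] tc(2) b0c, of "u \<bullet> b'"] t'(2) by simp
        also have "G b t' = (u \<bullet> b) * G b0 t'"
          using Gadd[OF tc(2,1) b0c, of "u \<bullet> b"] t(2) z Gsym[OF pc[OF b(1)] tc(2)] Gsym[OF tc] Gsym[OF tc(2) b0c] by simp
        also have "G b0 t' = G b0 b' - (u \<bullet> b') * G b0 b0"
          using Gadd[OF b0c tc(2) b0c, of "u \<bullet> b'"] t'(2) by simp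
        finally show ?thesis
          using wG[OF pc[OF b(1)]] wG[OF pc[OF b(2)]] wG[OF b0c] Gsym[OF pc[OF b(1)] b0c]
          by (simp add: algebra_simps)
      qed
      then have "lag D U M = lag D U (M0 + upd D u w (w \<bullet> b0))"
        unfolding lag_add_upd_iff[OF U M M0 uc wc] G_def by blast
      then show "\<exists>w\<in>carrier_vec D. lag D U M = lag D U (M0 + upd D u w (w \<bullet> b0))" using wc by blast
    next
      assume "\<exists>w\<in>carrier_vec D. lag D U M = lag D U (M0 + upd D u w (w \<bullet> b0))"
      then obtain w where w: "w \<in> carrier_vec D" "lag D U M = lag D U (M0 + upd D u w (w \<bullet> b0))" by blast
      show "\<forall>b\<in>?T'. M *\<^sub>v b - M0 *\<^sub>v b \<in> U'"
      proof
        fix b assume b: "b \<in> ?T'"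
        then have bc: "b \<in> carrier_vec D" using perp_carrier by blast
        show "M *\<^sub>v b - M0 *\<^sub>v b \<in> U'"
        proof (rule vec_in_perp_perp[OF U'])
          fix b' assume b': "b' \<in> ?T'"
          then have "b' \<in> carrier_vec D" using perp_carrier by blast
          then have "(M *\<^sub>v b - M0 *\<^sub>v b) \<bullet> b' = G b b'" using Gs[OF bc] by simp
          also have "\<dots> = 0"
            using w(2) subsetD[OF TT b] subsetD[OF TT b'] perpD[OF b u] perpD[OF b' u]
            unfolding G_def lag_add_upd_iff[OF U M M0 uc w(1)] by fastforce
          finally show "(M *\<^sub>v b - M0 *\<^sub>v b) \<bullet> b' = 0" .
        qed (use M M0 bc in simp)
      qed
    }
  qed
  show ?thesis
  proof (intro equalityI subsetI)
    fix x assume "x \<in> nbrs D U (lag D U' M0)"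
    then obtain M where M: "M \<in> Sym D" "x = lag D U M" "CARD('p) * card (lag D U M \<inter> lag D U' M0) = CARD('p) ^ D"
      unfolding nbrs_lag[OF U] by blast
    then show "x \<in> (\<lambda>w. lag D U (M0 + upd D u w (w \<bullet> b0))) ` carrier_vec D"
      using adj[OF M(1)] van[OF M(1)] by blast
  next
    fix x assume "x \<in> (\<lambda>w. lag D U (M0 + upd D u w (w \<bullet> b0))) ` carrier_vec D"
    then obtain w where w: "w \<in> carrier_vec D" "x = lag D U (M0 + upd D u w (w \<bullet> b0))" by blast
    have M: "M0 + upd D u w (w \<bullet> b0) \<in> Sym D" using Sym_add[OF M0 upd_Sym] .
    then show "x \<in> nbrs D U (lag D U' M0)"
      unfolding nbrs_lag[OF U] using w adj[OF M] van[OF M] by blast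
  qed
qed

text \<open>On a pair \<open>(b0, b)\<close> the update takes the value
  \<open>w \<bullet> b\<close>, since the term with \<open>w \<bullet> b0\<close> cancels. Hence two
  parameters give the same neighbour exactly when they agree on the annihilator of \<open>U\<close>,
  that is modulo \<open>U\<close>.\<close>

lemma nbrs_above_fiber:
  fixes U :: "'p::prime_card mod_ring vec set"
  assumes U: "sub D U" and M0: "M0 \<in> Sym D"
    and u: "u \<in> carrier_vec D" and b0: "b0 \<in> perp D U" "u \<bullet> b0 = 1" and w: "w \<in> carrier_vec D"
  shows "card {w' \<in> carrier_vec D. lag D U (M0 + upd D u w' (w' \<bullet> b0)) = lag D U (M0 + upd D u w (w \<bullet> b0))} = card U"
proof -
  have pc: "b \<in> carrier_vec D" if "b \<in> perp D U" for b using that perp_carrier by blast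
  have b0c: "b0 \<in> carrier_vec D" using pc b0 by blast
  have iff: "lag D U (M0 + upd D u w' (w' \<bullet> b0)) = lag D U (M0 + upd D u w (w \<bullet> b0)) \<longleftrightarrow> w' - w \<in> U"
    if w': "w' \<in> carrier_vec D" for w'
  proof -
    have G: "((M0 + upd D u w' c) *\<^sub>v b) \<bullet> b' - (M0 *\<^sub>v b) \<bullet> b'
      = (w' \<bullet> b) * (u \<bullet> b') + (u \<bullet> b) * (w' \<bullet> b') - c * (u \<bullet> b) * (u \<bullet> b')"
      if "b \<in> perp D U" "b' \<in> perp D U" for b b' c
      using lag_add_upd_iff[OF U Sym_add[OF M0 upd_Sym] M0 u w', of u w' c c] that by blast
    have "lag D U (M0 + upd D u w' (w' \<bullet> b0)) = lag D U (M0 + upd D u w (w \<bullet> b0))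
      \<longleftrightarrow> (\<forall>b\<in>perp D U. \<forall>b'\<in>perp D U.
        (w' \<bullet> b) * (u \<bullet> b') + (u \<bullet> b) * (w' \<bullet> b') - (w' \<bullet> b0) * (u \<bullet> b) * (u \<bullet> b')
        = (w \<bullet> b) * (u \<bullet> b') + (u \<bullet> b) * (w \<bullet> b') - (w \<bullet> b0) * (u \<bullet> b) * (u \<bullet> b'))"
      unfolding lag_add_upd_iff[OF U Sym_add[OF M0 upd_Sym] M0 u w] using G by simp
    also have "\<dots> \<longleftrightarrow> (\<forall>b\<in>perp D U. w' \<bullet> b = w \<bullet> b)"
    proof
      assume *: "\<forall>b\<in>perp D U. \<forall>b'\<in>perp D U.
        (w' \<bullet> b) * (u \<bullet> b') + (u \<bullet> b) * (w' \<bullet> b') - (w' \<bullet> b0) * (u \<bullet> b) * (u \<bullet> b')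
        = (w \<bullet> b) * (u \<bullet> b') + (u \<bullet> b) * (w \<bullet> b') - (w \<bullet> b0) * (u \<bullet> b) * (u \<bullet> b')"
      show "\<forall>b\<in>perp D U. w' \<bullet> b = w \<bullet> b"
        using bspec[OF *[THEN bspec, OF b0(1)]] b0(2) by auto
    qed (use b0(1) in simp)
    also have "\<dots> \<longleftrightarrow> w' - w \<in> U"
    proof -
      have e: "(w' - w) \<bullet> b = w' \<bullet> b - w \<bullet> b" if "b \<in> perp D U" for b
        using minus_scalar_prod_distrib[OF w' w pc[OF that]] .
      show ?thesis
      proof
        assume "\<forall>b\<in>perp D U. w' \<bullet> b = w \<bullet> b"
        then show "w' - w \<in> U" using e w w' by (intro vec_in_perp_perp[OF U]) auto
      next
        assume "w' - w \<in> U"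
        then show "\<forall>b\<in>perp D U. w' \<bullet> b = w \<bullet> b" using e perpD by fastforce
      qed
    qed
    finally show ?thesis .
  qed
  have Uc: "a \<in> carrier_vec D" if "a \<in> U" for a using that subD(1)[OF U] by blast
  have aw: "a + w - w = a" if "a \<in> U" for a using Uc[OF that] w by (intro eq_vecI) auto
  have "bij_betw (\<lambda>a. a + w) U {w' \<in> carrier_vec D. w' - w \<in> U}"
  proof (rule bij_betw_byWitness[of _ "\<lambda>w'. w' - w"])
    show "\<forall>a\<in>U. (a + w) - w = a" using aw by blast
    show "\<forall>w'\<in>{w' \<in> carrier_vec D. w' - w \<in> U}. (w' - w) + w = w'" using w diff_add_vec by blast
    show "(\<lambda>a. a + w) ` U \<subseteq> {w' \<in> carrier_vec D. w' - w \<in> U}" using aw Uc w by auto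
  qed auto
  from bij_betw_same_card[OF this] have "card {w' \<in> carrier_vec D. w' - w \<in> U} = card U" by simp
  moreover have "{w' \<in> carrier_vec D. lag D U (M0 + upd D u w' (w' \<bullet> b0)) = lag D U (M0 + upd D u w (w \<bullet> b0))}
     = {w' \<in> carrier_vec D. w' - w \<in> U}" using iff by blast
  ultimately show ?thesis by simp
qed

text \<open>The phase \<open>h\<close> is linear in the parameter \<open>w\<close>, so the sum over
  all \<open>q^D\<close> parameters is all or nothing. It survives only if
  \<open>S *\<^sub>v u = 0\<^sub>v D\<close>, and \<open>u\<close> together with \<open>U\<close>
  spans \<open>U'\<close>.\<close>

lemma sum_nbrs_above:
  fixes U :: "'p::prime_card mod_ring vec set"
  assumes S: "S \<in> Sym D" and U: "sub D U" "U \<subseteq> mat_kernel S" and U': "sub D U'" and M0: "M0 \<in> Sym D"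
    and le: "U \<subset> U'" "card U' = CARD('p) * card U"
    and char2: "\<And>u. CARD('p) = 2 \<Longrightarrow> u \<in> carrier_vec D \<Longrightarrow> u \<bullet> (S *\<^sub>v u) = 0 \<Longrightarrow> S *\<^sub>v u = 0\<^sub>v D"
  shows "of_nat (card U) * (\<Sum>x\<in>nbrs D U (lag D U' M0). wave D S x)
    = (if U' \<subseteq> mat_kernel S then chi (mtrace (S * M0)) * of_nat (CARD('p) ^ D) else 0)"
proof -
  note Sc = Sym_carrier[OF S] and M0c = Sym_carrier[OF M0]
  obtain u where u: "u \<in> U'" "u \<notin> U" using le by blast
  have uc: "u \<in> carrier_vec D" using u subD(1)[OF U'] by blast
  obtain b0 where b0: "b0 \<in> perp D U" "u \<bullet> b0 = 1" "b0 \<in> carrier_vec D"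
    using perp_separate[OF U(1) uc u(2)] by metis
  have U'e: "ext U u = U'" using ext_eq[OF U(1) U' _ le(2) u] le by blast
  define h where "h w = 2 * (w \<bullet> (S *\<^sub>v u)) - (w \<bullet> b0) * (u \<bullet> (S *\<^sub>v u))" for w
  have Su: "S *\<^sub>v u \<in> carrier_vec D" using S uc by simp
  have "of_nat (card U) * (\<Sum>x\<in>nbrs D U (lag D U' M0). wave D S x)
      = (\<Sum>w\<in>carrier_vec D. wave D S (lag D U (M0 + upd D u w (w \<bullet> b0))))"
    unfolding nbrs_above[OF U(1) U' M0 le u(1) b0(1,2)]
    by (rule sum_fibers[symmetric, OF finite_vec nbrs_above_fiber[OF U(1) M0 uc b0(1,2)]])
  also have "\<dots> = (\<Sum>w\<in>carrier_vec D. chi (mtrace (S * M0)) * chi (h w))"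
  proof (rule sum.cong[OF refl])
    fix w :: "'p mod_ring vec" assume w: "w \<in> carrier_vec D"
    have "wave D S (lag D U (M0 + upd D u w (w \<bullet> b0))) = chi (mtrace (S * (M0 + upd D u w (w \<bullet> b0))))"
      using wave_lag[OF S U Sym_add[OF M0 upd_Sym]] .
    also have "mtrace (S * (M0 + upd D u w (w \<bullet> b0))) = mtrace (S * M0) + h w"
      using mtrace_add[OF Sc M0c Sym_carrier[OF upd_Sym]] mtrace_upd[OF S uc w] by (simp add: h_def)
    finally show "wave D S (lag D U (M0 + upd D u w (w \<bullet> b0))) = chi (mtrace (S * M0)) * chi (h w)"
      by (simp add: chi_add)
  qed
  also have "\<dots> = chi (mtrace (S * M0)) * (\<Sum>w\<in>carrier_vec D. chi (h w))"
    by (simp add: sum_distrib_left)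
  finally have main: "of_nat (card U) * (\<Sum>x\<in>nbrs D U (lag D U' M0). wave D S x)
      = chi (mtrace (S * M0)) * (\<Sum>w\<in>carrier_vec D. chi (h w))" .
  have sumh: "(\<Sum>w\<in>carrier_vec D. chi (h w)) = (if \<forall>w\<in>carrier_vec D. h w = 0 then of_nat (card (carrier_vec D :: 'p mod_ring vec set)) else 0)"
    using Su b0(3) by (intro sum_chi_additive[OF sub_carrier])
      (simp add: h_def add_scalar_prod_distrib[where n = D] algebra_simps)
  have iff: "(\<forall>w\<in>carrier_vec D. h w = 0) \<longleftrightarrow> U' \<subseteq> mat_kernel S"
  proof
    assume h: "\<forall>w\<in>carrier_vec D. h w = 0"
    \<comment> \<open>At \<open>w = u\<close> the two terms of \<open>h\<close> leave a single
      \<open>u \<bullet> (S *\<^sub>v u)\<close>, because \<open>u \<bullet> b0 = 1\<close>; this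
      holds in every characteristic.\<close>
    have uu: "u \<bullet> (S *\<^sub>v u) = 0" using h[THEN bspec, OF uc] b0(2) by (simp add: h_def)
    have "S *\<^sub>v u = 0\<^sub>v D"
    proof (cases "CARD('p) = 2")
      case True
      then show ?thesis using char2 uc uu by blast
    next
      case False
      have two: "(2 :: 'p mod_ring) \<noteq> 0"
      proof
        assume "(2 :: 'p mod_ring) = 0"
        then have "of_nat 2 = (0 :: 'p mod_ring)" by simp
        then have "CARD('p) dvd 2" by (simp only: of_nat_0_mod_ring_dvd)
        then show False using False card_field_gt_1[where 'p = 'p] by (auto dest: dvd_imp_le)
      qed
      have "(S *\<^sub>v u) \<bullet> w = 0" if "w \<in> carrier_vec D" for w
        using h[THEN bspec, OF that] uu two comm_scalar_prod[OF Su that] by (simp add: h_def)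
      then show ?thesis using scalar_zero_iff[OF Su] by blast
    qed
    then have "u \<in> mat_kernel S" using uc by (simp add: mat_kernel_iff[OF Sc])
    moreover have "sub D (mat_kernel S)"
      unfolding sub_def using Sc mult_add_distrib_mat_vec[OF Sc] mult_mat_vec[OF Sc] mult_mat_zero_vec[OF Sc]
      by (auto simp: mat_kernel_iff[OF Sc])
    ultimately show "U' \<subseteq> mat_kernel S" using ext_subset[OF _ U(2)] U'e by blast
  next
    assume "U' \<subseteq> mat_kernel S"
    then have "S *\<^sub>v u = 0\<^sub>v D" using u mat_kernel_iff[OF Sc] by blast
    then show "\<forall>w\<in>carrier_vec D. h w = 0" using uc by (simp add: h_def)
  qed
  show ?thesis unfolding main sumh iff by simp
qed

text \<open>The argument \<open>2 - c\<close> makes \<open>upd\<close> equal to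
  \<open>c l l^t\<close>, since the two mixed terms contribute 2.\<close>

lemma lag_add_rank1_iff:
  assumes U: "sub D U" and M: "M \<in> Sym D" and M0: "M0 \<in> Sym D" and l: "l \<in> carrier_vec D"
  shows "lag D U M = lag D U (M0 + upd D l l (2 - c)) \<longleftrightarrow> (\<forall>b\<in>perp D U. \<forall>b'\<in>perp D U.
    (M *\<^sub>v b) \<bullet> b' - (M0 *\<^sub>v b) \<bullet> b' = c * (l \<bullet> b) * (l \<bullet> b'))"
  unfolding lag_add_upd_iff[OF U M M0 l l] by (simp add: algebra_simps)

lemma add_smult_diff_vec:
  "x \<in> carrier_vec n \<Longrightarrow> l \<in> carrier_vec n \<Longrightarrow>
    x + (a \<cdot>\<^sub>v l + b \<cdot>\<^sub>v l) - x = (a + b) \<cdot>\<^sub>v (l :: 'a :: comm_ring_1 vec)"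
  by (intro eq_vecI) (auto simp: algebra_simps)

text \<open>Adjacency over the same \<open>U\<close> means that the difference form on the
  annihilator has a radical of index \<open>q\<close>. A symmetric form of that kind is a non-zero
  multiple of the square of a linear functional, namely of its row \<open>l\<close> at a vector
  \<open>b0\<close> outside the radical.\<close>

lemma nbrs_same:
  fixes U :: "'p::prime_card mod_ring vec set"
  assumes U: "sub D U" and M0: "M0 \<in> Sym D"
  shows "nbrs D U (lag D U M0) =
    (\<lambda>(c, l). lag D U (M0 + upd D l l (2 - c))) ` ((UNIV - {0}) \<times> (carrier_vec D - U))"
proof -
  let ?T = "perp D U"
  have pc: "b \<in> carrier_vec D" if "b \<in> ?T" for b using that perp_carrier by blast
  have sT: "sub D ?T" using sub_perp subD(1) U by blast
  have cT: "card U * card ?T = CARD('p) ^ D" using card_perp[OF U] .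
  define Z where "Z M = {b \<in> ?T. M *\<^sub>v b - M0 *\<^sub>v b \<in> U}" for M
  have adj: "CARD('p) * card (lag D U M \<inter> lag D U M0) = CARD('p) ^ D \<longleftrightarrow> CARD('p) * card (Z M) = card ?T"
    if M: "M \<in> Sym D" for M
  proof -
    have "card (lag D U M \<inter> lag D U M0) = card U * card (Z M)"
      unfolding Z_def using card_lag_Int[OF U U _ M M0] by simp
    then have "CARD('p) * card (lag D U M \<inter> lag D U M0) = card U * (CARD('p) * card (Z M))" by simp
    then show ?thesis unfolding cT[symmetric] using subD(6)[OF U] by simp
  qed
  have fwd: "\<exists>c l. c \<noteq> 0 \<and> l \<in> carrier_vec D \<and> l \<notin> U \<and> lag D U M = lag D U (M0 + upd D l l (2 - c))"
    if M: "M \<in> Sym D" and cZ: "CARD('p) * card (Z M) = card ?T" for M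
  proof -
    define G where "G b b' = (M *\<^sub>v b) \<bullet> b' - (M0 *\<^sub>v b) \<bullet> b'" for b b'
    have Gs: "G b b' = (M *\<^sub>v b - M0 *\<^sub>v b) \<bullet> b'" if "b \<in> carrier_vec D" "b' \<in> carrier_vec D" for b b'
      unfolding G_def using that M M0 by (simp add: minus_scalar_prod_distrib[where n = D])
    have Gsym: "G b b' = G b' b" if "b \<in> carrier_vec D" "b' \<in> carrier_vec D" for b b'
      unfolding G_def using that M M0 Sym_scalar[OF M that] Sym_scalar[OF M0 that]
        comm_scalar_prod[OF that(1) Sym_mult_carrier[OF M that(2)]]
        comm_scalar_prod[OF that(1) Sym_mult_carrier[OF M0 that(2)]] by simp
    have Gadd: "G b (x + c \<cdot>\<^sub>v y) = G b x + c * G b y"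
      if "b \<in> carrier_vec D" "x \<in> carrier_vec D" "y \<in> carrier_vec D" for b c x y
      unfolding G_def using that M M0
      by (simp add: scalar_prod_add_distrib[where n = D] scalar_prod_smult_distrib[where n = D] algebra_simps)
    have Z_iff: "b \<in> Z M \<longleftrightarrow> b \<in> ?T \<and> (\<forall>b'\<in>?T. G b b' = 0)" for b
    proof (cases "b \<in> ?T")
      case True
      note bc = pc[OF True]
      show ?thesis
      proof
        assume "b \<in> Z M"
        then have "M *\<^sub>v b - M0 *\<^sub>v b \<in> U" by (simp add: Z_def)
        then show "b \<in> ?T \<and> (\<forall>b'\<in>?T. G b b' = 0)"
          using True Gs[OF bc] pc perpD by metis
      next
        assume g: "b \<in> ?T \<and> (\<forall>b'\<in>?T. G b b' = 0)"
        have "M *\<^sub>v b - M0 *\<^sub>v b \<in> U"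
          using g Gs[OF bc] pc M M0 bc by (intro vec_in_perp_perp[OF U]) auto
        then show "b \<in> Z M" using True by (simp add: Z_def)
      qed
    qed (simp add: Z_def)
    have sZ: "sub D (Z M)"
      unfolding sub_def
    proof (intro conjI ballI allI)
      show "Z M \<subseteq> carrier_vec D" using pc by (auto simp: Z_def)
      have "G (0\<^sub>v D) b' = 0" if "b' \<in> ?T" for b'
        unfolding G_def mult_mat_zero_vec[OF Sym_carrier[OF M]] mult_mat_zero_vec[OF Sym_carrier[OF M0]] by simp
      then show "0\<^sub>v D \<in> Z M" unfolding Z_iff using subD(2)[OF sT] by blast
    next
      fix b d assume "b \<in> Z M" "d \<in> Z M"
      then have bd: "b \<in> ?T" "d \<in> ?T" "\<And>b'. b' \<in> ?T \<Longrightarrow> G b b' = 0" "\<And>b'. b' \<in> ?T \<Longrightarrow> G d b' = 0"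
        unfolding Z_iff by blast+
      have "G (b + d) b' = 0" if b': "b' \<in> ?T" for b'
      proof -
        note c = pc[OF bd(1)] pc[OF bd(2)] pc[OF b']
        have "G (b + d) b' = G b' (b + 1 \<cdot>\<^sub>v d)" using Gsym[of "b + d" b'] c by simp
        then show ?thesis using Gadd[OF c(3,1,2), of 1] Gsym[OF c(1,3)] Gsym[OF c(2,3)] bd(3,4)[OF b'] by simp
      qed
      then show "b + d \<in> Z M" unfolding Z_iff using subD(3)[OF sT] bd by blast
    next
      fix e b assume "b \<in> Z M"
      then have b: "b \<in> ?T" "\<And>b'. b' \<in> ?T \<Longrightarrow> G b b' = 0" unfolding Z_iff by blast+
      have "G (e \<cdot>\<^sub>v b) b' = 0" if b': "b' \<in> ?T" for b'
      proof -
        note c = pc[OF b(1)] pc[OF b']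
        have z: "G b' (0\<^sub>v D) = 0" using M M0 c by (simp add: G_def)
        have "G (e \<cdot>\<^sub>v b) b' = G b' (0\<^sub>v D + e \<cdot>\<^sub>v b)" using Gsym[of "e \<cdot>\<^sub>v b" b'] c by simp
        then show ?thesis using Gadd[OF c(2) zero_carrier_vec c(1), of e] Gsym[OF c] b(2)[OF b'] z by simp
      qed
      then show "e \<cdot>\<^sub>v b \<in> Z M" unfolding Z_iff using subD(4)[OF sT] b by blast
    qed
    have "Z M \<noteq> ?T" using cZ subD(6)[OF sT] card_field_gt_1[where 'p = 'p] by auto
    then obtain b0 where b0: "b0 \<in> ?T" "b0 \<notin> Z M" by (auto simp: Z_def)
    note b0c = pc[OF b0(1)]
    have Te: "ext (Z M) b0 = ?T" using ext_eq[OF sZ sT _ cZ[symmetric] b0] by (auto simp: Z_def)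
    define l where "l = M *\<^sub>v b0 - M0 *\<^sub>v b0"
    have lc: "l \<in> carrier_vec D" unfolding l_def using M M0 b0c by simp
    have lG: "l \<bullet> b = G b0 b" if "b \<in> carrier_vec D" for b using Gs[OF b0c that] by (simp add: l_def)
    have lU: "l \<notin> U" using b0 by (simp add: Z_def l_def)
    have split: "\<exists>z \<beta>. z \<in> Z M \<and> b = z + \<beta> \<cdot>\<^sub>v b0" if "b \<in> ?T" for b
      using that unfolding Te[symmetric] by (auto simp: ext_def)
    \<comment> \<open>The value at \<open>b0\<close> cannot be zero, since \<open>l\<close> would
      then vanish on the whole annihilator. As \<open>l \<bullet> b0 = \<alpha>\<close>, the
      coefficient of the rank one form has to be \<open>1 / \<alpha>\<close>.\<close>
    define \<alpha> where "\<alpha> = G b0 b0"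
    have lb: "l \<bullet> (z + \<beta> \<cdot>\<^sub>v b0) = \<beta> * \<alpha>" "\<And>b'. b' \<in> ?T \<Longrightarrow> G (z + \<beta> \<cdot>\<^sub>v b0) b' = \<beta> * (l \<bullet> b')" if z: "z \<in> Z M" for z \<beta>
    proof -
      have zT: "z \<in> ?T" and zz: "\<And>b'. b' \<in> ?T \<Longrightarrow> G z b' = 0" using z unfolding Z_iff by blast+
      note zc = pc[OF zT]
      show "l \<bullet> (z + \<beta> \<cdot>\<^sub>v b0) = \<beta> * \<alpha>"
        using lG[of "z + \<beta> \<cdot>\<^sub>v b0"] Gadd[OF b0c zc b0c, of \<beta>] Gsym[OF zc b0c] zz[OF b0(1)] zc b0c
        by (simp add: \<alpha>_def)
      fix b' assume b': "b' \<in> ?T"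
      note b'c = pc[OF b']
      have "G (z + \<beta> \<cdot>\<^sub>v b0) b' = G b' (z + \<beta> \<cdot>\<^sub>v b0)" using Gsym b'c zc b0c by simp
      also have "\<dots> = \<beta> * (l \<bullet> b')"
        using Gadd[OF b'c zc b0c, of \<beta>] Gsym[OF zc b'c] zz[OF b'] Gsym[OF b'c b0c] lG[OF b'c] by simp
      finally show "G (z + \<beta> \<cdot>\<^sub>v b0) b' = \<beta> * (l \<bullet> b')" .
    qed
    have \<alpha>0: "\<alpha> \<noteq> 0"
    proof
      assume a: "\<alpha> = 0"
      have "l \<bullet> b = 0" if "b \<in> ?T" for b using split[OF that] lb(1) a by auto
      then show False using lU vec_in_perp_perp[OF U lc] by blast
    qed
    have "G b b' = (1 / \<alpha>) * (l \<bullet> b) * (l \<bullet> b')" if b: "b \<in> ?T" "b' \<in> ?T" for b b'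
    proof -
      obtain z \<beta> where z: "z \<in> Z M" "b = z + \<beta> \<cdot>\<^sub>v b0" using split[OF b(1)] by blast
      have "l \<bullet> b = \<beta> * \<alpha>" unfolding z(2) by (rule lb(1)[OF z(1)])
      moreover have "G b b' = \<beta> * (l \<bullet> b')" unfolding z(2) by (rule lb(2)[OF z(1) b(2)])
      ultimately show ?thesis using \<alpha>0 by simp
    qed
    then have "lag D U M = lag D U (M0 + upd D l l (2 - 1 / \<alpha>))"
      unfolding lag_add_rank1_iff[OF U M M0 lc] G_def by blast
    then show ?thesis using lc lU \<alpha>0 by (intro exI[of _ "1 / \<alpha>"] exI[of _ l]) simp
  qed
  have bwd: "CARD('p) * card (Z (M0 + upd D l l (2 - c))) = card ?T"
    if c: "c \<noteq> 0" and l: "l \<in> carrier_vec D" "l \<notin> U" for c l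
  proof -
    \<comment> \<open>Conversely the radical of \<open>c l l^t\<close> is the hyperplane
      \<open>l = 0\<close> of the annihilator, which is the annihilator of
      \<open>ext U l\<close>.\<close>
    have "Z (M0 + upd D l l (2 - c)) = perp D (ext U l)"
    proof (intro equalityI subsetI)
      fix b assume b: "b \<in> Z (M0 + upd D l l (2 - c))"
      then have bT: "b \<in> ?T" by (simp add: Z_def)
      note bc = pc[OF bT]
      have "(M0 + upd D l l (2 - c)) *\<^sub>v b - M0 *\<^sub>v b = (c * (l \<bullet> b)) \<cdot>\<^sub>v l"
        unfolding Sym_add_mult[OF M0 upd_Sym bc] upd_mult[OF l(1) l(1) bc]
          add_smult_diff_vec[OF Sym_mult_carrier[OF M0 bc] l(1)] by (simp add: algebra_simps)
      then have lU: "(c * (l \<bullet> b)) \<cdot>\<^sub>v l \<in> U" using b by (simp add: Z_def)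
      have lb: "l \<bullet> b = 0"
      proof (rule ccontr)
        assume nz: "l \<bullet> b \<noteq> 0"
        have "(1 / (c * (l \<bullet> b))) \<cdot>\<^sub>v ((c * (l \<bullet> b)) \<cdot>\<^sub>v l) = l" using nz c l by (intro eq_vecI) auto
        then show False using subD(4)[OF U lU, of "1 / (c * (l \<bullet> b))"] l(2) by simp
      qed
      have "(a + e \<cdot>\<^sub>v l) \<bullet> b = 0" if "a \<in> U" for a e
        using that subD(1)[OF U] l bc perpD[OF bT that] lb
        by (subst add_scalar_prod_distrib[where n = D]) auto
      then show "b \<in> perp D (ext U l)" using bc by (auto simp: perp_def ext_def)
    next
      fix b assume b: "b \<in> perp D (ext U l)"
      then have bT: "b \<in> ?T" using perp_mono[OF sub_ext(2)[OF U l(1)]] by blast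
      note bc = pc[OF bT]
      have lb: "l \<bullet> b = 0" using perpD[OF b sub_ext(3)[OF U l(1)]] .
      have "(M0 + upd D l l (2 - c)) *\<^sub>v b - M0 *\<^sub>v b = 0\<^sub>v D"
        unfolding Sym_add_mult[OF M0 upd_Sym bc] upd_mult[OF l(1) l(1) bc] lb
          add_smult_diff_vec[OF Sym_mult_carrier[OF M0 bc] l(1)] using l by auto
      then show "b \<in> Z (M0 + upd D l l (2 - c))" using bT subD(2)[OF U] by (simp add: Z_def)
    qed
    moreover have "card (ext U l) * card (perp D (ext U l)) = card U * card ?T"
      using card_perp[OF sub_ext(1)[OF U l(1)]] cT by simp
    ultimately show ?thesis using card_ext[OF U l] subD(6)[OF U] by simp
  qed
  show ?thesis
  proof (intro equalityI subsetI)
    fix x assume "x \<in> nbrs D U (lag D U M0)"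
    then obtain M where M: "M \<in> Sym D" "x = lag D U M" "CARD('p) * card (lag D U M \<inter> lag D U M0) = CARD('p) ^ D"
      unfolding nbrs_lag[OF U] by blast
    obtain c l where cl: "c \<noteq> 0" "l \<in> carrier_vec D" "l \<notin> U" "lag D U M = lag D U (M0 + upd D l l (2 - c))"
      using fwd[OF M(1)] adj[OF M(1)] M(3) by blast
    show "x \<in> (\<lambda>(c, l). lag D U (M0 + upd D l l (2 - c))) ` ((UNIV - {0}) \<times> (carrier_vec D - U))"
      by (rule image_eqI[of _ _ "(c, l)"]) (use cl M(2) in simp_all)
  next
    fix x assume "x \<in> (\<lambda>(c, l). lag D U (M0 + upd D l l (2 - c))) ` ((UNIV - {0}) \<times> (carrier_vec D - U))"
    then obtain c l where cl: "c \<noteq> 0" "l \<in> carrier_vec D" "l \<notin> U" "x = lag D U (M0 + upd D l l (2 - c))"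
      by auto
    have M: "M0 + upd D l l (2 - c) \<in> Sym D" using Sym_add[OF M0 upd_Sym] .
    then show "x \<in> nbrs D U (lag D U M0)"
      unfolding nbrs_lag[OF U] using cl(4) adj[OF M] bwd[OF cl(1-3)] by blast
  qed
qed

text \<open>Passing from \<open>(c, l)\<close> to \<open>(c / s^2, a + s l)\<close> with
  \<open>a\<close> in \<open>U\<close> and \<open>s \<noteq> 0\<close> leaves the form on the
  annihilator unchanged. Evaluation at a \<open>b0\<close> with \<open>l \<bullet> b0 = 1\<close>
  recovers \<open>s\<close>, so there is no further redundancy.\<close>

lemma nbrs_same_fiber:
  fixes U :: "'p::prime_card mod_ring vec set"
  assumes U: "sub D U" and M0: "M0 \<in> Sym D" and c: "c \<noteq> 0" and l: "l \<in> carrier_vec D" "l \<notin> U"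
  shows "card {p \<in> (UNIV - {0}) \<times> (carrier_vec D - U).
      (case p of (c', l') \<Rightarrow> lag D U (M0 + upd D l' l' (2 - c'))) = lag D U (M0 + upd D l l (2 - c))}
    = (CARD('p) - 1) * card U" (is "card ?F = _")
proof -
  have pc: "b \<in> carrier_vec D" if "b \<in> perp D U" for b using that perp_carrier by blast
  have Uc: "a \<in> carrier_vec D" if "a \<in> U" for a using that subD(1)[OF U] by blast
  obtain b0 where b0: "b0 \<in> perp D U" "l \<bullet> b0 = 1" using perp_separate[OF U l] by metis
  define g where "g = (\<lambda>(a, s). (c / s^2, a + s \<cdot>\<^sub>v l))"
  have iff: "lag D U (M0 + upd D l' l' (2 - c')) = lag D U (M0 + upd D l l (2 - c)) \<longleftrightarrow>
      (\<forall>b\<in>perp D U. \<forall>b'\<in>perp D U. c' * (l' \<bullet> b) * (l' \<bullet> b') = c * (l \<bullet> b) * (l \<bullet> b'))"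
    if l': "l' \<in> carrier_vec D" for l' c'
  proof -
    have "((M0 + upd D l' l' (2 - c')) *\<^sub>v b) \<bullet> b' - (M0 *\<^sub>v b) \<bullet> b' = c' * (l' \<bullet> b) * (l' \<bullet> b')"
      if "b \<in> perp D U" "b' \<in> perp D U" for b b'
      using lag_add_rank1_iff[OF U Sym_add[OF M0 upd_Sym] M0 l', of l' l' "2 - c'" c'] that by blast
    then show ?thesis unfolding lag_add_rank1_iff[OF U Sym_add[OF M0 upd_Sym] M0 l(1)] by simp
  qed
  have img: "g ` (U \<times> (UNIV - {0})) = ?F"
  proof (intro equalityI subsetI)
    fix p assume "p \<in> g ` (U \<times> (UNIV - {0}))"
    then obtain a s where as: "a \<in> U" "s \<noteq> 0" "p = (c / s^2, a + s \<cdot>\<^sub>v l)" by (auto simp: g_def)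
    have l'c: "a + s \<cdot>\<^sub>v l \<in> carrier_vec D" using Uc[OF as(1)] l by simp
    have l'U: "a + s \<cdot>\<^sub>v l \<notin> U"
    proof
      assume "a + s \<cdot>\<^sub>v l \<in> U"
      then have "(1 / s) \<cdot>\<^sub>v ((a + s \<cdot>\<^sub>v l) - a) \<in> U" using subD(4)[OF U] sub_minus[OF U _ as(1)] by blast
      moreover have "(1 / s) \<cdot>\<^sub>v ((a + s \<cdot>\<^sub>v l) - a) = l" using as(2) Uc[OF as(1)] l by (intro eq_vecI) auto
      ultimately show False using l by simp
    qed
    have "(a + s \<cdot>\<^sub>v l) \<bullet> b = s * (l \<bullet> b)" if "b \<in> perp D U" for b
      using perpD[OF that as(1)] Uc[OF as(1)] l pc[OF that] by (simp add: add_scalar_prod_distrib[where n = D])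
    then have "lag D U (M0 + upd D (a + s \<cdot>\<^sub>v l) (a + s \<cdot>\<^sub>v l) (2 - c / s^2)) = lag D U (M0 + upd D l l (2 - c))"
      unfolding iff[OF l'c] using as(2) by (simp add: power2_eq_square)
    then show "p \<in> ?F" using as c l'c l'U by simp
  next
    fix p assume "p \<in> ?F"
    then obtain c' l' where p: "p = (c', l')" "c' \<noteq> 0" "l' \<in> carrier_vec D" "l' \<notin> U"
      "lag D U (M0 + upd D l' l' (2 - c')) = lag D U (M0 + upd D l l (2 - c))" by auto
    define s where "s = l' \<bullet> b0"
    have eq: "c' * (l' \<bullet> b) * (l' \<bullet> b') = c * (l \<bullet> b) * (l \<bullet> b')" if "b \<in> perp D U" "b' \<in> perp D U" for b b'
      using p(5) that unfolding iff[OF p(3)] by blast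
    have cs: "c = c' * s * s" using eq[OF b0(1) b0(1)] b0(2) by (simp add: s_def)
    then have s0: "s \<noteq> 0" using c by auto
    have l'b: "l' \<bullet> b = s * (l \<bullet> b)" if "b \<in> perp D U" for b
      using eq[OF b0(1) that] b0(2) cs s0 p(2) by (simp add: s_def)
    have "l' - s \<cdot>\<^sub>v l \<in> U"
    proof (rule vec_in_perp_perp[OF U])
      fix b assume b: "b \<in> perp D U"
      show "(l' - s \<cdot>\<^sub>v l) \<bullet> b = 0"
        using l'b[OF b] p(3) l pc[OF b] by (simp add: minus_scalar_prod_distrib[where n = D])
    qed (use p l in simp)
    moreover have "p = g (l' - s \<cdot>\<^sub>v l, s)"
    proof -
      have "(l' - s \<cdot>\<^sub>v l) + s \<cdot>\<^sub>v l = l'" using p(3) l by (intro diff_add_vec) auto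
      then show ?thesis unfolding g_def p(1) using cs s0 by (simp add: power2_eq_square)
    qed
    ultimately show "p \<in> g ` (U \<times> (UNIV - {0}))" using s0 by blast
  qed
  have inj: "inj_on g (U \<times> (UNIV - {0}))"
  proof (rule inj_onI)
    fix p p' assume pp: "p \<in> U \<times> (UNIV - {0})" "p' \<in> U \<times> (UNIV - {0})" "g p = g p'"
    have "(\<lambda>(a, c). a + c \<cdot>\<^sub>v l) p = (\<lambda>(a, c). a + c \<cdot>\<^sub>v l) p'"
      using pp(3) by (simp add: g_def split_beta)
    then show "p = p'" using inj_onD[OF ext_inj[OF U l], of p p'] pp(1,2) by (simp add: mem_Times_iff)
  qed
  have "card (U \<times> (UNIV - {0 :: 'p mod_ring})) = (CARD('p) - 1) * card U"
    by (simp add: card_cartesian_product card_Diff_subset mult.commute)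
  then show ?thesis using card_image[OF inj] unfolding img by (rule trans[rotated])
qed

text \<open>Vectors of \<open>U\<close> would contribute phase 1, because \<open>U\<close> lies in
  the kernel. Completing the range of \<open>l\<close> to the whole space therefore costs exactly
  \<open>(q - 1) * card U\<close> and leaves pure quadratic sums.\<close>

lemma sum_nbrs_same:
  fixes U :: "'p::prime_card mod_ring vec set"
  assumes S: "S \<in> Sym D" and U: "sub D U" "U \<subseteq> mat_kernel S" and M0: "M0 \<in> Sym D"
  shows "of_nat ((CARD('p) - 1) * card U) * (\<Sum>x\<in>nbrs D U (lag D U M0). wave D S x)
    = chi (mtrace (S * M0)) * ((\<Sum>c\<in>UNIV - {0}. \<Sum>l\<in>carrier_vec D. chi (c * (l \<bullet> (S *\<^sub>v l))))
        - of_nat ((CARD('p) - 1) * card U))"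
proof -
  note Sc = Sym_carrier[OF S] and M0c = Sym_carrier[OF M0]
  let ?A = "(UNIV - {0 :: 'p mod_ring}) \<times> (carrier_vec D - U)"
  let ?h = "\<lambda>(c, l). lag D U (M0 + upd D l l (2 - c))"
  have "of_nat ((CARD('p) - 1) * card U) * (\<Sum>x\<in>nbrs D U (lag D U M0). wave D S x)
      = (\<Sum>p\<in>?A. wave D S (?h p))"
    unfolding nbrs_same[OF U(1) M0]
  proof (rule sum_fibers[symmetric])
    fix p :: "'p mod_ring \<times> 'p mod_ring vec" assume "p \<in> ?A"
    then obtain c l where p: "p = (c, l)" "c \<noteq> 0" "l \<in> carrier_vec D" "l \<notin> U" by auto
    show "card {p' \<in> ?A. ?h p' = ?h p} = (CARD('p) - 1) * card U"
      unfolding p(1) prod.case using nbrs_same_fiber[OF U(1) M0 p(2-4)] .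
  qed simp
  also have "\<dots> = (\<Sum>p\<in>?A. (\<lambda>(c, l). chi (mtrace (S * M0)) * chi (c * (l \<bullet> (S *\<^sub>v l)))) p)"
  proof (rule sum.cong[OF refl])
    fix p :: "'p mod_ring \<times> 'p mod_ring vec" assume "p \<in> ?A"
    then obtain c l where p: "p = (c, l)" "c \<noteq> 0" "l \<in> carrier_vec D" "l \<notin> U" by auto
    have "wave D S (lag D U (M0 + upd D l l (2 - c))) = chi (mtrace (S * (M0 + upd D l l (2 - c))))"
      using wave_lag[OF S U Sym_add[OF M0 upd_Sym]] .
    also have "mtrace (S * (M0 + upd D l l (2 - c))) = mtrace (S * M0) + c * (l \<bullet> (S *\<^sub>v l))"
      unfolding mtrace_add[OF Sc M0c Sym_carrier[OF upd_Sym]] mtrace_upd[OF S p(3) p(3)] by (simp add: left_diff_distrib)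
    finally show "wave D S (?h p) = (\<lambda>(c, l). chi (mtrace (S * M0)) * chi (c * (l \<bullet> (S *\<^sub>v l)))) p"
      unfolding p(1) by (simp add: chi_add)
  qed
  also have "\<dots> = chi (mtrace (S * M0)) * (\<Sum>c\<in>UNIV - {0}. \<Sum>l\<in>carrier_vec D - U. chi (c * (l \<bullet> (S *\<^sub>v l))))"
    by (simp only: sum.cartesian_product[symmetric] sum_distrib_left)
  also have "(\<Sum>c\<in>UNIV - {0}. \<Sum>l\<in>carrier_vec D - U. chi (c * (l \<bullet> (S *\<^sub>v l))))
     = (\<Sum>c\<in>UNIV - {0}. (\<Sum>l\<in>carrier_vec D. chi (c * (l \<bullet> (S *\<^sub>v l)))) - of_nat (card U))"
  proof (rule sum.cong[OF refl])
    fix c :: "'p mod_ring"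
    have "chi (c * (l \<bullet> (S *\<^sub>v l))) = 1" if "l \<in> U" for l
    proof -
      have "l \<in> carrier_vec D" "S *\<^sub>v l = 0\<^sub>v D" using that U(2) mat_kernel_iff[OF Sc] by blast+
      then show ?thesis by simp
    qed
    then have "(\<Sum>l\<in>U. chi (c * (l \<bullet> (S *\<^sub>v l)))) = of_nat (card U)" by simp
    then show "(\<Sum>l\<in>carrier_vec D - U. chi (c * (l \<bullet> (S *\<^sub>v l)))) = (\<Sum>l\<in>carrier_vec D. chi (c * (l \<bullet> (S *\<^sub>v l)))) - of_nat (card U)"
      using sum_diff[OF finite_vec subD(1)[OF U(1)], of "\<lambda>l. chi (c * (l \<bullet> (S *\<^sub>v l)))"] by simp
  qed
  also have "\<dots> = (\<Sum>c\<in>UNIV - {0}. \<Sum>l\<in>carrier_vec D. chi (c * (l \<bullet> (S *\<^sub>v l)))) - of_nat ((CARD('p) - 1) * card U)"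
    by (simp add: sum_subtractf card_Diff_subset)
  finally show ?thesis .
qed

subsection \<open>Gauss sums\<close>

lemma sub_mat_kernel: "S \<in> carrier_mat D D \<Longrightarrow> sub D (mat_kernel S)"
  unfolding sub_def using mult_add_distrib_mat_vec[of S D D] mult_mat_vec[of S D D] mult_mat_zero_vec[of S D D]
  by (auto simp: mat_kernel_iff)

lemma card_mat_kernel:
  assumes "(S :: 'p::prime_card mod_ring mat) \<in> carrier_mat D D"
  shows "card (mat_kernel S) = CARD('p) ^ kernel_dim S"
  using card_sub[OF sub_mat_kernel[OF assms]] assms by (simp add: kernel_dim_def)

lemma card_kernel_image:
  assumes S: "(S :: 'p::prime_card mod_ring mat) \<in> carrier_mat D D"
  shows "CARD('p) ^ D = card (mat_kernel S) * card ((*\<^sub>v) S ` carrier_vec D)"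
proof -
  let ?K = "mat_kernel S"
  have K: "v \<in> ?K \<longleftrightarrow> v \<in> carrier_vec D \<and> S *\<^sub>v v = 0\<^sub>v D" for v by (rule mat_kernel_iff[OF S])
  have fib: "card {a' \<in> carrier_vec D. S *\<^sub>v a' = S *\<^sub>v a} = card ?K" if a: "a \<in> carrier_vec D" for a
  proof -
    have "bij_betw (\<lambda>v. v + a) ?K {a' \<in> carrier_vec D. S *\<^sub>v a' = S *\<^sub>v a}"
    proof (rule bij_betw_byWitness[of _ "\<lambda>v. v - a"])
      have "(v + a) - a = v" if "v \<in> ?K" for v using that a K by (intro eq_vecI) auto
      then show "\<forall>v\<in>?K. (v + a) - a = v" by blast
      show "\<forall>v\<in>{a' \<in> carrier_vec D. S *\<^sub>v a' = S *\<^sub>v a}. (v - a) + a = v" using a diff_add_vec by blast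
      show "(\<lambda>v. v + a) ` ?K \<subseteq> {a' \<in> carrier_vec D. S *\<^sub>v a' = S *\<^sub>v a}"
        using a S mult_add_distrib_mat_vec[OF S _ a] by (auto simp: K)
      show "(\<lambda>v. v - a) ` {a' \<in> carrier_vec D. S *\<^sub>v a' = S *\<^sub>v a} \<subseteq> ?K"
        using a S mult_minus_distrib_mat_vec[OF S _ a] by (auto simp: K)
    qed
    from bij_betw_same_card[OF this] show ?thesis by simp
  qed
  have "(\<Sum>a\<in>(carrier_vec D :: 'p mod_ring vec set). 1 :: complex)
      = of_nat (card ?K) * (\<Sum>x\<in>(*\<^sub>v) S ` carrier_vec D. 1)"
    by (rule sum_fibers[where h = "\<lambda>_. 1", OF finite_vec fib])
  then have "of_nat (CARD('p) ^ D) = (of_nat (card ?K * card ((*\<^sub>v) S ` carrier_vec D)) :: complex)" by simp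
  then show ?thesis by (simp only: of_nat_eq_iff)
qed

lemma rank_kernel_dim:
  assumes S: "(S :: 'p::prime_card mod_ring mat) \<in> carrier_mat D D"
  shows "vec_space.rank D S + kernel_dim S = D"
proof -
  interpret vec_space "TYPE('p mod_ring)" D .
  have "span (set (cols S)) = (*\<^sub>v) S ` carrier_vec D"
    using col_space_eq[OF S] unfolding col_space_def using S by auto
  moreover have "card ((*\<^sub>v) S ` carrier_vec D) = CARD('p) ^ fdim D ((*\<^sub>v) S ` carrier_vec D)"
    by (rule card_sub[OF sub_image[OF S sub_carrier]])
  ultimately have "card ((*\<^sub>v) S ` carrier_vec D) = CARD('p) ^ rank S" by (simp add: rank_def)
  then have "CARD('p) ^ D = CARD('p) ^ (rank S + kernel_dim S)"
    using card_kernel_image[OF S] card_mat_kernel[OF S] by (simp add: power_add)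
  then show ?thesis using card_field_gt_1[where 'p = 'p] by (simp only: power_inject_exp)
qed

lemma two_neq_0: "CARD('p::prime_card) \<noteq> 2 \<Longrightarrow> (2 :: 'p mod_ring) \<noteq> 0"
proof
  assume n: "CARD('p) \<noteq> 2" and "(2 :: 'p mod_ring) = 0"
  then have "of_nat 2 = (0 :: 'p mod_ring)" by simp
  then have "CARD('p) dvd 2" by (simp only: of_nat_0_mod_ring_dvd)
  then show False using n card_field_gt_1[where 'p = 'p] by (auto dest: dvd_imp_le)
qed

lemma two_eq_0: "CARD('p::prime_card) = 2 \<Longrightarrow> (2 :: 'p mod_ring) = 0"
  using of_nat_card_eq_0[where 'a = 'p] by simp

definition squares :: "'p::prime_card mod_ring set" where
  "squares = (\<lambda>z. z^2) ` (UNIV - {0})"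

text \<open>The quadratic character of the prime field, with complex values.\<close>

definition eta :: "'p::prime_card mod_ring \<Rightarrow> complex" where
  "eta a = (if a = 0 then 0 else if \<exists>z. a = z^2 then 1 else - 1)"

definition gauss :: "'p::prime_card mod_ring \<Rightarrow> complex" where
  "gauss a = (\<Sum>x\<in>UNIV. chi (a * x^2))"

lemma square_fiber:
  assumes "CARD('p::prime_card) \<noteq> 2" "(z :: 'p mod_ring) \<in> UNIV - {0}"
  shows "card {z' \<in> UNIV - {0}. z'^2 = z^2} = 2"
proof -
  have "z \<noteq> - z" using assms two_neq_0[OF assms(1)] by (metis DiffE add.inverse_inverse eq_neg_iff_add_eq_0 insertI1 mult_2 mult_eq_0_iff)
  moreover have "{z' \<in> UNIV - {0}. z'^2 = z^2} = {z, - z}" using assms(2) by (auto simp: power2_eq_iff)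
  ultimately show ?thesis by simp
qed

lemma card_squares:
  assumes "CARD('p::prime_card) \<noteq> 2"
  shows "2 * card (squares :: 'p mod_ring set) = CARD('p) - 1"
proof -
  have "(\<Sum>z\<in>UNIV - {0 :: 'p mod_ring}. 1 :: complex) = of_nat 2 * (\<Sum>x\<in>(squares :: 'p mod_ring set). 1)"
    unfolding squares_def by (rule sum_fibers) (use square_fiber[OF assms] in auto)
  then have "of_nat (CARD('p) - 1) = (of_nat (2 * card (squares :: 'p mod_ring set)) :: complex)"
    by (simp add: card_Diff_subset)
  then show ?thesis by (simp only: of_nat_eq_iff)
qed

lemma squares_iff: "a \<in> squares \<longleftrightarrow> a \<noteq> 0 \<and> (\<exists>z. a = z^2)"
  by (auto simp: squares_def)

text \<open>Multiplication by a non-square sends squares to non-squares, and for odd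
  \<open>q\<close> both sets have \<open>(q - 1) / 2\<close> elements.\<close>

lemma nonsquare_times_squares:
  assumes odd: "CARD('p::prime_card) \<noteq> 2" and a: "(a :: 'p mod_ring) \<noteq> 0" "a \<notin> squares"
  shows "(\<lambda>y. a * y) ` squares = UNIV - {0} - squares"
proof (rule card_subset_eq)
  show "(\<lambda>y. a * y) ` squares \<subseteq> UNIV - {0} - squares"
  proof
    fix x assume "x \<in> (\<lambda>y. a * y) ` squares"
    then obtain z where z: "z \<noteq> 0" "x = a * z^2" by (auto simp: squares_def)
    have "x \<notin> squares"
    proof
      assume "x \<in> squares"
      then obtain w where w: "x = w^2" by (auto simp: squares_def)
      then have "a = (w / z)^2" using z by (simp add: power_divide field_simps)
      then show False using a by (auto simp: squares_iff)
    qed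
    then show "x \<in> UNIV - {0} - squares" using z a by simp
  qed
  have "card ((\<lambda>y. a * y) ` squares) = card (squares :: 'p mod_ring set)"
    using a by (intro card_image inj_onI) simp
  moreover have "card (UNIV - {0} - squares :: 'p mod_ring set) = CARD('p) - 1 - card (squares :: 'p mod_ring set)"
    by (subst card_Diff_subset) (auto simp: squares_iff card_Diff_subset)
  ultimately show "card ((\<lambda>y. a * y) ` squares) = card (UNIV - {0} - squares :: 'p mod_ring set)"
    using card_squares[OF odd] by simp
qed simp

lemma eta_squares: "eta a = (if a = 0 then 0 else if a \<in> squares then 1 else - 1)"
  by (auto simp: eta_def squares_iff)

text \<open>The product of two non-squares is the only case that needs counting: one of them is the
  other times a square, so the product is a square.\<close>

lemma eta_mult:
  assumes odd: "CARD('p::prime_card) \<noteq> 2"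
  shows "eta (a * b) = eta a * eta (b :: 'p mod_ring)"
proof (cases "a = 0 \<or> b = 0")
  case True
  then show ?thesis by (auto simp: eta_def)
next
  case False
  have sq: "x * y \<in> squares \<longleftrightarrow> y \<in> squares" if xy: "x \<in> squares" "y \<noteq> 0" for x y :: "'p mod_ring"
  proof -
    obtain s where s: "s \<noteq> 0" "x = s^2" using xy(1) by (auto simp: squares_def)
    have "\<exists>z. y = z^2" if "x * y = w^2" for w
      using that s by (intro exI[of _ "w / s"]) (simp add: power_divide field_simps)
    moreover have "\<exists>w. x * y = w^2" if "y = z^2" for z
      using that s by (intro exI[of _ "s * z"]) (simp add: power_mult_distrib)
    ultimately show ?thesis using s xy by (auto simp: squares_iff)
  qed
  show ?thesis
  proof (cases "a \<in> squares")
    case True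
    then show ?thesis using False sq[OF True] by (simp add: eta_squares)
  next
    case nsq: False
    show ?thesis
    proof (cases "b \<in> squares")
      case True
      then show ?thesis using False nsq sq[OF True, of a] by (simp add: eta_squares mult.commute)
    next
      case nsqb: False
      have "b \<in> (\<lambda>y. a * y) ` squares"
        unfolding nonsquare_times_squares[OF odd _ nsq, simplified False] using False nsqb nonsquare_times_squares[OF odd _ nsq] by auto
      then obtain s where s: "s \<noteq> 0" "b = a * s^2" by (auto simp: squares_def)
      have "a * b = (a * s)^2" unfolding s by (simp add: power2_eq_square)
      then show ?thesis using False nsq nsqb by (auto simp: eta_squares squares_iff)
    qed
  qed
qed

text \<open>A square factor is absorbed by substitution. In general \<open>gauss c\<close> is 1 plus
  twice the sum of \<open>chi (c * y)\<close> over the squares \<open>y\<close>; a non-square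
  \<open>c\<close> exchanges squares and non-squares, whose character sums add up to
  \<open>-1\<close>.\<close>

lemma gauss_eta:
  assumes odd: "CARD('p::prime_card) \<noteq> 2" and a: "(a :: 'p mod_ring) \<noteq> 0"
  shows "gauss a = eta a * gauss (1 :: 'p mod_ring)"
proof (cases "a \<in> squares")
  case True
  then obtain s where s: "s \<noteq> 0" "a = s^2" by (auto simp: squares_def)
  have "bij_betw (\<lambda>x. s * x) (UNIV :: 'p mod_ring set) UNIV"
    by (rule bij_betw_byWitness[of _ "\<lambda>x. x / s"]) (use s in auto)
  from sum.reindex_bij_betw[OF this, of "\<lambda>x. chi (x^2)"] have "gauss a = gauss (1 :: 'p mod_ring)"
    unfolding gauss_def s by (simp add: power_mult_distrib)
  then show ?thesis using a True by (simp add: eta_squares)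
next
  case False
  have *: "gauss c = 1 + 2 * (\<Sum>y\<in>squares. chi (c * y))" for c :: "'p mod_ring"
  proof -
    have "gauss c = chi 0 + (\<Sum>x\<in>UNIV - {0}. chi (c * x^2))"
      unfolding gauss_def by (subst sum.remove[of _ 0]) auto
    also have "(\<Sum>x\<in>UNIV - {0}. chi (c * x^2)) = of_nat 2 * (\<Sum>y\<in>squares. chi (c * y))"
      unfolding squares_def by (rule sum_fibers[of _ "\<lambda>x. x^2" 2 "\<lambda>y. chi (c * y)"]) (use square_fiber[OF odd] in auto)
    finally show ?thesis by simp
  qed
  have "(\<Sum>y\<in>squares. chi (a * y)) = (\<Sum>y\<in>(\<lambda>y. a * y) ` squares. chi y)"
    using a by (subst sum.reindex) (auto intro: inj_onI)
  also have "\<dots> = (\<Sum>y\<in>UNIV - {0} - squares. chi (y :: 'p mod_ring))" unfolding nonsquare_times_squares[OF odd a False] ..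
  also have "\<dots> = (\<Sum>y\<in>UNIV - {0 :: 'p mod_ring}. chi y) - (\<Sum>y\<in>squares. chi (y :: 'p mod_ring))"
    by (rule sum_diff) (auto simp: squares_iff)
  also have "(\<Sum>y\<in>UNIV - {0 :: 'p mod_ring}. chi y) = (\<Sum>y\<in>UNIV. chi (y * 1 :: 'p mod_ring)) - 1"
    by (simp add: sum_diff)
  also have "\<dots> = - 1" by (subst sum_chi_mult) simp
  finally have "gauss a = - gauss (1 :: 'p mod_ring)" by (simp add: *)
  then show ?thesis using a False by (simp add: eta_squares)
qed

text \<open>In \<open>gauss 1 * gauss (- 1)\<close> the substitution \<open>x = y + t\<close> turns
  \<open>x^2 - y^2\<close> into \<open>t^2 + 2 t y\<close>. Summing over \<open>y\<close> leaves
  \<open>t = 0\<close> with value \<open>q\<close>, and \<open>gauss (- 1)\<close> is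
  \<open>eta (- 1)\<close> times \<open>gauss 1\<close>.\<close>

lemma gauss_square:
  assumes odd: "CARD('p::prime_card) \<noteq> 2"
  shows "gauss (1 :: 'p mod_ring) ^ 2 = eta (- 1 :: 'p mod_ring) * of_nat CARD('p)"
proof -
  have shift: "(\<Sum>x\<in>UNIV. f (x :: 'p mod_ring)) = (\<Sum>t\<in>UNIV. f (y + t))" for f :: "'p mod_ring \<Rightarrow> complex" and y
    by (rule sum.reindex_bij_betw[symmetric], rule bij_betw_byWitness[of _ "\<lambda>x. x - y"]) auto
  have "gauss (1 :: 'p mod_ring) * gauss (- 1 :: 'p mod_ring) = (\<Sum>y\<in>UNIV. \<Sum>x\<in>UNIV. chi (x^2 - y^2 :: 'p mod_ring))"
    unfolding gauss_def sum_product by (subst sum.swap) (simp add: chi_add[symmetric])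
  also have "\<dots> = (\<Sum>y\<in>UNIV. \<Sum>t\<in>UNIV. chi (t^2) * chi (y * (2 * t) :: 'p mod_ring))"
  proof (rule sum.cong[OF refl])
    fix y :: "'p mod_ring"
    show "(\<Sum>x\<in>UNIV. chi (x^2 - y^2)) = (\<Sum>t\<in>UNIV. chi (t^2) * chi (y * (2 * t)))"
      unfolding shift[of "\<lambda>x. chi (x^2 - y^2)" y] by (simp add: chi_add[symmetric] power2_eq_square algebra_simps)
  qed
  also have "\<dots> = (\<Sum>t\<in>UNIV. chi (t^2) * (\<Sum>y\<in>UNIV. chi (y * (2 * t) :: 'p mod_ring)))"
    by (subst sum.swap) (simp add: sum_distrib_left)
  also have "\<dots> = (\<Sum>t\<in>UNIV. if t = (0 :: 'p mod_ring) then of_nat CARD('p) else 0)"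
    unfolding sum_chi_mult using two_neq_0[OF odd] by (intro sum.cong) auto
  also have "\<dots> = of_nat CARD('p)" by simp
  finally have "gauss (1 :: 'p mod_ring) * (eta (- 1 :: 'p mod_ring) * gauss (1 :: 'p mod_ring)) = of_nat CARD('p)"
    using gauss_eta[OF odd, of "- 1"] by simp
  then have "eta (- 1 :: 'p mod_ring) * eta (- 1 :: 'p mod_ring) * gauss (1 :: 'p mod_ring) ^ 2
      = eta (- 1 :: 'p mod_ring) * of_nat CARD('p)"
    by (simp add: power2_eq_square mult_ac)
  moreover have "eta (- 1 :: 'p mod_ring) * eta (- 1 :: 'p mod_ring) = 1" by (simp add: eta_def)
  ultimately show ?thesis by simp
qed

section \<open>Exponential sums of quadratic forms\<close>

definition qsum :: "nat \<Rightarrow> 'p::prime_card mod_ring mat \<Rightarrow> 'p mod_ring \<Rightarrow> complex" where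
  "qsum n Q c = (\<Sum>l\<in>carrier_vec n. chi (c * (l \<bullet> (Q *\<^sub>v l))))"

lemma congruence_scalar:
  assumes "Y \<in> carrier_mat n n" "S \<in> carrier_mat n n" "x \<in> carrier_vec n" "y \<in> carrier_vec n"
  shows "x \<bullet> ((transpose_mat Y * S * Y) *\<^sub>v y) = (Y *\<^sub>v x) \<bullet> (S *\<^sub>v (Y *\<^sub>v (y :: 'a :: comm_ring_1 vec)))"
proof -
  have "(transpose_mat Y * S * Y) *\<^sub>v y = transpose_mat Y *\<^sub>v (S *\<^sub>v (Y *\<^sub>v y))"
    using assms by (simp add: assoc_mult_mat_vec[where ?n\<^sub>1 = n and ?n\<^sub>2 = n and ?n\<^sub>3 = n])
  then have "x \<bullet> ((transpose_mat Y * S * Y) *\<^sub>v y) = (transpose_mat Y *\<^sub>v (S *\<^sub>v (Y *\<^sub>v y))) \<bullet> x"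
    using assms comm_scalar_prod[of x n "transpose_mat Y *\<^sub>v (S *\<^sub>v (Y *\<^sub>v y))"] by simp
  also have "\<dots> = (S *\<^sub>v (Y *\<^sub>v y)) \<bullet> (Y *\<^sub>v x)"
    using assms by (intro transpose_vec_mult_scalar) auto
  finally show ?thesis using assms comm_scalar_prod[of "Y *\<^sub>v x" n "S *\<^sub>v (Y *\<^sub>v y)"] by simp
qed

lemma mult_unit_vec_index:
  "R \<in> carrier_mat n n \<Longrightarrow> i < n \<Longrightarrow> j < n \<Longrightarrow> (R *\<^sub>v unit_vec n j) $ i = (R $$ (i, j) :: 'a :: comm_ring_1)"
  by simp

lemma congruence_index:
  assumes Y: "Y \<in> carrier_mat n n" and S: "S \<in> carrier_mat n n" and ij: "i < n" "j < n"
  shows "(transpose_mat Y * S * Y) $$ (i, j)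
    = (Y *\<^sub>v unit_vec n i) \<bullet> (S *\<^sub>v (Y *\<^sub>v unit_vec n j :: 'a :: comm_ring_1 vec))"
proof -
  let ?R = "transpose_mat Y * S * Y"
  have R: "?R \<in> carrier_mat n n" using Y S by auto
  have "unit_vec n i \<bullet> (?R *\<^sub>v unit_vec n j) = (?R *\<^sub>v unit_vec n j) $ i"
    using R ij by (intro scalar_prod_left_unit) auto
  also have "\<dots> = ?R $$ (i, j)" using mult_unit_vec_index[OF R ij] .
  finally show ?thesis using congruence_scalar[OF Y S unit_vec_carrier unit_vec_carrier] by metis
qed

lemma Sym_congruence:
  assumes S: "S \<in> Sym n" and Y: "Y \<in> carrier_mat n n"
  shows "transpose_mat Y * S * Y \<in> Sym n"
proof -
  note Sc = Sym_carrier[OF S]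
  have "(Y *\<^sub>v u) \<bullet> (S *\<^sub>v (Y *\<^sub>v v)) = (Y *\<^sub>v v) \<bullet> (S *\<^sub>v (Y *\<^sub>v u))"
    if "u \<in> carrier_vec n" "v \<in> carrier_vec n" for u v
  proof -
    have c: "Y *\<^sub>v u \<in> carrier_vec n" "Y *\<^sub>v v \<in> carrier_vec n" using Y that by auto
    show ?thesis
      using Sym_scalar[OF S c] comm_scalar_prod[OF c(2) Sym_mult_carrier[OF S c(1)]] by simp
  qed
  then show ?thesis
    using congruence_index[OF Y Sc] Y Sc unfolding Sym_def
    by (auto intro!: eq_matI simp del: index_mult_mat(1))
qed

lemma qsum_congruence:
  assumes Y: "Y \<in> GL n" and S: "S \<in> carrier_mat n n"
  shows "qsum n (transpose_mat Y * S * Y) c = qsum n S c"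
proof -
  have Yc: "Y \<in> carrier_mat n n" and inj: "inj_on ((*\<^sub>v) Y) (carrier_vec n)" using Y by (auto simp: GL_iff_inj)
  have "(*\<^sub>v) Y ` carrier_vec n \<subseteq> carrier_vec n" using Yc by auto
  then have "bij_betw ((*\<^sub>v) Y) (carrier_vec n) (carrier_vec n)"
    unfolding bij_betw_def using inj endo_inj_surj[OF finite_vec _ inj] by simp
  from sum.reindex_bij_betw[OF this, of "\<lambda>l. chi (c * (l \<bullet> (S *\<^sub>v l)))"]
  show ?thesis
    unfolding qsum_def using congruence_scalar[OF Yc S] by (simp cong: sum.cong)
qed

lemma qsum_block:
  assumes A: "A \<in> carrier_mat m m" and B: "B \<in> carrier_mat k k"
  shows "qsum (m + k) (four_block_mat A (0\<^sub>m m k) (0\<^sub>m k m) B) c = qsum m A c * qsum k B c"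
proof -
  let ?R = "four_block_mat A (0\<^sub>m m k) (0\<^sub>m k m) B"
  let ?h = "\<lambda>(a, b). a @\<^sub>v b"
  have "bij_betw ?h (carrier_vec m \<times> carrier_vec k) (carrier_vec (m + k))"
  proof (rule bij_betw_byWitness[of _ "\<lambda>v. (vec_first v m, vec_last v k)"])
    show "\<forall>p\<in>carrier_vec m \<times> carrier_vec k. (\<lambda>v. (vec_first v m, vec_last v k)) (?h p) = p"
      by (auto simp: vec_first_def vec_last_def)
    show "\<forall>v\<in>carrier_vec (m + k). ?h (vec_first v m, vec_last v k) = v" by auto
  qed auto
  from sum.reindex_bij_betw[OF this, of "\<lambda>l. chi (c * (l \<bullet> (?R *\<^sub>v l)))"]
  have "qsum (m + k) ?R c = (\<Sum>p\<in>carrier_vec m \<times> carrier_vec k. chi (c * (?h p \<bullet> (?R *\<^sub>v ?h p))))"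
    unfolding qsum_def by simp
  also have "\<dots> = (\<Sum>p\<in>carrier_vec m \<times> carrier_vec k. (\<lambda>(a, b). chi (c * (a \<bullet> (A *\<^sub>v a))) * chi (c * (b \<bullet> (B *\<^sub>v b)))) p)"
  proof (rule sum.cong[OF refl])
    fix p :: "'a mod_ring vec \<times> 'a mod_ring vec" assume "p \<in> carrier_vec m \<times> carrier_vec k"
    then obtain a b where p: "p = (a, b)" "a \<in> carrier_vec m" "b \<in> carrier_vec k" by auto
    have "(a @\<^sub>v b) \<bullet> (?R *\<^sub>v (a @\<^sub>v b)) = a \<bullet> (A *\<^sub>v a) + b \<bullet> (B *\<^sub>v b)"
      unfolding mult_mat_vec_split[OF A B p(2,3)]
      using A B p by (intro scalar_prod_append[where ?n1.0 = m and ?n2.0 = k]) auto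
    then show "chi (c * (?h p \<bullet> (?R *\<^sub>v ?h p)))
        = (\<lambda>(a, b). chi (c * (a \<bullet> (A *\<^sub>v a))) * chi (c * (b \<bullet> (B *\<^sub>v b)))) p"
      unfolding p(1) by (simp add: chi_add[symmetric] distrib_left)
  qed
  also have "\<dots> = qsum m A c * qsum k B c"
    unfolding qsum_def by (simp only: sum.cartesian_product[symmetric] sum_product)
  finally show ?thesis .
qed

lemma qsum_1:
  assumes "B \<in> carrier_mat 1 1"
  shows "qsum 1 B c = gauss (c * B $$ (0, 0))"
proof -
  have "bij_betw (\<lambda>s. vec 1 (\<lambda>_. s)) (UNIV :: 'a mod_ring set) (carrier_vec 1)"
    by (rule bij_betw_byWitness[of _ "\<lambda>v. v $ 0"]) auto
  from sum.reindex_bij_betw[OF this, of "\<lambda>l. chi (c * (l \<bullet> (B *\<^sub>v l)))"]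
  show ?thesis
    unfolding qsum_def gauss_def using assms
    by (auto simp: scalar_prod_def power2_eq_square mult_ac intro!: sum.cong)
qed

text \<open>Diagonalisation by splitting off one anisotropic vector at a time. Each diagonal entry
  \<open>d\<close> contributes \<open>eta (c * d) * gauss 1\<close>, and the product of the
  characters is that of the determinant.\<close>

lemma qsum_nonsingular:
  assumes odd: "CARD('p::prime_card) \<noteq> 2" and c: "c \<noteq> 0"
  shows "(Q :: 'p mod_ring mat) \<in> Sym n \<Longrightarrow> det Q \<noteq> 0 \<Longrightarrow> qsum n Q c = eta c ^ n * eta (det Q) * gauss (1 :: 'p mod_ring) ^ n"
proof (induction n arbitrary: Q)
  case 0
  have "carrier_vec 0 = {0\<^sub>v 0 :: 'p mod_ring vec}" by auto
  moreover have "Q *\<^sub>v 0\<^sub>v 0 = 0\<^sub>v 0" using mult_mat_zero_vec[OF Sym_carrier[OF 0(1)]] .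
  moreover have "det Q = 1" using Sym_carrier[OF 0(1)] by (rule det_dim_zero)
  ultimately show ?case by (simp add: qsum_def eta_def) (metis one_power2)
next
  case (Suc m)
  let ?n = "Suc m"
  note Qc = Sym_carrier[OF Suc.prems(1)]
  \<comment> \<open>Polarisation: if the quadratic form were zero, twice the bilinear form would be
    zero, and 2 is invertible.\<close>
  have "\<exists>v\<in>carrier_vec ?n. v \<bullet> (Q *\<^sub>v v) \<noteq> 0"
  proof (rule ccontr)
    assume "\<not> ?thesis"
    then have z: "v \<bullet> (Q *\<^sub>v v) = 0" if "v \<in> carrier_vec ?n" for v using that by blast
    have "(Q *\<^sub>v x) \<bullet> y = 0" if xy: "x \<in> carrier_vec ?n" "y \<in> carrier_vec ?n" for x y
    proof -
      have c: "Q *\<^sub>v x \<in> carrier_vec ?n" "Q *\<^sub>v y \<in> carrier_vec ?n" using Suc.prems(1) xy by auto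
      have "0 = (x + y) \<bullet> (Q *\<^sub>v (x + y))" using z[of "x + y"] xy by simp
      also have "\<dots> = x \<bullet> (Q *\<^sub>v x) + x \<bullet> (Q *\<^sub>v y) + (y \<bullet> (Q *\<^sub>v x) + y \<bullet> (Q *\<^sub>v y))"
        unfolding mult_add_distrib_mat_vec[OF Qc xy]
        using xy c by (simp add: add_scalar_prod_distrib[where n = ?n] scalar_prod_add_distrib[where n = ?n])
      also have "\<dots> = 2 * ((Q *\<^sub>v x) \<bullet> y)"
        using z xy Sym_scalar[OF Suc.prems(1) xy] comm_scalar_prod[OF xy(2) c(1)] by simp
      finally show ?thesis using two_neq_0[OF odd] by simp
    qed
    then have "Q *\<^sub>v x = 0\<^sub>v ?n" if "x \<in> carrier_vec ?n" for x
      using that Suc.prems(1) by (intro scalar_zero_iff) auto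
    moreover have "unit_vec ?n 0 \<noteq> (0\<^sub>v ?n :: 'p mod_ring vec)" by (simp add: unit_vec_nonzero)
    ultimately show False using Suc.prems(2) det_0_iff_vec_prod_zero_field[OF Qc] unit_vec_carrier by blast
  qed
  then obtain v where v: "v \<in> carrier_vec ?n" "v \<bullet> (Q *\<^sub>v v) \<noteq> 0" by blast
  have Qv: "Q *\<^sub>v v \<in> carrier_vec ?n" using Suc.prems(1) v by simp
  have Qv0: "Q *\<^sub>v v \<noteq> 0\<^sub>v ?n" using v by auto
  have s0: "sub ?n {0\<^sub>v ?n :: 'p mod_ring vec}" using sub_std[of ?n 0] by (simp add: std_0)
  let ?L = "ext {0\<^sub>v ?n} (Q *\<^sub>v v)"
  \<comment> \<open>The hyperplane orthogonal to \<open>v\<close> with respect to \<open>Q\<close>;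
    it does not contain \<open>v\<close>, so a basis of it can be completed by \<open>v\<close> as
    last vector.\<close>
  define V where "V = perp ?n ?L"
  have sV: "sub ?n V" unfolding V_def using sub_perp[OF subD(1)[OF sub_ext(1)[OF s0 Qv]]] .
  have "card ?L = CARD('p)" using card_ext[OF s0 Qv] Qv0 by simp
  then have cV: "card V = CARD('p) ^ m" using card_perp[OF sub_ext(1)[OF s0 Qv]] by (simp add: V_def)
  have Vz: "(Q *\<^sub>v v) \<bullet> x = 0" if "x \<in> V" for x using perpD[OF that[unfolded V_def] sub_ext(3)[OF s0 Qv]] .
  have vV: "v \<notin> V" using Vz[of v] v comm_scalar_prod[OF v(1) Qv] by auto
  obtain C where C: "C \<in> GL ?n" "(*\<^sub>v) C ` std ?n m = V" using GL_flag[OF sV cV] by auto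
  have Cc: "C \<in> carrier_mat ?n ?n" "inj_on ((*\<^sub>v) C) (std ?n m)"
    using C(1) inj_on_subset[of "(*\<^sub>v) C" "carrier_vec ?n" "std ?n m"] subD(1)[OF sub_std] by (auto simp: GL_iff_inj)
  obtain Y where Y: "Y \<in> carrier_mat ?n ?n" "inj_on ((*\<^sub>v) Y) (std ?n ?n)"
    "\<And>x. x \<in> std ?n m \<Longrightarrow> Y *\<^sub>v x = C *\<^sub>v x" "Y *\<^sub>v unit_vec ?n m = v"
    using flag_step[OF _ Cc v(1)] vV C(2) by (metis lessI)
  have YG: "Y \<in> GL ?n" using Y by (simp add: GL_iff_inj)
  define R where "R = transpose_mat Y * Q * Y"
  have RS: "R \<in> Sym ?n" unfolding R_def using Sym_congruence[OF Suc.prems(1) Y(1)] .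
  have Rim: "R $$ (i, m) = 0" if "i < m" for i
  proof -
    have "unit_vec ?n i \<in> (std ?n m :: 'p mod_ring vec set)" using that by (auto simp: std_def)
    then have "Y *\<^sub>v unit_vec ?n i \<in> V" using Y(3) C(2) by blast
    moreover have "Y *\<^sub>v unit_vec ?n i \<in> carrier_vec ?n" using Y(1) by simp
    ultimately have "(Y *\<^sub>v unit_vec ?n i) \<bullet> (Q *\<^sub>v v) = 0" using Vz comm_scalar_prod[OF Qv] by metis
    then show ?thesis unfolding R_def using congruence_index[OF Y(1) Qc, of i m] that Y(4) by simp
  qed
  define Q' where "Q' = mat m m (\<lambda>ij. R $$ ij)"
  define B where "B = mat 1 1 (\<lambda>_. R $$ (m, m))"
  have R4: "R = four_block_mat Q' (0\<^sub>m m 1) (0\<^sub>m 1 m) B"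
  proof (rule eq_matI)
    fix i j assume "i < dim_row (four_block_mat Q' (0\<^sub>m m 1) (0\<^sub>m 1 m) B)" "j < dim_col (four_block_mat Q' (0\<^sub>m m 1) (0\<^sub>m 1 m) B)"
    then have ij: "i < ?n" "j < ?n" by (auto simp: Q'_def B_def)
    have Rmj: "R $$ (m, j) = 0" if "j < m" using Rim[OF that] Sym_index[OF RS, of j m] that by simp
    show "R $$ (i, j) = four_block_mat Q' (0\<^sub>m m 1) (0\<^sub>m 1 m) B $$ (i, j)"
      using ij Rim Rmj by (auto simp: Q'_def B_def less_Suc_eq)
  qed (use Sym_carrier[OF RS] in \<open>auto simp: Q'_def B_def\<close>)
  have Q'S: "Q' \<in> Sym m" using Sym_index[OF RS] by (auto simp: Q'_def Sym_def intro!: eq_matI)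
  have Bc: "B \<in> carrier_mat 1 1" by (simp add: B_def)
  have a0: "R $$ (m, m) \<noteq> 0"
    unfolding R_def using congruence_index[OF Y(1) Qc, of m m] Y(4) v(2) by simp
  have detB: "det B = R $$ (m, m)" using Bc by (simp add: B_def det_single)
  have detR: "det R = det Q' * R $$ (m, m)"
    unfolding R4[symmetric] using det_four_block_mat_upper_right_zero[OF Sym_carrier[OF Q'S] refl _ Bc, of "0\<^sub>m 1 m"] R4 detB by simp
  \<comment> \<open>The change of basis multiplies the determinant by a non-zero square, which
    \<open>eta\<close> ignores.\<close>
  have "det R = det Y * det Q * det Y"
    unfolding R_def using Y(1) Qc by (simp add: det_mult[where n = ?n] det_transpose[where n = ?n])
  then have detR': "det R = (det Y)^2 * det Q" by (simp add: power2_eq_square mult_ac)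
  have dY: "det Y \<noteq> 0" using YG by (simp add: GL_iff_det)
  have Q'0: "det Q' \<noteq> 0" using detR detR' dY Suc.prems(2) by auto
  have "eta (det Q') * eta (R $$ (m, m)) = eta (det R)" using eta_mult[OF odd] detR by metis
  also have "\<dots> = eta ((det Y)^2) * eta (det Q)" unfolding detR' by (rule eta_mult[OF odd])
  also have "eta ((det Y)^2) = 1" using dY by (auto simp: eta_def)
  finally have etas: "eta (det Q') * eta (R $$ (m, m)) = eta (det Q)" by simp
  have "qsum ?n Q c = qsum (m + 1) R c" using qsum_congruence[OF YG Qc] by (simp add: R_def)
  also have "\<dots> = qsum m Q' c * qsum 1 B c" unfolding R4 by (rule qsum_block[OF Sym_carrier[OF Q'S] Bc])
  also have "qsum 1 B c = eta c * eta (R $$ (m, m)) * gauss (1 :: 'p mod_ring)"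
    unfolding qsum_1[OF Bc] using gauss_eta[OF odd, of "c * B $$ (0, 0)"] c a0 eta_mult[OF odd, of c]
    by (simp add: B_def)
  also have "qsum m Q' c = eta c ^ m * eta (det Q') * gauss (1 :: 'p mod_ring) ^ m" by (rule Suc.IH[OF Q'S Q'0])
  finally show ?case unfolding etas[symmetric] by (simp add: mult_ac)
qed

text \<open>In a basis that starts with the kernel of \<open>S\<close> everything outside the last
  block is zero. A kernel vector of the block, padded with zeros, would give a kernel vector of
  \<open>S\<close> outside the span of the leading basis vectors.\<close>

lemma nonsing_block_exists:
  assumes S: "(S :: 'p::prime_card mod_ring mat) \<in> Sym D" and r: "r = vec_space.rank D S"
  shows "\<exists>Q. Q \<in> carrier_mat r r \<and> invertible_mat Q \<and> (\<exists>Y\<in>GL D. transpose_mat Y * S * Y =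
    four_block_mat (0\<^sub>m (D - r) (D - r)) (0\<^sub>m (D - r) r) (0\<^sub>m r (D - r)) Q)"
proof -
  note Sc = Sym_carrier[OF S]
  define k where "k = D - r"
  have kr: "k + r = D" "k \<le> D" "kernel_dim S = k" using rank_kernel_dim[OF Sc] r by (auto simp: k_def)
  have "card (mat_kernel S) = CARD('p) ^ k" using card_mat_kernel[OF Sc] kr by simp
  then obtain Y where Y: "Y \<in> GL D" "(*\<^sub>v) Y ` std D k = mat_kernel S"
    using GL_flag[OF sub_mat_kernel[OF Sc] _ kr(2)] by blast
  have Yc: "Y \<in> carrier_mat D D" "inj_on ((*\<^sub>v) Y) (carrier_vec D)" using Y by (auto simp: GL_iff_inj)
  define R where "R = transpose_mat Y * S * Y"
  have RS: "R \<in> Sym D" unfolding R_def using Sym_congruence[OF S Yc(1)] .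
  have Rij: "R $$ (i, j) = 0" if "i < D" "j < k" for i j
  proof -
    have "unit_vec D j \<in> (std D k :: 'p mod_ring vec set)" using that by (auto simp: std_def)
    then have "S *\<^sub>v (Y *\<^sub>v unit_vec D j) = 0\<^sub>v D" using Y(2) mat_kernel_iff[OF Sc] by blast
    then show ?thesis unfolding R_def using congruence_index[OF Yc(1) Sc, of i j] that kr Yc by simp
  qed
  define Q where "Q = mat r r (\<lambda>(i, j). R $$ (k + i, k + j))"
  have Qc: "Q \<in> carrier_mat r r" by (simp add: Q_def)
  let ?F = "four_block_mat (0\<^sub>m k k) (0\<^sub>m k r) (0\<^sub>m r k) Q"
  have R4: "R = ?F"
  proof (rule eq_matI)
    fix i j assume "i < dim_row ?F" "j < dim_col ?F"
    then have ij: "i < D" "j < D" using kr by (auto simp: Q_def)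
    have "R $$ (i, j) = 0" if "i < k" using Rij[OF ij(2) that] Sym_index[OF RS ij] by simp
    then show "R $$ (i, j) = ?F $$ (i, j)" using ij Rij[OF ij(1)] kr by (auto simp: Q_def)
  qed (use Sym_carrier[OF RS] kr in \<open>auto simp: Q_def\<close>)
  have "det Q \<noteq> 0"
  proof
    assume "det Q = 0"
    then obtain w where w: "w \<in> carrier_vec r" "w \<noteq> 0\<^sub>v r" "Q *\<^sub>v w = 0\<^sub>v r"
      using det_0_iff_vec_prod_zero_field[OF Qc] by blast
    let ?x = "0\<^sub>v k @\<^sub>v w"
    have xc: "?x \<in> carrier_vec D" using w kr(1) by (metis append_carrier_vec zero_carrier_vec)
    have "R *\<^sub>v ?x = (0\<^sub>m k k *\<^sub>v 0\<^sub>v k) @\<^sub>v (Q *\<^sub>v w)"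
      unfolding R4 by (rule mult_mat_vec_split) (use Qc w in auto)
    also have "\<dots> = 0\<^sub>v D" using w kr(1) mult_mat_zero_vec[of "0\<^sub>m k k :: 'p mod_ring mat" k k]
      by (intro eq_vecI) auto
    finally have R0: "R *\<^sub>v ?x = 0\<^sub>v D" .
    have "(S *\<^sub>v (Y *\<^sub>v ?x)) \<bullet> z = 0" if z: "z \<in> carrier_vec D" for z
    proof -
      have "z \<in> (*\<^sub>v) Y ` carrier_vec D"
      proof -
        have "(*\<^sub>v) Y ` carrier_vec D \<subseteq> carrier_vec D" using Yc(1) by auto
        then show ?thesis using endo_inj_surj[OF finite_vec _ Yc(2)] z by blast
      qed
      then obtain y where y: "y \<in> carrier_vec D" "z = Y *\<^sub>v y" by auto
      have c: "Y *\<^sub>v y \<in> carrier_vec D" "S *\<^sub>v (Y *\<^sub>v ?x) \<in> carrier_vec D" using Yc Sc y xc by auto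
      have "(Y *\<^sub>v y) \<bullet> (S *\<^sub>v (Y *\<^sub>v ?x)) = 0"
        using congruence_scalar[OF Yc(1) Sc y(1) xc] R0 y unfolding R_def by simp
      then show ?thesis using comm_scalar_prod[OF c] y(2) by simp
    qed
    then have "S *\<^sub>v (Y *\<^sub>v ?x) = 0\<^sub>v D" using Sc Yc xc by (intro scalar_zero_iff) auto
    then have "Y *\<^sub>v ?x \<in> (*\<^sub>v) Y ` std D k" using Y(2) mat_kernel_iff[OF Sc] Yc xc by auto
    then have xs: "?x \<in> std D k" using inj_onD[OF Yc(2)] xc subD(1)[OF sub_std] by blast
    have "w = 0\<^sub>v r"
    proof (rule eq_vecI)
      fix i assume "i < dim_vec (0\<^sub>v r)"
      then have i: "i < r" by simp
      have "?x $ (k + i) = 0" using xs i kr(1) by (auto simp: std_def)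
      then show "w $ i = 0\<^sub>v r $ i" using i w(1) by simp
    qed (use w in simp)
    then show False using w by simp
  qed
  then have "invertible_mat Q" using Qc GL_iff_det[of Q r] by (simp add: GL_def)
  then show ?thesis using Qc Y(1) R4 unfolding R_def k_def by blast
qed

text \<open>If \<open>S u \<noteq> 0\<close> but \<open>u \<bullet> (S u) = 0\<close>, the
  hyperplane orthogonal to \<open>S u\<close> contains \<open>u\<close> and the kernel. The kernel
  has codimension at most 1 and misses \<open>u\<close>, so together they fill the space, a
  contradiction. In this form the rank bound enters the wave sums.\<close>

lemma rank_le_1_anisotropic:
  assumes S: "(S :: 'p::prime_card mod_ring mat) \<in> Sym D" and r: "vec_space.rank D S \<le> 1"
    and u: "u \<in> carrier_vec D" "u \<bullet> (S *\<^sub>v u) = 0"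
  shows "S *\<^sub>v u = 0\<^sub>v D"
proof (rule ccontr)
  assume nz: "S *\<^sub>v u \<noteq> 0\<^sub>v D"
  note Sc = Sym_carrier[OF S]
  have Su: "S *\<^sub>v u \<in> carrier_vec D" using S u by simp
  let ?L = "{v \<in> carrier_vec D. (S *\<^sub>v u) \<bullet> v = 0}"
  have uK: "u \<notin> mat_kernel S" using nz mat_kernel_iff[OF Sc] by simp
  have "ext (mat_kernel S) u \<subseteq> ?L"
  proof (rule ext_subset[where n = D])
    show "sub D ?L" using sub_perp[of "{S *\<^sub>v u}" D] Su by (simp add: perp_def)
    show "mat_kernel S \<subseteq> ?L"
      using Sym_scalar[OF S u(1)] u(1) by (auto simp: mat_kernel_iff[OF Sc])
    show "u \<in> ?L" using u comm_scalar_prod[OF u(1) Su] by simp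
  qed
  then have "card (ext (mat_kernel S) u) \<le> card ?L" by (intro card_mono) auto
  moreover have "card (ext (mat_kernel S) u) = CARD('p) * CARD('p) ^ kernel_dim S"
    using card_ext[OF sub_mat_kernel[OF Sc] u(1) uK] card_mat_kernel[OF Sc] by simp
  moreover have "CARD('p) ^ D \<le> CARD('p) * CARD('p) ^ kernel_dim S"
    using power_increasing[of D "Suc (kernel_dim S)" "CARD('p)"] rank_kernel_dim[OF Sc] r
      card_field_gt_1[where 'p = 'p] by simp
  ultimately have "?L = carrier_vec D" by (intro card_subset_eq) (auto intro: antisym card_mono[OF finite_vec, of _ D, simplified])
  then show False using nz scalar_zero_iff[OF Su] by auto
qed

lemma sum_eta: 
  assumes odd: "CARD('p::prime_card) \<noteq> 2"
  shows "(\<Sum>c\<in>UNIV - {0 :: 'p mod_ring}. eta c) = 0"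
proof -
  have sub: "squares \<subseteq> UNIV - {0 :: 'p mod_ring}" by (auto simp: squares_iff)
  have "(\<Sum>c\<in>UNIV - {0 :: 'p mod_ring}. eta c) = (\<Sum>c\<in>UNIV - {0} - squares. eta (c :: 'p mod_ring)) + (\<Sum>c\<in>squares. eta (c :: 'p mod_ring))"
    by (rule sum.subset_diff[OF sub]) simp
  also have "(\<Sum>c\<in>UNIV - {0} - squares. eta (c :: 'p mod_ring)) = - of_nat (card (UNIV - {0} - squares :: 'p mod_ring set))"
    by (simp add: eta_squares)
  also have "(\<Sum>c\<in>squares. eta (c :: 'p mod_ring)) = of_nat (card (squares :: 'p mod_ring set))"
    by (simp add: eta_squares squares_iff)
  also have "card (UNIV - {0} - squares :: 'p mod_ring set) = card (squares :: 'p mod_ring set)"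
    using card_squares[OF odd] sub by (subst card_Diff_subset) (auto simp: card_Diff_subset)
  finally show ?thesis by simp
qed

lemma nonsing_block_spec:
  assumes S: "(S :: 'p::prime_card mod_ring mat) \<in> Sym D" and r: "r = vec_space.rank D S"
  obtains Y where "nonsing_block D S \<in> carrier_mat r r" "invertible_mat (nonsing_block D S)" "Y \<in> GL D"
    "transpose_mat Y * S * Y =
      four_block_mat (0\<^sub>m (D - r) (D - r)) (0\<^sub>m (D - r) r) (0\<^sub>m r (D - r)) (nonsing_block D S)"
  using someI_ex[OF nonsing_block_exists[OF S r]] unfolding nonsing_block_def r[symmetric] Let_def by blast

text \<open>Each dimension of the kernel contributes a free factor \<open>q\<close>; the
  non-singular block contributes the Gauss sums.\<close>

lemma qsum_rank:
  assumes S: "(S :: 'p::prime_card mod_ring mat) \<in> Sym D" and odd: "CARD('p) \<noteq> 2"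
    and r: "r = vec_space.rank D S" and c: "c \<noteq> 0"
  shows "qsum D S c = of_nat (CARD('p) ^ (D - r)) * (eta c ^ r * eta (det (nonsing_block D S)) * gauss (1 :: 'p mod_ring) ^ r)"
    and "det (nonsing_block D S) \<noteq> 0"
proof -
  let ?Q = "nonsing_block D S"
  obtain Y where Q: "?Q \<in> carrier_mat r r" "invertible_mat ?Q" "Y \<in> GL D"
    "transpose_mat Y * S * Y = four_block_mat (0\<^sub>m (D - r) (D - r)) (0\<^sub>m (D - r) r) (0\<^sub>m r (D - r)) ?Q"
    using nonsing_block_spec[OF S r] .
  have rD: "r \<le> D" using rank_kernel_dim[OF Sym_carrier[OF S]] r by simp
  have Yc: "Y \<in> carrier_mat D D" using Q(3) by (simp add: GL_def)
  show det: "det ?Q \<noteq> 0" using Q(1,2) GL_iff_det[of ?Q r] by (simp add: GL_def)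
  have QS: "?Q \<in> Sym r"
  proof -
    have "transpose_mat Y * S * Y \<in> Sym D" using Sym_congruence[OF S Yc] .
    note ix = Sym_index[OF this]
    have lower: "four_block_mat (0\<^sub>m k k) (0\<^sub>m k r) (0\<^sub>m r k) ?Q $$ (k + i, k + j) = ?Q $$ (i, j)"
      if "i < r" "j < r" for i j k using that Q(1) by simp
    have "?Q $$ (i, j) = ?Q $$ (j, i)" if "i < r" "j < r" for i j
    proof -
      have "D - r + i < D" "D - r + j < D" using that rD by auto
      from ix[OF this] show ?thesis unfolding Q(4) lower[OF that] lower[OF that(2,1)] .
    qed
    then show ?thesis using Q(1) by (auto simp: Sym_def intro!: eq_matI)
  qed
  have z: "qsum k (0\<^sub>m k k) c = of_nat (CARD('p) ^ k)" for k and c :: "'p mod_ring"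
  proof -
    have "l \<bullet> (0\<^sub>m k k *\<^sub>v l) = 0" if "l \<in> carrier_vec k" for l :: "'p mod_ring vec"
      using that by (auto simp: scalar_prod_def)
    then have "qsum k (0\<^sub>m k k) c = (\<Sum>l\<in>(carrier_vec k :: 'p mod_ring vec set). 1)"
      unfolding qsum_def by (intro sum.cong) auto
    then show ?thesis by simp
  qed
  have "qsum D S c = qsum (D - r + r) (four_block_mat (0\<^sub>m (D - r) (D - r)) (0\<^sub>m (D - r) r) (0\<^sub>m r (D - r)) ?Q) c"
    using qsum_congruence[OF Q(3) Sym_carrier[OF S], of c] rD by (simp add: Q(4))
  also have "\<dots> = qsum (D - r) (0\<^sub>m (D - r) (D - r)) c * qsum r ?Q c"
    by (rule qsum_block) (use Q(1) in auto)
  finally show "qsum D S c = of_nat (CARD('p) ^ (D - r)) * (eta c ^ r * eta (det ?Q) * gauss (1 :: 'p mod_ring) ^ r)"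
    unfolding z qsum_nonsingular[OF odd c QS det] .
qed

text \<open>For odd \<open>q\<close> the sum depends on \<open>c\<close> only through
  \<open>eta c ^ r\<close>. For odd rank this sums to 0; for even rank it is 1, and the even power
  of the Gauss sum yields \<open>eta ((- 1) ^ (r div 2))\<close> and the size
  \<open>q^(D - r / 2) = q^((D + N) / 2)\<close>. For \<open>q = 2\<close> and rank 1 the quadratic
  form is additive and non-zero, so the sums vanish, in accordance with type 0.\<close>

lemma sum_qsum:
  assumes S: "(S :: 'p::prime_card mod_ring mat) \<in> Sym D"
    and char2: "CARD('p) = 2 \<longrightarrow> vec_space.rank D S \<le> 1"
  shows "(\<Sum>c\<in>UNIV - {0}. qsum D S c) = of_nat (CARD('p) - 1) *
    (of_int (form_type D S) * of_real (real CARD('p) powr ((real D + real (kernel_dim S)) / 2)))"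
proof -
  define r where "r = vec_space.rank D S"
  note Sc = Sym_carrier[OF S]
  have rk: "r + kernel_dim S = D" using rank_kernel_dim[OF Sc] by (simp add: r_def)
  have q0: "real CARD('p) > 0" by simp
  have cU: "of_nat (card (UNIV - {0 :: 'p mod_ring})) = (of_nat (CARD('p) - 1) :: complex)"
    by (simp add: card_Diff_subset)
  show ?thesis
  proof (cases "S = 0\<^sub>m D D")
    case True
    have "l \<bullet> (S *\<^sub>v l) = 0" if "l \<in> carrier_vec D" for l
      using that True by (auto simp: scalar_prod_def)
    then have q: "qsum D S c = (\<Sum>l\<in>(carrier_vec D :: 'p mod_ring vec set). 1)" for c
      unfolding qsum_def by (intro sum.cong) auto
    have "0\<^sub>m D D *\<^sub>v v = 0\<^sub>v D" if "v \<in> carrier_vec D" for v :: "'p mod_ring vec"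
      using that by (intro eq_vecI) (auto simp: scalar_prod_def)
    then have "v \<in> mat_kernel S \<longleftrightarrow> v \<in> carrier_vec D" for v
      unfolding mat_kernel_iff[OF Sc] using True by blast
    then have "mat_kernel S = carrier_vec D" by blast
    then have "CARD('p) ^ kernel_dim S = CARD('p) ^ D" using card_mat_kernel[OF Sc] by simp
    then have "kernel_dim S = D" using card_field_gt_1[where 'p = 'p] by (simp only: power_inject_exp)
    moreover have "form_type D S = 1" by (simp add: True form_type_def Let_def)
    ultimately show ?thesis unfolding q using q0 by (simp add: cU powr_realpow)
  next
    case nz: False
    show ?thesis
    proof (cases "CARD('p) = 2")
      case True
      have r1: "r \<le> 1" using char2 True by (simp add: r_def)
      have "\<exists>u\<in>carrier_vec D. S *\<^sub>v u \<noteq> 0\<^sub>v D"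
      proof (rule ccontr)
        assume a: "\<not> ?thesis"
        have "S = 0\<^sub>m D D"
        proof (rule eq_matI)
          fix i j assume "i < dim_row (0\<^sub>m D D)" "j < dim_col (0\<^sub>m D D)"
          then have ij: "i < D" "j < D" by auto
          have "(S *\<^sub>v unit_vec D j) $ i = 0" using a ij by simp
          then show "S $$ (i, j) = 0\<^sub>m D D $$ (i, j)" using mult_unit_vec_index[OF Sc ij] ij by simp
        qed (use Sc in auto)
        then show False using nz by simp
      qed
      then obtain u where u: "u \<in> carrier_vec D" "S *\<^sub>v u \<noteq> 0\<^sub>v D" by blast
      have uu: "u \<bullet> (S *\<^sub>v u) \<noteq> 0" using rank_le_1_anisotropic[OF S _ u(1)] u(2) r1 by (auto simp: r_def)
      have "r \<noteq> 0"
      proof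
        assume "r = 0"
        then have "card (mat_kernel S) = card (carrier_vec D :: 'p mod_ring vec set)"
          using card_mat_kernel[OF Sc] rk by simp
        then have "mat_kernel S = carrier_vec D"
          using card_subset_eq[OF finite_vec subD(1)[OF sub_mat_kernel[OF Sc]]] by simp
        then show False using u mat_kernel_iff[OF Sc] by blast
      qed
      then have "r = 1" using r1 by simp
      then have ft: "form_type D S = 0" using nz by (simp add: form_type_def Let_def r_def[symmetric])
      have "qsum D S c = 0" if c: "c \<noteq> 0" for c
      proof -
        \<comment> \<open>The mixed terms are equal by symmetry and cancel, as 2 is zero
          here.\<close>
        have add: "c * ((x + y) \<bullet> (S *\<^sub>v (x + y))) = c * (x \<bullet> (S *\<^sub>v x)) + c * (y \<bullet> (S *\<^sub>v y))"
          if xy: "x \<in> carrier_vec D" "y \<in> carrier_vec D" for x y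
        proof -
          have d: "S *\<^sub>v x \<in> carrier_vec D" "S *\<^sub>v y \<in> carrier_vec D" using S xy by auto
          have "(x + y) \<bullet> (S *\<^sub>v (x + y)) = x \<bullet> (S *\<^sub>v x) + x \<bullet> (S *\<^sub>v y) + (y \<bullet> (S *\<^sub>v x) + y \<bullet> (S *\<^sub>v y))"
            unfolding mult_add_distrib_mat_vec[OF Sc xy]
            using xy d by (simp add: add_scalar_prod_distrib[where n = D] scalar_prod_add_distrib[where n = D])
          also have "x \<bullet> (S *\<^sub>v y) = y \<bullet> (S *\<^sub>v x)"
            using Sym_scalar[OF S xy] comm_scalar_prod[OF xy(2) d(1)] by simp
          finally have "(x + y) \<bullet> (S *\<^sub>v (x + y)) = x \<bullet> (S *\<^sub>v x) + y \<bullet> (S *\<^sub>v y) + 2 * (y \<bullet> (S *\<^sub>v x))"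
            by simp
          then show ?thesis using two_eq_0[OF True] by (simp add: distrib_left)
        qed
        have "qsum D S c = (if \<forall>l\<in>carrier_vec D. c * (l \<bullet> (S *\<^sub>v l)) = 0 then of_nat (card (carrier_vec D :: 'p mod_ring vec set)) else 0)"
          unfolding qsum_def by (rule sum_chi_additive[OF sub_carrier]) (use add in blast)
        then show ?thesis using u(1) uu c by (subst (asm) if_not_P) auto
      qed
      then show ?thesis unfolding ft by simp
    next
      case odd: False
      let ?d = "det (nonsing_block D S)"
      have q: "qsum D S c = of_nat (CARD('p) ^ (D - r)) * (eta c ^ r * eta ?d * gauss (1 :: 'p mod_ring) ^ r)" if "c \<noteq> 0" for c
        using qsum_rank(1)[OF S odd r_def that] .
      have d0: "?d \<noteq> 0" using qsum_rank(2)[OF S odd r_def, of 1] by simp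
      have eta2: "eta c * eta c = 1" if "c \<noteq> 0" for c :: "'p mod_ring" using that by (simp add: eta_def)
      show ?thesis
      proof (cases "odd r")
        case True
        then obtain t where t: "r = Suc (2 * t)" by (auto elim: oddE)
        have "eta c ^ r = eta c" if "c \<noteq> 0" for c :: "'p mod_ring"
          using eta2[OF that] by (simp add: t power_mult power2_eq_square)
        then have "(\<Sum>c\<in>UNIV - {0}. qsum D S c)
            = (\<Sum>c\<in>UNIV - {0 :: 'p mod_ring}. eta c * (of_nat (CARD('p) ^ (D - r)) * (eta ?d * gauss (1 :: 'p mod_ring) ^ r)))"
          using q by (intro sum.cong) auto
        also have "\<dots> = 0" using sum_eta[OF odd] by (simp add: sum_distrib_right[symmetric])
        finally show ?thesis using True nz by (simp add: form_type_def Let_def r_def[symmetric])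
      next
        case False
        then obtain t where t: "r = 2 * t" by (auto elim: evenE)
        have e1: "eta c ^ r = 1" if "c \<noteq> 0" for c :: "'p mod_ring"
          using eta2[OF that] by (simp add: t power_mult power2_eq_square)
        have g: "gauss (1 :: 'p mod_ring) ^ r = eta (- 1 :: 'p mod_ring) ^ t * of_nat CARD('p) ^ t"
          by (simp add: t power_mult gauss_square[OF odd] power_mult_distrib)
        have "eta ((- 1) ^ t :: 'p mod_ring) = eta (- 1 :: 'p mod_ring) ^ t"
        proof (induction t)
          case 0
          show ?case by (simp add: eta_def) (metis one_power2)
        next
          case (Suc t)
          then show ?case using eta_mult[OF odd, of "- 1" "(- 1) ^ t"] by simp
        qed
        then have "eta ?d * eta (- 1 :: 'p mod_ring) ^ t = eta ((- 1) ^ t * ?d)"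
          using eta_mult[OF odd, of "(- 1) ^ t" ?d] by simp
        also have "\<dots> = of_int (form_type D S)"
          using d0 nz False by (auto simp: eta_def form_type_def Let_def r_def[symmetric] t)
        finally have ft: "eta ?d * eta (- 1 :: 'p mod_ring) ^ t = of_int (form_type D S)" .
        have "real CARD('p) powr ((real D + real (kernel_dim S)) / 2) = real CARD('p) powr real (D - r + t)"
          using rk t by (intro arg_cong[of _ _ "\<lambda>x. real CARD('p) powr x"]) (auto simp: field_simps of_nat_diff)
        also have "\<dots> = real CARD('p) ^ (D - r + t)" using q0 by (rule powr_realpow)
        finally have pw: "real CARD('p) powr ((real D + real (kernel_dim S)) / 2) = real CARD('p) ^ (D - r + t)" .
        have "(\<Sum>c\<in>UNIV - {0}. qsum D S c)
            = (\<Sum>c\<in>UNIV - {0 :: 'p mod_ring}. of_nat CARD('p) ^ (D - r + t) * of_int (form_type D S))"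
          by (intro sum.cong refl) (simp add: q e1 g ft[symmetric] power_add mult_ac)
        then show ?thesis unfolding pw by (simp add: cU mult_ac)
      qed
    qed
  qed
qed

subsection \<open>The adjacency operator by layers\<close>

definition subs :: "nat \<Rightarrow> 'p::prime_card mod_ring vec set set" where
  "subs D = {U. sub D U}"

lemma finite_subs [simp]: "finite (subs D :: 'p::prime_card mod_ring vec set set)"
  by (rule finite_subset[of _ "Pow (carrier_vec D)"]) (auto simp: subs_def sub_def)

lemma dpg_A_nbrs:
  assumes D: "D \<ge> 1" and y: "y \<in> max_isotropic D"
  shows "dpg_A D v y = (\<Sum>U\<in>subs D. \<Sum>x\<in>nbrs D U y. v (x :: 'p::prime_card mod_ring vec set))"
proof -
  let ?X = "max_isotropic D :: 'p mod_ring vec set set"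
  let ?N = "{x \<in> ?X. CARD('p) * card (x \<inter> y) = CARD('p) ^ D}"
  have "dpg_A D v y = (\<Sum>x\<in>?X. if CARD('p) * card (x \<inter> y) = CARD('p) ^ D then v x else 0)"
    unfolding dpg_A_def mat_op_def using y dpg_adj_iff[OF D y]
    by (auto simp: Int_commute intro!: sum.cong)
  also have "\<dots> = (\<Sum>x\<in>?N. v x)" by (rule sum.inter_filter[symmetric, OF finite_max_isotropic])
  also have "\<dots> = (\<Sum>U\<in>subs D. \<Sum>x\<in>{x \<in> ?N. upart D x = U}. v x)"
  proof (rule sum.group[symmetric])
    show "finite ?N" by (rule finite_subset[OF _ finite_max_isotropic]) auto
    show "upart D ` ?N \<subseteq> subs D" using sub_upart[OF max_isotropicD(1)] by (auto simp: subs_def)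
  qed simp
  also have "\<dots> = (\<Sum>U\<in>subs D. \<Sum>x\<in>nbrs D U y. v x)"
    by (intro sum.cong refl) (auto simp: nbrs_def)
  finally show ?thesis .
qed

definition covers :: "nat \<Rightarrow> 'p::prime_card mod_ring vec set \<Rightarrow> 'p mod_ring vec set set" where
  "covers D U = {U' \<in> subs D. U \<subset> U' \<and> card U' = CARD('p) * card U}"

definition cocovers :: "nat \<Rightarrow> 'p::prime_card mod_ring vec set \<Rightarrow> 'p mod_ring vec set set" where
  "cocovers D U = {U' \<in> subs D. U' \<subset> U \<and> card U = CARD('p) * card U'}"

lemma finite_covers [simp]: "finite (covers D U)" "finite (cocovers D U)"
  by (auto simp: covers_def cocovers_def)

lemma sum_nbrs_split:
  fixes y :: "'p::prime_card mod_ring vec set"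
  assumes y: "y \<in> max_isotropic D"
  shows "(\<Sum>U\<in>subs D. \<Sum>x\<in>nbrs D U y. v x :: complex) =
    (\<Sum>x\<in>nbrs D (upart D y) y. v x) + (\<Sum>U\<in>covers D (upart D y). \<Sum>x\<in>nbrs D U y. v x)
    + (\<Sum>U\<in>cocovers D (upart D y). \<Sum>x\<in>nbrs D U y. v x)"
proof -
  let ?U = "upart D y"
  let ?f = "\<lambda>U. \<Sum>x\<in>nbrs D U y. v x"
  have Us: "?U \<in> subs D" using sub_upart[OF max_isotropicD(1)[OF y]] by (simp add: subs_def)
  have "(\<Sum>U\<in>subs D. ?f U) = (\<Sum>U\<in>{?U} \<union> covers D ?U \<union> cocovers D ?U. ?f U)"
  proof (rule sum.mono_neutral_right)
    show "{?U} \<union> covers D ?U \<union> cocovers D ?U \<subseteq> subs D" using Us by (auto simp: covers_def cocovers_def)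
    show "\<forall>U\<in>subs D - ({?U} \<union> covers D ?U \<union> cocovers D ?U). ?f U = 0"
    proof
      fix U assume U: "U \<in> subs D - ({?U} \<union> covers D ?U \<union> cocovers D ?U)"
      then have "sub D U" by (simp add: subs_def)
      then have "nbrs D U y = {}" using nbrs_empty[OF _ y, of U] U by (auto simp: covers_def cocovers_def subs_def)
      then show "?f U = 0" by simp
    qed
  qed simp
  also have "\<dots> = (\<Sum>U\<in>{?U} \<union> covers D ?U. ?f U) + (\<Sum>U\<in>cocovers D ?U. ?f U)"
    by (rule sum.union_disjoint) (auto simp: covers_def cocovers_def)
  also have "(\<Sum>U\<in>{?U} \<union> covers D ?U. ?f U) = (\<Sum>U\<in>{?U}. ?f U) + (\<Sum>U\<in>covers D ?U. ?f U)"
    by (rule sum.union_disjoint) (auto simp: covers_def)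
  finally show ?thesis by simp
qed

text \<open>Every cover is \<open>ext U v\<close> for a \<open>v\<close> outside \<open>U\<close>,
  and exactly the \<open>q * card U - card U\<close> vectors of the cover outside \<open>U\<close>
  generate it.\<close>

lemma card_covers:
  fixes U :: "'p::prime_card mod_ring vec set"
  assumes U: "sub D U"
  shows "(CARD('p) - 1) * card U * card (covers D U) = CARD('p) ^ D - card U"
proof -
  have img: "ext U ` (carrier_vec D - U) = covers D U"
  proof (intro equalityI subsetI)
    fix U' assume "U' \<in> ext U ` (carrier_vec D - U)"
    then obtain v where v: "v \<in> carrier_vec D" "v \<notin> U" "U' = ext U v" by auto
    then show "U' \<in> covers D U"
      using sub_ext[OF U v(1)] card_ext[OF U v(1,2)] by (auto simp: covers_def subs_def)
  next
    fix U' assume "U' \<in> covers D U"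
    then have U': "sub D U'" "U \<subset> U'" "card U' = CARD('p) * card U" by (auto simp: covers_def subs_def)
    then obtain v where v: "v \<in> U'" "v \<notin> U" by auto
    have "U' = ext U v" using ext_eq[OF U U'(1) _ U'(3) v] U'(2) by auto
    then show "U' \<in> ext U ` (carrier_vec D - U)" using v subD(1)[OF U'(1)] by auto
  qed
  have fib: "card {v' \<in> carrier_vec D - U. ext U v' = ext U v} = (CARD('p) - 1) * card U"
    if "v \<in> carrier_vec D - U" for v
  proof -
    have v: "v \<in> carrier_vec D" "v \<notin> U" using that by auto
    note e = sub_ext[OF U v(1)] card_ext[OF U v]
    have "{v' \<in> carrier_vec D - U. ext U v' = ext U v} = ext U v - U"
    proof (intro equalityI subsetI)
      fix v' assume "v' \<in> {v' \<in> carrier_vec D - U. ext U v' = ext U v}"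
      then show "v' \<in> ext U v - U" using sub_ext(3)[OF U, of v'] by auto
    next
      fix v' assume v': "v' \<in> ext U v - U"
      have "v' \<in> carrier_vec D" using v' subD(1)[OF e(1)] by auto
      then show "v' \<in> {v' \<in> carrier_vec D - U. ext U v' = ext U v}"
        using v' ext_eq[OF U e(1,2,4), of v'] by auto
    qed
    then show ?thesis using e(2,4) subD(5)[OF U] by (simp add: card_Diff_subset diff_mult_distrib)
  qed
  have "(\<Sum>v\<in>carrier_vec D - U. 1 :: complex) = of_nat ((CARD('p) - 1) * card U) * (\<Sum>x\<in>ext U ` (carrier_vec D - U). 1)"
    by (rule sum_fibers[where h = "\<lambda>_. 1"]) (use fib in auto)
  then have "of_nat (card (carrier_vec D - U)) = (of_nat ((CARD('p) - 1) * card U * card (covers D U)) :: complex)"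
    unfolding img by simp
  then have "card (carrier_vec D - U) = (CARD('p) - 1) * card U * card (covers D U)"
    by (simp only: of_nat_eq_iff)
  then show ?thesis using subD(1,5)[OF U] by (simp add: card_Diff_subset)
qed

text \<open>The annihilator reverses inclusions and preserves index \<open>q\<close>, so counting
  covers also counts the subspaces covered by \<open>U\<close>.\<close>

lemma cocovers_perp:
  fixes U :: "'p::prime_card mod_ring vec set"
  assumes U: "sub D U"
  shows "bij_betw (perp D) (cocovers D U) (covers D (perp D U))"
proof (rule bij_betw_byWitness[of _ "perp D"])
  have sp: "sub D (perp D W)" if "sub D W" for W :: "'p mod_ring vec set" using sub_perp subD(1)[OF that] by blast
  have c: "card (perp D W') = CARD('p) * card (perp D W)" if "sub D W" "sub D W'" "card W = CARD('p) * card W'" for W W' :: "'p mod_ring vec set"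
  proof -
    have "card W' * card (perp D W') = card W' * (CARD('p) * card (perp D W))"
      using card_perp[OF that(1)] card_perp[OF that(2)] that(3) by (simp add: mult_ac)
    then show ?thesis using subD(6)[OF that(2)] by simp
  qed
  have ps: "perp D W \<subset> perp D W'" if "sub D W" "sub D W'" "W' \<subset> W" for W W' :: "'p mod_ring vec set"
    using perp_mono[of W' W D] that perp_perp[OF that(1)] perp_perp[OF that(2)] by (metis psubset_eq)
  show "\<forall>W\<in>cocovers D U. perp D (perp D W) = W" using perp_perp by (auto simp: cocovers_def subs_def)
  show "\<forall>W\<in>covers D (perp D U). perp D (perp D W) = W" using perp_perp by (auto simp: covers_def subs_def)
  have "perp D W \<in> covers D (perp D U)" if W: "W \<in> cocovers D U" for W
  proof -
    have W': "sub D W" "W \<subset> U" "card U = CARD('p) * card W" using W by (auto simp: cocovers_def subs_def)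
    show ?thesis
      using sp[OF W'(1)] ps[OF U W'(1,2)] c[OF U W'(1,3)] by (simp add: covers_def subs_def)
  qed
  then show "perp D ` cocovers D U \<subseteq> covers D (perp D U)" by blast
  have "perp D W \<in> cocovers D U" if W: "W \<in> covers D (perp D U)" for W
  proof -
    have W': "sub D W" "perp D U \<subset> W" "card W = CARD('p) * card (perp D U)" using W by (auto simp: covers_def subs_def)
    show ?thesis
      using sp[OF W'(1)] ps[OF W'(1) sp[OF U] W'(2)] c[OF W'(1) sp[OF U] W'(3)] perp_perp[OF U]
      by (simp add: cocovers_def subs_def)
  qed
  then show "perp D ` covers D (perp D U) \<subseteq> cocovers D U" by blast
qed

lemma card_cocovers:
  fixes U :: "'p::prime_card mod_ring vec set"
  assumes U: "sub D U"
  shows "(CARD('p) - 1) * card (cocovers D U) = card U - 1"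
proof -
  have sp: "sub D (perp D U)" using sub_perp subD(1)[OF U] by blast
  let ?t = "card (perp D U)"
  have "?t * ((CARD('p) - 1) * card (cocovers D U)) = CARD('p) ^ D - ?t"
    using card_covers[OF sp] bij_betw_same_card[OF cocovers_perp[OF U]] by (simp add: mult_ac)
  also have "\<dots> = ?t * (card U - 1)" using card_perp[OF U] by (simp add: diff_mult_distrib2 mult.commute)
  finally show ?thesis using subD(6)[OF sp] by simp
qed

section \<open>Numbers of neighbours, as wave sums for the zero matrix\<close>

lemma zero_mat_mult_vec: "v \<in> carrier_vec n \<Longrightarrow> 0\<^sub>m n n *\<^sub>v v = (0\<^sub>v n :: 'a :: comm_ring_1 vec)"
  by (intro eq_vecI) (auto simp: scalar_prod_def)

lemma mat_kernel_zero: "mat_kernel (0\<^sub>m D D :: 'p::prime_card mod_ring mat) = carrier_vec D"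
  using mat_kernel_iff[of "0\<^sub>m D D :: 'p mod_ring mat" D] zero_mat_mult_vec[where 'a = "'p mod_ring"] by auto

lemma mtrace_zero: "M \<in> carrier_mat D D \<Longrightarrow> mtrace (0\<^sub>m D D * M) = 0"
  by (simp add: mtrace_def)

lemma wave_zero:
  assumes "x \<in> max_isotropic D"
  shows "wave D (0\<^sub>m D D) x = 1"
proof -
  obtain M where M: "M \<in> Sym D" "x = lag D (upart D x) M" using max_isotropic_eq_lag[OF assms] .
  have U: "sub D (upart D x)" using sub_upart[OF max_isotropicD(1)[OF assms]] .
  have "mtrace (0\<^sub>m D D * M) = 0" by (rule mtrace_zero[OF Sym_carrier[OF M(1)]])
  then show ?thesis
    using wave_lag[OF Sym_zero U _ M(1)] M(2) subD(1)[OF U] by (simp add: mat_kernel_zero)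
qed

lemma sum_wave_zero: "(\<Sum>x\<in>nbrs D U y. wave D (0\<^sub>m D D) x) = of_nat (card (nbrs D U y))"
proof -
  have "(\<Sum>x\<in>nbrs D U y. wave D (0\<^sub>m D D) x) = (\<Sum>x\<in>nbrs D U y. 1)"
    by (rule sum.cong[OF refl], rule wave_zero) (simp add: nbrs_def)
  then show ?thesis by simp
qed

lemma card_nbrs_above:
  fixes y :: "'p::prime_card mod_ring vec set"
  assumes y: "y \<in> max_isotropic D" and U: "U \<in> cocovers D (upart D y)"
  shows "card U * card (nbrs D U y) = CARD('p) ^ D"
proof -
  obtain M where M: "M \<in> Sym D" "y = lag D (upart D y) M" using max_isotropic_eq_lag[OF y] .
  have sU: "sub D (upart D y)" using sub_upart[OF max_isotropicD(1)[OF y]] .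
  have U': "sub D U" "U \<subset> upart D y" "card (upart D y) = CARD('p) * card U" using U by (auto simp: cocovers_def subs_def)
  have K: "U \<subseteq> mat_kernel (0\<^sub>m D D)" "upart D y \<subseteq> mat_kernel (0\<^sub>m D D)"
    using subD(1)[OF U'(1)] subD(1)[OF sU] by (simp_all add: mat_kernel_zero)
  have "of_nat (card U) * (\<Sum>x\<in>nbrs D U y. wave D (0\<^sub>m D D) x) = of_nat (CARD('p) ^ D)"
    using sum_nbrs_above[OF Sym_zero U'(1) K(1) sU M(1) U'(2,3) zero_mat_mult_vec] M(2)
    unfolding if_P[OF K(2)] mtrace_zero[OF Sym_carrier[OF M(1)]] by simp
  then have "of_nat (card U * card (nbrs D U y)) = (of_nat (CARD('p) ^ D) :: complex)"
    unfolding sum_wave_zero by simp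
  then show ?thesis by (simp only: of_nat_eq_iff)
qed

lemma card_nbrs_below:
  fixes y :: "'p::prime_card mod_ring vec set"
  assumes y: "y \<in> max_isotropic D" and U: "U \<in> covers D (upart D y)"
  shows "card (nbrs D U y) = 1"
proof -
  obtain M where M: "M \<in> Sym D" "y = lag D (upart D y) M" using max_isotropic_eq_lag[OF y] .
  have sU: "sub D (upart D y)" using sub_upart[OF max_isotropicD(1)[OF y]] .
  have U': "sub D U" "upart D y \<subset> U" "card U = CARD('p) * card (upart D y)" using U by (auto simp: covers_def subs_def)
  show ?thesis using nbrs_below[OF U'(1) sU M(1) U'(2,3)] M(2) by simp
qed

lemma card_nbrs_same:
  fixes y :: "'p::prime_card mod_ring vec set"
  assumes y: "y \<in> max_isotropic D"
  shows "card (upart D y) * card (nbrs D (upart D y) y) = CARD('p) ^ D - card (upart D y)"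
proof -
  let ?U = "upart D y" and ?q = "CARD('p)"
  obtain M where M: "M \<in> Sym D" "y = lag D (upart D y) M" using max_isotropic_eq_lag[OF y] .
  have sU: "sub D (upart D y)" using sub_upart[OF max_isotropicD(1)[OF y]] .
  have "(\<Sum>c\<in>UNIV - {0 :: 'p mod_ring}. \<Sum>l\<in>carrier_vec D. chi (c * (l \<bullet> (0\<^sub>m D D *\<^sub>v l))))
      = (\<Sum>c\<in>UNIV - {0 :: 'p mod_ring}. \<Sum>l\<in>(carrier_vec D :: 'p mod_ring vec set). 1)"
    by (intro sum.cong refl) (simp add: zero_mat_mult_vec)
  also have "\<dots> = of_nat ((?q - 1) * ?q ^ D)" by (simp add: card_Diff_subset)
  finally have G: "(\<Sum>c\<in>UNIV - {0 :: 'p mod_ring}. \<Sum>l\<in>carrier_vec D. chi (c * (l \<bullet> (0\<^sub>m D D *\<^sub>v l))))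
      = of_nat ((?q - 1) * ?q ^ D)" .
  have K: "?U \<subseteq> mat_kernel (0\<^sub>m D D)" using subD(1)[OF sU] by (simp add: mat_kernel_zero)
  have "of_nat ((?q - 1) * card ?U) * of_nat (card (nbrs D ?U y))
      = of_nat ((?q - 1) * ?q ^ D) - (of_nat ((?q - 1) * card ?U) :: complex)"
    using sum_nbrs_same[OF Sym_zero sU K M(1)] M(2)
    unfolding G mtrace_zero[OF Sym_carrier[OF M(1)]] sum_wave_zero by simp
  then have "of_nat ((?q - 1) * (card ?U * card (nbrs D ?U y)) + (?q - 1) * card ?U) = (of_nat ((?q - 1) * ?q ^ D) :: complex)"
    by (simp add: mult.assoc)
  then have "(?q - 1) * (card ?U * card (nbrs D ?U y)) + (?q - 1) * card ?U = (?q - 1) * ?q ^ D"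
    by (simp only: of_nat_eq_iff)
  then have "(?q - 1) * (card ?U * card (nbrs D ?U y) + card ?U) = (?q - 1) * ?q ^ D"
    by (simp add: distrib_left)
  then show ?thesis using card_field_gt_1[where 'p = 'p] by simp
qed

text \<open>
  The number of neighbours \<open>x\<close> of \<open>y\<close> in each layer only depends on the layer of \<open>y\<close>,
  so sums of radial functions over neighbourhoods are given by a three-term operator.
\<close>

definition radial :: "real \<Rightarrow> nat \<Rightarrow> (nat \<Rightarrow> complex) \<Rightarrow> nat \<Rightarrow> nat \<Rightarrow> complex" where
  "radial q D g p u = of_real ((q ^ D - u) / ((q - 1) * u)) * g (p * u) + of_real (q ^ D / u - 1) * g u
     + of_real ((u - 1) / (q - 1) * (q ^ (D + 1) / u)) * g (u div p)"

text \<open>The coefficients are counts: \<open>(q^D - u) / ((q - 1) u)\<close> covers with one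
  neighbour each, \<open>q^D / u - 1\<close> neighbours over the same subspace, and
  \<open>(u - 1) / (q - 1)\<close> covered subspaces of size \<open>u / q\<close>, each with
  \<open>q^D / (u / q)\<close> neighbours.\<close>

lemma sum_nbrs_radial:
  fixes y :: "'p::prime_card mod_ring vec set"
  assumes y: "y \<in> max_isotropic D"
  shows "(\<Sum>U\<in>subs D. \<Sum>x\<in>nbrs D U y. g (card (upart D x))) = radial (real CARD('p)) D g CARD('p) (card (upart D y))"
proof -
  let ?U = "upart D y" and ?q = "CARD('p)"
  have q1: "real ?q > 1" using card_field_gt_1[where 'p = 'p] by simp
  have q1': "real (?q - 1) = real ?q - 1" using q1 by (simp add: of_nat_diff)
  have sU: "sub D ?U" using sub_upart[OF max_isotropicD(1)[OF y]] .
  have u0: "real (card ?U) > 0" using subD(6)[OF sU] by simp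
  have uq: "card ?U \<le> ?q ^ D" using card_mono[OF finite_vec subD(1)[OF sU]] by simp
  have const: "(\<Sum>x\<in>nbrs D U y. g (card (upart D x))) = of_real (real (card (nbrs D U y))) * g (card U)" for U
    by (simp add: nbrs_def)
  have same: "real (card (nbrs D ?U y)) = real ?q ^ D / real (card ?U) - 1"
  proof -
    have "real (card ?U * card (nbrs D ?U y)) = real (?q ^ D - card ?U)" using card_nbrs_same[OF y] by simp
    then have "real (card ?U) * real (card (nbrs D ?U y)) = real ?q ^ D - real (card ?U)" using uq by (simp add: of_nat_diff)
    then show ?thesis using u0 by (simp add: field_simps)
  qed
  have up: "(\<Sum>U\<in>covers D ?U. \<Sum>x\<in>nbrs D U y. g (card (upart D x)))
      = of_real ((real ?q ^ D - card ?U) / ((real ?q - 1) * card ?U)) * g (?q * card ?U)"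
  proof -
    have "(\<Sum>U\<in>covers D ?U. \<Sum>x\<in>nbrs D U y. g (card (upart D x))) = (\<Sum>U\<in>covers D ?U. g (?q * card ?U))"
      unfolding const using card_nbrs_below[OF y] by (intro sum.cong) (auto simp: covers_def)
    moreover have "real (card (covers D ?U)) = (real ?q ^ D - card ?U) / ((real ?q - 1) * card ?U)"
    proof -
      have "real ((?q - 1) * card ?U * card (covers D ?U)) = real (?q ^ D - card ?U)" using card_covers[OF sU] by simp
      then have "(real ?q - 1) * real (card ?U) * real (card (covers D ?U)) = real ?q ^ D - real (card ?U)"
        using uq q1' by (simp add: of_nat_diff)
      then show ?thesis using u0 q1 by (simp add: field_simps)
    qed
    moreover have "of_nat (card (covers D ?U)) = complex_of_real (real (card (covers D ?U)))" by simp
    ultimately show ?thesis by (simp only: sum_constant)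
  qed
  have down: "(\<Sum>U\<in>cocovers D ?U. \<Sum>x\<in>nbrs D U y. g (card (upart D x)))
      = of_real ((real (card ?U) - 1) / (real ?q - 1) * (real ?q ^ (D + 1) / card ?U)) * g (card ?U div ?q)"
  proof -
    have "(\<Sum>x\<in>nbrs D U y. g (card (upart D x))) = of_real (real ?q ^ (D + 1) / card ?U) * g (card ?U div ?q)"
      if U: "U \<in> cocovers D ?U" for U
    proof -
      have cU: "card ?U = ?q * card U" "sub D U" using U by (auto simp: cocovers_def subs_def)
      have "real (card U) * real (card (nbrs D U y)) = real ?q ^ D"
        using card_nbrs_above[OF y U] by (metis of_nat_mult of_nat_power)
      then have "real (card (nbrs D U y)) = real ?q ^ (D + 1) / card ?U"
        using cU(1) subD(6)[OF cU(2)] q1 by (simp add: field_simps)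
      moreover have "card ?U div ?q = card U" using cU(1) by simp
      ultimately show ?thesis unfolding const by simp
    qed
    then have "(\<Sum>U\<in>cocovers D ?U. \<Sum>x\<in>nbrs D U y. g (card (upart D x)))
        = (\<Sum>U\<in>cocovers D ?U. of_real (real ?q ^ (D + 1) / card ?U) * g (card ?U div ?q))" by (rule sum.cong[OF refl])
    also have "\<dots> = of_real (real (card (cocovers D ?U))) * (of_real (real ?q ^ (D + 1) / card ?U) * g (card ?U div ?q))"
      by simp
    also have "real (card (cocovers D ?U)) = (real (card ?U) - 1) / (real ?q - 1)"
    proof -
      have "real ((?q - 1) * card (cocovers D ?U)) = real (card ?U - 1)" using card_cocovers[OF sU] by simp
      then have "(real ?q - 1) * real (card (cocovers D ?U)) = real (card ?U) - 1"
        using q1' subD(6)[OF sU] by (simp add: of_nat_diff)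
      then show ?thesis using q1 by (simp add: field_simps)
    qed
    finally show ?thesis by (simp add: mult.assoc)
  qed
  show ?thesis
    unfolding sum_nbrs_split[OF y] up down unfolding const same radial_def by (simp only: add_ac)
qed

section \<open>The reference subspaces \<open>x_i\<close> as Lagrangians\<close>

lemma sub_supportI:
  assumes W: "sub n W" and J: "\<And>j. j \<in> J \<Longrightarrow> unit_vec n j \<in> W"
    and v: "v \<in> carrier_vec n" "\<And>j. j < n \<Longrightarrow> j \<notin> J \<Longrightarrow> v $ j = 0"
  shows "v \<in> W"
proof -
  have "v \<in> W" if "k \<le> n" "v \<in> std n k" "\<And>j. j < n \<Longrightarrow> j \<notin> J \<Longrightarrow> v $ j = 0" for k v
    using that
  proof (induction k arbitrary: v)
    case 0
    then show ?case using subD(2)[OF W] by (simp add: std_0)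
  next
    case (Suc k)
    let ?a = "vec n (\<lambda>j. if j = k then 0 else v $ j)"
    have "?a \<in> W" using Suc.prems by (intro Suc.IH) (auto simp: std_def)
    moreover have "(v $ k) \<cdot>\<^sub>v unit_vec n k \<in> W"
    proof (cases "k \<in> J")
      case True
      then show ?thesis using J subD(4)[OF W] by blast
    next
      case False
      then have "(v $ k) \<cdot>\<^sub>v unit_vec n k = 0\<^sub>v n" using Suc.prems by auto
      then show ?thesis using subD(2)[OF W] by simp
    qed
    moreover have "v = ?a + (v $ k) \<cdot>\<^sub>v unit_vec n k"
      using Suc.prems by (intro eq_vecI) (auto simp: std_def)
    ultimately show ?case using subD(3)[OF W] by metis
  qed
  from this[of n v] v show ?thesis by simp
qed

lemma perp_std:
  assumes "k \<le> n"
  shows "b \<in> perp n (std n k) \<longleftrightarrow> b \<in> carrier_vec n \<and> (\<forall>j<k. b $ j = (0 :: 'p::prime_card mod_ring))"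
proof
  assume b: "b \<in> perp n (std n k)"
  then have bc: "b \<in> carrier_vec n" using perp_carrier by blast
  have "b $ j = 0" if "j < k" for j
  proof -
    have "unit_vec n j \<in> (std n k :: 'p mod_ring vec set)" using that by (auto simp: std_def)
    then have "unit_vec n j \<bullet> b = 0" using perpD[OF b] by blast
    then show ?thesis using bc that assms by simp
  qed
  then show "b \<in> carrier_vec n \<and> (\<forall>j<k. b $ j = 0)" using bc by simp
next
  assume b: "b \<in> carrier_vec n \<and> (\<forall>j<k. b $ j = 0)"
  have "a \<bullet> b = 0" if "a \<in> std n k" for a
  proof -
    have "a $ i * b $ i = 0" if "i < n" for i using \<open>a \<in> std n k\<close> b that by (cases "i < k") (auto simp: std_def)
    then show ?thesis using b by (auto simp: scalar_prod_def intro!: sum.neutral)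
  qed
  then show "b \<in> perp n (std n k)" using b by (simp add: perp_def)
qed

lemma sub_fspan:
  assumes "A \<subseteq> carrier_vec n"
  shows "sub n (fspan n (A :: 'p::prime_card mod_ring vec set))" "A \<subseteq> fspan n A"
    "\<And>W. sub n W \<Longrightarrow> A \<subseteq> W \<Longrightarrow> fspan n A \<subseteq> W"
proof -
  interpret vec_space "TYPE('p mod_ring)" n .
  show "sub n (fspan n A)" using span_is_subspace[OF assms] by (simp add: fsubspace_iff)
  show "A \<subseteq> fspan n A" using in_own_span[OF assms] .
  show "fspan n A \<subseteq> W" if W: "sub n W" "A \<subseteq> W" for W
  proof -
    have "fsubspace n W" using W(1) by (simp only: fsubspace_iff)
    then show ?thesis using span_is_subset[OF W(2)] by (simp add: VectorSpace.subspace_def)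
  qed
qed

lemma x_sub_eq_lag:
  assumes i: "i \<le> D"
  shows "x_sub D i = (lag D (std D (D - i)) (0\<^sub>m D D) :: 'p::prime_card mod_ring vec set)"
proof -
  let ?E = "e_vec D ` {1..D - i} :: 'p mod_ring vec set" and ?F = "f_vec D ` {D - i + 1..D} :: 'p mod_ring vec set"
  let ?L = "lag D (std D (D - i)) (0\<^sub>m D D) :: 'p mod_ring vec set"
  have EF: "?E \<subseteq> carrier_vec (2 * D)" "?F \<subseteq> carrier_vec (2 * D)" by (auto simp: e_vec_def f_vec_def)
  have sum: "x_sub D i = {u + v | u v. u \<in> fspan (2 * D) ?E \<and> v \<in> fspan (2 * D) ?F}"
  proof -
    interpret vec_space "TYPE('p mod_ring)" "2 * D" .
    show ?thesis unfolding x_sub_def submodule_sum_def by (auto simp: module_vec_simps)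
  qed
  have mem: "a @\<^sub>v b \<in> ?L \<longleftrightarrow> a \<in> std D (D - i) \<and> b \<in> carrier_vec D \<and> (\<forall>j<D - i. b $ j = 0)"
    if a: "a \<in> carrier_vec D" for a b
  proof -
    have "a - 0\<^sub>m D D *\<^sub>v b = a" if "b \<in> carrier_vec D"
      using that a by (auto simp: zero_mat_mult_vec)
    then show ?thesis unfolding lag_iff[OF a] perp_std[OF diff_le_self] by auto
  qed
  have sL: "sub (2 * D) ?L" using sub_lag[OF sub_std Sym_zero] .
  have "?E \<subseteq> ?L"
  proof
    fix x assume "x \<in> ?E"
    then obtain m where m: "1 \<le> m" "m \<le> D - i" "x = e_vec D m" by auto
    have "x = unit_vec D (m - 1) @\<^sub>v 0\<^sub>v D" unfolding m(3) e_vec_def using m by (intro eq_vecI) auto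
    then show "x \<in> ?L" using m mem[of "unit_vec D (m - 1)" "0\<^sub>v D"] by (auto simp: std_def)
  qed
  moreover have "?F \<subseteq> ?L"
  proof
    fix x assume "x \<in> ?F"
    then obtain m where m: "D - i + 1 \<le> m" "m \<le> D" "x = f_vec D m" by auto
    have "x = 0\<^sub>v D @\<^sub>v unit_vec D (m - 1)" unfolding m(3) f_vec_def using m by (intro eq_vecI) auto
    then show "x \<in> ?L" using m mem[of "0\<^sub>v D" "unit_vec D (m - 1)"] by (auto simp: std_def)
  qed
  ultimately have "x_sub D i \<subseteq> ?L"
    unfolding sum using sub_fspan(3)[OF EF(1) sL] sub_fspan(3)[OF EF(2) sL] subD(3)[OF sL] by blast
  moreover have "?L \<subseteq> x_sub D i"
  proof
    fix x assume x: "x \<in> ?L"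
    then have "x \<in> carrier_vec (2 * D)" using subD(1)[OF sL] by blast
    then obtain a b where ab: "a \<in> carrier_vec D" "b \<in> carrier_vec D" "x = a @\<^sub>v b" by (rule carrier_vec_split)
    have m: "a \<in> std D (D - i)" "\<forall>j<D - i. b $ j = 0" using mem[OF ab(1)] x ab by auto
    have "a @\<^sub>v 0\<^sub>v D \<in> fspan (2 * D) ?E"
    proof (rule sub_supportI[OF sub_fspan(1)[OF EF(1)], of "{..<D - i}"])
      fix j assume "j \<in> {..<D - i}"
      then have "e_vec D (Suc j) \<in> ?E" by (intro imageI) auto
      moreover have "unit_vec (2 * D) j = e_vec D (Suc j)" by (simp add: e_vec_def)
      ultimately show "unit_vec (2 * D) j \<in> fspan (2 * D) ?E" using subsetD[OF sub_fspan(2)[OF EF(1)]] by metis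
    next
      fix j assume "j < 2 * D" "j \<notin> {..<D - i}"
      then show "(a @\<^sub>v 0\<^sub>v D) $ j = 0" using m(1) ab by (cases "j < D") (auto simp: std_def)
    qed (use ab in simp)
    moreover have "0\<^sub>v D @\<^sub>v b \<in> fspan (2 * D) ?F"
    \<comment> \<open>\<open>f_vec D m\<close> has index \<open>D + m - 1\<close>, so the vectors
      with \<open>m \<ge> D - i + 1\<close> occupy the positions from \<open>D + (D - i)\<close>
      on.\<close>
    proof (rule sub_supportI[OF sub_fspan(1)[OF EF(2)], of "{D + (D - i)..<2 * D}"])
      fix j assume j: "j \<in> {D + (D - i)..<2 * D}"
      have "D + (Suc j - D) - 1 = j" using j by auto
      then have "unit_vec (2 * D) j = f_vec D (Suc j - D)" by (simp add: f_vec_def)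
      moreover have "f_vec D (Suc j - D) \<in> ?F" using j by (intro imageI) auto
      ultimately show "unit_vec (2 * D) j \<in> fspan (2 * D) ?F" using subsetD[OF sub_fspan(2)[OF EF(2)]] by metis
    next
      fix j assume "j < 2 * D" "j \<notin> {D + (D - i)..<2 * D}"
      then show "(0\<^sub>v D @\<^sub>v b) $ j = 0" using m(2) ab by (cases "j < D") auto
    qed (use ab in simp)
    moreover have "x = (a @\<^sub>v 0\<^sub>v D) + (0\<^sub>v D @\<^sub>v b)"
      unfolding ab(3) using append_vec_add[OF ab(1) zero_carrier_vec zero_carrier_vec ab(2)] ab by simp
    ultimately show "x \<in> x_sub D i" unfolding sum by blast
  qed
  ultimately show ?thesis by blast
qed

section \<open>Symmetry of the adjacency operator and layer sums of eigenvectors\<close>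

lemma dpg_A_symmetric:
  "(\<Sum>y\<in>max_isotropic D. f y * dpg_A D v y) = (\<Sum>x\<in>max_isotropic D. dpg_A D f x * v (x :: 'p::prime_card mod_ring vec set))"
proof -
  have sym: "dpg_adj D y x = dpg_adj D x y" for x y :: "'p mod_ring vec set"
    by (simp add: dpg_adj_def Int_commute)
  have "(\<Sum>y\<in>max_isotropic D. f y * dpg_A D v y)
      = (\<Sum>y\<in>max_isotropic D. \<Sum>x\<in>max_isotropic D. dpg_adj D x y * f y * v x)"
    unfolding dpg_A_def mat_op_def using sym by (intro sum.cong refl) (simp add: sum_distrib_left mult_ac)
  also have "\<dots> = (\<Sum>x\<in>max_isotropic D. \<Sum>y\<in>max_isotropic D. dpg_adj D x y * f y * v x)" by (rule sum.swap)
  also have "\<dots> = (\<Sum>x\<in>max_isotropic D. dpg_A D f x * v x)"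
    unfolding dpg_A_def mat_op_def by (intro sum.cong refl) (simp add: sum_distrib_right)
  finally show ?thesis .
qed

lemma dpg_A_radial:
  fixes y :: "'p::prime_card mod_ring vec set"
  assumes "D \<ge> 1" "y \<in> max_isotropic D"
  shows "dpg_A D (\<lambda>x. g (card (upart D x))) y = radial (real CARD('p)) D g CARD('p) (card (upart D y))"
  using dpg_A_nbrs[OF assms] sum_nbrs_radial[OF assms(2)] by simp

lemma card_upart:
  fixes x :: "'p::prime_card mod_ring vec set"
  assumes "x \<in> max_isotropic D"
  obtains k where "k \<le> D" "card (upart D x) = CARD('p) ^ k"
  using sub_card_obtain[OF sub_upart[OF max_isotropicD(1)[OF assms]]] .

lemma x_sub_0:
  "(x_sub D 0 :: 'p::prime_card mod_ring vec set) \<in> max_isotropic D"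
  "upart D (x_sub D 0 :: 'p mod_ring vec set) = carrier_vec D"
  using lag_max_isotropic[OF sub_carrier Sym_zero, where 'a = 'p] upart_lag[OF sub_carrier Sym_zero, where 'a = 'p]
    x_sub_eq_lag[of 0 D, where 'p = 'p] by simp_all

lemma max_isotropic_top:
  fixes x :: "'p::prime_card mod_ring vec set"
  assumes x: "x \<in> max_isotropic D" and c: "card (upart D x) = CARD('p) ^ D"
  shows "x = x_sub D 0"
proof -
  have "upart D x = carrier_vec D"
    using card_subset_eq[OF finite_vec subD(1)[OF sub_upart[OF max_isotropicD(1)[OF x]]]] c by simp
  then obtain M where M: "M \<in> Sym D" "x = lag D (carrier_vec D) M" using max_isotropic_eq_lag[OF x] by metis
  have "lag D (carrier_vec D) M = lag D (carrier_vec D) (0\<^sub>m D D)"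
    unfolding lag_eq_iff[OF sub_carrier M(1) Sym_zero]
  proof
    fix b assume "b \<in> perp D (carrier_vec D :: 'p mod_ring vec set)"
    then have "b \<in> carrier_vec D" using perp_carrier by blast
    then show "M *\<^sub>v b - 0\<^sub>m D D *\<^sub>v b \<in> carrier_vec D"
      by (intro minus_carrier_vec Sym_mult_carrier[OF M(1)] Sym_mult_carrier[OF Sym_zero])
  qed
  then show ?thesis using M(2) x_sub_eq_lag[of 0 D, where 'p = 'p] by simp
qed

text \<open>
  Along the distance from \<open>x_0\<close> the layer sums of an eigenvector satisfy a three-term recurrence with
  non-zero leading coefficient, so they are determined by the value at \<open>x_0\<close>.
\<close>

lemma eigenvector_layer_sum_zero:
  fixes z :: "'p::prime_card mod_ring vec set \<Rightarrow> complex"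
  assumes D: "D \<ge> 1" and ev: "\<And>y. y \<in> max_isotropic D \<Longrightarrow> dpg_A D z y = \<theta> * z y"
    and z0: "z (x_sub D 0) = 0"
  shows "(\<Sum>x\<in>{x \<in> max_isotropic D. card (upart D x) = CARD('p) ^ k}. z x) = 0"
proof -
  let ?X = "max_isotropic D :: 'p mod_ring vec set set" and ?q = "CARD('p)"
  define Ls where "Ls u = (\<Sum>x\<in>{x \<in> ?X. card (upart D x) = u}. z x)" for u
  have Ls_if: "(\<Sum>x\<in>?X. (if card (upart D x) = u then f (card (upart D x)) else 0) * z x) = f u * Ls u" for u f
    unfolding Ls_def sum_distrib_left sum.inter_filter[OF finite_max_isotropic] by (intro sum.cong) auto
  have big: "Ls (?q ^ k) = 0" if "k > D" for k
  proof -
    have "card (upart D x) \<noteq> ?q ^ k" if "x \<in> ?X" for x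
    proof -
      obtain j where "j \<le> D" "card (upart D x) = ?q ^ j" using card_upart[OF \<open>x \<in> ?X\<close>] .
      then show ?thesis using \<open>k > D\<close> card_field_gt_1[where 'p = 'p] by (simp add: power_inject_exp)
    qed
    then have "{x \<in> ?X. card (upart D x) = ?q ^ k} = {}" by blast
    then show ?thesis unfolding Ls_def by (simp only: sum.empty)
  qed
  have rec: "of_real ((real ?q ^ D - real ?q ^ k) / ((real ?q - 1) * real ?q ^ k)) * Ls (?q ^ k) = 0"
    if k: "k < D" "Ls (?q ^ Suc k) = 0" "Ls (?q ^ Suc (Suc k)) = 0" for k
  proof -
    define u where "u = ?q ^ Suc k"
    \<comment> \<open>The eigenvector is paired with the indicator of layer \<open>Suc k\<close>.
      Its image under the adjacency operator lives on three consecutive layers, and only the lowest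
      of them is not yet known to have sum zero.\<close>
    define g :: "nat \<Rightarrow> complex" where "g v = (if v = u then 1 else 0)" for v
    define a where "a v = complex_of_real ((real ?q ^ D - real v) / ((real ?q - 1) * real v))" for v :: nat
    define b where "b v = complex_of_real (real ?q ^ D / real v - 1)" for v :: nat
    define c where "c v = complex_of_real ((real v - 1) / (real ?q - 1) * (real ?q ^ (D + 1) / real v))" for v :: nat
    have g: "radial (real ?q) D g ?q (card (upart D x))
        = (if card (upart D x) = ?q ^ k then a (card (upart D x)) else 0)
        + (if card (upart D x) = u then b (card (upart D x)) else 0)
        + (if card (upart D x) = ?q ^ Suc (Suc k) then c (card (upart D x)) else 0)" if x: "x \<in> ?X" for x
    proof -
      obtain j where j: "card (upart D x) = ?q ^ j" using card_upart[OF x] .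
      have q1: "?q > 1" by (rule card_field_gt_1)
      have "?q * ?q ^ j = u \<longleftrightarrow> ?q ^ j = ?q ^ k" using q1 by (simp add: u_def)
      moreover have "c (?q ^ j) * g (?q ^ j div ?q) = (if ?q ^ j = ?q ^ Suc (Suc k) then c (?q ^ j) else 0)"
      proof (cases j)
        \<comment> \<open>At the bottom layer \<open>1 div q\<close> is no layer size, but the
          coefficient \<open>c\<close> vanishes at 1.\<close>
        case 0
        have "?q ^ Suc (Suc k) > 1" using q1 by (intro one_less_power) auto
        then show ?thesis using 0 by (simp add: c_def)
      next
        case (Suc i)
        then show ?thesis using q1 by (simp add: g_def u_def power_inject_exp)
      qed
      ultimately show ?thesis unfolding j radial_def a_def[symmetric] b_def[symmetric] c_def[symmetric]
        by (simp add: g_def)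
    qed
    have "0 = \<theta> * (\<Sum>x\<in>?X. g (card (upart D x)) * z x)"
      using Ls_if[of u "\<lambda>_. 1"] k(2) by (simp add: g_def u_def)
    also have "\<dots> = (\<Sum>x\<in>?X. g (card (upart D x)) * dpg_A D z x)"
      using ev by (simp add: sum_distrib_left mult_ac)
    also have "\<dots> = (\<Sum>x\<in>?X. dpg_A D (\<lambda>x. g (card (upart D x))) x * z x)" by (rule dpg_A_symmetric)
    also have "\<dots> = (\<Sum>x\<in>?X. radial (real ?q) D g ?q (card (upart D x)) * z x)"
      using dpg_A_radial[OF D, where 'p = 'p] by (intro sum.cong refl) simp
    also have "\<dots> = (\<Sum>x\<in>?X. (if card (upart D x) = ?q ^ k then a (card (upart D x)) else 0) * z x)
        + (\<Sum>x\<in>?X. (if card (upart D x) = u then b (card (upart D x)) else 0) * z x)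
        + (\<Sum>x\<in>?X. (if card (upart D x) = ?q ^ Suc (Suc k) then c (card (upart D x)) else 0) * z x)"
      unfolding sum.distrib[symmetric] by (intro sum.cong refl) (simp only: g distrib_right)
    also have "\<dots> = a (?q ^ k) * Ls (?q ^ k)" unfolding Ls_if using k(2,3) by (simp add: u_def)
    finally show ?thesis by (simp add: a_def)
  qed
  have top: "Ls (?q ^ D) = 0"
  proof -
    have "{x \<in> ?X. card (upart D x) = ?q ^ D} = {x_sub D 0}"
    proof (intro equalityI subsetI)
      fix x assume "x \<in> {x \<in> ?X. card (upart D x) = ?q ^ D}"
      then show "x \<in> {x_sub D 0}" using max_isotropic_top[of x D] by blast
    next
      fix x :: "'p mod_ring vec set" assume "x \<in> {x_sub D 0}"
      then show "x \<in> {x \<in> ?X. card (upart D x) = ?q ^ D}" using x_sub_0[of D, where 'p = 'p] by simp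
    qed
    then show ?thesis unfolding Ls_def using z0 by simp
  qed
  \<comment> \<open>Two adjacent layers are carried along because the recurrence has three terms. It
    descends from \<open>x_0\<close>, the only vertex of layer \<open>D\<close>, with the empty
    layer above as the other start value.\<close>
  have "Ls (?q ^ k) = 0 \<and> Ls (?q ^ Suc k) = 0" if "k \<le> D" for k
    using that
  proof (induction k rule: inc_induct)
    case base
    then show ?case using top big[of "Suc D"] by simp
  next
    case (step k)
    have q1: "real ?q > 1" using card_field_gt_1[where 'p = 'p] by simp
    have "real ?q ^ k < real ?q ^ D" using step.hyps q1 by simp
    then have "(real ?q ^ D - real ?q ^ k) / ((real ?q - 1) * real ?q ^ k) \<noteq> 0" using q1 by simp
    then show ?case using rec[of k] step by (simp only: mult_eq_0_iff of_real_eq_0_iff) simp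
  qed
  then have "Ls (?q ^ k) = 0" using big[of k] by (cases "k \<le> D") auto
  then show ?thesis by (simp add: Ls_def)
qed

lemma eigenvector_radial_sum_zero:
  fixes z :: "'p::prime_card mod_ring vec set \<Rightarrow> complex"
  assumes D: "D \<ge> 1" and ev: "\<And>y. y \<in> max_isotropic D \<Longrightarrow> dpg_A D z y = \<theta> * z y"
    and z0: "z (x_sub D 0) = 0"
  shows "(\<Sum>x\<in>max_isotropic D. h (card (upart D x)) * z x) = 0"
proof -
  let ?X = "max_isotropic D :: 'p mod_ring vec set set"
  let ?I = "(\<lambda>x. card (upart D x)) ` ?X"
  have "(\<Sum>x\<in>?X. h (card (upart D x)) * z x) = (\<Sum>u\<in>?I. \<Sum>x\<in>{x \<in> ?X. card (upart D x) = u}. h (card (upart D x)) * z x)"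
    by (rule sum.image_gen[OF finite_max_isotropic])
  also have "\<dots> = (\<Sum>u\<in>?I. h u * (\<Sum>x\<in>{x \<in> ?X. card (upart D x) = u}. z x))"
    by (intro sum.cong refl) (simp add: sum_distrib_left)
  also have "\<dots> = 0"
  proof (intro sum.neutral ballI)
    fix u assume "u \<in> ?I"
    then obtain x where "x \<in> ?X" "u = card (upart D x)" by auto
    then obtain k where "u = CARD('p) ^ k" using card_upart by metis
    then show "h u * (\<Sum>x\<in>{x \<in> ?X. card (upart D x) = u}. z x) = 0"
      using eigenvector_layer_sum_zero[OF D ev z0, of k] by simp
  qed
  finally show ?thesis .
qed

subsection \<open>The dual adjacency matrix\<close>

text \<open>On powers of \<open>p\<close> the integer quotient is the real one, except at
  \<open>u = 1\<close>, where the factor \<open>u - 1\<close> removes the term.\<close>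

lemma radial_real:
  assumes "u = p ^ k" "p > 1"
  shows "radial (real p) D (\<lambda>u. of_real (h (real u))) p u = of_real
    ((real p ^ D - u) / ((real p - 1) * u) * h (p * u) + (real p ^ D / u - 1) * h u
      + (real u - 1) / (real p - 1) * (real p ^ (D + 1) / u) * h (u / p))"
proof (cases k)
  case 0
  then show ?thesis using assms by (simp add: radial_def)
next
  case (Suc j)
  then have "real (u div p) = real u / real p" using assms by simp
  then show ?thesis unfolding radial_def by simp
qed

text \<open>With \<open>Q = q^D\<close> the right-hand side is the valency of the graph.\<close>

lemma moment_0:
  fixes q u Q :: real
  assumes "q > 1" "u > 0"
  shows "(Q - u) / ((q - 1) * u) * 1 + (Q / u - 1) * 1 + (u - 1) / (q - 1) * (q * Q / u) * 1 = (q * Q - q) / (q - 1)"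
  using assms by (simp add: divide_simps) (simp add: algebra_simps)

text \<open>On \<open>s = u / Q\<close> the three-term operator acts as
  \<open>dpg_theta q D 1\<close> up to the constant 2, which is why an affine function of
  \<open>s\<close> can be an eigenvector.\<close>

lemma moment_1:
  fixes q u Q :: real
  assumes "q > 1" "u > 0" "Q > 0"
  shows "(Q - u) / ((q - 1) * u) * (q * u / Q) + (Q / u - 1) * (u / Q) + (u - 1) / (q - 1) * (q * Q / u) * (u / q / Q)
    = 2 + (1 - q + Q - q) / (q - 1) * (u / Q)"
  using assms by (simp add: divide_simps) (simp add: algebra_simps)

text \<open>On the square of \<open>s = u / (q R)\<close> the operator is triangular. With
  \<open>R = q^(D - 1)\<close> the coefficient of the square is \<open>dpg_theta q D 2\<close>, and
  what remains is a multiple of \<open>s\<close>.\<close>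

lemma moment_2:
  fixes q u R :: real
  assumes "q > 1" "u > 0" "R > 0"
  shows "(q * R - u) / ((q - 1) * u) * (q * u / (q * R))^2 + (q * R / u - 1) * (u / (q * R))^2
      + (u - 1) / (q - 1) * (q * (q * R) / u) * (u / q / (q * R))^2
    = (R - q^2 - q + 1) / (q - 1) * (u / (q * R))^2 + (q + 1)^2 / q * (u / (q * R))"
  using assms by (simp add: divide_simps power2_eq_square) (simp add: algebra_simps)

text \<open>The fractions \<open>2 / (q R + 1)\<close> and the longer factor after
  \<open>c1^2\<close> are the means of \<open>s\<close> and \<open>s^2\<close> over all vertices. So
  the mean square of \<open>c0 + c1 s\<close> equals its value at \<open>x_0\<close>, where
  \<open>s = 1\<close>.\<close>

lemma dual_norm:
  fixes q R :: real
  assumes q: "q > 1" and R: "R > 0"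
  defines "c0 \<equiv> - (q * (R + 1) / (q - 1))" and "c1 \<equiv> q * (R + 1) * (q * R + 1) / (2 * (q - 1))"
  shows "c0^2 + 2 * c0 * c1 * (2 / (q * R + 1)) + c1^2 * ((q + 1)^2 / q / ((q + 1) * (R + 1)) * (2 / (q * R + 1))) = c0 + c1"
proof -
  define Q1 where "Q1 = q * R + 1"
  have nz: "Q1 > 0" "R + 1 > 0" "q + 1 > 0" "q > 0" "q - 1 > 0"
    using q R by (auto simp: Q1_def add_pos_pos)
  have c1: "c1 = - (c0 * Q1 / 2)" unfolding c0_def c1_def Q1_def by simp
  have e1: "2 * c0 * c1 * (2 / Q1) = - 2 * c0^2"
    unfolding c1 using nz by (simp add: power2_eq_square)
  have f1: "(q + 1)^2 / q / ((q + 1) * (R + 1)) = (q + 1) / (q * (R + 1))"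
  proof -
    have "a^2 / q / (a * b) = a / (q * b)" if "a \<noteq> 0" for a b :: real
      using that by (simp add: power2_eq_square)
    then show ?thesis using nz by simp
  qed
  have f2: "c1^2 * (2 / Q1) = c0 * (c0 * Q1 / 2)"
    unfolding c1 using nz by (simp add: power2_eq_square)
  have e2: "c1^2 * ((q + 1)^2 / q / ((q + 1) * (R + 1)) * (2 / Q1)) = c0 * ((c0 * Q1 / 2) * ((q + 1) / (q * (R + 1))))"
  proof -
    have "c1^2 * ((q + 1)^2 / q / ((q + 1) * (R + 1)) * (2 / Q1)) = (c1^2 * (2 / Q1)) * ((q + 1)^2 / q / ((q + 1) * (R + 1)))"
      by (simp only: mult_ac)
    also have "\<dots> = c0 * (c0 * Q1 / 2) * ((q + 1) / (q * (R + 1)))" unfolding f1 f2 ..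
    finally show ?thesis by (simp only: mult.assoc)
  qed
  have e3: "c0 / (q * (R + 1)) = - (1 / (q - 1))"
  proof -
    have "- (w / d) / w = - (1 / d)" if "w \<noteq> 0" for w d :: real using that by simp
    then show ?thesis unfolding c0_def using nz by simp
  qed
  have "(c0 * Q1 / 2) * ((q + 1) / (q * (R + 1))) = (c0 / (q * (R + 1))) * (Q1 * (q + 1) / 2)"
    by (simp add: mult_ac)
  also have "\<dots> = - (Q1 * (q + 1) / (2 * (q - 1)))" unfolding e3 by simp
  finally have e4: "(c0 * Q1 / 2) * ((q + 1) / (q * (R + 1))) = - (Q1 * (q + 1) / (2 * (q - 1)))" .
  have "q * (R + 1) / (q - 1) - Q1 * (q + 1) / (2 * (q - 1)) = 1 - Q1 / 2"
    unfolding Q1_def using nz by (simp add: divide_simps) (simp add: algebra_simps)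
  then have e5: "- c0 - Q1 * (q + 1) / (2 * (q - 1)) = 1 - Q1 / 2" unfolding c0_def by simp
  have "c0^2 + 2 * c0 * c1 * (2 / Q1) + c1^2 * ((q + 1)^2 / q / ((q + 1) * (R + 1)) * (2 / Q1))
      = c0 * (- c0 - Q1 * (q + 1) / (2 * (q - 1)))"
    unfolding e1 e2 e4 by (simp add: power2_eq_square algebra_simps)
  also have "\<dots> = c0 + c1" unfolding e5 c1 by (simp add: algebra_simps)
  finally show ?thesis unfolding Q1_def .
qed

text \<open>The dual eigenvalue of the layer in which \<open>x \<inter> x_0\<close> has
  \<open>u\<close> elements, written so that the variable \<open>u / q ^ D\<close> is 1 at
  \<open>x_0\<close>.\<close>

definition dual_ev :: "real \<Rightarrow> nat \<Rightarrow> real \<Rightarrow> real" where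
  "dual_ev q D u = - (q * (q ^ (D - 1) + 1) / (q - 1))
    + q * (q ^ (D - 1) + 1) * (q ^ D + 1) / (2 * (q - 1)) * (u / q ^ D)"

section \<open>Orthogonal projections of functions on a finite set\<close>

lemma sum_fun_apply: "(\<Sum>x\<in>B. f x) y = (\<Sum>x\<in>B. f x y)"
  by (induction B rule: infinite_finite_induct) auto

lemma span_ket:
  assumes "finite B"
  shows "v \<in> cfun.span (ket ` B) \<longleftrightarrow> (\<forall>x. x \<notin> B \<longrightarrow> v x = 0)"
proof
  assume "v \<in> cfun.span (ket ` B)"
  moreover have "cfun.span (ket ` B) \<subseteq> {v. \<forall>x. x \<notin> B \<longrightarrow> v x = 0}"
    by (rule cfun.span_minimal) (auto simp: ket_def cfun.subspace_def cscale_def)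
  ultimately show "\<forall>x. x \<notin> B \<longrightarrow> v x = 0" by blast
next
  assume v: "\<forall>x. x \<notin> B \<longrightarrow> v x = 0"
  have "v = (\<Sum>x\<in>B. cscale (v x) (ket x))"
  proof
    fix y
    have "(\<Sum>x\<in>B. cscale (v x) (ket x)) y = (\<Sum>x\<in>B. if y = x then v x else 0)"
      unfolding sum_fun_apply by (intro sum.cong) (auto simp: cscale_def ket_def)
    then show "v y = (\<Sum>x\<in>B. cscale (v x) (ket x)) y" using assms v by (simp add: sum.delta)
  qed
  also have "\<dots> \<in> cfun.span (ket ` B)"
    by (intro cfun.span_sum cfun.span_scale cfun.span_base) auto
  finally show "v \<in> cfun.span (ket ` B)" .
qed

lemma cinner_diff_right: "cinner B u (v - w) = cinner B u v - cinner B u w"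
  by (simp add: cinner_def right_diff_distrib sum_subtractf)

lemma cinner_scale_right: "cinner B u (cscale c v) = c * cinner B u v"
  by (simp add: cinner_def cscale_def sum_distrib_left mult.left_commute)

lemma cinner_add_left: "cinner B (u + v) w = cinner B u w + cinner B v w"
  by (simp add: cinner_def distrib_right sum.distrib)

lemma cinner_scale_left: "cinner B (cscale c u) w = cnj c * cinner B u w"
  by (simp add: cinner_def cscale_def sum_distrib_left mult.assoc)

lemma cinner_commute: "cinner B u v = cnj (cinner B v u)"
  by (simp add: cinner_def mult.commute)

lemma cinner_self_0:
  assumes "finite B" "cinner B u u = 0" "x \<in> B"
  shows "u x = 0"
proof -
  have "cinner B u u = of_real (\<Sum>x\<in>B. (cmod (u x))\<^sup>2)"
    unfolding cinner_def of_real_sum by (intro sum.cong refl) (subst complex_norm_square, rule mult.commute)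
  then have "complex_of_real (\<Sum>x\<in>B. (cmod (u x))\<^sup>2) = 0" using assms(2) by metis
  then have "(\<Sum>x\<in>B. (cmod (u x))\<^sup>2) = 0" by (simp only: of_real_eq_0_iff)
  then show ?thesis using assms(1,3) by (simp add: sum_nonneg_eq_0_iff)
qed

text \<open>Gram-Schmidt without normalisation: the projection \<open>h\<close> of the new generator
  \<open>g\<close> to the old span leaves the new direction \<open>g - h\<close>, along which the
  projection of \<open>v\<close> is corrected.\<close>

lemma orth_proj_span_exists:
  assumes B: "finite B" and "finite G"
  shows "\<exists>w\<in>cfun.span G. \<forall>u\<in>cfun.span G. cinner B u (v - w) = 0"
  using assms(2)
proof (induction G arbitrary: v)
  case empty
  then show ?case by (simp add: cinner_def)
next
  case (insert g G)
  obtain h where h: "h \<in> cfun.span G" "\<And>u. u \<in> cfun.span G \<Longrightarrow> cinner B u (g - h) = 0"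
    using insert.IH by blast
  obtain w where w: "w \<in> cfun.span G" "\<And>u. u \<in> cfun.span G \<Longrightarrow> cinner B u (v - w) = 0"
    using insert.IH by blast
  \<comment> \<open>If \<open>g - h\<close> has norm 0, it vanishes on \<open>B\<close>; division by
    zero gives \<open>c = 0\<close>, and the required identity becomes trivial.\<close>
  define c where "c = cinner B (g - h) v / cinner B (g - h) (g - h)"
  define w' where "w' = w + cscale c (g - h)"
  have sub: "cfun.span G \<subseteq> cfun.span (insert g G)" by (rule cfun.span_mono) auto
  have "g \<in> cfun.span (insert g G)" by (rule cfun.span_base) simp
  then have "g - h \<in> cfun.span (insert g G)"
    using sub h(1) by (intro cfun.span_diff) auto
  then have w': "w' \<in> cfun.span (insert g G)"
    unfolding w'_def using sub w(1) by (intro cfun.span_add cfun.span_scale) auto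
  have vw: "v - w' = (v - w) - cscale c (g - h)" by (simp add: w'_def)
  have gw: "cinner B (g - h) (v - w') = 0"
  proof -
    have "cinner B (g - h) w = 0" using h(2)[OF w(1)] cinner_commute[of B "g - h" w] by simp
    moreover have "c * cinner B (g - h) (g - h) = cinner B (g - h) v"
    proof (cases "cinner B (g - h) (g - h) = 0")
      case True
      have "cinner B (g - h) v = (\<Sum>x\<in>B. 0)"
        unfolding cinner_def using cinner_self_0[OF B True] by (intro sum.cong refl) simp
      then show ?thesis using True by simp
    next
      case False
      then show ?thesis by (simp add: c_def)
    qed
    ultimately show ?thesis unfolding vw by (simp add: cinner_diff_right cinner_scale_right)
  qed
  have "cinner B u (v - w') = 0" if u: "u \<in> cfun.span (insert g G)" for u
  proof -
    obtain k where k: "u - cscale k g \<in> cfun.span G" using u unfolding cfun.span_insert by blast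
    have u0: "(u - cscale k g) + cscale k h \<in> cfun.span G" using k h(1) by (intro cfun.span_add cfun.span_scale)
    have "u = ((u - cscale k g) + cscale k h) + cscale k (g - h)"
      by (simp add: fun_eq_iff cscale_def algebra_simps)
    then have "cinner B u (v - w') = cinner B ((u - cscale k g) + cscale k h) (v - w') + cnj k * cinner B (g - h) (v - w')"
      by (metis cinner_add_left cinner_scale_left)
    also have "cinner B ((u - cscale k g) + cscale k h) (v - w') = 0"
      unfolding vw cinner_diff_right[of B _ "v - w"] cinner_scale_right using w(2)[OF u0] h(2)[OF u0] by simp
    finally show ?thesis unfolding gw by (simp only: mult_zero_right add_0_left)
  qed
  then show ?case using w' by blast
qed

text \<open>The support condition is used twice: it bounds the dimension of \<open>W\<close>, which
  gives existence, and it makes the form definite on \<open>W\<close>, which gives the uniqueness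
  needed for the definite description.\<close>

lemma orth_proj_props:
  assumes B: "finite B" and W: "cfun.subspace W" and supp: "\<And>u x. u \<in> W \<Longrightarrow> x \<notin> B \<Longrightarrow> u x = 0"
  shows "orth_proj B W v \<in> W" and "\<And>u. u \<in> W \<Longrightarrow> cinner B u (v - orth_proj B W v) = 0"
proof -
  obtain G where G: "G \<subseteq> W" "cfun.independent G" "W \<subseteq> cfun.span G" using cfun.basis_exists[of W] by metis
  have "G \<subseteq> cfun.span (ket ` B)" using G(1) supp span_ket[OF B] by blast
  then have "finite G" using cfun.independent_span_bound[OF _ G(2)] B by blast
  moreover have "cfun.span G = W" using G W by (metis cfun.span_minimal subset_antisym)
  ultimately obtain w where w: "w \<in> W" "\<forall>u\<in>W. cinner B u (v - w) = 0"
    using orth_proj_span_exists[OF B, of G v] by metis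
  have uniq: "w' = w" if w': "w' \<in> W \<and> (\<forall>u\<in>W. cinner B u (v - w') = 0)" for w'
  proof
    fix x
    have d: "w' - w \<in> W" using w' w(1) cfun.subspace_diff[OF W] by blast
    have "cinner B (w' - w) (w' - w) = cinner B (w' - w) (v - w) - cinner B (w' - w) (v - w')"
      unfolding cinner_diff_right[symmetric] by (rule arg_cong) simp
    also have "cinner B (w' - w) (v - w) = 0" using w(2) d by blast
    also have "cinner B (w' - w) (v - w') = 0" using w' d by blast
    finally have "cinner B (w' - w) (w' - w) = 0" by (simp only: diff_0_right)
    then have "(w' - w) x = 0" using cinner_self_0[OF B] supp[OF d] by blast
    then show "w' x = w x" by simp
  qed
  have eq: "orth_proj B W v = w"
    unfolding orth_proj_def
  proof (rule the_equality)
    show "w \<in> W \<and> (\<forall>u\<in>W. cinner B u (v - w) = 0)" using w by blast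
  qed (rule uniq)
  show "orth_proj B W v \<in> W" unfolding eq by (rule w(1))
  show "\<And>u. u \<in> W \<Longrightarrow> cinner B u (v - orth_proj B W v) = 0" unfolding eq using w(2) by blast
qed

lemma mat_op_cong:
  assumes "\<And>x. x \<in> B \<Longrightarrow> v x = w x" shows "mat_op B M v = mat_op B M w"
  using assms by (auto simp: mat_op_def fun_eq_iff intro!: sum.cong)

section \<open>The radial eigenvector for \<open>\<theta>_1\<close> and its normalisation\<close>

context
  fixes D :: nat and q :: real and X :: "'p::prime_card mod_ring vec set set"
  assumes D: "D \<ge> 1" and q: "q = real CARD('p)" and X: "X = max_isotropic D"
begin

definition rf :: "(real \<Rightarrow> real) \<Rightarrow> 'p mod_ring vec set \<Rightarrow> complex" where
  "rf h x = of_real (h (real (card (upart D x))))"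

lemma q_gt_1: "q > 1"
  unfolding q using card_field_gt_1[where 'p = 'p] by simp

lemma A_rf:
  assumes y: "y \<in> X" and u: "u = real (card (upart D y))"
  shows "dpg_A D (rf h) y = of_real ((q ^ D - u) / ((q - 1) * u) * h (q * u) + (q ^ D / u - 1) * h u
      + (u - 1) / (q - 1) * (q * q ^ D / u) * h (u / q))"
proof -
  obtain k where k: "card (upart D y) = CARD('p) ^ k" using card_upart[of y D] y X by metis
  have "dpg_A D (rf h) y = radial q D (\<lambda>u. of_real (h (real u))) CARD('p) (card (upart D y))"
    using dpg_A_radial[OF D, of y "\<lambda>u. of_real (h (real u))"] y X by (simp add: rf_def[abs_def] q)
  then show ?thesis
    unfolding q u radial_real[OF k card_field_gt_1] by simp
qed

lemma u_pos: "y \<in> X \<Longrightarrow> real (card (upart D y)) > 0"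
  using subD(6)[OF sub_upart[OF max_isotropicD(1)], of y D] by (simp add: X)

lemma A_one:
  assumes y: "y \<in> X"
  shows "dpg_A D (rf (\<lambda>_. 1)) y = of_real ((q * q ^ D - q) / (q - 1))"
  unfolding A_rf[OF y refl] moment_0[OF q_gt_1 u_pos[OF y]] ..

lemma A_s:
  assumes y: "y \<in> X"
  shows "dpg_A D (rf (\<lambda>u. u / q ^ D)) y = 2 + of_real ((1 - q + q ^ D - q) / (q - 1)) * rf (\<lambda>u. u / q ^ D) y"
proof -
  have Q: "q ^ D > 0" using q_gt_1 by simp
  show ?thesis
    unfolding A_rf[OF y refl] moment_1[OF q_gt_1 u_pos[OF y] Q] rf_def of_real_add of_real_mult by simp
qed

lemma A_s2:
  assumes y: "y \<in> X"
  shows "dpg_A D (rf (\<lambda>u. (u / q ^ D)^2)) y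
    = of_real ((q ^ (D - 1) - q^2 - q + 1) / (q - 1)) * rf (\<lambda>u. (u / q ^ D)^2) y + of_real ((q + 1)^2 / q) * rf (\<lambda>u. u / q ^ D) y"
proof -
  have Q: "q ^ D = q * q ^ (D - 1)" using D by (cases D) auto
  have R: "q ^ (D - 1) > 0" using q_gt_1 by simp
  show ?thesis
    unfolding A_rf[OF y refl] Q moment_2[OF q_gt_1 u_pos[OF y] R] rf_def of_real_add of_real_mult ..
qed

lemma A_lin: "dpg_A D (\<lambda>x. a * f x + b * g x) y = a * dpg_A D f y + b * dpg_A D g (y :: 'p mod_ring vec set)"
  by (simp add: dpg_A_def mat_op_def sum_distrib_left sum.distrib distrib_left mult.left_commute)

abbreviation ts where "ts \<equiv> rf (dual_ev q D)"

lemma ts_eq: "ts x = of_real (- (q * (q ^ (D - 1) + 1) / (q - 1))) * rf (\<lambda>_. 1) x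
    + of_real (q * (q ^ (D - 1) + 1) * (q ^ D + 1) / (2 * (q - 1))) * rf (\<lambda>u. u / q ^ D) x"
  by (simp add: rf_def dual_ev_def)

lemma dpg_theta_1: "dpg_theta q D 1 = (1 - q + q ^ D - q) / (q - 1)"
  by (simp add: dpg_theta_def)

text \<open>For \<open>c0 + c1 s\<close> to be an eigenvector, the valency \<open>k\<close> and the
  constant 2 have to balance: \<open>c0 (k - \<theta>_1) + 2 c1 = 0\<close>. As
  \<open>k - \<theta>_1 = q^D + 1\<close>, this is the ratio of the two coefficients in
  \<open>dual_ev\<close>.\<close>

lemma A_ts:
  assumes y: "y \<in> X"
  shows "dpg_A D ts y = of_real (dpg_theta q D 1) * ts y"
proof -
  let ?s = "real (card (upart D y)) / q ^ D"
  have Q: "q ^ D = q * q ^ (D - 1)" using D by (cases D) auto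
  have "dpg_A D ts y = of_real (- (q * (q ^ (D - 1) + 1) / (q - 1))) * of_real ((q * q ^ D - q) / (q - 1))
     + of_real (q * (q ^ (D - 1) + 1) * (q ^ D + 1) / (2 * (q - 1))) * (2 + of_real (dpg_theta q D 1) * of_real ?s)"
    unfolding ts_eq[abs_def] A_lin A_one[OF y] A_s[OF y] dpg_theta_1 by (simp add: rf_def)
  also have "\<dots> = of_real (- (q * (q ^ (D - 1) + 1) / (q - 1)) * ((q * q ^ D - q) / (q - 1))
     + q * (q ^ (D - 1) + 1) * (q ^ D + 1) / (2 * (q - 1)) * (2 + dpg_theta q D 1 * ?s))" by simp
  also have "- (q * (q ^ (D - 1) + 1) / (q - 1)) * ((q * q ^ D - q) / (q - 1))
     + q * (q ^ (D - 1) + 1) * (q ^ D + 1) / (2 * (q - 1)) * (2 + dpg_theta q D 1 * ?s)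
     = dpg_theta q D 1 * dual_ev q D (real (card (upart D y)))"
  proof -
    have *: "- (q * (R + 1) / (q - 1)) * ((q * Q - q) / (q - 1)) + q * (R + 1) * (Q + 1) / (2 * (q - 1)) * (2 + t * s)
        = t * (- (q * (R + 1) / (q - 1)) + q * (R + 1) * (Q + 1) / (2 * (q - 1)) * s)"
      if "t = (1 - q + Q - q) / (q - 1)" for R Q s t :: real
      unfolding that using q_gt_1 by (simp add: divide_simps) (simp add: algebra_simps)
    show ?thesis unfolding dual_ev_def by (rule *[OF dpg_theta_1])
  qed
  finally have *: "dpg_A D ts y = of_real (dpg_theta q D 1 * dual_ev q D (real (card (upart D y))))" .
  have "ts y = of_real (dual_ev q D (real (card (upart D y))))" by (simp only: rf_def)
  then show ?thesis unfolding * of_real_mult by (simp only:)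
qed

text \<open>The operator is symmetric with constant row sums, so summing \<open>A f\<close> over all
  vertices multiplies the sum of \<open>f\<close> by the valency \<open>k\<close>. Applied to
  \<open>s\<close> and \<open>s^2\<close> this gives linear equations for the sums \<open>P1\<close>
  and \<open>P2\<close>, solvable because \<open>k\<close> differs from both diagonal coefficients
  \<open>t\<close> and \<open>a\<close>.\<close>

lemma sum_ts_eigen_product:
  "(\<Sum>x\<in>X. ts x * ts x) = of_nat (card X) * ts (x_sub D 0)"
proof -
  define P1 where "P1 = (\<Sum>x\<in>X. rf (\<lambda>u. u / q ^ D) x)"
  define P2 where "P2 = (\<Sum>x\<in>X. rf (\<lambda>u. (u / q ^ D)^2) x)"
  define R where "R = q ^ (D - 1)"
  have Q: "q ^ D = q * R" unfolding R_def using D by (cases D) auto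
  have R: "R > 0" unfolding R_def using q_gt_1 by simp
  have tot: "(\<Sum>x\<in>X. dpg_A D f x) = of_real ((q * q ^ D - q) / (q - 1)) * (\<Sum>x\<in>X. f x)" for f
  proof -
    have "(\<Sum>x\<in>X. dpg_A D f x) = (\<Sum>x\<in>X. dpg_A D (rf (\<lambda>_. 1)) x * f x)"
      using dpg_A_symmetric[of "rf (\<lambda>_. 1)" D f] by (simp add: rf_def X)
    also have "\<dots> = (\<Sum>x\<in>X. of_real ((q * q ^ D - q) / (q - 1)) * f x)"
      by (intro sum.cong refl) (simp only: A_one)
    finally show ?thesis by (simp add: sum_distrib_left)
  qed
  define k where "k = (q * q ^ D - q) / (q - 1)"
  define t where "t = (1 - q + q ^ D - q) / (q - 1)"
  define a where "a = (R - q^2 - q + 1) / (q - 1)"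
  define b where "b = (q + 1)^2 / q"
  define n where "n = complex_of_nat (card X)"
  have kt: "k - t = q * R + 1"
    unfolding k_def t_def Q using q_gt_1 by (simp add: divide_simps) (simp add: algebra_simps)
  have ka: "k - a = (q + 1) * (R + 1)"
    unfolding k_def a_def Q using q_gt_1 by (simp add: divide_simps power2_eq_square) (simp add: algebra_simps)
  have "of_real k * P1 = (\<Sum>x\<in>X. 2 + of_real t * rf (\<lambda>u. u / q ^ D) x)"
    unfolding P1_def tot[symmetric, folded k_def] t_def by (intro sum.cong refl) (simp only: A_s)
  also have "\<dots> = 2 * n + of_real t * P1"
    by (simp add: sum.distrib P1_def n_def sum_distrib_left)
  finally have "of_real (k - t) * P1 = 2 * n" unfolding of_real_diff left_diff_distrib by simp
  then have "of_real (2 / (q * R + 1)) * n = of_real (1 / (q * R + 1)) * (of_real (q * R + 1) * P1)"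
    unfolding kt by simp
  also have "\<dots> = of_real (1 / (q * R + 1) * (q * R + 1)) * P1" by (simp only: of_real_mult mult.assoc)
  also have "1 / (q * R + 1) * (q * R + 1) = 1" using q_gt_1 R by (simp add: add_pos_pos less_imp_neq[symmetric])
  finally have P1: "P1 = of_real (2 / (q * R + 1)) * n" by simp
  have "of_real k * P2 = (\<Sum>x\<in>X. of_real a * rf (\<lambda>u. (u / q ^ D)^2) x + of_real b * rf (\<lambda>u. u / q ^ D) x)"
    unfolding P2_def tot[symmetric, folded k_def] a_def b_def R_def by (intro sum.cong refl) (simp only: A_s2)
  also have "\<dots> = of_real a * P2 + of_real b * P1"
    by (simp only: sum.distrib P1_def P2_def sum_distrib_left)
  finally have "of_real (k - a) * P2 = of_real b * P1" unfolding of_real_diff left_diff_distrib by simp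
  then have "of_real (b / ((q + 1) * (R + 1))) * P1 = of_real (1 / ((q + 1) * (R + 1))) * (of_real ((q + 1) * (R + 1)) * P2)"
    unfolding ka by simp
  also have "\<dots> = of_real (1 / ((q + 1) * (R + 1)) * ((q + 1) * (R + 1))) * P2" by (simp only: of_real_mult mult.assoc)
  also have "1 / ((q + 1) * (R + 1)) * ((q + 1) * (R + 1)) = 1" using q_gt_1 R by simp
  finally have P2: "P2 = of_real (b / ((q + 1) * (R + 1)) * (2 / (q * R + 1))) * n"
    unfolding P1 by (simp only: of_real_mult of_real_1 mult_1_left mult.assoc)
  define c0 where "c0 = - (q * (R + 1) / (q - 1))"
  define c1 where "c1 = q * (R + 1) * (q * R + 1) / (2 * (q - 1))"
  have tsx: "ts x = of_real (c0 + c1 * (real (card (upart D x)) / q ^ D))" for x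
    unfolding rf_def dual_ev_def c0_def c1_def R_def[symmetric] Q ..
  have sq: "ts x * ts x = of_real (c0^2) + of_real (2 * c0 * c1) * rf (\<lambda>u. u / q ^ D) x + of_real (c1^2) * rf (\<lambda>u. (u / q ^ D)^2) x" for x
  proof -
    let ?s = "real (card (upart D x)) / q ^ D"
    have "ts x * ts x = of_real ((c0 + c1 * ?s) * (c0 + c1 * ?s))" unfolding tsx of_real_mult ..
    also have "(c0 + c1 * ?s) * (c0 + c1 * ?s) = c0^2 + 2 * c0 * c1 * ?s + c1^2 * ?s^2"
      by (simp add: power2_eq_square algebra_simps)
    also have "complex_of_real \<dots> = of_real (c0^2) + of_real (2 * c0 * c1) * rf (\<lambda>u. u / q ^ D) x + of_real (c1^2) * rf (\<lambda>u. (u / q ^ D)^2) x"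
      by (simp only: rf_def of_real_add of_real_mult)
    finally show ?thesis .
  qed
  have "(\<Sum>x\<in>X. ts x * ts x) = (\<Sum>x\<in>X. of_real (c0^2) + of_real (2 * c0 * c1) * rf (\<lambda>u. u / q ^ D) x + of_real (c1^2) * rf (\<lambda>u. (u / q ^ D)^2) x)"
    by (rule sum.cong[OF refl sq])
  also have "\<dots> = of_real (c0^2) * n + of_real (2 * c0 * c1) * P1 + of_real (c1^2) * P2"
    unfolding P1_def P2_def n_def by (simp only: sum.distrib sum_distrib_left[symmetric] sum_constant mult.commute)
  also have "\<dots> = of_real (c0^2 + 2 * c0 * c1 * (2 / (q * R + 1)) + c1^2 * (b / ((q + 1) * (R + 1)) * (2 / (q * R + 1)))) * n"
    unfolding P1 P2 of_real_add of_real_mult by (simp only: distrib_right mult.assoc)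
  also have "c0^2 + 2 * c0 * c1 * (2 / (q * R + 1)) + c1^2 * (b / ((q + 1) * (R + 1)) * (2 / (q * R + 1))) = c0 + c1"
    unfolding b_def c0_def c1_def by (rule dual_norm[OF q_gt_1 R])
  also have "of_real (c0 + c1) = ts (x_sub D 0)"
  proof -
    have one: "real (card (upart D (x_sub D 0 :: 'p mod_ring vec set))) / q ^ D = 1"
      unfolding x_sub_0 card_vec by (simp add: q)
    show ?thesis unfolding tsx one mult_1_right ..
  qed
  finally show ?thesis by (simp add: n_def)
qed

text \<open>The combination \<open>z\<close> of \<open>v\<close> and \<open>ts\<close> vanishes at
  \<open>x_0\<close>, so it is orthogonal to every radial function, in particular to
  \<open>ts\<close>. Hence pairing with \<open>ts\<close> is proportional to evaluation at
  \<open>x_0\<close>, and the case \<open>v = ts\<close> fixes the factor.\<close>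

lemma eigenvector_pairing:
  assumes ev: "\<And>y. y \<in> X \<Longrightarrow> dpg_A D v y = of_real (dpg_theta q D 1) * v y"
  shows "(\<Sum>x\<in>X. ts x * v x) = of_nat (card X) * v (x_sub D 0)"
proof -
  let ?x0 = "x_sub D 0 :: 'p mod_ring vec set"
  define z where "z = (\<lambda>x. ts ?x0 * v x + (- v ?x0) * ts x)"
  have "(\<Sum>x\<in>X. ts x * z x) = 0"
    unfolding rf_def X
  proof (rule eigenvector_radial_sum_zero[OF D, of z _ "\<lambda>u. of_real (dual_ev q D (real u))"])
    fix y :: "'p mod_ring vec set" assume "y \<in> max_isotropic D"
    then have y: "y \<in> X" by (simp add: X)
    show "dpg_A D z y = of_real (dpg_theta q D 1) * z y"
      unfolding z_def A_lin ev[OF y] A_ts[OF y] by (simp add: algebra_simps)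
  qed (simp add: z_def)
  moreover have "(\<Sum>x\<in>X. ts x * z x) = ts ?x0 * (\<Sum>x\<in>X. ts x * v x) - v ?x0 * (\<Sum>x\<in>X. ts x * ts x)"
    unfolding z_def by (simp add: sum_distrib_left sum_subtractf right_diff_distrib mult_ac)
  ultimately have "ts ?x0 * (\<Sum>x\<in>X. ts x * v x) = ts ?x0 * (of_nat (card X) * v ?x0)"
    unfolding sum_ts_eigen_product by (simp add: mult_ac)
  moreover have "ts ?x0 \<noteq> 0"
  proof -
    have "real (card (upart D ?x0)) / q ^ D = 1" unfolding x_sub_0 card_vec by (simp add: q)
    then have "dual_ev q D (real (card (upart D ?x0))) = q * (q ^ (D - 1) + 1) / (q - 1) * ((q ^ D - 1) / 2)"
      unfolding dual_ev_def using q_gt_1 by (simp add: divide_simps) (simp add: algebra_simps)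
    moreover have "q ^ D > 1" using q_gt_1 D by (intro one_less_power) auto
    moreover have "q ^ (D - 1) > 0" using q_gt_1 by simp
    ultimately have "dual_ev q D (real (card (upart D ?x0))) > 0"
      using q_gt_1 by (simp add: add_pos_pos)
    then show ?thesis unfolding rf_def by simp
  qed
  ultimately show ?thesis by simp
qed

text \<open>On the eigenspace, evaluation at \<open>x_0\<close> is pairing with
  \<open>ts / card X\<close>. Pairing with an eigenvector does not distinguish \<open>ket x\<close>
  from its projection, so the entry at \<open>x_0\<close> can be read from
  \<open>ket x\<close>.\<close>

lemma dual_adj_diag:
  assumes x: "x \<in> X"
  shows "dpg_dual_adj D x x = ts x"
proof -
  let ?W = "{v \<in> V_space D. dpg_A D v = cscale (complex_of_real (dpg_theta q D 1)) v} :: ('p mod_ring vec set \<Rightarrow> complex) set"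
  have fin: "finite X" unfolding X by (rule finite_max_isotropic)
  have V: "v \<in> V_space D \<longleftrightarrow> (\<forall>x. x \<notin> X \<longrightarrow> v x = 0)" for v :: "'p mod_ring vec set \<Rightarrow> complex"
    unfolding V_space_def using span_ket[OF fin] by (simp add: X)
  have A_add: "dpg_A D (u + v) = dpg_A D u + dpg_A D v" for u v :: "'p mod_ring vec set \<Rightarrow> complex"
    using A_lin[of 1 u 1 v] by (simp add: fun_eq_iff plus_fun_def)
  have A_scale: "dpg_A D (cscale c v) = cscale c (dpg_A D v)" for c and v :: "'p mod_ring vec set \<Rightarrow> complex"
    using A_lin[of c v 0 v] by (simp add: fun_eq_iff cscale_def)
  have subW: "cfun.subspace ?W"
  proof (rule cfun.subspaceI)
    show "0 \<in> ?W" by (auto simp: V cscale_def fun_eq_iff dpg_A_def mat_op_def)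
    show "u + v \<in> ?W" if "u \<in> ?W" "v \<in> ?W" for u v
      using that A_add[of u v] by (auto simp: V cfun.scale_right_distrib)
    show "cscale c v \<in> ?W" if "v \<in> ?W" for c v
      using that A_scale[of c v] by (auto simp: V cscale_def mult_ac)
  qed
  note proj = orth_proj_props[OF fin subW]
  define w where "w = orth_proj X ?W (ket x)"
  have w: "w \<in> ?W" "\<And>u. u \<in> ?W \<Longrightarrow> cinner X u (ket x - w) = 0"
    unfolding w_def using proj by (auto simp: V)
  \<comment> \<open>Membership in \<open>V_space\<close> demands value 0 outside \<open>X\<close>;
    the adjacency operator does not notice the cut-off.\<close>
  define t where "t = (\<lambda>x. if x \<in> X then ts x else 0)"
  have tW: "t \<in> ?W"
  proof -
    have "dpg_A D t = dpg_A D ts" unfolding dpg_A_def by (rule mat_op_cong) (simp add: t_def X)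
    then have "dpg_A D t y = of_real (dpg_theta q D 1) * t y" for y
      using A_ts[of y] by (cases "y \<in> X") (auto simp: t_def dpg_A_def mat_op_def X)
    then show ?thesis by (auto simp: V t_def cscale_def fun_eq_iff)
  qed
  have ct: "cinner X t v = (\<Sum>x\<in>X. ts x * v x)" for v
    unfolding cinner_def t_def by (intro sum.cong refl) (simp add: rf_def)
  have "(\<Sum>y\<in>X. ts y * ket x y) = (\<Sum>y\<in>X. if y = x then ts x else 0)"
    by (intro sum.cong refl) (auto simp: ket_def)
  then have "cinner X t (ket x) = ts x" unfolding ct using x fin by simp
  moreover have "cinner X t w = of_nat (card X) * w (x_sub D 0)"
    unfolding ct using w(1) by (intro eigenvector_pairing) (simp add: cscale_def)
  ultimately have "of_nat (card X) * w (x_sub D 0) = ts x"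
    using w(2)[OF tW] by (simp add: cinner_diff_right)
  then show ?thesis unfolding dpg_dual_adj_def dpg_E_def w_def X q by simp
qed

end

subsection \<open>The action of the Siegel parabolic subgroup\<close>

lemma GL_obtain_inverse:
  assumes "C \<in> GL n"
  obtains B where "C \<in> carrier_mat n n" "B \<in> carrier_mat n n" "C * B = 1\<^sub>m n" "B * C = 1\<^sub>m n"
    "transpose_mat B * transpose_mat C = 1\<^sub>m n" "transpose_mat C * transpose_mat B = 1\<^sub>m n"
proof -
  obtain B where B: "C \<in> carrier_mat n n" "B \<in> carrier_mat n n" "C * B = 1\<^sub>m n" "B * C = 1\<^sub>m n"
    using assms by (auto simp: GL_iff)
  then have "transpose_mat B * transpose_mat C = 1\<^sub>m n" "transpose_mat C * transpose_mat B = 1\<^sub>m n"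
    unfolding transpose_mult[OF B(1,2), symmetric] transpose_mult[OF B(2,1), symmetric] by simp_all
  then show ?thesis using that B by blast
qed

lemma mult_inverse_vec:
  assumes "A \<in> carrier_mat n n" "B \<in> carrier_mat n n" "A * B = 1\<^sub>m n" "v \<in> carrier_vec n"
  shows "A *\<^sub>v (B *\<^sub>v v) = (v :: 'a :: comm_ring_1 vec)"
  using assoc_mult_mat_vec[OF assms(1,2,4)] assms(3,4) by simp

lemma mat_inverse_transpose:
  assumes "C \<in> GL n" "B \<in> carrier_mat n n" "transpose_mat B * transpose_mat C = 1\<^sub>m n" "transpose_mat C * transpose_mat B = 1\<^sub>m n"
  shows "the (mat_inverse (transpose_mat C)) = transpose_mat B"
proof -
  have Cc: "transpose_mat C \<in> carrier_mat n n" using assms(1) by (simp add: GL_def)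
  have Bc: "transpose_mat B \<in> carrier_mat n n" using assms(2) by simp
  obtain Z where Z: "mat_inverse (transpose_mat C) = Some Z"
    using mat_inverse(1)[OF Cc, of "()"] assms(3,4) Cc Bc by (cases "mat_inverse (transpose_mat C)") (auto simp: Units_def ring_mat_simps)
  note Z' = mat_inverse(2)[OF Cc Z]
  have "Z = (transpose_mat B * transpose_mat C) * Z"
    unfolding assms(3) using Z' left_mult_one_mat[of Z n n] by simp
  also have "\<dots> = transpose_mat B * (transpose_mat C * Z)" using Bc Cc Z' by (intro assoc_mult_mat) auto
  also have "\<dots> = transpose_mat B" using Z' Bc by simp
  finally show ?thesis using Z by simp
qed

lemma siegel_mult:
  assumes C: "C \<in> GL D" and F: "F \<in> carrier_mat D D" and B: "B \<in> carrier_mat D D"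
      "transpose_mat B * transpose_mat C = 1\<^sub>m D" "transpose_mat C * transpose_mat B = 1\<^sub>m D"
    and ab: "a \<in> carrier_vec D" "b \<in> carrier_vec D"
  shows "siegel D C F *\<^sub>v (a @\<^sub>v b) = (C *\<^sub>v (a + F *\<^sub>v b)) @\<^sub>v (transpose_mat B *\<^sub>v b)"
proof -
  have Cc: "C \<in> carrier_mat D D" using C by (simp add: GL_def)
  have Bc: "transpose_mat B \<in> carrier_mat D D" using B(1) by simp
  let ?A1 = "four_block_mat C (0\<^sub>m D D) (0\<^sub>m D D) (transpose_mat B)"
  let ?A2 = "four_block_mat (1\<^sub>m D) F (0\<^sub>m D D) (1\<^sub>m D)"
  have c: "?A1 \<in> carrier_mat (D + D) (D + D)" "?A2 \<in> carrier_mat (D + D) (D + D)" using Cc Bc F by auto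
  have "siegel D C F *\<^sub>v (a @\<^sub>v b) = ?A1 *\<^sub>v (?A2 *\<^sub>v (a @\<^sub>v b))"
    unfolding siegel_def mat_inverse_transpose[OF C B] using c ab by (intro assoc_mult_mat_vec) auto
  also have "?A2 *\<^sub>v (a @\<^sub>v b) = (1\<^sub>m D *\<^sub>v a + F *\<^sub>v b) @\<^sub>v (0\<^sub>m D D *\<^sub>v a + 1\<^sub>m D *\<^sub>v b)"
    using F ab by (intro four_block_mat_mult_vec) auto
  also have "\<dots> = (a + F *\<^sub>v b) @\<^sub>v b" using F ab by (simp add: zero_mat_mult_vec)
  also have "?A1 *\<^sub>v \<dots> = (C *\<^sub>v (a + F *\<^sub>v b)) @\<^sub>v (transpose_mat B *\<^sub>v b)"
    using F ab by (intro mult_mat_vec_split[OF Cc Bc]) auto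
  finally show ?thesis .
qed

lemma Sym_congruence':
  assumes "M \<in> Sym D" "C \<in> carrier_mat D D"
  shows "C * M * transpose_mat C \<in> Sym D"
  using Sym_congruence[OF assms(1), of "transpose_mat C"] assms(2) by simp

lemma congruence'_mult:
  assumes "M \<in> carrier_mat D D" "C \<in> carrier_mat D D" "b \<in> carrier_vec D"
  shows "(C * M * transpose_mat C) *\<^sub>v b = C *\<^sub>v (M *\<^sub>v (transpose_mat C *\<^sub>v (b :: 'a :: comm_ring_1 vec)))"
  using assms by (simp add: assoc_mult_mat_vec[where ?n\<^sub>1 = D and ?n\<^sub>2 = D and ?n\<^sub>3 = D])

lemma congruence'_scalar:
  assumes M: "M \<in> carrier_mat D D" and C: "C \<in> carrier_mat D D" and b: "b \<in> carrier_vec D" "b' \<in> carrier_vec D"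
  shows "((C * M * transpose_mat C) *\<^sub>v b) \<bullet> b' = (M *\<^sub>v (transpose_mat C *\<^sub>v b)) \<bullet> (transpose_mat C *\<^sub>v (b' :: 'a :: comm_ring_1 vec))"
  unfolding congruence'_mult[OF M C b(1)]
  using transpose_vec_mult_scalar[of "transpose_mat C" D D b' "M *\<^sub>v (transpose_mat C *\<^sub>v b)"] M C b by simp

lemma perp_image_iff:
  assumes C: "C \<in> carrier_mat D D" and U: "U \<subseteq> carrier_vec D" and b: "b \<in> carrier_vec D"
  shows "b \<in> perp D ((*\<^sub>v) C ` U) \<longleftrightarrow> transpose_mat C *\<^sub>v b \<in> perp D U"
proof -
  have "(C *\<^sub>v u) \<bullet> b = u \<bullet> (transpose_mat C *\<^sub>v b)" if "u \<in> U" for u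
    using transpose_vec_mult_scalar[of "transpose_mat C" D D b u] C b U that by auto
  then show ?thesis using C b by (auto simp: perp_def)
qed

text \<open>One inclusion suffices, since the matrix is injective and all these Lagrangians have
  \<open>q^D\<close> elements. If \<open>B\<close> is the inverse of \<open>C\<close>, the second
  half \<open>b\<close> goes to \<open>B^t b\<close>, so the form \<open>M + F\<close> is
  transported by a congruence.\<close>

lemma act_siegel_lag:
  fixes U :: "'p::prime_card mod_ring vec set"
  assumes C: "C \<in> GL D" and F: "F \<in> Sym D" and U: "sub D U" and M: "M \<in> Sym D"
  shows "act (siegel D C F) (lag D U M) = lag D ((*\<^sub>v) C ` U) (C * (M + F) * transpose_mat C)"
proof (rule card_subset_eq)
  obtain B where B: "C \<in> carrier_mat D D" "B \<in> carrier_mat D D" "C * B = 1\<^sub>m D" "B * C = 1\<^sub>m D"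
    "transpose_mat B * transpose_mat C = 1\<^sub>m D" "transpose_mat C * transpose_mat B = 1\<^sub>m D"
    using GL_obtain_inverse[OF C] .
  note Fc = Sym_carrier[OF F] and Mc = Sym_carrier[OF M]
  note sm = siegel_mult[OF C Fc B(2,5,6)]
  have MF: "M + F \<in> Sym D" using Sym_add[OF M F] .
  have CU: "sub D ((*\<^sub>v) C ` U)" using sub_image[OF B(1) U] .
  have CMC: "C * (M + F) * transpose_mat C \<in> Sym D" using Sym_congruence'[OF MF B(1)] .
  have pc: "b \<in> carrier_vec D" if "b \<in> perp D W" for b W using that perp_carrier by blast
  have tB: "transpose_mat B *\<^sub>v b \<in> carrier_vec D" if "b \<in> carrier_vec D" for b using B(2) that by simp
  have tCB: "transpose_mat C *\<^sub>v (transpose_mat B *\<^sub>v b) = b" if "b \<in> carrier_vec D" for b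
    using mult_inverse_vec[OF _ _ B(6) that] B by simp
  show "finite (lag D ((*\<^sub>v) C ` U) (C * (M + F) * transpose_mat C))" using subD(5)[OF sub_lag[OF CU CMC]] .
  show "act (siegel D C F) (lag D U M) \<subseteq> lag D ((*\<^sub>v) C ` U) (C * (M + F) * transpose_mat C)"
  proof
    fix x assume "x \<in> act (siegel D C F) (lag D U M)"
    then obtain a b where ab: "a \<in> carrier_vec D" "b \<in> perp D U" "a - M *\<^sub>v b \<in> U" "x = siegel D C F *\<^sub>v (a @\<^sub>v b)"
      by (auto simp: act_def lag_def)
    note bc = pc[OF ab(2)]
    have x: "x = (C *\<^sub>v (a + F *\<^sub>v b)) @\<^sub>v (transpose_mat B *\<^sub>v b)" using sm[OF ab(1) bc] ab(4) by simp
    have c: "a + F *\<^sub>v b \<in> carrier_vec D" "(M + F) *\<^sub>v b \<in> carrier_vec D"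
      using ab(1) Sym_mult_carrier[OF F bc] Sym_mult_carrier[OF MF bc] by auto
    have "transpose_mat B *\<^sub>v b \<in> perp D ((*\<^sub>v) C ` U)"
      unfolding perp_image_iff[OF B(1) subD(1)[OF U] tB[OF bc]] tCB[OF bc] by (rule ab(2))
    moreover have "C *\<^sub>v (a + F *\<^sub>v b) - (C * (M + F) * transpose_mat C) *\<^sub>v (transpose_mat B *\<^sub>v b) = C *\<^sub>v (a - M *\<^sub>v b)"
    proof -
      have "(a + F *\<^sub>v b) - (M + F) *\<^sub>v b = a - M *\<^sub>v b"
        unfolding Sym_add_mult[OF M F bc] using ab(1) bc Fc Mc by (intro eq_vecI) auto
      then show ?thesis
        unfolding congruence'_mult[OF Sym_carrier[OF MF] B(1) tB[OF bc]] tCB[OF bc]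
        using mult_minus_distrib_mat_vec[OF B(1) c] by simp
    qed
    ultimately show "x \<in> lag D ((*\<^sub>v) C ` U) (C * (M + F) * transpose_mat C)"
      unfolding x using B(1) c ab(3) by (simp add: lag_iff)
  qed
  have "inj_on ((*\<^sub>v) (siegel D C F)) (lag D U M)"
  proof (rule inj_onI)
    fix x y assume xy: "x \<in> lag D U M" "y \<in> lag D U M" "siegel D C F *\<^sub>v x = siegel D C F *\<^sub>v y"
    obtain a b where x: "a \<in> carrier_vec D" "b \<in> carrier_vec D" "x = a @\<^sub>v b"
      using xy(1) pc by (auto simp: lag_def)
    obtain a' b' where y: "a' \<in> carrier_vec D" "b' \<in> carrier_vec D" "y = a' @\<^sub>v b'"
      using xy(2) pc by (auto simp: lag_def)
    have c: "a + F *\<^sub>v b \<in> carrier_vec D" "a' + F *\<^sub>v b' \<in> carrier_vec D" using x y Fc by auto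
    have "C *\<^sub>v (a + F *\<^sub>v b) = C *\<^sub>v (a' + F *\<^sub>v b') \<and> transpose_mat B *\<^sub>v b = transpose_mat B *\<^sub>v b'"
      using xy(3) sm[OF x(1,2)] sm[OF y(1,2)] append_eq[of "C *\<^sub>v (a + F *\<^sub>v b)" D "C *\<^sub>v (a' + F *\<^sub>v b')"] B(1) c
      unfolding x(3) y(3) by simp
    then have 1: "C *\<^sub>v (a + F *\<^sub>v b) = C *\<^sub>v (a' + F *\<^sub>v b')" and 2: "b = b'"
      using tCB[OF x(2)] tCB[OF y(2)] by metis+
    have "a + F *\<^sub>v b = a' + F *\<^sub>v b'"
      using 1 mult_inverse_vec[OF B(2,1,4) c(1)] mult_inverse_vec[OF B(2,1,4) c(2)] by metis
    then have "a = a'" unfolding 2 using x(1) y(1) y(2) Fc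
      by (intro eq_vecI) (auto dest: arg_cong[of _ _ "\<lambda>v. v $ _"] simp: vec_eq_iff)
    then show "x = y" using x y 2 by simp
  qed
  then show "card (act (siegel D C F) (lag D U M)) = card (lag D ((*\<^sub>v) C ` U) (C * (M + F) * transpose_mat C))"
    unfolding act_def using card_image card_lag[OF U M] card_lag[OF CU CMC] by metis
qed

lemma one_GL: "1\<^sub>m D \<in> GL D"
  by (auto simp: GL_iff)

lemma act_siegel_x_sub:
  assumes "i \<le> D" "C \<in> GL D"
  shows "act (siegel D C (0\<^sub>m D D)) (x_sub D i) = lag D ((*\<^sub>v) C ` std D (D - i)) (0\<^sub>m D D)"
proof -
  have Cc: "C \<in> carrier_mat D D" using assms(2) by (simp add: GL_def)
  have "C * (0\<^sub>m D D + 0\<^sub>m D D) * transpose_mat C = 0\<^sub>m D D" using Cc by simp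
  then show ?thesis
    using act_siegel_lag[OF assms(2) Sym_zero sub_std Sym_zero, of "D - i"] by (simp add: x_sub_eq_lag[OF assms(1)])
qed

lemma act_unipotent_x_sub:
  fixes F :: "'p::prime_card mod_ring mat"
  assumes "i \<le> D" "F \<in> Sym D"
  shows "act (siegel D (1\<^sub>m D) F) (x_sub D i) = lag D (std D (D - i)) F"
proof -
  have "(*\<^sub>v) (1\<^sub>m D) ` std D (D - i) = (std D (D - i) :: 'p mod_ring vec set)"
    using subD(1)[OF sub_std[of D "D - i"]] by (force simp: image_iff)
  moreover have "1\<^sub>m D * (0\<^sub>m D D + F) * transpose_mat (1\<^sub>m D) = F" using Sym_carrier[OF assms(2)] by simp
  ultimately show ?thesis
    using act_siegel_lag[OF one_GL assms(2) sub_std Sym_zero, of "D - i"]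
    by (simp add: x_sub_eq_lag[OF assms(1)])
qed

text \<open>As \<open>C^t\<close> is invertible, the leading \<open>D - i\<close> columns of
  \<open>C^t S C\<close> vanish exactly when \<open>S\<close> kills the corresponding columns of
  \<open>C\<close>; symmetry turns zero columns into zero rows.\<close>

lemma Sym_sub_iff_kernel:
  assumes S: "S \<in> Sym D" and C: "C \<in> GL D"
  shows "transpose_mat C * S * C \<in> Sym_sub D i \<longleftrightarrow> (*\<^sub>v) C ` std D (D - i) \<subseteq> mat_kernel S"
proof -
  obtain B where B: "C \<in> carrier_mat D D" "B \<in> carrier_mat D D" "C * B = 1\<^sub>m D" "B * C = 1\<^sub>m D"
    "transpose_mat B * transpose_mat C = 1\<^sub>m D" using GL_obtain_inverse[OF C] .
  note Sc = Sym_carrier[OF S]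
  let ?R = "transpose_mat C * S * C"
  have R: "?R \<in> Sym D" using Sym_congruence[OF S B(1)] .
  show ?thesis
  proof
    assume h: "?R \<in> Sym_sub D i"
    show "(*\<^sub>v) C ` std D (D - i) \<subseteq> mat_kernel S"
    proof
      fix x assume "x \<in> (*\<^sub>v) C ` std D (D - i)"
      then obtain v where v: "v \<in> std D (D - i)" "x = C *\<^sub>v v" by auto
      have vc: "v \<in> carrier_vec D" using v by (simp add: std_def)
      have xc: "x \<in> carrier_vec D" using v vc B by simp
      have "?R *\<^sub>v v = 0\<^sub>v D"
      proof (rule eq_vecI)
        fix m assume "m < dim_vec (0\<^sub>v D)"
        then have m: "m < D" by simp
        have "(?R *\<^sub>v v) $ m = (\<Sum>n\<in>{0..<D}. ?R $$ (m, n) * v $ n)"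
          using Sym_carrier[OF R] vc m unfolding index_mult_mat_vec[OF m[folded carrier_matD(1)[OF Sym_carrier[OF R]]]]
          by (auto simp: scalar_prod_def simp del: index_mult_mat(1) intro!: sum.cong)
        also have "\<dots> = 0"
        proof (intro sum.neutral ballI)
          fix n assume "n \<in> {0..<D}"
          then show "?R $$ (m, n) * v $ n = 0"
            using h v(1) m by (cases "n < D - i") (auto simp: Sym_sub_def std_def simp del: index_mult_mat(1))
        qed
        finally show "(?R *\<^sub>v v) $ m = 0\<^sub>v D $ m" using m by simp
      qed (use Sym_carrier[OF R] in auto)
      then have "transpose_mat C *\<^sub>v (S *\<^sub>v x) = 0\<^sub>v D"
        unfolding v(2) using B Sc vc by (simp add: assoc_mult_mat_vec[where ?n\<^sub>1 = D and ?n\<^sub>2 = D and ?n\<^sub>3 = D])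
      then have "S *\<^sub>v x = transpose_mat B *\<^sub>v 0\<^sub>v D"
        using mult_inverse_vec[OF _ _ B(5), of "S *\<^sub>v x"] B Sc xc by simp
      also have "\<dots> = 0\<^sub>v D" using B(2) by (intro mult_mat_zero_vec) auto
      finally show "x \<in> mat_kernel S" using xc by (simp add: mat_kernel_iff[OF Sc])
    qed
  next
    assume h: "(*\<^sub>v) C ` std D (D - i) \<subseteq> mat_kernel S"
    have z: "?R $$ (m, n) = 0" if "m < D" "n < D - i" for m n
    proof -
      have "unit_vec D n \<in> (std D (D - i) :: 'a mod_ring vec set)" using that by (auto simp: std_def)
      then have "S *\<^sub>v (C *\<^sub>v unit_vec D n) = 0\<^sub>v D" using h mat_kernel_iff[OF Sc] by blast
      then show ?thesis using congruence_index[OF B(1) Sc, of m n] that B(1) by simp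
    qed
    have "?R $$ (m, n) = 0" if "m < D" "n < D" "m < D - i \<or> n < D - i" for m n
      using z[of m n] z[of n m] Sym_index[OF R that(1,2)] that by metis
    then show "?R \<in> Sym_sub D i" using R by (simp add: Sym_sub_def)
  qed
qed

text \<open>In the coordinates \<open>C^t b\<close> the annihilator of \<open>U\<close> consists of
  the vectors whose first \<open>D - i\<close> entries are zero. It sees exactly the lower right
  block of a symmetric matrix, so \<open>Sym_sub D i\<close> contains one representative for each
  Lagrangian over \<open>U\<close>.\<close>

lemma bij_Sym_sub_lag:
  fixes C :: "'p::prime_card mod_ring mat"
  assumes C: "C \<in> GL D" and i: "i \<le> D"
  defines "U \<equiv> (*\<^sub>v) C ` std D (D - i)"
  shows "bij_betw (\<lambda>F. lag D U (C * F * transpose_mat C)) (Sym_sub D i) {x \<in> max_isotropic D. upart D x = U}"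
proof -
  obtain B where B: "C \<in> carrier_mat D D" "B \<in> carrier_mat D D" "C * B = 1\<^sub>m D" "B * C = 1\<^sub>m D"
    "transpose_mat B * transpose_mat C = 1\<^sub>m D" "transpose_mat C * transpose_mat B = 1\<^sub>m D"
    using GL_obtain_inverse[OF C] .
  have sU: "sub D U" unfolding U_def using sub_image[OF B(1) sub_std] .
  have FS: "F \<in> Sym D" if "F \<in> Sym_sub D i" for F :: "'p mod_ring mat" using that by (simp add: Sym_sub_def)
  have tC: "transpose_mat C *\<^sub>v b \<in> carrier_vec D" if "b \<in> carrier_vec D" for b using B(1) that by simp
  have pU: "b \<in> perp D U \<longleftrightarrow> b \<in> carrier_vec D \<and> (\<forall>j<D - i. (transpose_mat C *\<^sub>v b) $ j = 0)" for b
  proof (cases "b \<in> carrier_vec D")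
    case True
    then show ?thesis
      unfolding U_def using perp_image_iff[OF B(1) subD(1)[OF sub_std] True] using True tC[OF True] by (simp add: perp_std)
  qed (use perp_carrier[of D U] in auto)
  have lc: "lag D U (C * F * transpose_mat C) = lag D U M \<longleftrightarrow> (\<forall>b\<in>perp D U. \<forall>b'\<in>perp D U.
      (F *\<^sub>v (transpose_mat C *\<^sub>v b)) \<bullet> (transpose_mat C *\<^sub>v b') = (M *\<^sub>v b) \<bullet> b')"
    if F: "F \<in> Sym D" and M: "M \<in> Sym D" for F M
    unfolding lag_eq_iff_scalar[OF sU Sym_congruence'[OF F B(1)] M]
    using congruence'_scalar[OF Sym_carrier[OF F] B(1)] pU by simp
  show ?thesis
    unfolding bij_betw_def
  proof
    show "inj_on (\<lambda>F. lag D U (C * F * transpose_mat C)) (Sym_sub D i)"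
    proof (rule inj_onI)
      fix F F' :: "'p mod_ring mat"
      assume F: "F \<in> Sym_sub D i" "F' \<in> Sym_sub D i" "lag D U (C * F * transpose_mat C) = lag D U (C * F' * transpose_mat C)"
      note Fc = Sym_carrier[OF FS[OF F(1)]] Sym_carrier[OF FS[OF F(2)]]
      have eq: "(F *\<^sub>v (transpose_mat C *\<^sub>v b)) \<bullet> (transpose_mat C *\<^sub>v b') = (F' *\<^sub>v (transpose_mat C *\<^sub>v b)) \<bullet> (transpose_mat C *\<^sub>v b')"
        if "b \<in> perp D U" "b' \<in> perp D U" for b b'
        using F(3) that congruence'_scalar[OF Fc(2) B(1)] pU
        unfolding lc[OF FS[OF F(1)] Sym_congruence'[OF FS[OF F(2)] B(1)]] by simp
      show "F = F'"
      proof (rule eq_matI)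
        fix m n assume "m < dim_row F'" "n < dim_col F'"
        then have mn: "m < D" "n < D" using Fc by auto
        show "F $$ (m, n) = F' $$ (m, n)"
        proof (cases "m < D - i \<or> n < D - i")
          case True
          then show ?thesis using F(1,2) mn by (auto simp: Sym_sub_def)
        next
          case False
          have e: "transpose_mat B *\<^sub>v unit_vec D k \<in> perp D U" "transpose_mat C *\<^sub>v (transpose_mat B *\<^sub>v unit_vec D k) = unit_vec D k"
            if "k < D" "\<not> k < D - i" for k
          proof -
            show "transpose_mat C *\<^sub>v (transpose_mat B *\<^sub>v unit_vec D k) = unit_vec D k"
              using mult_inverse_vec[OF _ _ B(6), of "unit_vec D k"] B by simp
            then show "transpose_mat B *\<^sub>v unit_vec D k \<in> perp D U"
              unfolding pU using that B(2) by auto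
          qed
          have "(F *\<^sub>v unit_vec D n) \<bullet> unit_vec D m = (F' *\<^sub>v unit_vec D n) \<bullet> unit_vec D m"
            using eq[OF e(1)[of n] e(1)[of m]] e(2)[of n] e(2)[of m] mn False by simp
          then have "(F *\<^sub>v unit_vec D n) $ m = (F' *\<^sub>v unit_vec D n) $ m"
            using mn by (simp only: scalar_prod_right_unit)
          then show ?thesis using mult_unit_vec_index[OF Fc(1) mn] mult_unit_vec_index[OF Fc(2) mn] by simp
        qed
      qed (use Fc in auto)
    qed
    show "(\<lambda>F. lag D U (C * F * transpose_mat C)) ` Sym_sub D i = {x \<in> max_isotropic D. upart D x = U}"
    proof (intro equalityI subsetI)
      fix x assume "x \<in> (\<lambda>F. lag D U (C * F * transpose_mat C)) ` Sym_sub D i"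
      then obtain F where F: "F \<in> Sym_sub D i" "x = lag D U (C * F * transpose_mat C)" by auto
      then show "x \<in> {x \<in> max_isotropic D. upart D x = U}"
        using lag_max_isotropic[OF sU Sym_congruence'[OF FS[OF F(1)] B(1)]] upart_lag[OF sU Sym_congruence'[OF FS[OF F(1)] B(1)]]
        by simp
    next
      fix x assume x: "x \<in> {x \<in> max_isotropic D. upart D x = U}"
      then obtain M where M: "M \<in> Sym D" "x = lag D U M" using max_isotropic_eq_lag[of x D] by auto
      define M' where "M' = B * M * transpose_mat B"
      have M': "M' \<in> Sym D" unfolding M'_def using Sym_congruence'[OF M(1) B(2)] .
      \<comment> \<open>Entries outside the block are discarded; the annihilator does not see
        them.\<close>
      define F where "F = mat D D (\<lambda>(m, n). if m < D - i \<or> n < D - i then 0 else M' $$ (m, n))"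
      have F: "F \<in> Sym_sub D i"
        using Sym_index[OF M'] by (auto simp: F_def Sym_sub_def Sym_def intro!: eq_matI)
      have "lag D U (C * F * transpose_mat C) = lag D U M"
        unfolding lc[OF FS[OF F] M(1)]
      proof (intro ballI)
        fix b b' assume b: "b \<in> perp D U" "b' \<in> perp D U"
        then have bc: "b \<in> carrier_vec D" "b' \<in> carrier_vec D" using perp_carrier by blast+
        let ?\<beta> = "transpose_mat C *\<^sub>v b" and ?\<beta>' = "transpose_mat C *\<^sub>v b'"
        have \<beta>: "?\<beta> $ j = 0" "?\<beta>' $ j = 0" if "j < D - i" for j using b that unfolding pU by auto
        have \<beta>c: "?\<beta> \<in> carrier_vec D" "?\<beta>' \<in> carrier_vec D" using tC bc by auto
        have ent: "(G *\<^sub>v x) \<bullet> y = (\<Sum>m\<in>{0..<D}. \<Sum>n\<in>{0..<D}. G $$ (m, n) * x $ n * y $ m)"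
          if "G \<in> carrier_mat D D" "x \<in> carrier_vec D" "y \<in> carrier_vec D" for G :: "'p mod_ring mat" and x y
          using that by (auto simp: scalar_prod_def sum_distrib_right intro!: sum.cong)
        have "(F *\<^sub>v ?\<beta>) \<bullet> ?\<beta>' = (M' *\<^sub>v ?\<beta>) \<bullet> ?\<beta>'"
          unfolding ent[OF Sym_carrier[OF FS[OF F]] \<beta>c] ent[OF Sym_carrier[OF M'] \<beta>c]
        proof (intro sum.cong refl)
          fix m n assume "m \<in> {0..<D}" "n \<in> {0..<D}"
          then show "F $$ (m, n) * ?\<beta> $ n * ?\<beta>' $ m = M' $$ (m, n) * ?\<beta> $ n * ?\<beta>' $ m"
            using \<beta>(1)[of n] \<beta>(2)[of m] by (cases "m < D - i \<or> n < D - i") (auto simp: F_def)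
        qed
        also have "\<dots> = (M *\<^sub>v b) \<bullet> b'"
          unfolding M'_def congruence'_scalar[OF Sym_carrier[OF M(1)] B(2) \<beta>c]
          using mult_inverse_vec[OF _ _ B(5) bc(1)] mult_inverse_vec[OF _ _ B(5) bc(2)] B by simp
        finally show "(F *\<^sub>v ?\<beta>) \<bullet> ?\<beta>' = (M *\<^sub>v b) \<bullet> b'" .
      qed
      then show "x \<in> (\<lambda>F. lag D U (C * F * transpose_mat C)) ` Sym_sub D i" using F M(2) by blast
    qed
  qed
qed

subsection \<open>The space \<open>W(S)\<close> and the isomorphism \<open>\<phi>\<close>\<close>

lemma fdim_eqI: "sub n (U :: 'p::prime_card mod_ring vec set) \<Longrightarrow> card U = CARD('p) ^ k \<Longrightarrow> fdim n U = k"
  using card_sub[of n U] power_inject_exp[OF card_field_gt_1[where 'p = 'p]] by simp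

lemma fdim_le:
  assumes "sub n (U :: 'p::prime_card mod_ring vec set)"
  shows "fdim n U \<le> n"
proof -
  obtain k where "k \<le> n" "card U = CARD('p) ^ k" using sub_card_obtain[OF assms] .
  then show ?thesis using fdim_eqI[OF assms] by simp
qed

lemma GL_image_std:
  fixes C :: "'p::prime_card mod_ring mat"
  assumes C: "C \<in> GL D" and i: "i \<le> D"
  shows "sub D ((*\<^sub>v) C ` std D (D - i))" "fdim D ((*\<^sub>v) C ` std D (D - i)) = D - i"
proof -
  obtain B where B: "C \<in> carrier_mat D D" "B \<in> carrier_mat D D" "C * B = 1\<^sub>m D" "B * C = 1\<^sub>m D"
    using GL_obtain_inverse[OF C] by metis
  show s: "sub D ((*\<^sub>v) C ` std D (D - i))" using sub_image[OF B(1) sub_std] .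
  have "inj_on ((*\<^sub>v) C) (std D (D - i))"
  proof (rule inj_on_inverseI)
    fix v :: "'p mod_ring vec" assume "v \<in> std D (D - i)"
    then show "B *\<^sub>v (C *\<^sub>v v) = v" using mult_inverse_vec[OF B(2,1,4)] subD(1)[OF sub_std[of D "D - i"]] by blast
  qed
  then have "card ((*\<^sub>v) C ` std D (D - i)) = CARD('p) ^ (D - i)"
    using card_std[of "D - i" D, where 'p = 'p] by (simp add: card_image)
  then show "fdim D ((*\<^sub>v) C ` std D (D - i)) = D - i" using fdim_eqI[OF s] by blast
qed

lemma covers_fdim:
  assumes "sub D U" "U' \<in> covers D U"
  shows "fdim D U' = fdim D (U :: 'p::prime_card mod_ring vec set) + 1"
  using assms card_sub[OF assms(1)] by (intro fdim_eqI) (auto simp: covers_def subs_def)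

lemma covers_iff_fdim:
  assumes "sub D U" "sub D (U' :: 'p::prime_card mod_ring vec set)"
  shows "U' \<in> covers D U \<longleftrightarrow> U \<subset> U' \<and> fdim D U' = fdim D U + 1"
  using assms card_sub[OF assms(1)] card_sub[OF assms(2)] covers_fdim[OF assms(1), of U']
  by (auto simp: covers_def subs_def)

lemma cocovers_iff_covers:
  assumes "sub D U" "sub D (U' :: 'p::prime_card mod_ring vec set)"
  shows "U' \<in> cocovers D U \<longleftrightarrow> U \<in> covers D U'"
  using assms by (auto simp: cocovers_def covers_def subs_def)

text \<open>Inverse to \<open>upart\<close> on subspaces of \<open>x_0\<close>: it puts a subspace
  of \<open>F_q^D\<close> back into the ambient symplectic space.\<close>

definition up0 :: "nat \<Rightarrow> 'p::prime_card mod_ring vec set \<Rightarrow> 'p mod_ring vec set" where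
  "up0 D U = (\<lambda>u. u @\<^sub>v 0\<^sub>v D) ` U"

lemma upart_up0: "U \<subseteq> carrier_vec D \<Longrightarrow> upart D (up0 D U) = U"
  by (auto simp: upart_def up0_def append_eq subset_iff image_iff)

lemma up0_upart:
  assumes "V \<subseteq> {v @\<^sub>v 0\<^sub>v D | v. v \<in> carrier_vec D}"
  shows "up0 D (upart D V) = V"
  using assms by (auto simp: upart_def up0_def)

lemma sub_up0:
  assumes "sub D U"
  shows "sub (2 * D) (up0 D U)"
proof -
  have c: "u \<in> carrier_vec D" if "u \<in> U" for u using subD(1)[OF assms] that by auto
  have z: "(0\<^sub>v D :: 'a mod_ring vec) + 0\<^sub>v D = 0\<^sub>v D" "\<And>c. c \<cdot>\<^sub>v (0\<^sub>v D :: 'a mod_ring vec) = 0\<^sub>v D" by (auto simp: vec_eq_iff)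
  have "(a @\<^sub>v 0\<^sub>v D) + (b @\<^sub>v 0\<^sub>v D) = (a + b) @\<^sub>v 0\<^sub>v D" if "a \<in> U" "b \<in> U" for a b
    using append_vec_add[OF c[OF that(1)] c[OF that(2)], of "0\<^sub>v D" D "0\<^sub>v D"] z by simp
  then show ?thesis
    using subD(2,3,4)[OF assms] c z unfolding sub_def up0_def by (auto simp: smult_append zero_append)
qed

lemma fdim_up0:
  assumes "sub D (U :: 'p::prime_card mod_ring vec set)"
  shows "fdim (2 * D) (up0 D U) = fdim D U"
proof (rule fdim_eqI[OF sub_up0[OF assms]])
  have "inj_on (\<lambda>u. u @\<^sub>v 0\<^sub>v D) U"
    using subD(1)[OF assms] append_eq by (intro inj_onI) blast
  then show "card (up0 D U) = CARD('p) ^ fdim D U"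
    unfolding up0_def using card_sub[OF assms] by (simp add: card_image)
qed

lemma lag_Int_x_sub_0:
  assumes U: "sub D (U :: 'p::prime_card mod_ring vec set)"
  shows "lag D U (0\<^sub>m D D) \<inter> x_sub D 0 = up0 D U"
proof -
  have x0: "x_sub D 0 = lag D (carrier_vec D) (0\<^sub>m D D :: 'p mod_ring mat)" using x_sub_eq_lag[of 0 D] by simp
  have p: "b \<in> perp D (carrier_vec D) \<longleftrightarrow> b = 0\<^sub>v D" for b :: "'p mod_ring vec"
    using perp_std[of D D b] by (auto simp: vec_eq_iff)
  have z: "0\<^sub>m D D *\<^sub>v b = (0\<^sub>v D :: 'p mod_ring vec)" if "b \<in> carrier_vec D" for b using zero_mat_mult_vec[OF that] .
  have pc: "b \<in> carrier_vec D" if "b \<in> perp D W" for b and W :: "'p mod_ring vec set" using that perp_carrier by blast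
  have p0: "(0\<^sub>v D :: 'p mod_ring vec) \<in> perp D U" using subD(2)[OF sub_perp[OF subD(1)[OF U]]] .
  have Uc: "u \<in> carrier_vec D" if "u \<in> U" for u using subD(1)[OF U] that by auto
  show ?thesis
  proof (intro equalityI subsetI)
    fix x assume "x \<in> lag D U (0\<^sub>m D D) \<inter> x_sub D 0"
    then obtain a b where x: "x = a @\<^sub>v b" "a \<in> carrier_vec D" "a @\<^sub>v b \<in> lag D U (0\<^sub>m D D)"
      "a @\<^sub>v b \<in> lag D (carrier_vec D) (0\<^sub>m D D)"
      unfolding x0 by (auto simp: lag_def[of D U])
    have b: "b = 0\<^sub>v D" using x(4) unfolding lag_iff[OF x(2)] p by blast
    have "a - 0\<^sub>m D D *\<^sub>v b \<in> U" using x(3) unfolding lag_iff[OF x(2)] by blast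
    then have "a \<in> U" using z[of b] b x(2) by simp
    then show "x \<in> up0 D U" using x(1) b by (simp add: up0_def)
  next
    fix x assume "x \<in> up0 D U"
    then obtain a where a: "a \<in> U" "x = a @\<^sub>v 0\<^sub>v D" by (auto simp: up0_def)
    note ac = Uc[OF a(1)]
    show "x \<in> lag D U (0\<^sub>m D D) \<inter> x_sub D 0"
      unfolding x0 a(2) Int_iff lag_iff[OF ac] p using p0 z[of "0\<^sub>v D"] a(1) ac by simp
  qed
qed

text \<open>The common index set of coordinates for \<open>W(S)\<close> and for the span of the
  subspace lattice.\<close>

definition KS :: "nat \<Rightarrow> 'p::prime_card mod_ring mat \<Rightarrow> 'p mod_ring vec set set" where
  "KS D S = {U. sub D U \<and> U \<subseteq> mat_kernel S}"

lemma finite_KS [simp]: "finite (KS D S)"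
  by (rule finite_subset[OF _ finite_subs[of D]]) (auto simp: KS_def subs_def)

lemma upart_up0_KS [simp]: "U \<in> KS D S \<Longrightarrow> upart D (up0 D U) = U"
  using upart_up0[OF subD(1)[of D U]] by (simp add: KS_def)

lemma subs_V0_eq: "subs_V0 D S = up0 D ` KS D (S :: 'p::prime_card mod_ring mat)" if "S \<in> Sym D"
proof (intro equalityI subsetI)
  note Sc = Sym_carrier[OF that]
  have kc: "v \<in> carrier_vec D" if "v \<in> mat_kernel S" for v using that mat_kernel_iff[OF Sc] by blast
  fix V assume "V \<in> subs_V0 D S"
  then have V: "sub (2 * D) V" "V \<subseteq> V0 D S" by (auto simp: subs_V0_def fsubspace_iff)
  have Vu: "up0 D (upart D V) = V" using V(2) kc by (intro up0_upart) (force simp: V0_def)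
  have "upart D V \<subseteq> mat_kernel S"
  proof
    fix a assume "a \<in> upart D V"
    then have a: "a \<in> carrier_vec D" "a @\<^sub>v 0\<^sub>v D \<in> V0 D S" using V(2) by (auto simp: upart_def)
    then obtain v where v: "v \<in> mat_kernel S" "a @\<^sub>v 0\<^sub>v D = v @\<^sub>v 0\<^sub>v D" by (auto simp: V0_def)
    then show "a \<in> mat_kernel S" using append_eq[OF a(1) kc[OF v(1)]] by blast
  qed
  then have "upart D V \<in> KS D S" using sub_upart[OF V(1)] by (simp add: KS_def)
  then show "V \<in> up0 D ` KS D S" using Vu by (metis imageI)
next
  fix V assume "V \<in> up0 D ` KS D S"
  then show "V \<in> subs_V0 D S" using sub_up0 by (auto simp: subs_V0_def fsubspace_iff KS_def V0_def up0_def)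
qed

lemma sum_ket: "finite B \<Longrightarrow> (\<Sum>b\<in>B. f b * ket b x) = (if x \<in> B then f x else 0)"
proof -
  assume "finite B"
  moreover have "(\<Sum>b\<in>B. f b * ket b x) = (\<Sum>b\<in>B. if x = b then f x else 0)"
    by (intro sum.cong refl) (simp add: ket_def)
  ultimately show ?thesis by simp
qed

lemma lin_ext_apply: "lin_ext B f v y = (\<Sum>b\<in>B. v b * f b y)"
  by (simp add: lin_ext_def sum_fun_apply cscale_def)

lemma lin_ext_sum_ket:
  assumes "finite B" "\<And>i. i \<in> I \<Longrightarrow> x i \<in> B"
  shows "lin_ext B f (cscale c (\<Sum>i\<in>I. cscale (a i) (ket (x i)))) = cscale c (\<Sum>i\<in>I. cscale (a i) (f (x i)))"
proof
  fix y
  have "(\<Sum>b\<in>B. ket (x i) b * f b y) = f (x i) y" if "i \<in> I" for i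
  proof -
    have "(\<Sum>b\<in>B. ket (x i) b * f b y) = (\<Sum>b\<in>B. if b = x i then f (x i) y else 0)"
      by (intro sum.cong refl) (simp add: ket_def)
    then show ?thesis using assms that by simp
  qed
  then have "(\<Sum>i\<in>I. a i * (\<Sum>b\<in>B. ket (x i) b * f b y)) = (\<Sum>i\<in>I. a i * f (x i) y)"
    by simp
  moreover have "(\<Sum>b\<in>B. (c * (\<Sum>i\<in>I. a i * ket (x i) b)) * f b y) = c * (\<Sum>i\<in>I. a i * (\<Sum>b\<in>B. ket (x i) b * f b y))"
    unfolding sum_distrib_left sum_distrib_right by (subst sum.swap) (simp add: mult_ac)
  ultimately show "lin_ext B f (cscale c (\<Sum>i\<in>I. cscale (a i) (ket (x i)))) y = cscale c (\<Sum>i\<in>I. cscale (a i) (f (x i))) y"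
    unfolding lin_ext_apply by (simp add: cscale_def sum_fun_apply)
qed

text \<open>The factor \<open>q^(- i (i + 1) / 4)\<close> with \<open>i = D - dim U\<close>. There
  are \<open>q^(i (i + 1) / 2)\<close> vertices over \<open>U\<close>, one for each symmetric matrix
  of size \<open>i\<close>, so it gives the plane wave norm 1.\<close>

definition nrm :: "nat \<Rightarrow> 'p::prime_card mod_ring vec set \<Rightarrow> real" where
  "nrm D U = real CARD('p) powr (- (real (D - fdim D U) * (real (D - fdim D U) + 1) / 4))"

lemma nrm_pos: "nrm D (U :: 'p::prime_card mod_ring vec set) > 0"
  using card_field_gt_1[where 'p = 'p] by (simp add: nrm_def)

text \<open>
  The vector \<open>|[C],S>_i\<close> depends on \<open>C\<close> only through \<open>U = (C,0) x_i \<inter> x_0\<close>: it is the normalised plane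
  wave on the layer over \<open>U\<close>.  Thus \<open>Psi D S g\<close> is the element of \<open>W(S)\<close> with coordinates \<open>g U\<close>.
\<close>

definition Psi :: "nat \<Rightarrow> 'p::prime_card mod_ring mat \<Rightarrow> 'p state \<Rightarrow> 'p state" where
  "Psi D S g = (\<lambda>x. if x \<in> max_isotropic D \<and> upart D x \<in> KS D S
     then g (upart D x) * of_real (nrm D (upart D x)) * wave D S x else 0)"

lemma Psi_add: "Psi D S (g + h) = Psi D S g + Psi D S h"
  by (auto simp: Psi_def fun_eq_iff algebra_simps)

lemma Psi_cscale: "Psi D S (cscale c g) = cscale c (Psi D S g)"
  by (auto simp: Psi_def cscale_def fun_eq_iff)

lemma Psi_expand: "Psi D S g = (\<Sum>U\<in>KS D S. cscale (g U) (Psi D S (ket U)))"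
proof
  fix x
  have "(\<Sum>U\<in>KS D S. cscale (g U) (Psi D S (ket U)) x) = (\<Sum>U\<in>KS D S. if x \<in> max_isotropic D \<and> upart D x \<in> KS D S
      then of_real (nrm D (upart D x)) * wave D S x * (g U * ket U (upart D x)) else 0)"
    by (intro sum.cong refl) (auto simp: Psi_def cscale_def)
  also have "\<dots> = Psi D S g x"
    using sum_ket[of "KS D S" g "upart D x"] by (auto simp: Psi_def sum_distrib_left[symmetric])
  finally show "Psi D S g x = (\<Sum>U\<in>KS D S. cscale (g U) (Psi D S (ket U))) x"
    by (simp add: sum_fun_apply)
qed

text \<open>The sum over \<open>Sym_sub D i\<close> visits each vertex over \<open>U\<close> once,
  and cyclicity of the trace, \<open>tr (C^t S C F) = tr (S C F C^t)\<close>, identifies the phase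
  with the wave there. The dependence on \<open>C\<close> disappears.\<close>

lemma psi_eq_Psi:
  fixes C :: "'p::prime_card mod_ring mat"
  assumes S: "S \<in> Sym D" and i: "i \<le> D" and C: "C \<in> GL D" and CS: "transpose_mat C * S * C \<in> Sym_sub D i"
  shows "psi D i C S = Psi D S (ket ((*\<^sub>v) C ` std D (D - i)))"
proof
  fix x
  let ?U = "(*\<^sub>v) C ` std D (D - i)" and ?X = "max_isotropic D :: 'p mod_ring vec set set"
  let ?h = "\<lambda>F. lag D ?U (C * F * transpose_mat C)"
  note U = GL_image_std[OF C i]
  have UK: "?U \<subseteq> mat_kernel S" using Sym_sub_iff_kernel[OF S C] CS by blast
  have Cc: "C \<in> carrier_mat D D" using C by (simp add: GL_def)
  have FS: "F \<in> Sym D" if "F \<in> Sym_sub D i" for F :: "'p mod_ring mat" using that by (simp add: Sym_sub_def)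
  let ?c = "complex_of_real (nrm D ?U)"
  have "psi_id D i (transpose_mat C * S * C) = cscale ?c (\<Sum>F\<in>Sym_sub D i.
      cscale (chi (mtrace (transpose_mat C * S * C * F))) (ket (lag D (std D (D - i)) F)))"
    unfolding psi_id_def chi_def nrm_def U(2) using i FS by (simp add: act_unipotent_x_sub)
  then have "psi D i C S = cscale ?c (\<Sum>F\<in>Sym_sub D i.
      cscale (chi (mtrace (transpose_mat C * S * C * F))) (ket (act (siegel D C (0\<^sub>m D D)) (lag D (std D (D - i)) F))))"
    unfolding psi_def rho_def
    by (simp only:) (rule lin_ext_sum_ket[OF finite_max_isotropic], rule lag_max_isotropic[OF sub_std], rule FS)
  also have "\<dots> = cscale ?c (\<Sum>F\<in>Sym_sub D i. cscale (wave D S (?h F)) (ket (?h F)))"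
  proof (intro arg_cong[of _ _ "cscale ?c"] sum.cong refl)
    fix F :: "'p mod_ring mat" assume F: "F \<in> Sym_sub D i"
    have "act (siegel D C (0\<^sub>m D D)) (lag D (std D (D - i)) F) = ?h F"
      using act_siegel_lag[OF C Sym_zero sub_std FS[OF F], of "D - i"] Sym_carrier[OF FS[OF F]] by simp
    moreover have "chi (mtrace (transpose_mat C * S * C * F)) = wave D S (?h F)"
      unfolding wave_lag[OF S U(1) UK Sym_congruence'[OF FS[OF F] Cc]]
        mtrace_congruence[OF Cc Sym_carrier[OF S] Sym_carrier[OF FS[OF F]]] ..
    ultimately show "cscale (chi (mtrace (transpose_mat C * S * C * F))) (ket (act (siegel D C (0\<^sub>m D D)) (lag D (std D (D - i)) F)))
        = cscale (wave D S (?h F)) (ket (?h F))" by simp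
  qed
  finally have "psi D i C S x = ?c * (\<Sum>F\<in>Sym_sub D i. wave D S (?h F) * ket (?h F) x)"
    by (simp add: cscale_def sum_fun_apply)
  also have "\<dots> = ?c * (\<Sum>z\<in>{x \<in> ?X. upart D x = ?U}. wave D S z * ket z x)"
    by (rule arg_cong[OF sum.reindex_bij_betw[OF bij_Sym_sub_lag[OF C i]]])
  also have "\<dots> = Psi D S (ket ?U) x"
  proof -
    have fin: "finite {x \<in> ?X. upart D x = ?U}" using finite_max_isotropic by (rule rev_finite_subset) auto
    moreover have "?U \<in> KS D S" using U(1) UK by (simp add: KS_def)
    ultimately show ?thesis
      unfolding sum_ket[OF fin] by (cases "upart D x = ?U") (simp_all add: Psi_def ket_def)
  qed
  finally show "psi D i C S x = Psi D S (ket ?U) x" .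
qed

lemma KS_obtain:
  assumes S: "(S :: 'p::prime_card mod_ring mat) \<in> Sym D" and U: "U \<in> KS D S"
  obtains C where "C \<in> GL D" "U = (*\<^sub>v) C ` std D (D - (D - fdim D U))" "transpose_mat C * S * C \<in> Sym_sub D (D - fdim D U)"
proof -
  have U': "sub D U" "U \<subseteq> mat_kernel S" using U by (auto simp: KS_def)
  have k: "fdim D U \<le> D" using fdim_le[OF U'(1)] .
  obtain C where C: "C \<in> GL D" "(*\<^sub>v) C ` std D (fdim D U) = U"
    using GL_flag[OF U'(1) card_sub[OF U'(1)] k] by metis
  then show ?thesis using that[of C] Sym_sub_iff_kernel[OF S C(1), of "D - fdim D U"] k U'(2) by simp
qed

text \<open>\<open>Psi\<close> is linear and its values at the kets of kernel subspaces are the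
  generators of the layers. Identities on \<open>W(S)\<close> can therefore be verified on
  coordinate functions.\<close>

lemma W_space_eq:
  assumes S: "(S :: 'p::prime_card mod_ring mat) \<in> Sym D"
  shows "W_space D S = range (Psi D S)"
proof (intro equalityI subsetI)
  have sub: "cfun.subspace (range (Psi D S))"
  proof (rule cfun.subspaceI)
    have "Psi D S 0 = 0" by (auto simp: Psi_def fun_eq_iff)
    then show "0 \<in> range (Psi D S)" by (metis rangeI)
  qed (auto simp: Psi_add[symmetric] Psi_cscale[symmetric])
  have layer: "W_layer D S i \<subseteq> range (Psi D S)" if "i \<le> D" for i
    unfolding W_layer_def using psi_eq_Psi[OF S that] by (intro cfun.span_minimal sub) auto
  fix w assume "w \<in> W_space D S"
  then obtain f where f: "w = (\<Sum>i\<le>D. f i)" "\<forall>i\<le>D. f i \<in> W_layer D S i" by (auto simp: W_space_def)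
  show "w \<in> range (Psi D S)" unfolding f(1) using f(2) layer by (intro cfun.subspace_sum sub) auto
next
  fix w assume "w \<in> range (Psi D S)"
  then obtain g where g: "w = Psi D S g" by auto
  let ?f = "\<lambda>U. cscale (g U) (Psi D S (ket U))"
  have "w = (\<Sum>i\<le>D. \<Sum>U\<in>{U \<in> KS D S. D - fdim D U = i}. ?f U)"
    unfolding g by (subst Psi_expand, rule sum.group[symmetric]) auto
  moreover have "(\<Sum>U\<in>{U \<in> KS D S. D - fdim D U = i}. ?f U) \<in> W_layer D S i" for i
    unfolding W_layer_def
  proof (intro cfun.span_sum cfun.span_scale cfun.span_base)
    fix U assume "U \<in> {U \<in> KS D S. D - fdim D U = i}"
    then have U: "U \<in> KS D S" "i = D - fdim D U" by auto
    obtain C where C: "C \<in> GL D" "U = (*\<^sub>v) C ` std D (D - (D - fdim D U))" "transpose_mat C * S * C \<in> Sym_sub D (D - fdim D U)"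
      using KS_obtain[OF S U(1)] .
    have "Psi D S (ket U) = psi D i C S" using psi_eq_Psi[OF S _ C(1,3)] C(2) U(2) by simp
    then show "Psi D S (ket U) \<in> {psi D i C S | C. C \<in> GL D \<and> transpose_mat C * S * C \<in> Sym_sub D i}"
      using C(1,3) U(2) by blast
  qed
  ultimately show "w \<in> W_space D S" unfolding W_space_def by blast
qed

text \<open>The counterpart of \<open>Psi\<close> on the lattice side: the vector whose coordinate
  at the copy of \<open>U\<close> in \<open>x_0\<close> is \<open>g U\<close>.\<close>

definition Lam :: "nat \<Rightarrow> 'p::prime_card mod_ring mat \<Rightarrow> 'p state \<Rightarrow> 'p state" where
  "Lam D S g = (\<lambda>V. if V \<in> subs_V0 D S then g (upart D V) else 0)"

text \<open>An explicit candidate for the isomorphism: the coordinate at \<open>U\<close> is read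
  off at the vertex with \<open>M = 0\<close>, where every wave has value 1.\<close>

definition phi_map :: "nat \<Rightarrow> 'p::prime_card mod_ring mat \<Rightarrow> 'p state \<Rightarrow> 'p state" where
  "phi_map D S = restrict (\<lambda>w. Lam D S (\<lambda>U. w (lag D U (0\<^sub>m D D)) / of_real (nrm D U))) (W_space D S)"

lemma Lam_cong: "S \<in> Sym D \<Longrightarrow> (\<And>U. U \<in> KS D S \<Longrightarrow> g U = h U) \<Longrightarrow> Lam D S g = Lam D S h"
  by (auto simp: Lam_def fun_eq_iff subs_V0_eq)

lemma Psi_cong: "(\<And>U. U \<in> KS D S \<Longrightarrow> g U = h U) \<Longrightarrow> Psi D S g = Psi D S h"
  by (auto simp: Psi_def fun_eq_iff)

lemma Psi_eval:
  assumes S: "S \<in> Sym D" and U: "U \<in> KS D S" and M: "M \<in> Sym D"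
  shows "Psi D S g (lag D U M) = g U * of_real (nrm D U) * chi (mtrace (S * M))"
proof -
  have U': "sub D U" "U \<subseteq> mat_kernel S" using U by (auto simp: KS_def)
  show ?thesis
    using lag_max_isotropic[OF U'(1) M] upart_lag[OF U'(1) M] U wave_lag[OF S U' M] by (simp add: Psi_def)
qed

lemma phi_map_Psi:
  assumes S: "(S :: 'p::prime_card mod_ring mat) \<in> Sym D"
  shows "phi_map D S (Psi D S g) = Lam D S g"
proof -
  have "mtrace (S * 0\<^sub>m D D) = 0" using Sym_carrier[OF S] by (simp add: mtrace_def)
  then have "Psi D S g (lag D U (0\<^sub>m D D)) / of_real (nrm D U) = g U" if "U \<in> KS D S" for U
    using Psi_eval[OF S that Sym_zero, of g] nrm_pos[of D U] by simp
  then show ?thesis unfolding phi_map_def using W_space_eq[OF S] by (auto intro: Lam_cong[OF S])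
qed

lemma Lam_eqD:
  assumes S: "S \<in> Sym D" and eq: "Lam D S g = Lam D S h" and U: "U \<in> KS D S"
  shows "g U = h U"
proof -
  have V: "up0 D U \<in> subs_V0 D S" using subs_V0_eq[OF S] U by blast
  then show ?thesis using fun_cong[OF eq, of "up0 D U"] upart_up0_KS[OF U] by (simp add: Lam_def)
qed

lemma finite_subs_V0 [simp]: "finite (subs_V0 D (S :: 'p::prime_card mod_ring mat))"
  by (rule finite_subset[of _ "Pow (carrier_vec (2 * D))"]) (auto simp: subs_V0_def fsubspace_iff sub_def)

lemma VL_space_eq:
  assumes S: "(S :: 'p::prime_card mod_ring mat) \<in> Sym D"
  shows "VL_space D S = range (Lam D S)"
proof (intro equalityI subsetI)
  fix c assume "c \<in> VL_space D S"
  then have c: "\<forall>V. V \<notin> subs_V0 D S \<longrightarrow> c V = 0" unfolding VL_space_def span_ket[OF finite_subs_V0] .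
  have "up0 D (upart D V) = V" if "V \<in> subs_V0 D S" for V
    using that by (auto simp: subs_V0_eq[OF S])
  then have "c = Lam D S (\<lambda>U. c (up0 D U))" using c by (auto simp: Lam_def fun_eq_iff)
  then show "c \<in> range (Lam D S)" by blast
next
  fix c assume "c \<in> range (Lam D S)"
  then show "c \<in> VL_space D S" unfolding VL_space_def span_ket[OF finite_subs_V0] by (auto simp: Lam_def)
qed

lemma Lam_ket:
  assumes S: "S \<in> Sym D" and U: "U \<in> KS D S"
  shows "Lam D S (ket U) = ket (up0 D U)"
proof
  fix V
  have "V = up0 D U \<longleftrightarrow> V \<in> subs_V0 D S \<and> upart D V = U"
    unfolding subs_V0_eq[OF S] using U by auto
  then show "Lam D S (ket U) V = ket (up0 D U) V" by (simp add: Lam_def ket_def)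
qed

lemma is_phi_phi_map:
  assumes S: "(S :: 'p::prime_card mod_ring mat) \<in> Sym D"
  shows "is_phi D S (phi_map D S)"
  unfolding is_phi_def
proof (intro conjI ballI allI impI)
  note W = W_space_eq[OF S] and p = phi_map_Psi[OF S]
  show "phi_map D S \<in> extensional (W_space D S)" by (simp add: phi_map_def)
  show "phi_map D S (u + v) = phi_map D S u + phi_map D S v" if "u \<in> W_space D S" "v \<in> W_space D S" for u v
    using that unfolding W by (auto simp: Psi_add[symmetric] p Lam_def fun_eq_iff)
  show "phi_map D S (cscale c v) = cscale c (phi_map D S v)" if "v \<in> W_space D S" for c v
  proof -
    obtain g where v: "v = Psi D S g" using \<open>v \<in> W_space D S\<close> unfolding W by blast
    show ?thesis unfolding v Psi_cscale[symmetric] p by (simp add: Lam_def fun_eq_iff cscale_def)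
  qed
  show "phi_map D S (psi D i C S) = ket (act (siegel D C (0\<^sub>m D D)) (x_sub D i) \<inter> x_sub D 0)"
    if i: "i \<le> D" and C: "C \<in> GL D" and CS: "transpose_mat C * S * C \<in> Sym_sub D i" for i C
  proof -
    note U = GL_image_std[OF C i]
    have "(*\<^sub>v) C ` std D (D - i) \<in> KS D S" using U(1) Sym_sub_iff_kernel[OF S C] CS by (auto simp: KS_def)
    then show ?thesis
      unfolding psi_eq_Psi[OF S i C CS] p act_siegel_x_sub[OF i C] lag_Int_x_sub_0[OF U(1)] by (rule Lam_ket[OF S])
  qed
  show "bij_betw (phi_map D S) (W_space D S) (VL_space D S)"
    unfolding bij_betw_def W VL_space_eq[OF S]
  proof
    show "inj_on (phi_map D S) (range (Psi D S))"
      by (intro inj_onI) (auto simp: p intro!: Psi_cong dest: Lam_eqD[OF S])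
    show "phi_map D S ` range (Psi D S) = range (Lam D S)" by (auto simp: p image_iff)
  qed
qed

text \<open>Any map with the required properties has prescribed values at
  \<open>Psi D S (ket U)\<close>, and these vectors span \<open>W(S)\<close>. Linearity is available
  only on \<open>W(S)\<close>, hence the induction over partial sums that stay inside it.\<close>

lemma phi_eq:
  assumes S: "(S :: 'p::prime_card mod_ring mat) \<in> Sym D"
  shows "phi D S = phi_map D S"
  unfolding phi_def
proof (rule the_equality)
  show "is_phi D S (phi_map D S)" by (rule is_phi_phi_map[OF S])
  fix f assume f: "is_phi D S f"
  note W = W_space_eq[OF S]
  have ext: "f \<in> extensional (W_space D S)" and add: "\<And>u v. u \<in> W_space D S \<Longrightarrow> v \<in> W_space D S \<Longrightarrow> f (u + v) = f u + f v"
    and scale: "\<And>c v. v \<in> W_space D S \<Longrightarrow> f (cscale c v) = cscale c (f v)"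
    and gen: "\<And>i C. i \<le> D \<Longrightarrow> C \<in> GL D \<Longrightarrow> transpose_mat C * S * C \<in> Sym_sub D i \<Longrightarrow>
        f (psi D i C S) = ket (act (siegel D C (0\<^sub>m D D)) (x_sub D i) \<inter> x_sub D 0)"
    using f unfolding is_phi_def by blast+
  have fket: "f (Psi D S (ket U)) = ket (up0 D U)" if U: "U \<in> KS D S" for U
  proof -
    obtain C where C: "C \<in> GL D" "U = (*\<^sub>v) C ` std D (D - (D - fdim D U))" "transpose_mat C * S * C \<in> Sym_sub D (D - fdim D U)"
      using KS_obtain[OF S U] .
    have sU: "sub D U" using U by (simp add: KS_def)
    have "f (psi D (D - fdim D U) C S) = ket (up0 D U)"
      unfolding gen[OF diff_le_self C(1,3)] act_siegel_x_sub[OF diff_le_self C(1)] C(2)[symmetric] lag_Int_x_sub_0[OF sU] ..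
    then show ?thesis unfolding psi_eq_Psi[OF S diff_le_self C(1,3)] C(2)[symmetric] .
  qed
  have f0: "f 0 = 0"
  proof -
    have "Psi D S 0 = 0" by (auto simp: Psi_def fun_eq_iff)
    then have "0 \<in> W_space D S" unfolding W by (metis rangeI)
    then show ?thesis using scale[of 0 0] by (simp add: cscale_def zero_fun_def)
  qed
  have fin: "f (Psi D S (\<Sum>U\<in>B. cscale (g U) (ket U))) = (\<Sum>U\<in>B. cscale (g U) (ket (up0 D U)))"
    if "B \<subseteq> KS D S" for B g
    using finite_subset[OF that finite_KS] that
  proof (induction B rule: finite_induct)
    case empty
    have "Psi D S 0 = 0" by (auto simp: Psi_def fun_eq_iff)
    then show ?case using f0 unfolding sum.empty by (simp only:)
  next
    case (insert U B)
    have W': "Psi D S h \<in> W_space D S" for h unfolding W by blast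
    have *: "f (Psi D S (cscale (g U) (ket U) + h)) = cscale (g U) (f (Psi D S (ket U))) + f (Psi D S h)" for h
      using add[OF W' W', of "cscale (g U) (ket U)" h] scale[OF W', of "g U" "ket U"] by (simp only: Psi_add Psi_cscale)
    have U: "U \<in> KS D S" and IH: "f (Psi D S (\<Sum>U\<in>B. cscale (g U) (ket U))) = (\<Sum>U\<in>B. cscale (g U) (ket (up0 D U)))"
      using insert.IH insert.prems by blast+
    show ?case unfolding sum.insert[OF insert.hyps] * IH fket[OF U] ..
  qed
  show "f = phi_map D S"
  proof (rule extensionalityI[OF ext])
    show "phi_map D S \<in> extensional (W_space D S)" by (simp add: phi_map_def)
    fix w assume "w \<in> W_space D S"
    then obtain g where g: "w = Psi D S g" unfolding W by blast
    have "Psi D S g = Psi D S (\<Sum>U\<in>KS D S. cscale (g U) (ket U))"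
      by (rule Psi_cong) (simp add: sum_fun_apply cscale_def sum_ket)
    moreover have "(\<Sum>U\<in>KS D S. cscale (g U) (ket (up0 D U))) = Lam D S g"
    proof -
      have "(\<Sum>U\<in>KS D S. cscale (g U) (ket (up0 D U))) = (\<Sum>U\<in>KS D S. cscale (g U) (Lam D S (ket U)))"
        using Lam_ket[OF S] by (intro sum.cong refl) simp
      also have "\<dots> = Lam D S (\<Sum>U\<in>KS D S. cscale (g U) (ket U))"
        by (auto simp: Lam_def fun_eq_iff sum_fun_apply cscale_def)
      also have "\<dots> = Lam D S g"
        by (rule Lam_cong[OF S]) (simp add: sum_fun_apply cscale_def sum_ket)
      finally show ?thesis .
    qed
    ultimately show "f w = phi_map D S w"
      unfolding g phi_map_Psi[OF S] using fin[of "KS D S" g] by simp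
  qed
qed

text \<open>Since \<open>phi\<close> carries the coordinates of \<open>Psi\<close> to those of
  \<open>Lam\<close>, a transported operator acts on coordinates exactly as the operator on the
  lattice does.\<close>

lemma transport_Psi:
  assumes S: "(S :: 'p::prime_card mod_ring mat) \<in> Sym D" and T: "T (Lam D S g) = Lam D S h"
  shows "transport D S T (Psi D S g) = Psi D S h"
proof -
  have "inj_on (phi D S) (W_space D S)" using is_phi_phi_map[OF S] phi_eq[OF S] by (simp add: is_phi_def bij_betw_def)
  moreover have "Psi D S h \<in> W_space D S" unfolding W_space_eq[OF S] by blast
  moreover have "phi D S (Psi D S h) = T (phi D S (Psi D S g))" using phi_eq[OF S] phi_map_Psi[OF S] T by simp
  ultimately show ?thesis unfolding transport_def comp_def by (intro inv_into_f_eq)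
qed

subsection \<open>The adjacency operators in coordinates\<close>

lemma opK_Lam:
  assumes S: "(S :: 'p::prime_card mod_ring mat) \<in> Sym D"
  shows "lin_ext (subs_V0 D S) (\<lambda>U. cscale (f (fdim (2 * D) U)) (ket U)) (Lam D S g) = Lam D S (\<lambda>U. f (fdim D U) * g U)"
proof
  fix V
  have fd: "fdim (2 * D) (up0 D U) = fdim D U" if "U \<in> KS D S" for U
    using fdim_up0[of D U] that by (simp add: KS_def)
  have "(\<Sum>b\<in>subs_V0 D S. Lam D S g b * (f (fdim (2 * D) b) * ket b V))
      = (if V \<in> subs_V0 D S then Lam D S g V * f (fdim (2 * D) V) else 0)"
    using sum_ket[of "subs_V0 D S" "\<lambda>b. Lam D S g b * f (fdim (2 * D) b)" V] by (simp add: mult.assoc)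
  also have "\<dots> = Lam D S (\<lambda>U. f (fdim D U) * g U) V"
    using fd by (auto simp: Lam_def subs_V0_eq[OF S])
  finally show "lin_ext (subs_V0 D S) (\<lambda>U. cscale (f (fdim (2 * D) U)) (ket U)) (Lam D S g) V = Lam D S (\<lambda>U. f (fdim D U) * g U) V"
    by (simp add: lin_ext_apply cscale_def)
qed

lemma up0_mono:
  assumes "U \<in> KS D S" "U' \<in> KS D S"
  shows "up0 D U \<subset> up0 D U' \<longleftrightarrow> U \<subset> U'"
proof -
  have le: "A \<subseteq> B" if "up0 D A \<subseteq> up0 D B" "A \<in> KS D S" "B \<in> KS D S" for A B
  proof -
    have "upart D (up0 D A) \<subseteq> upart D (up0 D B)" using that(1) unfolding upart_def by blast
    then show ?thesis unfolding upart_up0_KS[OF that(2)] upart_up0_KS[OF that(3)] .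
  qed
  have "up0 D A \<subseteq> up0 D B \<longleftrightarrow> A \<subseteq> B" if "A \<in> KS D S" "B \<in> KS D S" for A B
    using le[OF _ that] image_mono unfolding up0_def by blast
  then show ?thesis unfolding psubset_eq set_eq_subset using assms by blast
qed

text \<open>Coordinates transform by the transposed relation: the new coordinate at \<open>U\<close>
  collects those of the \<open>U'\<close> whose image contains \<open>U\<close>. Lowering thus sums
  over covers and raising over covered subspaces.\<close>

lemma shift_Lam:
  assumes S: "(S :: 'p::prime_card mod_ring mat) \<in> Sym D"
    and P: "\<And>U U'. U \<in> KS D S \<Longrightarrow> U' \<in> KS D S \<Longrightarrow> P (up0 D U) (up0 D U') \<longleftrightarrow> U' \<in> R U"
  shows "lin_ext (subs_V0 D S) (\<lambda>V'. \<Sum>V\<in>{V \<in> subs_V0 D S. P V V'}. ket V) (Lam D S g)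
    = Lam D S (\<lambda>U. \<Sum>U'\<in>R U \<inter> KS D S. g U')"
proof
  fix V
  have inj: "inj_on (up0 D) (KS D S)" by (rule inj_on_inverseI[of _ "upart D"]) simp
  have k: "(\<Sum>W\<in>{W \<in> subs_V0 D S. P W V'}. ket W) V = (if V \<in> subs_V0 D S \<and> P V V' then 1 else 0)" for V'
  proof -
    have "finite {W \<in> subs_V0 D S. P W V'}" using finite_subs_V0 by (rule rev_finite_subset) auto
    then show ?thesis using sum_ket[of "{W \<in> subs_V0 D S. P W V'}" "\<lambda>_. 1" V] by (simp add: sum_fun_apply)
  qed
  have "lin_ext (subs_V0 D S) (\<lambda>V'. \<Sum>V\<in>{V \<in> subs_V0 D S. P V V'}. ket V) (Lam D S g) V
      = (\<Sum>V'\<in>subs_V0 D S. Lam D S g V' * (if V \<in> subs_V0 D S \<and> P V V' then 1 else 0))"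
    unfolding lin_ext_apply k ..
  also have "\<dots> = (\<Sum>U'\<in>KS D S. g U' * (if V \<in> subs_V0 D S \<and> P V (up0 D U') then 1 else 0))"
    unfolding subs_V0_eq[OF S] sum.reindex[OF inj] by (intro sum.cong refl) (simp add: Lam_def subs_V0_eq[OF S])
  also have "\<dots> = Lam D S (\<lambda>U. \<Sum>U'\<in>R U \<inter> KS D S. g U') V"
  proof (cases "V \<in> subs_V0 D S")
    case True
    then obtain U where U: "U \<in> KS D S" "V = up0 D U" using subs_V0_eq[OF S] by auto
    have "(\<Sum>U'\<in>KS D S. g U' * (if V \<in> subs_V0 D S \<and> P V (up0 D U') then 1 else 0)) = (\<Sum>U'\<in>KS D S. if U' \<in> R U then g U' else 0)"
      using True P[OF U(1)] U(2) by (intro sum.cong refl) simp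
    also have "\<dots> = (\<Sum>U'\<in>R U \<inter> KS D S. g U')"
      by (simp add: sum.inter_restrict[symmetric] Int_commute)
    finally show ?thesis using True upart_up0_KS[OF U(1)] by (simp add: Lam_def U(2))
  qed (simp add: Lam_def)
  finally show "lin_ext (subs_V0 D S) (\<lambda>V'. \<Sum>V\<in>{V \<in> subs_V0 D S. P V V'}. ket V) (Lam D S g) V
    = Lam D S (\<lambda>U. \<Sum>U'\<in>R U \<inter> KS D S. g U') V" .
qed

lemma opL_Lam:
  assumes S: "(S :: 'p::prime_card mod_ring mat) \<in> Sym D"
  shows "opL D S (Lam D S g) = Lam D S (\<lambda>U. \<Sum>U'\<in>covers D U \<inter> KS D S. g U')"
  unfolding opL_def
proof (rule shift_Lam[OF S])
  fix U U' assume U: "U \<in> KS D S" "U' \<in> KS D S"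
  then have s: "sub D U" "sub D U'" by (simp_all add: KS_def)
  show "up0 D U \<subset> up0 D U' \<and> fdim (2 * D) (up0 D U) + 1 = fdim (2 * D) (up0 D U') \<longleftrightarrow> U' \<in> covers D U"
    unfolding covers_iff_fdim[OF s] up0_mono[OF U] fdim_up0[OF s(1)] fdim_up0[OF s(2)] by auto
qed

lemma opR_Lam:
  assumes S: "(S :: 'p::prime_card mod_ring mat) \<in> Sym D"
  shows "opR D S (Lam D S g) = Lam D S (\<lambda>U. \<Sum>U'\<in>cocovers D U \<inter> KS D S. g U')"
  unfolding opR_def
proof (rule shift_Lam[OF S])
  fix U U' assume U: "U \<in> KS D S" "U' \<in> KS D S"
  then have s: "sub D U" "sub D U'" by (simp_all add: KS_def)
  show "up0 D U' \<subset> up0 D U \<and> fdim (2 * D) (up0 D U) = fdim (2 * D) (up0 D U') + 1 \<longleftrightarrow> U' \<in> cocovers D U"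
    unfolding cocovers_iff_covers[OF s] covers_iff_fdim[OF s(2,1)] up0_mono[OF U(2,1)] fdim_up0[OF s(1)] fdim_up0[OF s(2)] ..
qed

text \<open>With \<open>i = D - dim U\<close> the exponents differ by
  \<open>(i (i + 1) - (i - 1) i) / 4 = i / 2\<close>.\<close>

lemma nrm_covers:
  assumes U: "sub D (U :: 'p::prime_card mod_ring vec set)" and U': "U' \<in> covers D U"
  shows "nrm D U' = nrm D U * real CARD('p) powr (real (D - fdim D U) / 2)"
proof -
  have "sub D U'" using U' by (simp add: covers_def subs_def)
  then have le: "fdim D U + 1 \<le> D" using fdim_le[of D U'] covers_fdim[OF U U'] by simp
  define i where "i = D - fdim D U'"
  have i: "D - fdim D U = Suc i" "D - fdim D U' = i"
    using le covers_fdim[OF U U'] by (simp_all add: i_def)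
  have "- (real i * (real i + 1) / 4) = - (real (Suc i) * (real (Suc i) + 1) / 4) + real (Suc i) / 2"
    by (simp add: field_simps)
  then show ?thesis unfolding nrm_def i powr_add[symmetric] by simp
qed

text \<open>The fraction is the number \<open>q^(i + 1)\<close> of neighbours over
  \<open>U'\<close>, where \<open>i = D - dim U\<close>; the quotient of the normalisations cancels
  half of that exponent.\<close>

lemma nrm_cocovers:
  assumes U: "sub D (U :: 'p::prime_card mod_ring vec set)" and U': "U' \<in> cocovers D U"
  shows "nrm D U' * (real CARD('p) ^ D / real (card U')) = nrm D U * real CARD('p) powr ((real (D - fdim D U) + 1) / 2)"
proof -
  let ?q = "real CARD('p)"
  have q: "?q > 0" using card_field_gt_1[where 'p = 'p] by simp
  have s: "sub D U'" "U \<in> covers D U'" using U' U cocovers_iff_covers[OF U] by (auto simp: cocovers_def subs_def)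
  have f: "fdim D U = fdim D U' + 1" "fdim D U \<le> D" using covers_fdim[OF s] fdim_le[OF U] by auto
  then have d: "real (D - fdim D U') = real (D - fdim D U) + 1" by (simp add: of_nat_diff)
  have "nrm D U = nrm D U' * ?q powr ((real (D - fdim D U) + 1) / 2)" using nrm_covers[OF s] d by simp
  then have "nrm D U * ?q powr ((real (D - fdim D U) + 1) / 2) = nrm D U' * ?q powr (real (D - fdim D U) + 1)"
    by (simp add: powr_add[symmetric])
  moreover have "?q ^ D / real (card U') = ?q powr (real (D - fdim D U) + 1)"
  proof -
    have "?q ^ D / real (card U') = ?q ^ (D - fdim D U')"
      using card_sub[OF s(1)] q fdim_le[OF s(1)] by (simp add: power_diff)
    then show ?thesis using q d by (simp add: powr_realpow[symmetric])
  qed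
  ultimately show ?thesis by simp
qed

text \<open>Over a kernel subspace each neighbour sum of the wave is the wave at \<open>y\<close>
  times a scalar that depends only on the subspaces, so the operator acts on coordinates. The first
  coefficient stems from the Gauss sums, the other two from the normalisations and the neighbour
  counts.\<close>

lemma dpg_A_Psi:
  assumes D: "D \<ge> 1" and S: "(S :: 'p::prime_card mod_ring mat) \<in> Sym D"
    and char2: "CARD('p) = 2 \<longrightarrow> vec_space.rank D S \<le> 1"
  shows "dpg_A D (Psi D S g) = Psi D S (\<lambda>U.
      g U * (of_int (form_type D S) * of_real (real CARD('p) powr ((real D + real (kernel_dim S)) / 2) / real (card U)) - 1)
      + of_real (real CARD('p) powr (real (D - fdim D U) / 2)) * (\<Sum>U'\<in>covers D U \<inter> KS D S. g U')
      + of_real (real CARD('p) powr ((real (D - fdim D U) + 1) / 2)) * (\<Sum>U'\<in>cocovers D U \<inter> KS D S. g U'))"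
    (is "_ = Psi D S ?h")
proof
  fix y
  let ?X = "max_isotropic D :: 'p mod_ring vec set set" and ?q = "CARD('p)"
  show "dpg_A D (Psi D S g) y = Psi D S ?h y"
  proof (cases "y \<in> ?X")
    case False
    then show ?thesis by (simp add: dpg_A_def mat_op_def Psi_def)
  next
    case y: True
    let ?U = "upart D y"
    obtain M where M: "M \<in> Sym D" "y = lag D ?U M" using max_isotropic_eq_lag[OF y] .
    have sU: "sub D ?U" using sub_upart[OF max_isotropicD(1)[OF y]] .
    have c2: "S *\<^sub>v u = 0\<^sub>v D" if "?q = 2" "u \<in> carrier_vec D" "u \<bullet> (S *\<^sub>v u) = 0" for u
      using rank_le_1_anisotropic[OF S _ that(2,3)] char2 that(1) by blast
    let ?w = "chi (mtrace (S * M))"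
    have inner: "(\<Sum>x\<in>nbrs D U y. Psi D S g x) = (if U \<in> KS D S then g U * of_real (nrm D U) * (\<Sum>x\<in>nbrs D U y. wave D S x) else 0)" for U
    proof -
      have "(\<Sum>x\<in>nbrs D U y. Psi D S g x) = (\<Sum>x\<in>nbrs D U y. if U \<in> KS D S then g U * of_real (nrm D U) * wave D S x else 0)"
        by (intro sum.cong refl) (auto simp: nbrs_def Psi_def)
      then show ?thesis by (simp add: sum_distrib_left)
    qed
    have split: "dpg_A D (Psi D S g) y = (\<Sum>x\<in>nbrs D ?U y. Psi D S g x) + (\<Sum>U\<in>covers D ?U \<inter> KS D S. \<Sum>x\<in>nbrs D U y. Psi D S g x)
        + (\<Sum>U\<in>cocovers D ?U \<inter> KS D S. \<Sum>x\<in>nbrs D U y. Psi D S g x)"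
      unfolding dpg_A_nbrs[OF D y] sum_nbrs_split[OF y]
      by (intro arg_cong2[of _ _ _ _ "(+)"] refl sum.mono_neutral_right) (auto simp: inner)
    have cov: "sub D U'" "?U \<subset> U'" "card U' = ?q * card ?U" "U' \<subseteq> mat_kernel S" if "U' \<in> covers D ?U \<inter> KS D S" for U'
      using that by (auto simp: covers_def KS_def)
    have coc: "sub D U'" "U' \<subset> ?U" "card ?U = ?q * card U'" "U' \<subseteq> mat_kernel S" if "U' \<in> cocovers D ?U \<inter> KS D S" for U'
      using that by (auto simp: cocovers_def KS_def)
    have above: "of_nat (card U') * (\<Sum>x\<in>nbrs D U' y. wave D S x) = (if ?U \<subseteq> mat_kernel S then ?w * of_nat (?q ^ D) else 0)"
      if "U' \<in> cocovers D ?U \<inter> KS D S" for U'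
      using sum_nbrs_above[OF S coc(1,4)[OF that] sU M(1) coc(2,3)[OF that] c2] unfolding M(2)[symmetric] by blast
    have pos: "(of_nat (card U') :: complex) \<noteq> 0" if "sub D U'" for U' :: "'p mod_ring vec set"
      using subD(6)[OF that] by simp
    show ?thesis
    proof (cases "?U \<in> KS D S")
      \<comment> \<open>This is where \<open>W(S)\<close> is seen to be invariant: no cover of
        \<open>U\<close> lies in the kernel either, and the wave sums over covered kernel subspaces
        vanish.\<close>
      case False
      then have nk: "\<not> ?U \<subseteq> mat_kernel S" using sU by (simp add: KS_def)
      have e: "covers D ?U \<inter> KS D S = {}" using nk cov by blast
      have c0: "(\<Sum>x\<in>nbrs D U' y. Psi D S g x) = 0" if "U' \<in> cocovers D ?U \<inter> KS D S" for U'
        using above[OF that] pos[OF coc(1)[OF that]] nk by (simp add: inner)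
      have s0: "(\<Sum>x\<in>nbrs D ?U y. Psi D S g x) = 0" using inner[of ?U] False by simp
      have "dpg_A D (Psi D S g) y = 0" unfolding split s0 e by (simp add: c0)
      moreover have "Psi D S h y = 0" for h using False by (simp add: Psi_def)
      ultimately show ?thesis by simp
    next
      case True
      then have UK: "?U \<subseteq> mat_kernel S" by (simp add: KS_def)
      let ?n = "complex_of_real (nrm D ?U)"
      have alg1: "n * (c * s) = n * (w * (e - c))" if "n * c * s = w * (n * e - n * c)" for n c s w e :: complex
        using that by (simp add: algebra_simps)
      have alg2: "g' * n * s = g' * (e / c - 1) * n * w" if "c * s = w * (e - c)" "c \<noteq> 0" for g' n c s w e :: complex
      proof -
        have s: "s = w * (e / c - 1)" using that by (simp add: field_simps)
        show ?thesis unfolding s by (simp only: mult_ac)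
      qed
      have "of_nat ((?q - 1) * card ?U) * (\<Sum>x\<in>nbrs D ?U y. wave D S x)
          = ?w * ((\<Sum>c\<in>UNIV - {0}. qsum D S c) - of_nat ((?q - 1) * card ?U))"
        using sum_nbrs_same[OF S sU UK M(1)] unfolding M(2)[symmetric] qsum_def .
      then have "of_nat (?q - 1) * (of_nat (card ?U) * (\<Sum>x\<in>nbrs D ?U y. wave D S x))
          = of_nat (?q - 1) * (?w * (of_int (form_type D S) * of_real (real ?q powr ((real D + real (kernel_dim S)) / 2)) - of_nat (card ?U)))"
        unfolding sum_qsum[OF S char2] of_nat_mult by (rule alg1)
      moreover have "of_nat (?q - 1) \<noteq> (0 :: complex)" using card_field_gt_1[where 'p = 'p] by simp
      ultimately have *: "of_nat (card ?U) * (\<Sum>x\<in>nbrs D ?U y. wave D S x)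
          = ?w * (of_int (form_type D S) * of_real (real ?q powr ((real D + real (kernel_dim S)) / 2)) - of_nat (card ?U))"
        by (simp only: mult_cancel_left) simp
      have same: "(\<Sum>x\<in>nbrs D ?U y. Psi D S g x) = g ?U * (of_int (form_type D S) * of_real (real ?q powr ((real D + real (kernel_dim S)) / 2) / real (card ?U)) - 1) * ?n * ?w"
        using alg2[OF * pos[OF sU], of "g ?U" ?n] inner[of ?U] True by simp
      have c1: "(\<Sum>x\<in>nbrs D U' y. Psi D S g x) = of_real (real ?q powr (real (D - fdim D ?U) / 2)) * g U' * ?n * ?w"
        if U': "U' \<in> covers D ?U \<inter> KS D S" for U'
      proof -
        have "nbrs D U' y = {lag D U' M}" using nbrs_below[OF cov(1)[OF U'] sU M(1) cov(2,3)[OF U']] M(2) by simp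
        then have "(\<Sum>x\<in>nbrs D U' y. Psi D S g x) = g U' * of_real (nrm D U') * ?w"
          using Psi_eval[OF S _ M(1), of U' g] U' by simp
        then show ?thesis using nrm_covers[OF sU, of U'] U' by (simp add: mult_ac)
      qed
      have c2: "(\<Sum>x\<in>nbrs D U' y. Psi D S g x) = of_real (real ?q powr ((real (D - fdim D ?U) + 1) / 2)) * g U' * ?n * ?w"
        if U': "U' \<in> cocovers D ?U \<inter> KS D S" for U'
      proof -
        have "(\<Sum>x\<in>nbrs D U' y. wave D S x) = ?w * of_real (real ?q ^ D / real (card U'))"
          using above[OF U'] pos[OF coc(1)[OF U']] UK by (simp add: field_simps)
        then have "(\<Sum>x\<in>nbrs D U' y. Psi D S g x) = g U' * of_real (nrm D U' * (real ?q ^ D / real (card U'))) * ?w"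
          using inner[of U'] U' by simp
        then show ?thesis by (simp only: nrm_cocovers[OF sU IntD1[OF U']] of_real_mult mult_ac)
      qed
      have C1: "(\<Sum>U'\<in>covers D ?U \<inter> KS D S. \<Sum>x\<in>nbrs D U' y. Psi D S g x)
          = of_real (real ?q powr (real (D - fdim D ?U) / 2)) * (\<Sum>U'\<in>covers D ?U \<inter> KS D S. g U') * ?n * ?w"
        unfolding sum_distrib_left sum_distrib_right by (rule sum.cong[OF refl c1])
      have C2: "(\<Sum>U'\<in>cocovers D ?U \<inter> KS D S. \<Sum>x\<in>nbrs D U' y. Psi D S g x)
          = of_real (real ?q powr ((real (D - fdim D ?U) + 1) / 2)) * (\<Sum>U'\<in>cocovers D ?U \<inter> KS D S. g U') * ?n * ?w"
        unfolding sum_distrib_left sum_distrib_right by (rule sum.cong[OF refl c2])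
      have "Psi D S ?h y = ?h ?U * ?n * ?w" using Psi_eval[OF S True M(1), of ?h] M(2) by simp
      moreover have "dpg_A D (Psi D S g) y = ?h ?U * ?n * ?w"
        unfolding split same C1 C2 by (simp only: distrib_right)
      ultimately show ?thesis by simp
    qed
  qed
qed

lemma dpg_Astar_Psi:
  assumes D: "D \<ge> 1" and S: "(S :: 'p::prime_card mod_ring mat) \<in> Sym D"
  shows "dpg_Astar D (Psi D S g) = Psi D S (\<lambda>U. of_real (dual_ev (real CARD('p)) D (real (card U))) * g U)"
proof
  fix x
  let ?X = "max_isotropic D :: 'p mod_ring vec set set"
  show "dpg_Astar D (Psi D S g) x = Psi D S (\<lambda>U. of_real (dual_ev (real CARD('p)) D (real (card U))) * g U) x"
  proof (cases "x \<in> ?X")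
    case x: True
    have "dpg_Astar D (Psi D S g) x = (\<Sum>y\<in>?X. dpg_dual_adj D x y * Psi D S g y)"
      using x by (simp only: dpg_Astar_def mat_op_def if_True)
    also have "\<dots> = (\<Sum>y\<in>?X. if x = y then dpg_dual_adj D x x * Psi D S g x else 0)"
      by (intro sum.cong refl) (simp only: dpg_dual_adj_def split: if_split, simp)
    also have "\<dots> = dpg_dual_adj D x x * Psi D S g x" using x finite_max_isotropic[of D, where 'p = 'p] by simp
    also have "dpg_dual_adj D x x = of_real (dual_ev (real CARD('p)) D (real (card (upart D x))))"
      using dual_adj_diag[OF D refl refl x] by (simp only: rf_def[OF D refl refl])
    finally show ?thesis by (simp add: Psi_def)
  qed (simp add: dpg_Astar_def mat_op_def Psi_def)
qed

lemma Psi_diff: "Psi D S (g - h) = Psi D S g - Psi D S h"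
  by (auto simp: Psi_def fun_eq_iff algebra_simps)

lemma Lam_cscale: "cscale c (Lam D S g) = Lam D S (cscale c g)"
  by (auto simp: Lam_def cscale_def fun_eq_iff)

context
  fixes S :: "'p::prime_card mod_ring mat" and D :: nat
  assumes S: "S \<in> Sym D"
begin

abbreviation (input) \<kappa> :: "'p mod_ring vec set \<Rightarrow> real" where
  "\<kappa> U \<equiv> real CARD('p) powr (real (kernel_dim S) / 2 - real (fdim D U))"

abbreviation (input) hat :: real where
  "hat \<equiv> real CARD('p) powr ((1 - real (kernel_dim S)) / 4)"

lemma calK_Psi: "calK D S (Psi D S g) = Psi D S (\<lambda>U. of_real (\<kappa> U) * g U)"
  unfolding calK_def opK_def kappa_def
  by (rule transport_Psi[OF S]) (rule opK_Lam[OF S, of "\<lambda>k. of_real (real CARD('p) powr (real (kernel_dim S) / 2 - real k))"])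

lemma calK_half_Psi: "calK_half D S (Psi D S g) = Psi D S (\<lambda>U. of_real (sqrt (\<kappa> U)) * g U)"
  unfolding calK_half_def opK_half_def kappa_def
  by (rule transport_Psi[OF S]) (rule opK_Lam[OF S, of "\<lambda>k. of_real (sqrt (real CARD('p) powr (real (kernel_dim S) / 2 - real k)))"])

lemma calL_Psi: "calL D S (Psi D S g) = Psi D S (cscale (of_real hat) (\<lambda>U. \<Sum>U'\<in>covers D U \<inter> KS D S. g U'))"
  unfolding calL_def by (rule transport_Psi[OF S]) (simp only: opLhat_def opL_Lam[OF S] Lam_cscale)

lemma calR_Psi: "calR D S (Psi D S g) = Psi D S (cscale (of_real hat) (\<lambda>U. \<Sum>U'\<in>cocovers D U \<inter> KS D S. g U'))"
  unfolding calR_def by (rule transport_Psi[OF S]) (simp only: opRhat_def opR_Lam[OF S] Lam_cscale)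

lemma kappa_pos: "\<kappa> U > 0"
  using card_field_gt_1[where 'p = 'p] by simp

text \<open>All \<open>\<kappa> U\<close> are positive, so the diagonal operator is injective on
  \<open>W(S)\<close> and \<open>inv_into\<close> returns its true inverse.\<close>

lemma calK_inv_Psi: "calK_inv D S (Psi D S g) = Psi D S (\<lambda>U. g U / of_real (\<kappa> U))"
  unfolding calK_inv_def
proof (rule inv_into_f_eq)
  show "inj_on (calK D S) (W_space D S)"
    unfolding W_space_eq[OF S]
  proof (rule inj_onI)
    fix v w assume "v \<in> range (Psi D S)" "w \<in> range (Psi D S)" "calK D S v = calK D S w"
    then obtain g h where gh: "v = Psi D S g" "w = Psi D S h"
      "Psi D S (\<lambda>U. of_real (\<kappa> U) * g U) = Psi D S (\<lambda>U. of_real (\<kappa> U) * h U)" by (auto simp: calK_Psi)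
    have "g U = h U" if "U \<in> KS D S" for U
      using Lam_eqD[OF S arg_cong[OF gh(3), of "phi_map D S", unfolded phi_map_Psi[OF S]] that] kappa_pos[of U]
      by simp
    then show "v = w" unfolding gh(1,2) by (rule Psi_cong)
  qed
  show "Psi D S (\<lambda>U. g U / of_real (\<kappa> U)) \<in> W_space D S" unfolding W_space_eq[OF S] by blast
  show "calK D S (Psi D S (\<lambda>U. g U / of_real (\<kappa> U))) = Psi D S g"
    unfolding calK_Psi using kappa_pos by (intro Psi_cong) simp
qed

text \<open>Bookkeeping of exponents. With \<open>d = dim U\<close> the factors \<open>h\<close>,
  \<open>sqrt (\<kappa> U)\<close> and \<open>hat\<close> combine to
  \<open>(D - d) / 2 + 1 / 4\<close>; the outer powers \<open>- 1 / 4\<close> and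
  \<open>1 / 4\<close> adjust this to the exponents for covers and for covered subspaces.\<close>

lemma scalar_identities:
  assumes U: "U \<in> KS D S"
  defines "h \<equiv> real CARD('p) powr (real D / 2)"
  shows "real CARD('p) powr ((real D + real (kernel_dim S)) / 2) / real (card U) = h * \<kappa> U"
    and "real CARD('p) powr (real (D - fdim D U) / 2) = h * (sqrt (\<kappa> U) * (real CARD('p) powr (- 1 / 4) * hat))"
    and "real CARD('p) powr ((real (D - fdim D U) + 1) / 2) = h * (sqrt (\<kappa> U) * (real CARD('p) powr (1 / 4) * hat))"
    and "real (card U) / real CARD('p) ^ D = real CARD('p) powr (- real D + real (kernel_dim S) / 2) / \<kappa> U"
proof -
  have q: "real CARD('p) > 0" using card_field_gt_1[where 'p = 'p] by simp
  have sU: "sub D U" using U by (simp add: KS_def)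
  have c: "real (card U) = real CARD('p) powr real (fdim D U)" using card_sub[OF sU] q by (simp add: powr_realpow)
  have d: "real (D - fdim D U) = real D - real (fdim D U)" using fdim_le[OF sU] by (simp add: of_nat_diff)
  have r: "sqrt (\<kappa> U) = real CARD('p) powr ((real (kernel_dim S) / 2 - real (fdim D U)) / 2)"
    using q by (simp add: powr_half_sqrt[symmetric] powr_powr)
  have p: "real CARD('p) ^ D = real CARD('p) powr real D" using q by (simp add: powr_realpow)
  show "real CARD('p) powr ((real D + real (kernel_dim S)) / 2) / real (card U) = h * \<kappa> U"
    unfolding c h_def powr_add[symmetric] powr_diff[symmetric] by (rule arg_cong[of _ _ "(powr) _"]) (simp add: field_simps)
  show "real CARD('p) powr (real (D - fdim D U) / 2) = h * (sqrt (\<kappa> U) * (real CARD('p) powr (- 1 / 4) * hat))"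
    unfolding d r h_def powr_add[symmetric] by (rule arg_cong[of _ _ "(powr) _"]) (simp add: field_simps)
  show "real CARD('p) powr ((real (D - fdim D U) + 1) / 2) = h * (sqrt (\<kappa> U) * (real CARD('p) powr (1 / 4) * hat))"
    unfolding d r h_def powr_add[symmetric] by (rule arg_cong[of _ _ "(powr) _"]) (simp add: field_simps)
  show "real (card U) / real CARD('p) ^ D = real CARD('p) powr (- real D + real (kernel_dim S) / 2) / \<kappa> U"
    unfolding c p powr_diff[symmetric] by (rule arg_cong[of _ _ "(powr) _"]) (simp add: field_simps)
qed

end

text \<open>\<open>phi\<close> is a definite description, so the conjunct \<open>is_phi\<close>
  certifies that the transported operators refer to the intended isomorphism. For
  \<open>q = 2\<close> the rank bound excludes, for instance, the hyperbolic plane with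
  \<open>D = 2\<close>: there the wave over the zero subspace is constant, and its image under the
  adjacency operator does not vanish over lines.\<close>

theorem theorem2:
  fixes S :: "'p::prime_card mod_ring mat" and D N :: nat and q :: real
  assumes q: "q = real CARD('p)"
    and D: "D \<ge> 1"
    and S: "S \<in> Sym D"
    and N: "N = kernel_dim S"
    and char2: "CARD('p) = 2 \<longrightarrow> vec_space.rank D S \<le> 1"
  shows "is_phi D S (phi D S) \<and>
      dpg_A D ` W_space D S \<subseteq> W_space D S \<and>
      dpg_Astar D ` W_space D S \<subseteq> W_space D S \<and>
      (\<forall>w\<in>W_space D S. dpg_A D w =
      cscale (of_int (form_type D S) * complex_of_real (q powr (real D / 2))) (calK D S w) - w
      + cscale (complex_of_real (q powr (real D / 2)))
          (calK_half D S (cscale (complex_of_real (q powr (- 1 / 4))) (calL D S w)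
                        + cscale (complex_of_real (q powr (1 / 4))) (calR D S w)))) \<and>
      (\<forall>w\<in>W_space D S. dpg_Astar D w =
      cscale (complex_of_real (- (q * (q ^ (D - 1) + 1) / (q - 1)))) w
      + cscale (complex_of_real (q * (q ^ (D - 1) + 1) * (q ^ D + 1) / (2 * (q - 1))
                                 * q powr (- real D + real N / 2))) (calK_inv D S w))"
proof (intro conjI ballI)
  note W = W_space_eq[OF S]
  note A = dpg_A_Psi[OF D S char2] and As = dpg_Astar_Psi[OF D S]
  show "is_phi D S (phi D S)" using is_phi_phi_map[OF S] phi_eq[OF S] by simp
  show "dpg_A D ` W_space D S \<subseteq> W_space D S" unfolding W by (auto simp: A)
  show "dpg_Astar D ` W_space D S \<subseteq> W_space D S" unfolding W by (auto simp: As)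
  fix w assume "w \<in> W_space D S"
  then obtain g where w: "w = Psi D S g" unfolding W by blast
  show "dpg_A D w = cscale (of_int (form_type D S) * complex_of_real (q powr (real D / 2))) (calK D S w) - w
      + cscale (complex_of_real (q powr (real D / 2)))
          (calK_half D S (cscale (complex_of_real (q powr (- 1 / 4))) (calL D S w)
                        + cscale (complex_of_real (q powr (1 / 4))) (calR D S w)))"
    unfolding w A calL_Psi[OF S] calR_Psi[OF S] Psi_cscale[symmetric] Psi_add[symmetric]
      calK_half_Psi[OF S] calK_Psi[OF S] Psi_diff[symmetric]
  \<comment> \<open>All operators are now explicit on coordinates, and what remains is an identity
    of scalars at each kernel subspace.\<close>
  proof (rule Psi_cong, goal_cases)
    case (1 U)
    show ?case
      unfolding q scalar_identities[OF S 1] of_real_mult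
      by (simp only: cscale_def plus_fun_apply minus_apply) (simp add: algebra_simps)
  qed
  show "dpg_Astar D w = cscale (complex_of_real (- (q * (q ^ (D - 1) + 1) / (q - 1)))) w
      + cscale (complex_of_real (q * (q ^ (D - 1) + 1) * (q ^ D + 1) / (2 * (q - 1))
                                 * q powr (- real D + real N / 2))) (calK_inv D S w)"
    unfolding w As calK_inv_Psi[OF S] Psi_cscale[symmetric] Psi_add[symmetric]
  proof (rule Psi_cong, goal_cases)
    case (1 U)
    \<comment> \<open>The quotient by \<open>k\<close> in the dual eigenvalue is moved onto the
      coordinate, where it is the action of the inverse operator.\<close>
    have affine: "complex_of_real (a + b * (c / k)) * z = of_real a * z + of_real (b * c) * (z / of_real k)" for a b c k z
      by (simp add: algebra_simps)
    show ?case
      unfolding q N dual_ev_def scalar_identities(4)[OF S 1] by (simp only: cscale_def plus_fun_apply affine)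
  qed
qed

end
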